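(* Consider the mixed integer quadratic programming problem (MIQP) $$\min\ x^{\mathsf T} H x + h^{\mathsf T} x \quad \text{s.t.}\quad Wx \le w,\quad x \in \mathbb{Z}^p \times \mathbb{R}^{n-p},$$ where $H \in \mathbb{Q}^{n\times n}$ is symmetric, $h \in \mathbb{Q}^n$, $W \in \mathbb{Q}^{m\times n}$, $w \in \mathbb{Q}^m$, and $p \in \{0,\dots,n\}$. Assume that there exists $\bar f \in \mathbb{R}$ such that every feasible solution has objective value at least $\bar f$. There is an algorithm which either finds an $\epsilon$-approximate solution to the problem, where the approximation factor is $\epsilon = 1 - \Theta(n^{-2})$, or correctly detects that the feasible region is empty. The running time of the algorithm is polynomial in the size of (MIQP), provided that the number $p$ of integer variables is fixed.
   Context: For an optimization problem $\inf\{f(x) : x \in \mathcal{S}\}$, let $f_{\inf}$ and $f_{\sup}$ denote the infimum and supremum of $f$ on $\mathcal{S}$. For $\epsilon \in [0,1]$, a point $x^\diamond \in \mathcal{S}$ is an $\epsilon$-approximate solution if $f(x^\diamond) - f_{\inf} \le \epsilon \cdot (f_{\sup} - f_{\inf})$. The statement "$\epsilon = 1-\Theta(n^{-2})$" means that $\epsilon=\epsilon(n)$ is a function of $n$ with $1-\epsilon(n) = \Theta(n^{-2})$. The size (bit size) of rational numbers, vectors, matrices, constraints, and optimization problems is the standard one in mathematical programming: essentially the number of bits required to encode the object (rationals being encoded by binary numerator and denominator). "Provided that $p$ is fixed" means that $p$ is treated as a constant in the running time bound. *)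

theory Defs
  imports
    "Jordan_Normal_Form.Matrix"
    "HOL-Library.Extended_Real"
    "HOL-Library.Landau_Symbols"
    "HOL-Library.Log_Nat"
    "HOL-Computational_Algebra.Polynomial"
begin

section \<open>Approximate solutions\<close>

text \<open>
  Infimum and supremum are taken in the extended reals, so that the supremum may be infinite.
  In that case the inequality holds for every point of \<open>S\<close> if \<open>0 < e\<close> (and the infimum is
  finite); for \<open>e = 0\<close> it states, by \<open>0 * \<infinity> = 0\<close>, that \<open>x\<close> is a minimizer.
\<close>

definition approx_solution :: "real \<Rightarrow> ('a \<Rightarrow> real) \<Rightarrow> 'a set \<Rightarrow> 'a \<Rightarrow> bool" where
  "approx_solution e f S x \<longleftrightarrow>
     x \<in> S \<and>
     ereal (f x) - (INF y\<in>S. ereal (f y))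
       \<le> ereal e * ((SUP y\<in>S. ereal (f y)) - (INF y\<in>S. ereal (f y)))"


section \<open>Mixed integer quadratic programs\<close>

abbreviation real_mat :: "rat mat \<Rightarrow> real mat" where
  "real_mat \<equiv> map_mat of_rat"

abbreviation real_vec :: "rat vec \<Rightarrow> real vec" where
  "real_vec \<equiv> map_vec of_rat"

definition miqp_objective :: "rat mat \<Rightarrow> rat vec \<Rightarrow> real vec \<Rightarrow> real" where
  "miqp_objective H h x = x \<bullet> (real_mat H *\<^sub>v x) + real_vec h \<bullet> x"

text \<open>The order on vectors is componentwise. The first \<open>p\<close> variables are the integer ones.\<close>

definition miqp_feasible :: "nat \<Rightarrow> rat mat \<Rightarrow> rat vec \<Rightarrow> real vec set" where
  "miqp_feasible p W w =
     {x \<in> carrier_vec (dim_col W). real_mat W *\<^sub>v x \<le> real_vec w \<and> (\<forall>i<p. x $ i \<in> \<int>)}"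


section \<open>Bit size\<close>

text \<open>
  These are the usual conventions of mathematical programming: the size of \<open>a/b\<close> in lowest
  terms is \<open>1 + \<lceil>log 2 (\<bar>a\<bar> + 1)\<rceil> + \<lceil>log 2 (b + 1)\<rceil>\<close>, a vector or matrix contributes in addition
  its number of entries, and a system of linear constraints contributes an additional \<open>1\<close>. Note
  that \<open>floorlog 2 k = \<lceil>log 2 (k + 1)\<rceil>\<close> is the number of binary digits of \<open>k\<close>, and that
  \<open>quotient_of\<close> returns the reduced fraction with positive denominator.
\<close>

definition size_int :: "int \<Rightarrow> nat" where
  "size_int k = floorlog 2 (nat \<bar>k\<bar>)"

definition size_rat :: "rat \<Rightarrow> nat" where
  "size_rat r = (case quotient_of r of (a, b) \<Rightarrow> 1 + size_int a + size_int b)"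

definition size_rat_vec :: "rat vec \<Rightarrow> nat" where
  "size_rat_vec v = dim_vec v + (\<Sum>i<dim_vec v. size_rat (v $ i))"

definition size_rat_mat :: "rat mat \<Rightarrow> nat" where
  "size_rat_mat A =
     dim_row A * dim_col A + (\<Sum>i<dim_row A. \<Sum>j<dim_col A. size_rat (A $$ (i, j)))"

definition miqp_size :: "rat mat \<Rightarrow> rat vec \<Rightarrow> rat mat \<Rightarrow> rat vec \<Rightarrow> nat" where
  "miqp_size H h W w =
     size_rat_mat H + size_rat_vec h + (1 + size_rat_mat W + size_rat_vec w)"


section \<open>Algorithms and running time\<close>

text \<open>
  The model of computation is a random access machine with logarithmic cost, programmed by
  structured programs. A store consists of arrays of integers of unbounded size, numbered by
  natural numbers and indexed by integers; a program is finite, so it refers to only finitely many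
  arrays, and each scalar variable is a cell of an array. Every operation is charged the number of
  bits of all integers it handles, array indices included. Hence a run of cost \<open>t\<close> touches at most
  \<open>t\<close> cells and only handles integers with at most \<open>t\<close> bits, and polynomial running time is the
  same as for Turing machines.
\<close>

type_synonym store = "nat \<Rightarrow> int \<Rightarrow> int"

datatype iexp =
    Const int
  | Read nat iexp
  | Add iexp iexp
  | Sub iexp iexp
  | Mul iexp iexp
  | Quot iexp iexp

datatype prog =
    Skip
  | Write nat iexp iexp
  | Seq prog prog
  | IfPos iexp prog prog
  | WhilePos iexp prog

fun ival :: "store \<Rightarrow> iexp \<Rightarrow> int" where
  "ival s (Const k) = k"
| "ival s (Read a e) = s a (ival s e)"
| "ival s (Add e1 e2) = ival s e1 + ival s e2"
| "ival s (Sub e1 e2) = ival s e1 - ival s e2"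
| "ival s (Mul e1 e2) = ival s e1 * ival s e2"
| "ival s (Quot e1 e2) = ival s e1 div ival s e2"

text \<open>The summand \<open>1\<close> makes every operation cost at least one unit, also if it handles zeros only.\<close>

fun icost :: "store \<Rightarrow> iexp \<Rightarrow> nat" where
  "icost s (Const k) = 1 + size_int k"
| "icost s (Read a e) = 1 + size_int (ival s (Read a e)) + icost s e"
| "icost s (Add e1 e2) = 1 + size_int (ival s (Add e1 e2)) + icost s e1 + icost s e2"
| "icost s (Sub e1 e2) = 1 + size_int (ival s (Sub e1 e2)) + icost s e1 + icost s e2"
| "icost s (Mul e1 e2) = 1 + size_int (ival s (Mul e1 e2)) + icost s e1 + icost s e2"
| "icost s (Quot e1 e2) = 1 + size_int (ival s (Quot e1 e2)) + icost s e1 + icost s e2"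

text \<open>
  \<open>Write a e1 e2\<close> assigns \<open>e2\<close> to cell \<open>e1\<close> of array \<open>a\<close>. The proposition \<open>runs c s t s'\<close> means
  that program \<open>c\<close> started in store \<open>s\<close> terminates in store \<open>s'\<close> after time \<open>t\<close>.
\<close>

inductive runs :: "prog \<Rightarrow> store \<Rightarrow> nat \<Rightarrow> store \<Rightarrow> bool" where
  Skip: "runs Skip s 1 s"
| Write: "runs (Write a e1 e2) s (1 + icost s e1 + icost s e2)
            (s(a := (s a)(ival s e1 := ival s e2)))"
| Seq: "runs c1 s t1 s1 \<Longrightarrow> runs c2 s1 t2 s2 \<Longrightarrow> runs (Seq c1 c2) s (1 + t1 + t2) s2"
| IfTrue: "ival s e > 0 \<Longrightarrow> runs c1 s t s' \<Longrightarrow> runs (IfPos e c1 c2) s (1 + icost s e + t) s'"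
| IfFalse: "\<not> ival s e > 0 \<Longrightarrow> runs c2 s t s' \<Longrightarrow> runs (IfPos e c1 c2) s (1 + icost s e + t) s'"
| WhileFalse: "\<not> ival s e > 0 \<Longrightarrow> runs (WhilePos e c) s (1 + icost s e) s"
| WhileTrue: "ival s e > 0 \<Longrightarrow> runs c s t1 s1 \<Longrightarrow> runs (WhilePos e c) s1 t2 s2 \<Longrightarrow>
            runs (WhilePos e c) s (1 + icost s e + t1 + t2) s2"


section \<open>Input and output of programs\<close>

definition rats_as_ints :: "rat list \<Rightarrow> int list" where
  "rats_as_ints rs = concat (map (\<lambda>r. case quotient_of r of (a, b) \<Rightarrow> [a, b]) rs)"

text \<open>
  The input is the number of variables, of integer variables and of constraints, followed by the
  numerators and denominators of all entries of the data, matrices being listed row by row.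
\<close>

definition miqp_as_ints :: "nat \<Rightarrow> rat mat \<Rightarrow> rat vec \<Rightarrow> rat mat \<Rightarrow> rat vec \<Rightarrow> int list" where
  "miqp_as_ints p H h W w =
     [int (dim_vec h), int p, int (dim_vec w)] @
     rats_as_ints (concat (mat_to_list H) @ list_of_vec h @ concat (mat_to_list W) @ list_of_vec w)"

text \<open>The input is written to array \<open>0\<close>; all other cells are initially zero.\<close>

definition input_store :: "int list \<Rightarrow> store" where
  "input_store ks = (\<lambda>a i. if a = 0 \<and> 0 \<le> i \<and> i < int (length ks) then ks ! nat i else 0)"

text \<open>
  The answer is read from array \<open>1\<close>: cell \<open>0\<close> holds \<open>0\<close> if the problem is claimed to be
  infeasible, and it holds \<open>1\<close> if a point is returned. In the latter case, component \<open>i\<close> of the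
  point is the fraction formed by cells \<open>2 * i + 1\<close> and \<open>2 * i + 2\<close>.
\<close>

definition reports_infeasible :: "store \<Rightarrow> bool" where
  "reports_infeasible s \<longleftrightarrow> s 1 0 = 0"

definition returns_point :: "nat \<Rightarrow> store \<Rightarrow> real vec \<Rightarrow> bool" where
  "returns_point n s x \<longleftrightarrow>
     s 1 0 = 1 \<and> x \<in> carrier_vec n \<and>
     (\<forall>i<n. s 1 (2 * int i + 2) > 0 \<and>
            x $ i = of_int (s 1 (2 * int i + 1)) / of_int (s 1 (2 * int i + 2)))"

end

theory Submission
  imports Defs "Jordan_Normal_Form.Determinant"
begin

text \<open>
Linear programs are solved in integer arithmetic by rescaling with orthogonal projections. Used as an
optimization oracle, this yields a barycentric spanner of a polytope; after reducing the lattice with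
respect to it, either rounding gives a mixed integer point or the polytope is thin along a lattice direction,
and branching there is Lenstra's algorithm for fixed \<open>p\<close>. A bounded objective allows restriction to a box.
In each parity class of the integer parts take a barycentric spanner of the mixed integer points. The
midpoints of its members are feasible, and comparing the quadratic at a minimizer with its values at the
spanner and these midpoints gives the factor \<open>1 - 1 / (8 * (n + 1)\<^sup>2)\<close>.

\<open>PT D f\<close> says that on inputs from any \<open>D p\<close> the encoded value of \<open>f\<close> is computed in polynomial time, where
the program is the same for all \<open>p\<close> but the polynomial is not.
\<close>

text \<open>Every intermediate number must have polynomially many bits. Points are therefore
  homogeneous integer vectors, to be divided by entry 0, and linear algebra goes through one object:
  an orthogonal projection multiplied by the Gram determinant of independent vectors spanning its
  kernel. This is an integer matrix whose entries that determinant bounds; vertices, coordinates and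
  Gram-Schmidt data are read off from it. Spanners play the part of ellipsoidal rounding. They need
  only a linear optimization oracle, so one construction serves the continuous slices inside
  Lenstra's algorithm and the mixed integer hulls outside it. If a hull is not full-dimensional,
  artificial points \<open>e_i / K\<close> with huge \<open>K\<close> stay in the spanner, in
  directions that the hull lacks. The approximation factor is a polarization identity: on affine
  combinations with coefficients at most 2 in absolute value, the quadratic is a combination of its
  values at spanner points and midpoints, which costs \<open>8 * M^2\<close> for
  \<open>M = n + 1\<close> homogeneous coordinates. Since parity classes are cosets of
  \<open>2 * Z^p\<close>, Lenstra's algorithm runs on cosets throughout.\<close>

abbreviation (input) iffb (infixr "<->" 25) where "A <-> B == A = (B :: bool)"
abbreviation ri :: "int => real" where "ri == real_of_int"

abbreviation sk where "sk k == size_int (int (k))"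

section \<open>Bit lengths of integers\<close>

lemma size_int_le_iff: "size_int x <= e <-> (abs x) < 2^e"
proof -
have "size_int x <= e <-> nat (abs x) < 2^e" unfolding size_int_def by (simp add: floorlog_le_iff)
also have "... <-> int (nat (abs x)) < int (2^e)" by (rule of_nat_less_iff[symmetric])
also have "... <-> (abs x) < 2^e" by simp
finally show ?thesis .
qed

lemma size_int_less: "abs x < 2^size_int x" using size_int_le_iff by blast

lemma size_int_0 [simp]: "size_int 0 = 0" using size_int_le_iff[of 0 0] by simp

lemma size_int_1 [simp]: "size_int 1 = 1"
proof -
have "size_int 1 <= 1" "~ size_int 1 <= 0" by (simp_all add: size_int_le_iff del: le_zero_eq)
thus ?thesis by simp
qed

lemma size_int_mono: "abs x <= abs y ==> size_int x <= size_int y" using size_int_less[of y] by (simp add: size_int_le_iff)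

lemma size_int_add: "size_int (x+y) <= size_int x+size_int y+1"
proof -
have "abs (x+y) < 2^size_int x+2^size_int y" using size_int_less[of x] size_int_less[of y] by linarith
also have "... <= 2^(size_int x+size_int y)+2^(size_int x+size_int y)" by (intro add_mono power_increasing) auto
finally show ?thesis by (simp add: size_int_le_iff)
qed

lemma size_int_minus [simp]: "size_int (- x) = size_int x" by (simp add: size_int_def)

lemma size_int_abs [simp]: "size_int (abs x) = size_int x" by (simp add: size_int_def)

lemma size_int_diff: "size_int (x - y) <= size_int x+size_int y+1" using size_int_add[of x "- y"] by simp

lemma size_int_mult: "size_int (x*y) <= size_int x+size_int y"
proof -
have "abs (x*y) < 2^size_int x*2^size_int y" unfolding abs_mult using size_int_less[of x] size_int_less[of y] by (intro mult_strict_mono) auto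
thus ?thesis by (simp add: size_int_le_iff power_add)
qed

lemma abs_div_le: "abs (a div b) <= abs (a :: int)"
proof (cases "b = 0")
case False
have pos: "abs (a div b) <= abs a" if "b > 0" for a b :: int
proof (cases "a >= 0")
 case True
 hence "1*(a div b) <= b*(a div b)" using that by (intro mult_right_mono) (auto simp: pos_imp_zdiv_nonneg_iff)
 moreover have "b*(a div b)+a mod b = a" "0 <= a mod b" "0 <= a div b" using that True by (auto simp: pos_imp_zdiv_nonneg_iff)
 ultimately show ?thesis by linarith
next
 case False
 have "a*b <= a*1" using False that by (intro mult_left_mono_neg) auto
 hence "a*b div b <= a div b" using that by (intro zdiv_mono1) auto
 moreover have "a div b < 0" using that False by (simp add: pos_imp_zdiv_neg_iff)
 ultimately show ?thesis using that False by simp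
qed
show ?thesis using pos[of b a] pos[of "-b" "-a"] False by (cases "b > 0") auto
qed auto

lemma size_int_div: "size_int (x div y) <= size_int x" by (intro size_int_mono abs_div_le)

section \<open>A self-delimiting pairing of integers\<close>

definition zz :: "int => int" where
"zz a = (if a < 0 then - 2*a - 1 else 2*a)"

definition unzz :: "int => int" where
"unzz a = (if a mod 2 = 1 then - (a div 2) - 1 else a div 2)"

lemma unzz_zz [simp]: "unzz (zz a) = a" unfolding zz_def unzz_def by presburger

lemma zz_nonneg [simp]: "zz a >= 0" by (simp add: zz_def)

lemma size_int_zz: "size_int (zz a) <= size_int a+1" using size_int_less[of a] by (auto simp: size_int_le_iff zz_def)

definition pw :: "int => int" where "pw a = 2^size_int a"

text \<open>Read from the lowest bit: the number of trailing zeros announces the length of the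
  zigzag code \<open>zz a\<close>, a one ends the announcement, then come the bits of
  \<open>zz a\<close>, and \<open>b\<close> occupies the rest. Decoding needs only divisions,
  \<open>b\<close> may be negative because \<open>div\<close> rounds down, and the value is never 0,
  which leaves 0 free for the empty list.\<close>

definition pr :: "int => int => int" where
"pr a b = ((b*pw (zz a)+zz a)*2+1)*pw (zz a)"

lemma size_int_pow2: "size_int (2^e) = e+1"
proof -
have "size_int (2^e) <= e+1" "~ size_int (2^e) <= e" by (auto simp: size_int_le_iff)
thus ?thesis by simp
qed

lemma size_int_pw [simp]: "size_int (pw a) = size_int a+1" by (simp add: pw_def size_int_pow2)

lemma pw_gt: "zz a < pw (zz a)" using size_int_less[of "zz a"] by (simp add: pw_def)

lemma pw_pos [simp]: "pw a > 0" by (simp add: pw_def)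

lemma pw_nonneg [simp]: "0 <= pw a" by (simp add: pw_def)

text \<open>The coefficient 1 of \<open>size_int b\<close> is the point of this pairing: a list is a
  nest of pairs in the second component, and a larger factor would make its code exponential in the
  length.\<close>

lemma size_int_pr: "size_int (pr a b) <= size_int b+3*size_int a+10"
proof -
have "size_int (pr a b) <= size_int ((b*pw (zz a)+zz a)*2+1)+(size_int (zz a)+1)" unfolding pr_def using size_int_mult by (metis size_int_pw)
also have "size_int ((b*pw (zz a)+zz a)*2+1) <= size_int (b*pw (zz a)+zz a)+2" using size_int_less[of "b*pw (zz a)+zz a"] by (subst size_int_le_iff) (auto simp: power_add)
also have "size_int (b*pw (zz a)+zz a) <= size_int b+size_int (zz a)+2"
proof -
 have "abs (b*pw (zz a)+zz a) <= abs b*pw (zz a)+pw (zz a)" using pw_gt[of a] pw_pos[of "zz a"] by (intro order_trans[OF abs_triangle_ineq] add_mono) (auto simp: abs_mult simp del: pw_pos)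
 also have "... < 2^size_int b*pw (zz a)+pw (zz a)" using size_int_less[of b] by simp
 also have "... <= 2^size_int b*pw (zz a)+2^size_int b*pw (zz a)" by simp
 also have "... <= 2^(size_int b+size_int (zz a)+2)" by (simp add: pw_def power_add)
 finally show ?thesis by (simp add: size_int_le_iff)
qed
finally show ?thesis using size_int_zz[of a] by simp
qed

lemma pr_nonzero [simp]: "pr a b ~= 0"
proof -
have "(b*pw (zz a)+zz a)*2+1 ~= 0" by presburger
thus ?thesis unfolding pr_def using pw_pos[of "zz a"] by (simp del: pw_pos)
qed

lemma pw_le_abs_pr: "pw (zz a) <= abs (pr a b)"
proof -
have "abs ((b*pw (zz a)+zz a)*2+1) >= 1" by presburger
hence "1*pw (zz a) <= abs ((b*pw (zz a)+zz a)*2+1)*pw (zz a)" using pw_pos[of "zz a"] by (intro mult_right_mono) auto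
thus ?thesis unfolding pr_def abs_mult by (simp add: order_less_imp_le[OF pw_pos])
qed

lemma size_int_pr_fst: "size_int a <= size_int (pr a b)"
proof -
have "size_int a <= size_int (pw (zz a))" using pw_gt[of a] by (intro size_int_mono) (auto simp: zz_def split: if_splits)
also have "... <= size_int (pr a b)" using pw_le_abs_pr[of a b] pw_pos[of "zz a"] by (intro size_int_mono) linarith
finally show ?thesis .
qed

lemma size_int_pr_snd: "size_int b <= size_int (pr a b)"
proof -
let ?P = "pw (zz a)"
have "b = (pr a b div ?P) div 2 div ?P" unfolding pr_def using pw_pos[of "zz a"] pw_gt[of a] zz_nonneg[of a] by (simp add: div_pos_pos_trivial less_imp_neq[symmetric])
thus ?thesis by (metis size_int_div order_trans)
qed

section \<open>Encoding of data as integers\<close>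

class enc = fixes enc :: "'a => int"

definition isize :: "'a::enc => nat" where "isize x = size_int (enc x)"

instantiation int :: enc begin
definition enc_int :: "int => int" where "enc_int x = x"
instance ..
end
instantiation nat :: enc begin
definition enc_nat :: "nat => int" where "enc_nat x = int x"
instance ..
end
instantiation bool :: enc begin
definition enc_bool :: "bool => int" where "enc_bool x = (if x then 1 else 0)"
instance ..
end
instantiation prod :: (enc, enc) enc begin
definition enc_prod :: "'a \<times> 'b => int" where "enc_prod x = pr (enc (fst x)) (enc (snd x))"
instance ..
end
instantiation list :: (enc) enc begin
fun enc_list :: "'a list => int" where
"enc_list [] = 0" | "enc_list (x # xs) = pr (enc x) (enc_list xs)"
instance ..
end

section \<open>Straight-line code\<close>

text \<open>Array 2 is the working memory; arrays 0 and 1 are left to input and output.\<close>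

definition cell :: "store => nat => int" where "cell s j = s 2 (int j)"
definition setc :: "store => nat => int => store" where "setc s j v = s(2 := (s 2)(int j := v))"
text \<open>The calling convention: code at base \<open>k\<close> may spoil only the working cells
  from \<open>k\<close> on, so a caller keeps its own data below the base of the callee.\<close>

definition agree :: "nat => store => store => bool" where
"agree k s s' <-> (ALL a i. a ~= 2 | i < int k --> s' a i = s a i)"

definition vr :: "nat => iexp" where "vr j = Read 2 (Const (int j))"
definition wr :: "nat => iexp => prog" where "wr j e = Write 2 (Const (int j)) e"

lemma cell_setc [simp]: "cell (setc s j v) i = (if i = j then v else cell s i)" by (simp add: cell_def setc_def)

lemma agree_setc [simp]: "agree k s s' ==> j >= k ==> agree k s (setc s' j v)" by (auto simp: agree_def setc_def)

lemma agree_refl [simp]: "agree k s s" by (simp add: agree_def)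
lemma agree_trans: "agree k s s' ==> agree j s' s'' ==> k <= j ==> agree k s s''" unfolding agree_def by (metis of_nat_le_iff order_less_le_trans)
lemma agree_cell: "agree k s s' ==> j < k ==> cell s' j = cell s j" by (simp add: agree_def cell_def)

lemma ival_vr [simp]: "ival s (vr j) = cell s j" by (simp add: vr_def cell_def)
lemma icost_vr [simp]: "icost s (vr j) = size_int (cell s j)+(2+sk j)" by (simp add: vr_def cell_def)

definition ex :: "prog => store => nat => store => bool" where
"ex c s T s' <-> (EX t<=T. runs c s t s')"

lemma ex_wr: "2+sk j+icost s e <= T ==> ex (wr j e) s T (setc s j (ival s e))" unfolding ex_def wr_def setc_def
by (rule exI[of _ "1+icost s (Const (int j))+icost s e"]) (use Write[of 2 "Const (int j)" e s] in auto)

lemma ex_seq: "ex c1 s T1 s1 ==> ex c2 s1 T2 s2 ==> 1+T1+T2 <= T ==> ex (Seq c1 c2) s T s2" unfolding ex_def by (meson Seq add_mono le_refl order_trans)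

lemma ex_if: "(ival s e > 0 ==> ex c1 s T1 s') ==> (~ ival s e > 0 ==> ex c2 s T1 s') ==>
1+icost s e+T1 <= T ==> ex (IfPos e c1 c2) s T s'" unfolding ex_def by (metis (no_types, opaque_lifting) IfFalse IfTrue add_le_mono le_refl order_trans)

text \<open>The invariant is indexed by the number of completed rounds, and this index alone decides
  the guard; no termination measure is needed.\<close>

lemma ex_while:
assumes "!!i s. Inv i s ==> i < n ==> ival s e > 0 & icost s e <= C & (EX s'. ex c s B s' & Inv (Suc i) s')"
 and "!!s. Inv n s ==> ~ ival s e > 0 & icost s e <= C"
 and "Inv 0 s" and "(n+1)*(1+C+B) <= T"
shows "EX s'. ex (WhilePos e c) s T s' & Inv n s'"
proof -
have "EX s'. ex (WhilePos e c) s ((n - i+1)*(1+C+B)) s' & Inv n s'" if "i <= n" "Inv i s" for i s using that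
proof (induction i arbitrary: s rule: inc_induct)
 case base
 hence "runs (WhilePos e c) s (1+icost s e) s" using assms(2) by (intro WhileFalse) auto
 moreover have "1+icost s e <= (n - n+1)*(1+C+B)" using assms(2)[of s] base by auto
 ultimately show ?case using base unfolding ex_def by blast
next
 case (step i)
 from assms(1)[OF step.prems] step.hyps obtain s1 t1
  where 1: "ival s e > 0" "icost s e <= C" "runs c s t1 s1" "t1 <= B" "Inv (Suc i) s1" unfolding ex_def by fastforce
 from step.IH[OF 1(5)] obtain s2 t2
  where 2: "runs (WhilePos e c) s1 t2 s2" "t2 <= (n - Suc i+1)*(1+C+B)" "Inv n s2" unfolding ex_def by auto
 have "runs (WhilePos e c) s (1+icost s e+t1+t2) s2" using WhileTrue 1 2 by blast
 moreover have "1+icost s e+t1+t2 <= (n - i+1)*(1+C+B)"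
 proof -
  have eq: "n - i+1 = Suc (n - Suc i+1)" using step.hyps by simp
  show ?thesis unfolding eq mult_Suc using 1 2 by linarith
 qed
 ultimately show ?case unfolding ex_def using 2 by blast
qed
from this[of 0 s] assms(3,4) show ?thesis unfolding ex_def by (metis diff_zero le0 order_trans)
qed

lemma ival_size: "size_int (ival s e) <= icost s e" by (cases e) auto

text \<open>Writing a number costs at least its size, so running time bounds the growth of every
  cell. This is the source of all bounds on output sizes.\<close>

lemma runs_size: "runs c s t s' ==> size_int (s' a i) <= size_int (s a i)+t"
proof (induction rule: runs.induct)
case (Write b e1 e2 s)
thus ?case using ival_size[of s e2] by auto
qed auto

section \<open>Polynomially bounded functions\<close>

text \<open>The base is at least 2, so one exponent absorbs constants, sums and products; the
  exponent may depend on \<open>p\<close>.\<close>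

definition pb :: "(nat => 'a::enc set) => ('a => nat) => bool" where
"pb D g <-> (ALL p. EX d. ALL x:D p. g x <= (isize x+2)^d)"

lemma pbI: "(!!p. EX d. ALL x:D p. g x <= (isize x+2)^d) ==> pb D g" by (simp add: pb_def)

lemma pb_mono: "pb D g ==> (!!p x. x : D p ==> f x <= g x) ==> pb D f" unfolding pb_def by (meson order_trans)

lemma pb_subset: "pb D g ==> (!!p. E p \<subseteq> D p) ==> pb E g" unfolding pb_def by (meson subsetD)

lemma pb_isize: "pb D isize" unfolding pb_def by (intro allI exI[of _ 1]) auto

lemma pb_const: "pb D (%_. c)"
proof (rule pbI, intro exI[of _ c] ballI)
fix x :: 'a
have "c <= 2^c" by (simp add: less_imp_le_nat)
also have "... <= (isize x+2)^c" by (intro power_mono) auto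
finally show "c <= (isize x+2)^c" .
qed

lemma pb_pconst: "(!!p x. x : D p ==> g x <= h p) ==> pb D g" using pb_const[of D] unfolding pb_def by (meson order_trans)

lemma pb_mult: assumes "pb D f" "pb D g" shows "pb D (%x. f x*g x)"
proof (rule pbI)
fix p
from assms obtain d e where "ALL x:D p. f x <= (isize x+2)^d" "ALL x:D p. g x <= (isize x+2)^e" unfolding pb_def by meson
thus "EX d. ALL x:D p. f x*g x <= (isize x+2)^d" by (intro exI[of _ "d+e"]) (auto simp: power_add intro!: mult_le_mono)
qed

lemma pb_add: assumes "pb D f" "pb D g" shows "pb D (%x. f x+g x)"
proof -
from assms have 1: "pb D (%x. (f x+1)*(g x+1))"
proof -
 have s: "pb D (%x. f x+1)" if "pb D f" for f
 proof (rule pbI)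
  fix p
  from that obtain d where d: "ALL x:D p. f x <= (isize x+2)^d" unfolding pb_def by meson
  { fix x assume "x : D p"
   with d have "f x+1 <= (isize x+2)^d+1" by simp
   also have "... <= (isize x+2)^d*2" by simp
   also have "... <= (isize x+2)^Suc d" by simp
   finally have "f x+1 <= (isize x+2)^Suc d" . }
  thus "EX d. ALL x:D p. f x+1 <= (isize x+2)^d" by blast
 qed
 show ?thesis using s[OF assms(1)] s[OF assms(2)] by (rule pb_mult)
qed
show ?thesis by (rule pb_mono[OF 1]) simp
qed

lemma pb_Suc: "pb D f ==> pb D (%x. Suc (f x))" using pb_add[OF _ pb_const[of D 1]] by simp

lemma pb_power: "pb D f ==> pb D (%x. f x^n)" by (induction n) (simp_all add: pb_const pb_mult)

lemma pb_max: "pb D f ==> pb D g ==> pb D (%x. max (f x) (g x))" by (rule pb_mono[OF pb_add[of D f g]]) auto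

lemma pb_diff: "pb D f ==> pb D (%x. f x - g x)" by (rule pb_mono) auto

lemma pb_comp:
assumes "pb E T" "pb D (%x. isize (f x))" "!!p x. x : D p ==> f x : E p"
shows "pb D (%x. T (f x))"
proof (rule pbI)
fix p
from assms obtain d where d: "ALL x:E p. T x <= (isize x+2)^d" unfolding pb_def by meson
from pb_add[OF assms(2) pb_const[of D 2]] obtain e where
 e: "ALL x:D p. isize (f x)+2 <= (isize x+2)^e" unfolding pb_def by meson
{ fix x assume x: "x : D p"
 have "T (f x) <= (isize (f x)+2)^d" using d assms(3) x by blast
 also have "... <= ((isize x+2)^e)^d" using e x by (intro power_mono) auto
 finally have "T (f x) <= (isize x+2)^(e*d)" by (simp add: power_mult) }
thus "EX d. ALL x:D p. T (f x) <= (isize x+2)^d" by blast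
qed

lemmas pb_intros = pb_isize pb_const pb_mult pb_add pb_Suc pb_power pb_max pb_diff

section \<open>Polynomial-time functions\<close>

definition impl :: "nat => prog => int => int => nat => bool" where
"impl k c x y T <-> (ALL s. cell s k = x --> (EX s'. ex c s T s' & cell s' k = y & agree k s s'))"

text \<open>The quantifier over \<open>k\<close> makes code relocatable. The machine has no
  procedures, so every use of a function is a fresh copy of its code at another base; input and
  output share the cell at the base.\<close>

definition PT :: "(nat => 'a::enc set) => ('a => 'b::enc) => bool" where
"PT D f <-> (ALL k. EX c T. pb D T & (ALL p. ALL x:D p. impl k c (enc x) (enc (f x)) (T x)))"

abbreviation pimp where "pimp D k f == EX c T. pb D T & (ALL p. ALL x:D p. impl k c (enc x) (enc (f x)) (T x))"

lemma PTI: "(!!k. pimp D k (%x. f x)) ==> PT D f" by (simp add: PT_def)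

lemma PTE:
assumes "PT D f"
shows "EX T c. pb D T & (ALL p. ALL x:D p. ALL s. cell s k = enc x -->
 (EX s'. ex c s (T x) s' & cell s' k = enc (f x) & agree k s s'))" using assms unfolding PT_def impl_def by blast

lemma PT_subset: "PT D f ==> (!!p. E p \<subseteq> D p) ==> PT E f" unfolding PT_def by (metis pb_subset subsetD)

lemma PT_cong: "PT D f ==> (!!p x. x : D p ==> f x = g x) ==> PT D g" unfolding PT_def by metis

lemma PT_size: assumes "PT D f" shows "pb D (%x. isize (f x))"
proof -
from PTE[OF assms, of 0] obtain c T where T: "pb D T" and c: "!!p x s. x : D p ==> cell s 0 = enc x ==>
 (EX s'. ex c s (T x) s' & cell s' 0 = enc (f x) & agree 0 s s')" by blast
have "pb D (%x. isize x+T x)" using T by (intro pb_intros)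
thus ?thesis
proof (rule pb_mono)
 fix p x assume "x : D p"
 \<comment> \<open>A store that holds the input in every cell makes all initial sizes equal to
   \<open>isize x\<close>.\<close>
 from c[OF this, of "%_ _. enc x"] obtain t s' where "runs c (%_ _. enc x) t s'" "t <= T x" "cell s' 0 = enc (f x)" by (auto simp: ex_def cell_def)
 with runs_size[OF this(1), of 2 "int 0"] show "isize (f x) <= isize x+T x" by (simp add: cell_def isize_def)
qed
qed

lemma PT_id: "PT D (%x. x)"
proof (rule PTI)
fix k
show "EX c T. pb D T & (ALL p. ALL x:D p. impl k c (enc x) (enc x) (T x))" by (intro exI[of _ Skip] exI[of _ "%_. 1"])
  (auto simp: pb_const impl_def ex_def intro!: exI[of _ "Suc 0"] runs.Skip[simplified])
qed

lemma PT_const: "PT D (%x. v)"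
proof (rule PTI)
fix k
have "impl k (wr k (Const (enc v))) (enc x) (enc v) (3+sk k+size_int (enc v))" for x :: 'a unfolding impl_def
proof (intro allI impI)
 fix s
 show "EX s'. ex (wr k (Const (enc v))) s (3+sk k+size_int (enc v)) s' &
  cell s' k = enc v & agree k s s'" by (intro exI[of _ "setc s k (enc v)"] conjI ex_wr[where e = "Const (enc v)", simplified]) simp_all
qed
thus "EX c T. pb D T & (ALL p. ALL x:D p. impl k c (enc x) (enc v) (T x))" by (intro exI[of _ "wr k (Const (enc v))"] exI[of _ "%_. 3+sk k+size_int (enc v)"])
  (auto simp: pb_const)
qed

lemma PT_comp:
assumes "PT E g" "PT D f" "!!p x. x : D p ==> f x : E p"
shows "PT D (%x. g (f x))"
proof (rule PTI)
fix k
from PTE[OF assms(1), of k] obtain cg Tg where Tg: "pb E Tg" and cg: "!!p x s. x : E p ==> cell s k = enc x ==>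
 (EX s'. ex cg s (Tg x) s' & cell s' k = enc (g x) & agree k s s')" by blast
from PTE[OF assms(2), of k] obtain cf Tf where Tf: "pb D Tf" and cf: "!!p x s. x : D p ==> cell s k = enc x ==>
 (EX s'. ex cf s (Tf x) s' & cell s' k = enc (f x) & agree k s s')" by blast
have "pb D (%x. 1+Tf x+Tg (f x))" by (intro pb_intros Tf pb_comp[OF Tg] PT_size assms)
moreover have "impl k (Seq cf cg) (enc x) (enc (g (f x))) (1+Tf x+Tg (f x))" if "x : D p" for p x unfolding impl_def
proof (intro allI impI)
 fix s assume "cell s k = enc x"
 from cf[OF that this] obtain s1 where 1: "ex cf s (Tf x) s1" "cell s1 k = enc (f x)" "agree k s s1" by blast
 from cg[OF assms(3)[OF that] 1(2)] obtain s2
  where 2: "ex cg s1 (Tg (f x)) s2" "cell s2 k = enc (g (f x))" "agree k s1 s2" by blast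
 show "EX s'. ex (Seq cf cg) s (1+Tf x+Tg (f x)) s' & cell s' k = enc (g (f x)) & agree k s s'" using 1 2 by (intro exI[of _ s2] conjI ex_seq[OF 1(1) 2(1)] agree_trans[OF 1(3) 2(3)]) auto
qed
ultimately show "pimp D k (%x. g (f x))" by blast
qed

lemma enc_pair: "enc (x, y) = pr (enc x) (enc y)" by (simp add: enc_prod_def)

lemma isize_pair: "isize (x, y) <= isize y+3*isize x+10" by (simp add: isize_def enc_pair size_int_pr)
lemma isize_fst: "isize (fst x) <= isize x" and isize_snd: "isize (snd x) <= isize x" by (cases x; simp add: isize_def enc_pair size_int_pr_fst size_int_pr_snd)+

text \<open>Doubles cell \<open>j\<close> from \<open>1\<close> until it exceeds the nonnegative cell \<open>i\<close>, counting in cell \<open>l\<close>.\<close>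
definition dbl :: "nat => nat => nat => prog" where
"dbl i j l = Seq (wr j (Const 1)) (Seq (wr l (Const 0))
 (WhilePos (Add (Sub (vr i) (vr j)) (Const 1))
  (Seq (wr j (Add (vr j) (vr j))) (wr l (Add (vr l) (Const 1))))))"

lemma ex_wr_val: "ival s e = v ==> 2+sk j+icost s e <= T ==> ex (wr j e) s T (setc s j v)" using ex_wr by blast

lemma size_int_of_nat_le: "sk n <= n" unfolding size_int_le_iff by (metis abs_of_nat of_nat_less_two_power)

lemma dbl_ex:
assumes "cell s i = v" "v >= 0" "k <= j" "k <= l" "j ~= i" "l ~= i" "j ~= l"
defines "c == size_int v+sk i+sk j+sk l"
shows "EX s'. ex (dbl i j l) s (100*(c+2)*(c+2)) s' & agree k s s' &
 (ALL m. m ~= j & m ~= l --> cell s' m = cell s m) & cell s' j = pw v & cell s' l = int (size_int v)"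
proof -
define s1 where "s1 = setc (setc s j 1) l 0"
define Inv where "Inv n s' <-> agree k s s' & (ALL m. m ~= j & m ~= l --> cell s' m = cell s m) &
 cell s' j = 2^n & cell s' l = int n" for n s'
let ?e = "Add (Sub (vr i) (vr j)) (Const 1)"
let ?b = "Seq (wr j (Add (vr j) (vr j))) (wr l (Add (vr l) (Const 1)))"
have C: "icost s' ?e <= 6*c+20" if "Inv n s'" "n <= size_int v" for n s' using that assms size_int_diff[of v "2^n"] size_int_add[of "v - 2^n" 1] by (simp add: Inv_def size_int_pow2)
have "EX s'. ex (WhilePos ?e ?b) s1 (80*(c+1)*(c+1)) s' & Inv (size_int v) s'"
proof (rule ex_while[where C = "6*c+20" and B = "10*c+30"])
 fix n s' assume I: "Inv n s'" and n: "n < size_int v"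
 have "~ v < 2^n" using n assms(2) size_int_le_iff[of v n] by simp
 hence 1: "0 < ival s' ?e" using I assms by (simp add: Inv_def)
 let ?s1 = "setc s' j (2^n+2^n)"
 have 2: "ex (wr j (Add (vr j) (vr j))) s' (2+sk j+icost s' (Add (vr j) (vr j))) ?s1" using ex_wr[OF order_refl, where j = j and s = s' and e = "Add (vr j) (vr j)"] I by (simp add: Inv_def)
 let ?s2 = "setc ?s1 l (int (Suc n))"
 have 3: "ex (wr l (Add (vr l) (Const 1))) ?s1 (2+sk l+icost ?s1 (Add (vr l) (Const 1))) ?s2"
  using ex_wr[OF order_refl, where j = l and s = ?s1 and e = "Add (vr l) (Const 1)"] I assms(7) by (simp add: Inv_def add.commute)
 have "ex ?b s' (10*c+30) ?s2"
 proof (rule ex_seq[OF 2 3])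
  have "size_int (2^n+2^n) = n+2" using size_int_pow2[of "Suc n"] by simp
  hence "icost s' (Add (vr j) (vr j)) = 1+(n+2)+2*(n+1+(2+sk j))" using I by (simp add: Inv_def size_int_pow2)
  moreover have "icost ?s1 (Add (vr l) (Const 1)) <= 1+Suc n+(n+(2+sk l))+2" using I assms(7) size_int_of_nat_le[of n] size_int_of_nat_le[of "Suc n"]
   by (simp add: Inv_def add.commute[of "int n"])
  ultimately show "1+(2+sk j+icost s' (Add (vr j) (vr j))) +
   (2+sk l+icost ?s1 (Add (vr l) (Const 1))) <= 10*c+30" using n unfolding c_def by (simp del: icost.simps icost_vr)
 qed
 moreover have "Inv (Suc n) ?s2" using I assms(3-7) by (auto simp: Inv_def)
 ultimately show "0 < ival s' ?e & icost s' ?e <= 6*c+20 & (EX s''. ex ?b s' (10*c+30) s'' & Inv (Suc n) s'')" using 1 C[OF I less_imp_le[OF n]] by blast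
next
 fix s' assume I: "Inv (size_int v) s'"
 have "v < 2^size_int v" using size_int_less[of v] assms(2) by simp
 thus "~ 0 < ival s' ?e & icost s' ?e <= 6*c+20" using C[OF I] I assms by (simp add: Inv_def)
next
 show "Inv 0 s1" using assms(3-7) by (auto simp: Inv_def s1_def)
 have "(size_int v+1)*(1+(6*c+20)+(10*c+30)) <= (c+1)*(80*(c+1))" by (intro mult_le_mono) (auto simp: c_def)
 thus "(size_int v+1)*(1+(6*c+20)+(10*c+30)) <= 80*(c+1)*(c+1)" by (simp add: mult.commute mult.left_commute)
qed
then obtain s' where s': "ex (WhilePos ?e ?b) s1 (80*(c+1)*(c+1)) s'" "Inv (size_int v) s'" by blast
have "ex (wr l (Const 0)) (setc s j 1) (3+sk l) s1" unfolding s1_def by (rule ex_wr[where e = "Const 0", simplified]) simp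
from ex_seq[OF this s'(1) order_refl] have 1: "ex (Seq (wr l (Const 0)) (WhilePos ?e ?b)) (setc s j 1) (1+(3+sk l)+80*(c+1)*(c+1)) s'" .
have 2: "ex (wr j (Const 1)) s (4+sk j) (setc s j 1)" by (rule ex_wr[where e = "Const 1", simplified]) simp
have "ex (dbl i j l) s (100*(c+2)*(c+2)) s'" unfolding dbl_def
proof (rule ex_seq[OF 2 1])
 have "sk j+sk l <= c" by (simp add: c_def)
 moreover have le: "80*(c+1)*(c+1) <= 80*(c+2)*(c+2)" by (intro mult_le_mono) auto
 moreover have *: "1+(4+a)+(1+(3+b)+q) <= 100*m*m" if "a+b <= m" "q <= 80*m*m" "2 <= m" for a b q m :: nat
 proof -
  have "m <= m*m" "4 <= m*m" using that mult_le_mono[of 2 m 2 m] by simp_all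
  thus ?thesis using that(1,2) unfolding mult.assoc by linarith
 qed
 ultimately show "1+(4+sk j)+(1+(3+sk l)+80*(c+1)*(c+1)) <= 100*(c+2)*(c+2)" by (intro *[OF _ le]) linarith+
qed
thus ?thesis using s'(2) by (auto simp: Inv_def pw_def)
qed

section \<open>Pairing and unpairing\<close>

definition zzP :: "nat => prog" where
"zzP i = IfPos (Sub (Const 0) (vr i)) (wr i (Sub (Mul (Const (-2)) (vr i)) (Const 1))) (wr i (Mul (Const 2) (vr i)))"

definition pairP :: "nat => prog" where
"pairP k = Seq (zzP k) (Seq (dbl k (k+2) (k+3))
 (wr k (Mul (Add (Mul (Add (Mul (vr (k+1)) (vr (k+2))) (vr k)) (Const 2)) (Const 1)) (vr (k+2)))))"

lemma size_int_2 [simp]: "size_int 2 = 2" "size_int (-2) = 2" using size_int_pow2[of 1] by simp_all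

definition kk :: "nat => nat" where "kk k = sk k+sk (k+1)+sk (k+2)+sk (k+3)"

lemma zzP_ex: "ex (zzP i) s (100+20*(size_int (cell s i)+sk i)) (setc s i (zz (cell s i)))" unfolding zzP_def
proof (rule ex_if)
assume "0 < ival s (Sub (Const 0) (vr i))"
hence eq: "zz (cell s i) = ival s (Sub (Mul (Const (-2)) (vr i)) (Const 1))" by (simp add: zz_def)
show "ex (wr i (Sub (Mul (Const (-2)) (vr i)) (Const 1))) s (50+10*(size_int (cell s i)+sk i)) (setc s i (zz (cell s i)))"
 unfolding eq using size_int_mult[of "-2" "cell s i"] size_int_diff[of "-2*cell s i" 1] by (intro ex_wr) simp
next
assume "~ 0 < ival s (Sub (Const 0) (vr i))"
hence eq: "zz (cell s i) = ival s (Mul (Const 2) (vr i))" by (simp add: zz_def)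
show "ex (wr i (Mul (Const 2) (vr i))) s (50+10*(size_int (cell s i)+sk i)) (setc s i (zz (cell s i)))" unfolding eq using size_int_mult[of "2" "cell s i"] by (intro ex_wr) simp
qed simp

lemma pairP_ex:
obtains s' where "ex (pairP k) s (1000*(size_int (cell s k)+size_int (cell s (k+1))+kk k+3)^2) s'"
 "agree k s s'" "cell s' k = pr (cell s k) (cell s (k+1))"
proof -
let ?a = "cell s k" and ?b = "cell s (k+1)"
let ?m = "size_int ?a+size_int ?b+kk k+3"
define s1 where "s1 = setc s k (zz ?a)"
have 1: "ex (zzP k) s (100+20*(size_int ?a+sk k)) s1" unfolding s1_def by (rule zzP_ex)
obtain s2 where s2: "ex (dbl k (k+2) (k+3)) s1 (100*(size_int (zz ?a)+sk k+sk (k+2)+sk (k+3)+2) *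
  (size_int (zz ?a)+sk k+sk (k+2)+sk (k+3)+2)) s2" "agree k s1 s2"
 "ALL m. m ~= k+2 & m ~= k+3 --> cell s2 m = cell s1 m" "cell s2 (k+2) = pw (zz ?a)" using dbl_ex[of s1 k "zz ?a" k "k+2" "k+3"] by (auto simp: s1_def)
have T2: "100*(size_int (zz ?a)+sk k+sk (k+2)+sk (k+3)+2) *
  (size_int (zz ?a)+sk k+sk (k+2)+sk (k+3)+2) <= 100 * ?m * ?m" using size_int_zz[of ?a] by (intro mult_le_mono) (auto simp: kk_def)
let ?e = "Mul (Add (Mul (Add (Mul (vr (k+1)) (vr (k+2))) (vr k)) (Const 2)) (Const 1)) (vr (k+2))"
have c: "cell s2 k = zz ?a" "cell s2 (k+1) = ?b" using s2 by (simp_all add: s1_def)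
let ?P = "pw (zz ?a)"
have sz: "size_int ((?b * ?P+zz ?a)*2) <= size_int (?b * ?P+zz ?a)+2"
 "size_int ((?b * ?P+zz ?a)*2+1) <= size_int ((?b * ?P+zz ?a)*2)+2"
 "size_int (?b * ?P+zz ?a) <= size_int (?b * ?P)+size_int (zz ?a)+1"
 "size_int (?b * ?P) <= size_int ?b+(size_int (zz ?a)+1)" using size_int_mult[of "?b * ?P+zz ?a" 2] size_int_add[of "(?b * ?P+zz ?a)*2" 1] size_int_add size_int_mult[of ?b ?P] by auto
have "ex (wr k ?e) s2 (200 * ?m) (setc s2 k (ival s2 ?e))" using sz size_int_pr[of ?a ?b] size_int_zz[of ?a] c s2(4) by (intro ex_wr) (simp add: kk_def pr_def)
moreover have "ival s2 ?e = pr ?a ?b" using c s2(4) by (simp add: pr_def)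
ultimately have 3: "ex (wr k ?e) s2 (200 * ?m) (setc s2 k (pr ?a ?b))" by simp
have T: "1+(100+20*(size_int ?a+sk k))+(1+100 * ?m * ?m+200 * ?m) <= 1000 * ?m^2"
proof -
 have "1+(100+20*z)+(1+100*m*m+200*m) <= 1000*m^2" if "z <= m" "3 <= m" for z m :: nat
 proof -
  have "m <= m*m" "9 <= m*m" using that mult_le_mono[of 3 m 3 m] by simp_all
  thus ?thesis using that unfolding power2_eq_square mult.assoc by linarith
 qed
 note * = this
 show ?thesis by (rule *) (auto simp: kk_def)
qed
show ?thesis
proof (rule that)
 show "ex (pairP k) s (1000 * ?m^2) (setc s2 k (pr ?a ?b))" unfolding pairP_def by (rule ex_seq[OF 1 ex_seq[OF s2(1) 3 order_refl]]) (use T T2 in linarith)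
 show "agree k s (setc s2 k (pr ?a ?b))" using s2(2) by (auto simp: s1_def agree_def setc_def)
 show "cell (setc s2 k (pr ?a ?b)) k = pr (cell s k) (cell s (k+1))" by simp
qed
qed

text \<open>The loop finds the trailing power of two of the code: its guard is 1 minus a remainder,
  hence positive exactly while twice the current power still divides. The last branch undoes the
  zigzag code according to parity.\<close>

definition unpairP :: "nat => prog" where
"unpairP k = Seq (wr (k+2) (Const 1))
 (Seq (WhilePos (Sub (Const 1) (Sub (vr k) (Mul (Quot (vr k) (Add (vr (k+2)) (vr (k+2)))) (Add (vr (k+2)) (vr (k+2))))))
   (wr (k+2) (Add (vr (k+2)) (vr (k+2)))))
 (Seq (wr k (Quot (Quot (vr k) (vr (k+2))) (Const 2)))
 (Seq (wr (k+1) (Quot (vr k) (vr (k+2))))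
 (Seq (wr k (Sub (vr k) (Mul (vr (k+1)) (vr (k+2)))))
 (IfPos (Sub (vr k) (Mul (Quot (vr k) (Const 2)) (Const 2)))
   (wr k (Sub (Sub (Const 0) (Quot (vr k) (Const 2))) (Const 1)))
   (wr k (Quot (vr k) (Const 2))))))))"

lemma pr_mod:
assumes "i <= size_int (zz a)"
shows "pr a b mod (2^i+2^i) = 0 <-> i < size_int (zz a)"
proof -
define m where "m = b*pw (zz a)+zz a"
define n where "n = size_int (zz a)"
have c: "pr a b = (m*2+1)*2^n" by (simp add: pr_def m_def n_def pw_def)
have e: "2^i+2^i = (2 :: int)^Suc i" by simp
show ?thesis
proof (cases "i < n")
 case True
 hence "(2 :: int)^Suc i dvd 2^n" by (intro le_imp_power_dvd) simp
 thus ?thesis using True unfolding c e n_def[symmetric] by auto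
next
 case False
 hence "i = n" using assms by (simp add: n_def)
 have "~ (2 :: int)^Suc n dvd (m*2+1)*2^n"
 proof
  assume "(2 :: int)^Suc n dvd (m*2+1)*2^n"
  hence "2 dvd m*2+1" by simp
  thus False by presburger
 qed
 thus ?thesis unfolding c e \<open>i = n\<close> by (simp add: n_def[symmetric] dvd_eq_mod_eq_0)
qed
qed

lemma pr_dest: "pr a b div pw (zz a) div 2 = b*pw (zz a)+zz a"
"(b*pw (zz a)+zz a) div pw (zz a) = b"
"(b*pw (zz a)+zz a) - b*pw (zz a) = zz a" using pw_pos[of "zz a"] pw_gt[of a] zz_nonneg[of a] by (simp_all add: pr_def div_pos_pos_trivial less_imp_neq[symmetric])

lemma unpairP_ex:
assumes "cell s k = pr a b"
shows "EX s'. ex (unpairP k) s (1000*(size_int (pr a b)+kk k+3)^2) s' &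
 agree k s s' & cell s' k = a & cell s' (k+1) = b"
proof -
define c where "c = pr a b"
define n where "n = size_int (zz a)"
define P where "P = pw (zz a)"
define m where "m = size_int c+kk k+3"
have szP: "size_int P <= size_int c" using pw_le_abs_pr[of a b] pw_pos[of "zz a"] unfolding P_def c_def by (intro size_int_mono) linarith
have n1: "n+1 <= size_int c" using szP by (simp add: P_def n_def)
have kk: "sk k+sk (k+1)+sk (k+2)+sk (k+3)+size_int c+3 = m" by (simp add: kk_def m_def)
define s1 where "s1 = setc s (k+2) 1"
define Inv where "Inv i s' <-> agree k s s' & cell s' k = c & cell s' (k+2) = 2^i" for i s'
let ?v = "vr (k+2)"
let ?e = "Sub (Const 1) (Sub (vr k) (Mul (Quot (vr k) (Add ?v ?v)) (Add ?v ?v)))"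
have 1: "ex (wr (k+2) (Const 1)) s (2*m) s1" unfolding s1_def by (rule ex_wr[where e = "Const 1", simplified]) (use kk in simp)
have C: "icost s' ?e <= 40*m" if I: "Inv i s'" and "i <= n" for s' i
proof -
 let ?w = "2^i+2^i :: int"
 have w: "size_int ?w = i+2" using size_int_pow2[of "Suc i"] by simp
 have "size_int (c div ?w) <= size_int c" by (rule size_int_div)
 moreover have "size_int (c div ?w * ?w) <= size_int (c div ?w)+(i+2)" using size_int_mult w by metis
 moreover have "size_int (c - c div ?w * ?w) <= size_int c+size_int (c div ?w * ?w)+1" by (rule size_int_diff)
 moreover have "size_int (1 - (c - c div ?w * ?w)) <= size_int 1+size_int (c - c div ?w * ?w)+1" by (rule size_int_diff)
 ultimately show ?thesis using I that(2) n1 kk w by (simp add: Inv_def size_int_pow2)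
qed
have val: "ival s' ?e = 1 - c mod (2^i+2^i)" if "Inv i s'" for i s' using that by (simp add: Inv_def minus_div_mult_eq_mod)
have modn: "c mod (2^i+2^i) >= 0" for i :: nat by simp
have "EX s'. ex (WhilePos ?e (wr (k+2) (Add ?v ?v))) s1 (100*m*m) s' & Inv n s'"
proof (rule ex_while[where C = "40*m" and B = "20*m"])
 fix i s' assume I: "Inv i s'" and i: "i < n"
 have "size_int (2^i+2^i) = i+2" using size_int_pow2[of "Suc i"] by simp
 hence "ex (wr (k+2) (Add ?v ?v)) s' (20*m) (setc s' (k+2) (ival s' (Add ?v ?v)))" using I i n1 kk by (intro ex_wr) (simp add: Inv_def size_int_pow2)
 moreover have "Inv (Suc i) (setc s' (k+2) (ival s' (Add ?v ?v)))" using I by (simp add: Inv_def)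
 ultimately show "0 < ival s' ?e & icost s' ?e <= 40*m & (EX s''. ex (wr (k+2) (Add ?v ?v)) s' (20*m) s'' & Inv (Suc i) s'')"
 proof (intro conjI exI)
  show "0 < ival s' ?e" using i pr_mod[of i a b] unfolding val[OF I] c_def n_def by simp
 qed (use C[OF I] i in auto)
next
 fix s' assume I: "Inv n s'"
 have "~ 0 < ival s' ?e" using pr_mod[of n a b] modn[of n] unfolding val[OF I] c_def n_def by linarith
 thus "~ 0 < ival s' ?e & icost s' ?e <= 40*m" using C[OF I] by blast
next
 show "Inv 0 s1" using assms by (simp add: Inv_def s1_def c_def)
 have "(n+1)*(1+40*m+20*m) <= m*(100*m)" using n1 kk by (intro mult_le_mono) linarith+
 thus "(n+1)*(1+40*m+20*m) <= 100*m*m" by (simp add: mult.commute mult.left_commute)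
qed
then obtain s2 where s2: "ex (WhilePos ?e (wr (k+2) (Add ?v ?v))) s1 (100*m*m) s2" "Inv n s2" by blast
hence s2c: "cell s2 k = c" "cell s2 (k+2) = P" "agree k s s2" by (simp_all add: Inv_def P_def pw_def n_def)
define q where "q = b*P+zz a"
have q: "c div P div 2 = q" "q div P = b" "q - b*P = zz a" unfolding c_def P_def q_def by (rule pr_dest)+
have szq: "size_int (c div P) <= size_int c" "size_int q <= size_int c" "size_int b <= size_int c" "size_int (zz a) <= size_int c" "size_int a <= size_int c"
 using q(1) size_int_div[of c P] size_int_div[of "c div P" 2] size_int_pr_fst[of a b] size_int_pr_snd[of b a] n1 by (auto simp: c_def n_def)
define s3 where "s3 = setc s2 k q"
have 3: "ex (wr k (Quot (Quot (vr k) ?v) (Const 2))) s2 (20*m) s3" unfolding s3_def using szq kk szP s2c q by (intro ex_wr_val) simp_all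
define s4 where "s4 = setc s3 (k+1) b"
have 4: "ex (wr (k+1) (Quot (vr k) ?v)) s3 (20*m) s4" unfolding s4_def using szq kk szP s2c q by (intro ex_wr_val) (simp_all add: s3_def)
define s5 where "s5 = setc s4 k (zz a)"
have 5: "ex (wr k (Sub (vr k) (Mul (vr (k+1)) ?v))) s4 (20*m) s5" unfolding s5_def using szq kk szP s2c q size_int_mult[of b P] by (intro ex_wr_val) (simp_all add: s3_def s4_def)
define s6 where "s6 = setc s5 k a"
have z: "ival s5 (Sub (vr k) (Mul (Quot (vr k) (Const 2)) (Const 2))) = zz a mod 2" by (simp add: s5_def minus_div_mult_eq_mod)
have szz: "size_int (zz a mod 2) <= 1" by (cases "zz a mod 2 = 0") (auto simp: not_mod_2_eq_0_eq_1)
have szd: "size_int (zz a div 2) <= size_int c" using size_int_div[of "zz a" 2] szq by linarith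
have 6: "ex (IfPos (Sub (vr k) (Mul (Quot (vr k) (Const 2)) (Const 2)))
   (wr k (Sub (Sub (Const 0) (Quot (vr k) (Const 2))) (Const 1)))
   (wr k (Quot (vr k) (Const 2)))) s5 (100*m) s6"
proof (rule ex_if[where ?T1.0 = "50*m"])
 assume "0 < ival s5 (Sub (vr k) (Mul (Quot (vr k) (Const 2)) (Const 2)))"
 hence eq: "a = ival s5 (Sub (Sub (Const 0) (Quot (vr k) (Const 2))) (Const 1))" using z unzz_zz[of a] by (simp add: unzz_def s5_def split: if_splits)
 show "ex (wr k (Sub (Sub (Const 0) (Quot (vr k) (Const 2))) (Const 1))) s5 (50*m) s6" unfolding s6_def
 proof (subst eq, rule ex_wr)
  have "icost s5 (Sub (Sub (Const 0) (Quot (vr k) (Const 2))) (Const 1)) = size_int a+2*size_int (zz a div 2)+size_int (zz a)+sk k+11" using eq by (simp add: s5_def)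
  thus "2+sk k+icost s5 (Sub (Sub (Const 0) (Quot (vr k) (Const 2))) (Const 1)) <= 50*m" using szq szd kk by linarith
 qed
next
 assume "~ 0 < ival s5 (Sub (vr k) (Mul (Quot (vr k) (Const 2)) (Const 2)))"
 hence "zz a mod 2 = 0" using z pos_mod_sign[of 2 "zz a"] by linarith
 hence eq: "a = ival s5 (Quot (vr k) (Const 2))" using unzz_zz[of a] by (simp add: unzz_def s5_def split: if_splits)
 show "ex (wr k (Quot (vr k) (Const 2))) s5 (50*m) s6" unfolding s6_def using szq szd kk by (subst eq, intro ex_wr) (simp add: s5_def)
next
 have "size_int (zz a div 2*2) <= size_int c+2" using size_int_mult[of "zz a div 2" 2] szd by simp
 moreover have "icost s5 (Sub (vr k) (Mul (Quot (vr k) (Const 2)) (Const 2))) = size_int (zz a mod 2)+size_int (zz a div 2*2)+size_int (zz a div 2)+2*size_int (zz a)+2*sk k+13"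
  using z by (simp add: s5_def)
 ultimately show "1+icost s5 (Sub (vr k) (Mul (Quot (vr k) (Const 2)) (Const 2)))+50*m <= 100*m" using szq szd szz kk by linarith
qed
have "ex (unpairP k) s (1000*m^2) s6" unfolding unpairP_def
proof (rule ex_seq[OF 1 ex_seq[OF s2(1) ex_seq[OF 3 ex_seq[OF 4 ex_seq[OF 5 6 order_refl] order_refl] order_refl] order_refl]])
 have "3 <= m" using kk by simp
 hence "m <= m*m" "9 <= m*m" using mult_le_mono[of 3 m 3 m] by simp_all
 thus "1+2*m+(1+100*m*m+(1+20*m+(1+20*m+(1+20*m+100*m)))) <= 1000*m^2" unfolding power2_eq_square mult.assoc by linarith
qed
thus ?thesis using s2c by (intro exI[of _ s6]) (auto simp: s6_def s5_def s4_def s3_def m_def c_def)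
qed

section \<open>Closure properties of polynomial time\<close>

text \<open>Made for loops, in which a subprogram meets many arguments: if all of them have size at
  most \<open>S x\<close>, the worst cost is still polynomial. The inserted 0 covers an empty
  \<open>A x\<close>.\<close>

lemma pb_Max:
assumes "pb E T" "pb D S" "!!p x y. x : D p ==> y : A x ==> g x y : E p & isize (g x y) <= S x"
shows "pb D (%x. Max (insert 0 ((%y. T (g x y)) ` A x)))"
proof (rule pbI)
fix p
from assms(1) obtain d where d: "ALL x:E p. T x <= (isize x+2)^d" unfolding pb_def by meson
from pb_power[OF pb_add[OF assms(2) pb_const[of D 2]], of d] obtain e where
 e: "ALL x:D p. (S x+2)^d <= (isize x+2)^e" unfolding pb_def by meson
{ fix x assume x: "x : D p"
 have le: "T (g x y) <= (S x+2)^d" if "y : A x" for y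
 proof -
  have "T (g x y) <= (isize (g x y)+2)^d" using d assms(3)[OF x that] by blast
  also have "... <= (S x+2)^d" using assms(3)[OF x that] by (intro power_mono) auto
  finally show ?thesis .
 qed
 hence "(%y. T (g x y)) ` A x \<subseteq> {..(S x+2)^d}" by auto
 hence "finite ((%y. T (g x y)) ` A x)" using finite_subset by blast
 hence "Max (insert 0 ((%y. T (g x y)) ` A x)) <= (S x+2)^d" using le by (subst Max_le_iff) auto
 also have "... <= (isize x+2)^e" using e x by blast
 finally have "Max (insert 0 ((%y. T (g x y)) ` A x)) <= (isize x+2)^e" . }
thus "EX d. ALL x:D p. Max (insert 0 ((%y. T (g x y)) ` A x)) <= (isize x+2)^d" by blast
qed

lemma ex_copy: "i ~= j ==> ex (wr j (vr i)) s (4+size_int (cell s i)+sk i+sk j) (setc s j (cell s i))" by (rule ex_wr_val) simp_all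

text \<open>A program overwrites its input cell, so the input is copied first; running the second
  program at base \<open>k+2\<close> protects the first result in cell \<open>k+1\<close>.\<close>

lemma PT_two:
assumes "PT D f" "PT D g"
shows "EX c T. pb D T & (ALL p. ALL x:D p. ALL s. cell s k = enc x -->
 (EX s'. ex c s (T x) s' & cell s' k = enc (f x) & cell s' (k+1) = enc (g x) & agree k s s'))"
proof -
from PTE[OF assms(1), of "k+1"] obtain cf Tf where Tf: "pb D Tf" and cf: "!!p x s. x : D p ==> cell s (k+1) = enc x ==>
 (EX s'. ex cf s (Tf x) s' & cell s' (k+1) = enc (f x) & agree (k+1) s s')" by blast
from PTE[OF assms(2), of "k+2"] obtain cg Tg where Tg: "pb D Tg" and cg: "!!p x s. x : D p ==> cell s (k+2) = enc x ==>
 (EX s'. ex cg s (Tg x) s' & cell s' (k+2) = enc (g x) & agree (k+2) s s')" by blast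
let ?z = "%a x i j. 4+isize (a x)+sk i+sk j"
define c where "c = Seq (wr (k+1) (vr k)) (Seq cf (Seq (wr (k+2) (vr k)) (Seq cg
 (Seq (wr k (vr (k+1))) (wr (k+1) (vr (k+2)))))))"
define T where "T x = 1 + ?z (%x. x) x k (k+1)+(1+Tf x+(1 + ?z (%x. x) x k (k+2)+(1+Tg x+(1 + ?z f x (k+1) k + ?z g x (k+2) (k+1)))))" for x
have "pb D T" unfolding T_def by (intro pb_intros Tf Tg PT_size[OF assms(1)] PT_size[OF assms(2)])
moreover have "EX s'. ex c s (T x) s' & cell s' k = enc (f x) & cell s' (k+1) = enc (g x) & agree k s s'"
 if x: "x : D p" and s: "cell s k = enc x" for p x s
proof -
 define s1 where "s1 = setc s (k+1) (cell s k)"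
 have 1: "ex (wr (k+1) (vr k)) s (?z (%x. x) x k (k+1)) s1" unfolding s1_def using ex_copy[of k "k+1" s] s by (simp add: isize_def)
 from cf[OF x, of s1] obtain s2 where s2: "ex cf s1 (Tf x) s2" "cell s2 (k+1) = enc (f x)" "agree (k+1) s1 s2" using s by (auto simp: s1_def)
 have k2: "cell s2 k = enc x" using agree_cell[OF s2(3), of k] s by (simp add: s1_def)
 define s3 where "s3 = setc s2 (k+2) (cell s2 k)"
 have 3: "ex (wr (k+2) (vr k)) s2 (?z (%x. x) x k (k+2)) s3" unfolding s3_def using ex_copy[of k "k+2" s2] k2 by (simp add: isize_def)
 from cg[OF x, of s3] obtain s4 where s4: "ex cg s3 (Tg x) s4" "cell s4 (k+2) = enc (g x)" "agree (k+2) s3 s4" using k2 by (auto simp: s3_def)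
 have k4: "cell s4 (k+1) = enc (f x)" using agree_cell[OF s4(3), of "k+1"] s2(2) by (simp add: s3_def)
 define s5 where "s5 = setc s4 k (cell s4 (k+1))"
 have 5: "ex (wr k (vr (k+1))) s4 (?z f x (k+1) k) s5" unfolding s5_def using ex_copy[of "k+1" k s4] k4 by (simp add: isize_def)
 define s6 where "s6 = setc s5 (k+1) (cell s5 (k+2))"
 have 6: "ex (wr (k+1) (vr (k+2))) s5 (?z g x (k+2) (k+1)) s6" unfolding s6_def using ex_copy[of "k+2" "k+1" s5] s4(2) by (simp add: isize_def s5_def)
 have "ex c s (T x) s6" unfolding c_def T_def by (rule ex_seq[OF 1 ex_seq[OF s2(1) ex_seq[OF 3 ex_seq[OF s4(1) ex_seq[OF 5 6 order_refl] order_refl] order_refl] order_refl] order_refl])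
 moreover have "agree k s s4" using agree_trans[of k s s1 "k+1" s2] agree_trans[of k s s2 k s3] agree_trans[of k s s3 "k+2" s4] s2(3) s4(3) by (simp add: s1_def s3_def)
 hence "agree k s s6" by (simp add: s6_def s5_def)
 ultimately show ?thesis using k4 s4(2) by (intro exI[of _ s6]) (simp add: s6_def s5_def)
qed
ultimately show ?thesis by blast
qed

lemma PT_mkpair:
assumes "PT D f" "PT D g" "!!p x. x : D p ==> enc (h x) = pr (enc (f x)) (enc (g x))"
shows "PT D h"
proof (rule PTI)
fix k
from PT_two[OF assms(1,2), of k] obtain c T where T: "pb D T" and c: "!!p x s. x : D p ==> cell s k = enc x ==>
 (EX s'. ex c s (T x) s' & cell s' k = enc (f x) & cell s' (k+1) = enc (g x) & agree k s s')" by blast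
let ?T = "%x. 1+T x+1000*(isize (f x)+isize (g x)+kk k+3)^2"
have "pb D ?T" by (intro pb_intros T PT_size assms)
moreover have "impl k (Seq c (pairP k)) (enc x) (enc (h x)) (?T x)" if x: "x : D p" for p x unfolding impl_def
proof (intro allI impI)
 fix s assume "cell s k = enc x"
 from c[OF x this] obtain s1 where s1: "ex c s (T x) s1" "cell s1 k = enc (f x)" "cell s1 (k+1) = enc (g x)" "agree k s s1" by blast
 obtain s2 where "ex (pairP k) s1 (1000*(isize (f x)+isize (g x)+kk k+3)^2) s2"
  "agree k s1 s2" "cell s2 k = enc (h x)" using pairP_ex[of k s1] s1(2,3) assms(3)[OF x] unfolding isize_def by metis
 thus "EX s'. ex (Seq c (pairP k)) s (?T x) s' & cell s' k = enc (h x) & agree k s s'" using s1 by (intro exI[of _ s2] conjI ex_seq[OF s1(1)] agree_trans[OF s1(4)]) auto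
qed
ultimately show "pimp D k (%x. h x)" by blast
qed

lemma PT_unpair:
assumes "PT D f" "!!p x. x : D p ==> enc (f x) = pr (enc (g x)) (enc (h x))"
shows "PT D g" "PT D h"
proof -
have "EX c T. pb D T & (ALL p. ALL x:D p. ALL s. cell s k = enc x -->
 (EX s'. ex c s (T x) s' & cell s' k = enc (g x) & cell s' (k+1) = enc (h x) & agree k s s'))" for k
proof -
 from PTE[OF assms(1), of k] obtain c T where T: "pb D T" and c: "!!p x s. x : D p ==> cell s k = enc x ==>
  (EX s'. ex c s (T x) s' & cell s' k = enc (f x) & agree k s s')" by blast
 let ?T = "%x. 1+T x+1000*(isize (f x)+kk k+3)^2"
 have "pb D ?T" by (intro pb_intros T PT_size assms)
 moreover have "EX s'. ex (Seq c (unpairP k)) s (?T x) s' & cell s' k = enc (g x) & cell s' (k+1) = enc (h x) & agree k s s'"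
  if x: "x : D p" and s: "cell s k = enc x" for p x s
 proof -
  from c[OF x s] obtain s1 where s1: "ex c s (T x) s1" "cell s1 k = enc (f x)" "agree k s s1" by blast
  obtain s2 where s2: "ex (unpairP k) s1 (1000*(isize (f x)+kk k+3)^2) s2"
   "agree k s1 s2" "cell s2 k = enc (g x)" "cell s2 (k+1) = enc (h x)" using unpairP_ex[of s1 k "enc (g x)" "enc (h x)"] s1(2) assms(2)[OF x] unfolding isize_def by metis
  thus ?thesis by (intro exI[of _ s2] conjI ex_seq[OF s1(1) s2(1)] agree_trans[OF s1(3) s2(2)]) auto
 qed
 ultimately show ?thesis by blast
qed
note * = this
show "PT D g"
proof (rule PTI)
 fix k
 from *[of k] show "pimp D k (%x. g x)" unfolding impl_def by blast
qed
show "PT D h"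
proof (rule PTI)
 fix k
 from *[of k] obtain c T where T: "pb D T" and c: "!!p x s. x : D p ==> cell s k = enc x ==>
  (EX s'. ex c s (T x) s' & cell s' k = enc (g x) & cell s' (k+1) = enc (h x) & agree k s s')" by blast
 let ?z = "%x. 4+(isize x+T x)+sk (k+1)+sk k"
 have "pb D (%x. 1+T x + ?z x)" by (intro pb_intros T)
 moreover have "impl k (Seq c (wr k (vr (k+1)))) (enc x) (enc (h x)) (1+T x + ?z x)" if x: "x : D p" for p x unfolding impl_def
 proof (intro allI impI)
  fix s0 assume s0: "cell s0 k = enc x"
  define s where "s = (%a i. if i = int k+1 then 0 else s0 a i)"
  from c[OF x s0] obtain s1 where s1: "ex c s0 (T x) s1" "cell s1 k = enc (g x)" "cell s1 (k+1) = enc (h x)" "agree k s0 s1" by blast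
  \<comment> \<open>The size of the second component is bounded by a run on the store filled with
    the input, because in the given store cell \<open>k+1\<close> may start with an arbitrarily
    large number.\<close>
  from c[OF x, of "%a i. enc x"] obtain s' where "ex c (%a i. enc x) (T x) s'" "cell s' (k+1) = enc (h x)" by (auto simp: cell_def)
  hence sz: "size_int (enc (h x)) <= isize x+T x" using runs_size[of c "%a i. enc x" _ s' 2 "int (k+1)"] unfolding ex_def cell_def isize_def by fastforce
  have "ex (wr k (vr (k+1))) s1 (?z x) (setc s1 k (enc (h x)))" using sz s1(3) by (intro ex_wr_val) simp_all
  from ex_seq[OF s1(1) this order_refl] show "EX s'. ex (Seq c (wr k (vr (k+1)))) s0 (1+T x + ?z x) s' & cell s' k = enc (h x) & agree k s0 s'"
   using s1(4) by (intro exI[of _ "setc s1 k (enc (h x))"]) simp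
 qed
 ultimately show "pimp D k (%x. h x)" by blast
qed
qed

lemma PT_cast: "PT D f ==> (!!p x. x : D p ==> enc (g x) = enc (f x)) ==> PT D g" unfolding PT_def by metis

lemma PT_pair: "PT D f ==> PT D g ==> PT D (%x. (f x, g x))" by (rule PT_mkpair) (auto simp: enc_pair)
lemma PT_fst: "PT D f ==> PT D (%x. fst (f x))" by (rule PT_unpair(1)[where h = "%x. snd (f x)"]) (auto simp: enc_prod_def)
lemma PT_snd: "PT D f ==> PT D (%x. snd (f x))" by (rule PT_unpair(2)[where g = "%x. fst (f x)"]) (auto simp: enc_prod_def)
lemma PT_Cons: "PT D f ==> PT D g ==> PT D (%x. f x # g x)" by (rule PT_mkpair) auto
lemma PT_hd: "PT D f ==> (!!p x. x : D p ==> f x ~= []) ==> PT D (%x. hd (f x))" by (rule PT_unpair(1)[where h = "%x. tl (f x)"]) (assumption, metis enc_list.simps(2) list.collapse)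
lemma PT_tl0: "PT D f ==> (!!p x. x : D p ==> f x ~= []) ==> PT D (%x. tl (f x))" by (rule PT_unpair(2)[where g = "%x. hd (f x)"]) (assumption, metis enc_list.simps(2) list.collapse)

lemma bin_cost:
assumes "!!x y. size_int (F x y) <= size_int x+size_int y+1" "!!s. icost s (e k) = 1+size_int (F (cell s k) (cell s (k+1)))+icost s (vr k)+icost s (vr (k+1))"
shows "EX C. ALL s. icost s (e k) <= C*(size_int (cell s k)+size_int (cell s (k+1))+1)"
proof (intro exI allI)
fix s
show "icost s (e k) <= (10+sk k+sk (k+1))*(size_int (cell s k)+size_int (cell s (k+1))+1)" unfolding assms(2) using assms(1)[of "cell s k" "cell s (k+1)"] by (simp add: add_mult_distrib)
qed

lemma PT_bin:
fixes h :: "'a::enc => int" and f g :: "'a => int"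
assumes "PT D f" "PT D g"
 and "!!k s. ival s (e k) = F (cell s k) (cell s (k+1))"
 and "!!x y. size_int (F x y) <= size_int x+size_int y+1"
 and "!!k s. icost s (e k) = 1+size_int (F (cell s k) (cell s (k+1)))+icost s (vr k)+icost s (vr (k+1))"
shows "PT D (%x. F (f x) (g x))"
proof (rule PTI)
fix k
from PT_two[OF assms(1,2), of k] obtain c T where T: "pb D T" and c: "!!p x s. x : D p ==> cell s k = enc x ==>
 (EX s'. ex c s (T x) s' & cell s' k = enc (f x) & cell s' (k+1) = enc (g x) & agree k s s')" by blast
from bin_cost[of F e k, OF assms(4,5)] obtain C where C: "!!s. icost s (e k) <= C*(size_int (cell s k)+size_int (cell s (k+1))+1)" by blast
let ?T = "%x. 1+T x+(2+sk k+C*(isize (f x)+isize (g x)+1))"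
have "pb D ?T" by (intro pb_intros T PT_size assms)
moreover have "impl k (Seq c (wr k (e k))) (enc x) (enc (F (f x) (g x))) (?T x)" if x: "x : D p" for p x unfolding impl_def
proof (intro allI impI)
 fix s assume "cell s k = enc x"
 from c[OF x this] obtain s1 where s1: "ex c s (T x) s1" "cell s1 k = enc (f x)" "cell s1 (k+1) = enc (g x)" "agree k s s1" by blast
 have 2: "ex (wr k (e k)) s1 (2+sk k+C*(isize (f x)+isize (g x)+1)) (setc s1 k (F (f x) (g x)))" using C[of s1] s1(2,3) assms(3) by (intro ex_wr_val) (auto simp: enc_int_def isize_def)
 show "EX s'. ex (Seq c (wr k (e k))) s (?T x) s' & cell s' k = enc (F (f x) (g x)) & agree k s s'" using ex_seq[OF s1(1) 2 order_refl] s1(4) 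
  by (intro exI[of _ "setc s1 k (F (f x) (g x))"]) (auto simp: enc_int_def)
qed
ultimately show "pimp D k (%x. F (f x) (g x))" by blast
qed

lemma PT_add: "PT D f ==> PT D g ==> PT D (%x. f x+g x :: int)" by (rule PT_bin[where F = "%x y. x+y" and e = "%k. Add (vr k) (vr (k+1))"]) (simp_all add: size_int_add[simplified])
lemma PT_sub: "PT D f ==> PT D g ==> PT D (%x. f x - g x :: int)" by (rule PT_bin[where F = "%x y. x - y" and e = "%k. Sub (vr k) (vr (k+1))"]) (simp_all add: size_int_diff[simplified])
lemma PT_mul: "PT D f ==> PT D g ==> PT D (%x. f x*g x :: int)" by (rule PT_bin[where F = "%x y. x*y" and e = "%k. Mul (vr k) (vr (k+1))"])
 (simp_all add: le_SucI[OF size_int_mult])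
lemma PT_div: "PT D f ==> PT D g ==> PT D (%x. f x div g x :: int)" by (rule PT_bin[where F = "%x y. x div y" and e = "%k. Quot (vr k) (vr (k+1))"])
 (simp_all add: le_SucI[OF trans_le_add1[OF size_int_div]])
lemma PT_uminus: "PT D f ==> PT D (%x. - f x :: int)" using PT_sub[OF PT_const[of D 0]] by simp

text \<open>Each branch has to be polynomial only on its own part of the domain, which allows
  partial operations such as \<open>hd\<close> behind a test.\<close>

lemma PT_if_pos:
assumes t: "PT D (t :: _ => int)" and f: "PT (%p. {x : D p. t x > 0}) f" and g: "PT (%p. {x : D p. ~ t x > 0}) g"
shows "PT D (%x. if t x > 0 then f x else g x)"
proof (rule PTI)
fix k
from PTE[OF t, of "k+1"] obtain ct Tt where Tt: "pb D Tt" and ct: "!!p x s. x : D p ==> cell s (k+1) = enc x ==>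
 (EX s'. ex ct s (Tt x) s' & cell s' (k+1) = enc (t x) & agree (k+1) s s')" by blast
from PTE[OF f, of k] obtain cf Tf where Tf: "pb (%p. {x : D p. t x > 0}) Tf" and cf: "!!p x s. x : D p ==> t x > 0 ==> cell s k = enc x ==>
 (EX s'. ex cf s (Tf x) s' & cell s' k = enc (f x) & agree k s s')" by blast
from PTE[OF g, of k] obtain cg Tg where Tg: "pb (%p. {x : D p. ~ t x > 0}) Tg" and cg: "!!p x s. x : D p ==> ~ t x > 0 ==> cell s k = enc x ==>
 (EX s'. ex cg s (Tg x) s' & cell s' k = enc (g x) & agree k s s')" by blast
define c where "c = Seq (wr (k+1) (vr k)) (Seq ct (IfPos (vr (k+1)) cf cg))"
let ?z = "%x. 4+isize x+sk k+sk (k+1)"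
let ?B = "%x. if t x > 0 then Tf x else Tg x"
let ?T = "%x. 1 + ?z x+(1+Tt x+(1+(isize (t x)+(2+sk (k+1))) + ?B x))"
have "pb D ?B"
proof (rule pbI)
 fix p
 from Tf Tg obtain d e where de: "ALL x:{x : D p. t x > 0}. Tf x <= (isize x+2)^d"
  "ALL x:{x : D p. ~ t x > 0}. Tg x <= (isize x+2)^e" unfolding pb_def by meson
 { fix x assume "x : D p"
  hence "?B x <= max ((isize x+2)^d) ((isize x+2)^e)" using de by (auto simp: le_max_iff_disj)
  also have "... <= (isize x+2)^(max d e)" by (auto intro!: power_increasing)
  finally have "?B x <= (isize x+2)^(max d e)" . }
 thus "EX d. ALL x:D p. ?B x <= (isize x+2)^d" by blast
qed
hence "pb D ?T" by (intro pb_intros Tt PT_size[OF t])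
moreover have "impl k c (enc x) (enc (if t x > 0 then f x else g x)) (?T x)" if x: "x : D p" for p x unfolding impl_def
proof (intro allI impI)
 fix s assume s: "cell s k = enc x"
 define s1 where "s1 = setc s (k+1) (cell s k)"
 have 1: "ex (wr (k+1) (vr k)) s (?z x) s1" unfolding s1_def using ex_copy[of k "k+1" s] s by (simp add: isize_def)
 from ct[OF x, of s1] obtain s2 where s2: "ex ct s1 (Tt x) s2" "cell s2 (k+1) = enc (t x)" "agree (k+1) s1 s2" using s by (auto simp: s1_def)
 have k2: "cell s2 k = enc x" using agree_cell[OF s2(3), of k] s by (simp add: s1_def)
 have a2: "agree k s s2" using agree_trans[of k s s1 "k+1" s2] s2(3) by (simp add: s1_def)
 have "EX s3. ex (if t x > 0 then cf else cg) s2 (?B x) s3 & cell s3 k = enc (if t x > 0 then f x else g x) & agree k s2 s3" using cf[OF x _ k2] cg[OF x _ k2] by auto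
 then obtain s3 where s3: "ex (if t x > 0 then cf else cg) s2 (?B x) s3" "cell s3 k = enc (if t x > 0 then f x else g x)" "agree k s2 s3" by blast
 have 3: "ex (IfPos (vr (k+1)) cf cg) s2 (1+(isize (t x)+(2+sk (k+1))) + ?B x) s3" by (rule ex_if[where ?T1.0 = "?B x"]) (use s3(1) s2(2) in "auto simp: isize_def enc_int_def")
 show "EX s'. ex c s (?T x) s' & cell s' k = enc (if t x > 0 then f x else g x) & agree k s s'"
  unfolding c_def using ex_seq[OF 1 ex_seq[OF s2(1) 3 order_refl] order_refl] s3 agree_trans[OF a2 s3(3)] by blast
qed
ultimately show "pimp D k (%x. if t x > 0 then f x else g x)" by blast
qed

lemma PT_if:
assumes "PT D b" "PT (%p. {x : D p. b x}) f" "PT (%p. {x : D p. ~ b x}) g"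
shows "PT D (%x. if b x then f x else g x)"
proof -
have "PT D (%x. if (if b x then 1 else 0) > (0::int) then f x else g x)"
proof (rule PT_if_pos)
 have *: "(if b x then 1 else 0) > (0::int) <-> b x" for x by simp
 show "PT (%p. {x : D p. (if b x then 1 else 0) > (0::int)}) f" "PT (%p. {x : D p. ~ (if b x then 1 else 0) > (0::int)}) g" unfolding * using assms by auto
qed (auto intro: PT_cast[OF assms(1)] simp: enc_bool_def enc_int_def)
thus ?thesis by (rule PT_cong) auto
qed

text \<open>The bound \<open>M\<close> on all intermediate states is a hypothesis because
  polynomially many polynomial-time rounds can still blow up the size exponentially.
  \<open>E\<close> is the set of states on which guard and body are known to be fast.\<close>

lemma PT_while:
assumes b: "PT E b" and f: "PT (%p. {x : E p. b x}) f" and n: "pb D n" and M: "pb D M"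
 and it: "!!p x i. x : D p ==> i <= n x ==> (f ^^ i) x : E p & isize ((f ^^ i) x) <= M x & (b ((f ^^ i) x) <-> i < n x)"
shows "PT D (%x. (f ^^ n x) x)"
proof (rule PTI)
fix k
from PTE[OF b, of "k+1"] obtain cb Tb where Tb: "pb E Tb" and cb: "!!p x s. x : E p ==> cell s (k+1) = enc x ==>
 (EX s'. ex cb s (Tb x) s' & cell s' (k+1) = enc (b x) & agree (k+1) s s')" by blast
from PTE[OF f, of k] obtain cf Tf where Tf: "pb (%p. {x : E p. b x}) Tf" and cf: "!!p x s. x : E p ==> b x ==> cell s k = enc x ==>
 (EX s'. ex cf s (Tf x) s' & cell s' k = enc (f x) & agree k s s')" by blast
let ?pre = "Seq (wr (k+1) (vr k)) cb"
let ?body = "Seq cf ?pre"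
define c where "c = Seq ?pre (WhilePos (vr (k+1)) ?body)"
define Bb where "Bb x = Max (insert 0 ((%i. Tb ((f ^^ i) x)) ` {..n x}))" for x
define Bf where "Bf x = Max (insert 0 ((%i. Tf ((f ^^ i) x)) ` {..<n x}))" for x
let ?K = "sk k+sk (k+1)"
let ?P = "%x. 1+(4+M x + ?K)+Bb x"
let ?C = "3 + ?K"
let ?T = "%x. 1 + ?P x+(n x+1)*(1 + ?C+(1+Bf x + ?P x))"
have "pb D Bb" unfolding Bb_def using it by (intro pb_Max[OF Tb M]) auto
moreover have "pb D Bf" unfolding Bf_def using it by (intro pb_Max[OF Tf M]) (auto simp: less_imp_le)
ultimately have "pb D ?T" by (intro pb_intros n M)
moreover have "impl k c (enc x) (enc ((f ^^ n x) x)) (?T x)" if x: "x : D p" for p x unfolding impl_def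
proof (intro allI impI)
 fix s assume s: "cell s k = enc x"
 define Inv where "Inv i s' <-> cell s' k = enc ((f ^^ i) x) & cell s' (k+1) = (if i < n x then 1 else 0) & agree k s s'" for i s'
 have pre: "EX s'. ex ?pre s0 (?P x) s' & Inv i s'" if s0: "cell s0 k = enc ((f ^^ i) x)" "agree k s s0" and i: "i <= n x" for i s0
 proof -
  define s1 where "s1 = setc s0 (k+1) (cell s0 k)"
  have 1: "ex (wr (k+1) (vr k)) s0 (4+M x + ?K) s1" unfolding s1_def using s0 it[OF x i] by (intro ex_wr_val) (auto simp: isize_def)
  from cb[of "(f ^^ i) x" p s1] it[OF x i] obtain s2 where s2: "ex cb s1 (Tb ((f ^^ i) x)) s2" "cell s2 (k+1) = enc (b ((f ^^ i) x))" "agree (k+1) s1 s2" using s0 by (auto simp: s1_def)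
  have "Tb ((f ^^ i) x) <= Bb x" unfolding Bb_def using i by (intro Max_ge) auto
  hence "ex ?pre s0 (?P x) s2" by (intro ex_seq[OF 1 s2(1)]) auto
  moreover have "cell s2 k = enc ((f ^^ i) x)" using agree_cell[OF s2(3), of k] s0 by (simp add: s1_def)
  moreover have "agree k s s2" using agree_trans[of k s s1 "k+1" s2] s2(3) s0 by (simp add: s1_def)
  ultimately show ?thesis using s2 it[OF x i] by (auto simp: Inv_def enc_bool_def)
 qed
 from pre[of s 0] s obtain s1 where s1: "ex ?pre s (?P x) s1" "Inv 0 s1" by auto
 have "EX s'. ex (WhilePos (vr (k+1)) ?body) s1 ((n x+1)*(1 + ?C+(1+Bf x + ?P x))) s' & Inv (n x) s'"
 proof (rule ex_while[where C = "?C" and B = "1+Bf x + ?P x"])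
  fix i s' assume I: "Inv i s'" and i: "i < n x"
  have "(f ^^ i) x : E p" "b ((f ^^ i) x)" using it[OF x, of i] i by auto
  from cf[OF this, of s'] I obtain s2 where s2: "ex cf s' (Tf ((f ^^ i) x)) s2" "cell s2 k = enc ((f ^^ Suc i) x)" "agree k s' s2" by (auto simp: Inv_def)
  have "Tf ((f ^^ i) x) <= Bf x" unfolding Bf_def using i by (intro Max_ge) auto
  moreover obtain s3 where s3: "ex ?pre s2 (?P x) s3" "Inv (Suc i) s3" using pre[OF s2(2)] s2(3) I i agree_trans[of k s s' k s2] by (auto simp: Inv_def)
  ultimately have "ex ?body s' (1+Bf x + ?P x) s3" by (intro ex_seq[OF s2(1) s3(1)]) auto
  thus "0 < ival s' (vr (k+1)) & icost s' (vr (k+1)) <= ?C & (EX s''. ex ?body s' (1+Bf x + ?P x) s'' & Inv (Suc i) s'')" using s3(2) I i by (auto simp: Inv_def)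
 qed (use s1 in "auto simp: Inv_def")
 then obtain s2 where s2: "ex (WhilePos (vr (k+1)) ?body) s1 ((n x+1)*(1 + ?C+(1+Bf x + ?P x))) s2" "Inv (n x) s2" by blast
 show "EX s'. ex c s (?T x) s' & cell s' k = enc ((f ^^ n x) x) & agree k s s'" unfolding c_def using ex_seq[OF s1(1) s2(1) order_refl] s2(2) unfolding Inv_def by blast
qed
ultimately show "pimp D k (%x. (f ^^ n x) x)" by blast
qed

lemma PT_size_int:
assumes "PT D f"
shows "PT D (%x. size_int (f x))"
proof (rule PTI)
fix k
from PTE[OF assms, of k] obtain c T where T: "pb D T" and c: "!!p x s. x : D p ==> cell s k = enc x ==>
 (EX s'. ex c s (T x) s' & cell s' k = enc (f x) & agree k s s')" by blast
define c' where "c' = Seq c (Seq (IfPos (Sub (Const 0) (vr k)) (wr k (Sub (Const 0) (vr k))) Skip) (Seq (dbl k (k+1) (k+2)) (wr k (vr (k+2)))))"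
let ?q = "%x. isize (f x)+kk k+10"
let ?T = "%x. 1+T x+(1+20 * ?q x+(1+100 * ?q x * ?q x+10 * ?q x))"
have "pb D ?T" by (intro pb_intros T PT_size assms)
moreover have "impl k c' (enc x) (enc (size_int (f x))) (?T x)" if x: "x : D p" for p x unfolding impl_def
proof (intro allI impI)
 fix s assume "cell s k = enc x"
 from c[OF x this] obtain s1 where s1: "ex c s (T x) s1" "cell s1 k = f x" "agree k s s1" by (auto simp: enc_int_def)
 have k: "size_int (f x)+sk k+sk (k+1)+sk (k+2)+10 <= ?q x" by (simp add: kk_def isize_def enc_int_def)
 let ?v = "abs (f x)"
 have "EX s2. ex (IfPos (Sub (Const 0) (vr k)) (wr k (Sub (Const 0) (vr k))) Skip) s1 (20 * ?q x) s2 & cell s2 k = ?v & agree k s1 s2"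
 proof (cases "f x < 0")
  case True
  have "ex (IfPos (Sub (Const 0) (vr k)) (wr k (Sub (Const 0) (vr k))) Skip) s1 (20 * ?q x) (setc s1 k (- f x))"
   by (rule ex_if[where ?T1.0 = "10 * ?q x"], rule ex_wr_val) (use k True s1(2) in simp_all)
  thus ?thesis using True by (intro exI[of _ "setc s1 k (- f x)"]) simp
 next
  case False
  have "ex (IfPos (Sub (Const 0) (vr k)) (wr k (Sub (Const 0) (vr k))) Skip) s1 (20 * ?q x) s1"
   by (rule ex_if[where ?T1.0 = "10 * ?q x"]) (use k False s1(2) runs.Skip[of s1] in \<open>auto simp: ex_def intro!: exI[of _ "Suc 0"]\<close>)
  thus ?thesis using False s1 by auto
 qed
 then obtain s2 where s2: "ex (IfPos (Sub (Const 0) (vr k)) (wr k (Sub (Const 0) (vr k))) Skip) s1 (20 * ?q x) s2" "cell s2 k = ?v" "agree k s1 s2" by blast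
 obtain s3 where s3: "ex (dbl k (k+1) (k+2)) s2 (100*(size_int ?v+sk k+sk (k+1)+sk (k+2)+2)*(size_int ?v+sk k+sk (k+1)+sk (k+2)+2)) s3"
  "agree k s2 s3" "cell s3 (k+2) = int (size_int ?v)" using dbl_ex[of s2 k ?v k "k+1" "k+2"] s2(2) by auto
 have T3: "100*(size_int ?v+sk k+sk (k+1)+sk (k+2)+2)*(size_int ?v+sk k+sk (k+1)+sk (k+2)+2) <= 100 * ?q x * ?q x" using k by (intro mult_le_mono) simp_all
 have s4: "ex (wr k (vr (k+2))) s3 (10 * ?q x) (setc s3 k (int (size_int (f x))))" using s3(3) k size_int_of_nat_le[of "size_int (f x)"] by (intro ex_wr_val) simp_all
 have "ex c' s (?T x) (setc s3 k (int (size_int (f x))))" unfolding c'_def by (rule ex_seq[OF s1(1) ex_seq[OF s2(1) ex_seq[OF s3(1) s4 order_refl] order_refl]]) (use T3 in linarith)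
 thus "EX s'. ex c' s (?T x) s' & cell s' k = enc (size_int (f x)) & agree k s s'" using agree_trans[OF agree_trans[OF s1(3) s2(3) order_refl] s3(2) order_refl]
  by (intro exI[of _ "setc s3 k (int (size_int (f x)))"]) (simp add: enc_nat_def)
qed
ultimately show "pimp D k (%x. size_int (f x))" by blast
qed

lemma PT_loop:
assumes g: "PT D g" and b: "PT E b" and h: "PT (%p. {z : E p. b z}) (%z. h (fst z) (snd z))"
 and n: "pb D n" and M: "pb D M"
 and it: "!!p x i. x : D p ==> i <= n x ==> (x, (h x ^^ i) (g x)) : E p & isize ((h x ^^ i) (g x)) <= M x &
  (b (x, (h x ^^ i) (g x)) <-> i < n x)"
shows "PT D (%x. (h x ^^ n x) (g x))"
proof -
let ?s = "%x. (x, g x)"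
let ?D = "%p. ?s ` D p"
let ?f = "%z. (fst z, h (fst z) (snd z))"
have pw: "(?f ^^ i) z = (fst z, (h (fst z) ^^ i) (snd z))" for i z by (induction i arbitrary: z) auto
have pbf: "pb ?D (%z. m (fst z))" if "pb D m" for m :: "'a => nat" by (rule pb_comp[OF that, of ?D fst]) (auto intro: pb_mono[OF pb_isize] isize_fst)
have "PT ?D (%z. (?f ^^ n (fst z)) z)"
proof (rule PT_while[OF b])
 show "PT (%p. {x : E p. b x}) ?f" by (intro PT_pair PT_fst PT_id h)
 show "pb ?D (%z. n (fst z))" by (rule pbf[OF n])
 show "pb ?D (%z. M (fst z)+3*isize z+10)" by (intro pb_intros pbf[OF M])
 show "(?f ^^ i) z : E p & isize ((?f ^^ i) z) <= M (fst z)+3*isize z+10 & b ((?f ^^ i) z) = (i < n (fst z))"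
  if "z : ?D p" "i <= n (fst z)" for p z i
 proof -
  from that(1) obtain x where x: "x : D p" "z = (x, g x)" by blast
  show ?thesis using it[OF x(1), of i] that(2) x(2) isize_pair[of x "(h x ^^ i) (g x)"] isize_fst[of "(x, g x)"] unfolding pw by auto
 qed
qed
from PT_comp[OF this PT_pair[OF PT_id g]] have "PT D (%x. (?f ^^ n x) (x, g x))" by auto
from PT_snd[OF this] show ?thesis unfolding pw by simp
qed

subsection \<open>Numbers and truth values\<close>

lemma PT_int: "PT D f ==> PT D (%x. int (f x))" by (erule PT_cast) (simp add: enc_int_def enc_nat_def)
lemma PT_nadd: "PT D f ==> PT D g ==> PT D (%x. f x+g x :: nat)" by (rule PT_cast[OF PT_add[OF PT_int PT_int]]) (auto simp: enc_int_def enc_nat_def)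
lemma PT_nmul: "PT D f ==> PT D g ==> PT D (%x. f x*g x :: nat)" by (rule PT_cast[OF PT_mul[OF PT_int PT_int]]) (auto simp: enc_int_def enc_nat_def)
lemma PT_Suc: "PT D f ==> PT D (%x. Suc (f x))" using PT_nadd[OF _ PT_const[of D 1]] by simp
lemma PT_less: "PT D f ==> PT D g ==> PT D (%x. f x < (g x :: int))" by (rule PT_cong[OF PT_if_pos[OF PT_sub[of D g f] PT_const[of _ True] PT_const[of _ False]]]) auto
lemma PT_not: "PT D f ==> PT D (%x. ~ f x)" by (rule PT_cong[OF PT_if[OF _ PT_const[of _ False] PT_const[of _ True]]]) auto
lemma PT_conj: "PT D f ==> PT D g ==> PT D (%x. f x & g x)" by (rule PT_cong[OF PT_if[OF _ PT_subset[of D g] PT_const[of _ False]]]) auto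
lemma PT_disj: "PT D f ==> PT D g ==> PT D (%x. f x | g x)" by (rule PT_cong[OF PT_if[OF _ PT_const[of _ True] PT_subset[of D g]]]) auto
lemma PT_le: "PT D f ==> PT D g ==> PT D (%x. f x <= (g x :: int))" by (rule PT_cong[OF PT_not[OF PT_less[of D g f]]]) auto
lemma PT_eq: "PT D f ==> PT D g ==> PT D (%x. f x = (g x :: int))" unfolding order_eq_iff by (intro PT_conj PT_le)
lemma PT_nless: "PT D f ==> PT D g ==> PT D (%x. f x < (g x :: nat))" by (rule PT_cong[OF PT_less[OF PT_int[of D f] PT_int[of D g]]]) auto
lemma PT_neq: "PT D f ==> PT D g ==> PT D (%x. f x = (g x :: nat))" by (rule PT_cong[OF PT_eq[OF PT_int[of D f] PT_int[of D g]]]) auto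
lemma PT_nat: assumes "PT D f" shows "PT D (%x. nat (f x))"
proof -
have "PT (%p. {x : D p. f x > 0}) (%x. nat (f x))" by (rule PT_cast[OF PT_subset[OF assms]]) (auto simp: enc_int_def enc_nat_def)
from PT_if_pos[OF assms this PT_const[of _ 0]] show ?thesis by (rule PT_cong) auto
qed
lemma PT_nsub: "PT D f ==> PT D g ==> PT D (%x. f x - g x :: nat)" by (rule PT_cong[OF PT_nat[OF PT_sub[OF PT_int[of D f] PT_int[of D g]]]]) auto
lemma PT_isnil: "PT D f ==> PT D (%x. f x = [])"
proof -
assume "PT D f"
hence "PT D (%x. enc (f x))" by (rule PT_cast) (simp add: enc_int_def)
from PT_eq[OF this PT_const[of D 0]] show ?thesis by (rule PT_cong) (metis enc_list.elims pr_nonzero enc_list.simps(1))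
qed
lemma PT_if': "PT D b ==> PT D f ==> PT D g ==> PT D (%x. if b x then f x else g x)" by (rule PT_if) (auto elim: PT_subset)

lemma PT_max: "PT D f ==> PT D g ==> PT D (%x. max (f x) (g x :: int))" unfolding max_def by (intro PT_if' PT_le)
subsection \<open>Sizes of lists\<close>

lemma isize_Nil [simp]: "isize [] = 0" by (simp add: isize_def)
lemma isize_Cons: "isize (x # xs) <= 3*isize x+10+isize xs" using size_int_pr[of "enc x" "enc xs"] by (simp add: isize_def)
lemma isize_hd: "isize x <= isize (x # xs)" and isize_tl: "isize xs <= isize (x # xs)" by (auto simp: isize_def size_int_pr_fst size_int_pr_snd)
text \<open>Codes of lists are nonnegative and at least double with every \<open>Cons\<close>; this
  is why the length of a list is bounded by the size of its code.\<close>

lemma pr_gt: "b >= 0 ==> pr a b >= 2*b+1"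
proof -
assume b: "b >= 0"
have P: "pw (zz a) >= 1" using pw_pos[of "zz a"] by linarith
have "b*1 <= b*pw (zz a)" using b P by (intro mult_left_mono) auto
hence "b <= b*pw (zz a)" by simp
hence 1: "2*b+1 <= (b*pw (zz a)+zz a)*2+1" using zz_nonneg[of a] unfolding distrib_right by linarith
have "((b*pw (zz a)+zz a)*2+1)*1 <= pr a b" unfolding pr_def using b P zz_nonneg[of a] by (intro mult_left_mono) auto
thus ?thesis using 1 by (metis mult_1_right order_trans)
qed
lemma enc_list_nonneg: "0 <= enc (xs :: 'a::enc list)"
proof (induction xs)
case (Cons x xs)
thus ?case using pr_gt[of "enc xs" "enc x"] by simp
qed simp
lemma isize_Suc: "isize xs+1 <= isize (x # xs)"
proof -
let ?b = "enc xs"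
have b: "?b >= 0" by (rule enc_list_nonneg)
have "~ size_int (pr (enc x) ?b) <= size_int ?b"
proof
 assume "size_int (pr (enc x) ?b) <= size_int ?b"
 hence lt: "pr (enc x) ?b < 2^size_int ?b" using pr_gt[OF b, of "enc x"] b by (simp add: size_int_le_iff)
 have "abs (?b) < 2^(size_int ?b - 1)"
 proof (cases "size_int ?b")
  case 0
  thus ?thesis using lt pr_gt[OF b, of "enc x"] b by simp
 next
  case (Suc m)
  thus ?thesis using lt pr_gt[OF b, of "enc x"] b by simp
 qed
 hence "size_int ?b <= size_int ?b - 1" by (simp add: size_int_le_iff)
 hence "size_int ?b = 0" by simp
 thus False using lt pr_gt[OF b, of "enc x"] b by simp
qed
thus ?thesis by (simp add: isize_def)
qed
lemma length_le_isize: "length xs <= isize xs"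
proof (induction xs)
case (Cons x xs)
thus ?case using isize_Suc[of xs x] by simp
qed simp
lemma isize_mem: "x : set xs ==> isize x <= isize xs" by (induction xs) (auto intro: order_trans[OF _ isize_tl] isize_hd)
lemma isize_drop: "isize (drop i xs) <= isize xs"
proof (induction xs arbitrary: i)
case (Cons x xs)
thus ?case by (cases i) (auto intro: order_trans[OF _ isize_tl])
qed simp
lemma isize_list_le: "(!!x. x : set xs ==> isize x <= e) ==> isize xs <= length xs*(3*e+10)"
proof (induction xs)
case (Cons x xs)
have "isize (x # xs) <= 3*isize x+10+isize xs" by (rule isize_Cons)
also have "... <= 3*e+10+length xs*(3*e+10)" using Cons by (intro add_mono) auto
finally show ?case by simp
qed simp
lemma isize_list_le': "(!!x. x : set xs ==> isize x <= e) ==> length xs <= n ==> isize xs <= n*(3*e+10)" using isize_list_le[of xs e] by (meson mult_le_mono1 order_trans)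
lemma isize_int [simp]: "isize (x::int) = size_int x" by (simp add: isize_def enc_int_def)
lemma isize_nat [simp]: "isize (n::nat) = sk n" by (simp add: isize_def enc_nat_def)
lemma isize_nat_le: "isize (n::nat) <= n" by (simp add: size_int_of_nat_le)

lemma pb_length: "PT D f ==> pb D (%x. length (f x))" by (rule pb_mono[OF PT_size]) (auto intro: length_le_isize)

subsection \<open>Iteration over lists and numbers\<close>

lemma PT_fold_dom:
assumes l: "PT D l" and g: "PT D g" and h: "PT E (%z. h (fst z) (fst (snd z)) (snd (snd z)))" and M: "pb D M"
 and sz: "!!p x i. x : D p ==> i <= length (l x) ==> isize (fold (h x) (take i (l x)) (g x)) <= M x"
 and E: "!!p x i. x : D p ==> i < length (l x) ==> (x, l x ! i, fold (h x) (take i (l x)) (g x)) : E p"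
shows "PT D (%x. fold (h x) (l x) (g x))"
proof -
let ?h = "%x s. (tl (fst s), h x (hd (fst s)) (snd s))"
let ?b = "%z. ~ (fst (snd z) = [])"
let ?E = "%p. {z. fst (snd z) ~= [] --> (fst z, hd (fst (snd z)), snd (snd z)) : E p}"
have pw: "(?h x ^^ i) (ys, a) = (drop i ys, fold (h x) (take i ys) a)" if "i <= length ys" for x i ys a using that
proof (induction i)
 case (Suc i)
 hence "drop i ys = ys ! i # drop (Suc i) ys" "take (Suc i) ys = take i ys @ [ys ! i]" by (auto simp: Cons_nth_drop_Suc take_Suc_conv_app_nth)
 thus ?case using Suc by (simp add: drop_Suc tl_drop)
qed simp
have "PT D (%x. (?h x ^^ length (l x)) (l x, g x))"
proof (rule PT_loop[where E = ?E and b = ?b])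
 show "PT D (%x. (l x, g x))" by (intro PT_pair l g)
 show "PT ?E ?b" by (intro PT_not PT_isnil PT_fst PT_snd PT_id)
 show "PT (%p. {z : ?E p. ?b z}) (%z. (tl (fst (snd z)), h (fst z) (hd (fst (snd z))) (snd (snd z))))"
 proof (rule PT_pair)
  show "PT (%p. {z : ?E p. ?b z}) (%z. tl (fst (snd z)))" by (rule PT_tl0[OF PT_fst[OF PT_snd[OF PT_id]]]) auto
  have "PT (%p. {z : ?E p. ?b z}) (%z. (fst z, hd (fst (snd z)), snd (snd z)))" by (intro PT_pair PT_hd[OF PT_fst[OF PT_snd[OF PT_id]]] PT_fst PT_snd PT_id) auto
  from PT_comp[OF h this] show "PT (%p. {z : ?E p. ?b z}) (%z. h (fst z) (hd (fst (snd z))) (snd (snd z)))" by auto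
 qed
 show "pb D (%x. length (l x))" by (rule pb_length[OF l])
 show "pb D (%x. M x+3*isize (l x)+10)" by (intro pb_intros M PT_size l)
 show "(x, (?h x ^^ i) (l x, g x)) : ?E p & isize ((?h x ^^ i) (l x, g x)) <= M x+3*isize (l x)+10 &
  ?b (x, (?h x ^^ i) (l x, g x)) = (i < length (l x))" if x: "x : D p" and i: "i <= length (l x)" for p x i unfolding pw[OF i]
  using sz[OF x i] E[OF x, of i] isize_pair[of "drop i (l x)" "fold (h x) (take i (l x)) (g x)"] isize_drop[of i "l x"] by (auto simp: hd_drop_conv_nth)
qed
from PT_snd[OF this] show ?thesis unfolding pw[OF order_refl] by simp
qed

lemma PT_iter_dom:
assumes n: "PT D n" "pb D n" and g: "PT D g" and h: "PT E (%z. h (fst z) (snd z))" and M: "pb D M"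
 and sz: "!!p x i. x : D p ==> i <= n x ==> isize ((h x ^^ i) (g x)) <= M x"
 and E: "!!p x i. x : D p ==> i < n x ==> (x, (h x ^^ i) (g x)) : E p"
shows "PT D (%x. (h x ^^ n x) (g x))"
proof -
let ?h = "%x s. (fst s - (1::nat), h x (snd s))"
let ?b = "%z. (0::nat) < fst (snd z)"
let ?E = "%p. {z. 0 < fst (snd z) --> (fst z, snd (snd z)) : E p}"
have pw: "(?h x ^^ i) (k, a) = (k - i, (h x ^^ i) a)" for x i k a by (induction i) auto
have "PT D (%x. (?h x ^^ n x) (n x, g x))"
proof (rule PT_loop[where E = ?E and b = ?b])
 show "PT D (%x. (n x, g x))" by (intro PT_pair n g)
 show "PT ?E ?b" by (intro PT_nless PT_const PT_fst PT_snd PT_id)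
 show "PT (%p. {z : ?E p. ?b z}) (%z. (fst (snd z) - (1::nat), h (fst z) (snd (snd z))))"
 proof (rule PT_pair)
  show "PT (%p. {z : ?E p. ?b z}) (%z. fst (snd z) - (1::nat))" by (intro PT_nsub PT_fst PT_snd PT_id PT_const)
  have "PT (%p. {z : ?E p. ?b z}) (%z. (fst z, snd (snd z)))" by (intro PT_pair PT_fst PT_snd PT_id)
  from PT_comp[OF h this] show "PT (%p. {z : ?E p. ?b z}) (%z. h (fst z) (snd (snd z)))" by auto
 qed
 show "pb D n" by (rule n)
 show "pb D (%x. M x+3*n x+10)" by (intro pb_intros M n)
 show "(x, (?h x ^^ i) (n x, g x)) : ?E p & isize ((?h x ^^ i) (n x, g x)) <= M x+3*n x+10 &
  ?b (x, (?h x ^^ i) (n x, g x)) = (i < n x)" if x: "x : D p" and i: "i <= n x" for p x i unfolding pw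
  using sz[OF x i] E[OF x, of i] isize_pair[of "n x - i" "(h x ^^ i) (g x)"] isize_nat_le[of "n x - i"] by auto
qed
from PT_snd[OF this] show ?thesis unfolding pw by simp
qed

lemma PT_rev: assumes "PT D l" shows "PT D (%x. rev (l x))"
proof -
have "PT D (%x. fold (%y a. y # a) (l x) [])"
proof (rule PT_fold_dom[OF assms PT_const, where h = "%x y a. y # a" and E = "%_. UNIV" and M = "%x. length (l x)*(3*isize (l x)+10)"])
 show "PT (%_. UNIV) (%z. fst (snd z) # snd (snd z))" by (intro PT_Cons PT_fst PT_snd PT_id)
 show "pb D (%x. length (l x)*(3*isize (l x)+10))" by (intro pb_intros pb_length PT_size assms)
 fix x i assume "i <= length (l x)"
 have "fold (%y a. y # a) (take i (l x)) [] = rev (take i (l x))" by (simp add: fold_Cons_rev)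
 also have "isize ... <= length (l x)*(3*isize (l x)+10)" by (rule isize_list_le') (auto intro: isize_mem dest: in_set_takeD)
 finally show "isize (fold (%y a. y # a) (take i (l x)) []) <= length (l x)*(3*isize (l x)+10)" .
qed auto
thus ?thesis by (simp add: fold_Cons_rev)
qed

text \<open>Unlike a fold, a map needs no size bound from outside: each result depends on a single
  member of the list, and \<open>pb_Max\<close> bounds all of them together.\<close>

lemma PT_map_dom:
assumes l: "PT D l" and h: "PT E (%z. h (fst z) (snd z))" and E: "!!p x y. x : D p ==> y : set (l x) ==> (x, y) : E p"
shows "PT D (%x. map (h x) (l x))"
proof -
define M0 where "M0 x = Max (insert 0 ((%y. isize (h x y)) ` set (l x)))" for x
have "pb D (%x. Max (insert 0 ((%y. isize (h (fst (x, y)) (snd (x, y)))) ` set (l x))))"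
proof (rule pb_Max[OF PT_size[OF h], where S = "%x. isize (l x)+3*isize x+10"])
 fix p x y assume "x : D p" "y : set (l x)"
 thus "(x, y) : E p & isize (x, y) <= isize (l x)+3*isize x+10" using E[of x p y] isize_pair[of x y] isize_mem[of y "l x"] by simp
qed (intro pb_intros PT_size[OF l])
hence "pb D M0" unfolding M0_def by simp
have M0: "isize (h x y) <= M0 x" if "y : set (l x)" for x y unfolding M0_def using that by (intro Max_ge) auto
have "PT D (%x. fold (%y a. h x y # a) (l x) [])"
proof (rule PT_fold_dom[OF l PT_const, where h = "%x y a. h x y # a" and E = "%p. {z. (fst z, fst (snd z)) : E p}" and M = "%x. length (l x)*(3*M0 x+10)"])
 have "PT (%p. {z. (fst z, fst (snd z)) : E p}) (%z. (fst z, fst (snd z)))" by (intro PT_pair PT_fst PT_snd PT_id)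
 from PT_comp[OF h this] have "PT (%p. {z. (fst z, fst (snd z)) : E p}) (%z. h (fst z) (fst (snd z)))" by simp
 thus "PT (%p. {z. (fst z, fst (snd z)) : E p}) (%z. h (fst z) (fst (snd z)) # snd (snd z))" by (intro PT_Cons PT_snd PT_id)
 show "pb D (%x. length (l x)*(3*M0 x+10))" by (intro pb_intros pb_length l \<open>pb D M0\<close>)
 fix x i assume "i <= length (l x)"
 have "fold (%y a. h x y # a) ys b = rev (map (h x) ys) @ b" for ys b by (induction ys arbitrary: b) auto
 hence "fold (%y a. h x y # a) (take i (l x)) [] = rev (map (h x) (take i (l x)))" by simp
 also have "isize ... <= length (l x)*(3*M0 x+10)" by (rule isize_list_le') (auto intro: M0 dest: in_set_takeD)
 finally show "isize (fold (%y a. h x y # a) (take i (l x)) []) <= length (l x)*(3*M0 x+10)" .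
qed (auto intro: E)
from PT_rev[OF this] have "PT D (%x. rev (fold (%y a. h x y # a) (l x) []))" .
moreover have "fold (%y a. h x y # a) ys b = rev (map (h x) ys) @ b" for ys b x by (induction ys arbitrary: b) auto
ultimately show ?thesis by simp
qed

text \<open>The domain for the body of a binder: the parameter together with the value of the bound
  variable.\<close>

definition ext :: "(nat => 'a set) => ('a => 'b set) => nat => ('a \<times> 'b) set" where
"ext D A p = {z. fst z : D p & snd z : A (fst z)}"

lemma PT_lift: "PT D f ==> PT (ext D A) (%z. f (fst z))" by (rule PT_comp[of D f "ext D A" fst]) (auto simp: ext_def intro: PT_fst PT_id)
lemma pb_lift: "pb D n ==> pb (ext D A) (%z. n (fst z))" by (rule pb_comp[of D n "ext D A" fst]) (auto simp: ext_def intro: pb_mono[OF pb_isize] isize_fst)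

lemma PT_map: "PT D l ==> PT (ext D (%x. set (l x))) (%z. h (fst z) (snd z)) ==> PT D (%x. map (h x) (l x))" by (rule PT_map_dom) (auto simp: ext_def)

lemma PT_length: assumes "PT D l" shows "PT D (%x. length (l x))"
proof -
have fl: "fold (%y. Suc) xs a = length xs+a" for xs :: "'b list" and a by (induction xs arbitrary: a) auto
have "PT D (%x. fold (%y a. Suc a) (l x) 0)" by (rule PT_fold_dom[OF assms PT_const, where E = "%_. UNIV" and M = "%x. length (l x)" and h = "%x y a. Suc a"])
  (auto simp: fl intro!: PT_Suc PT_snd PT_id pb_length assms order_trans[OF size_int_of_nat_le])
thus ?thesis by (simp add: fl)
qed

lemma PT_append: assumes "PT D f" "PT D g" shows "PT D (%x. f x @ g x)"
proof -
have fl: "fold (%y a. y # a) xs a = rev xs @ a" for xs a :: "'b list" by (induction xs arbitrary: a) auto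
let ?M = "%x. (length (f x)+length (g x))*(3*(isize (f x)+isize (g x))+10)"
have "PT D (%x. fold (%y a. y # a) (rev (f x)) (g x))"
proof (rule PT_fold_dom[OF PT_rev[OF assms(1)] assms(2), where E = "%_. UNIV" and h = "%x y a. y # a" and M = ?M])
 show "PT (%_. UNIV) (%z. fst (snd z) # snd (snd z))" by (intro PT_Cons PT_fst PT_snd PT_id)
 show "pb D ?M" by (intro pb_intros PT_size pb_length assms)
 show "isize (fold (%y a. y # a) (take i (rev (f x))) (g x)) <= ?M x" for x i unfolding fl by (rule isize_list_le') (auto dest!: in_set_takeD isize_mem[of _ "f x"] isize_mem[of _ "g x"])
qed auto
thus ?thesis unfolding fl by simp
qed

lemma PT_concat: assumes "PT D f" shows "PT D (%x. concat (f x))"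
proof -
have fl: "fold (%y a. a @ y) xs a = a @ concat xs" for xs and a :: "'b list" by (induction xs arbitrary: a) auto
let ?M = "%x. (length (f x)*isize (f x))*(3*isize (f x)+10)"
have "PT D (%x. fold (%y a. a @ y) (f x) [])"
proof (rule PT_fold_dom[OF assms PT_const, where E = "%_. UNIV" and h = "%x y a. a @ y" and M = ?M])
 show "PT (%_. UNIV) (%z. snd (snd z) @ fst (snd z))" by (intro PT_append PT_fst PT_snd PT_id)
 show "pb D ?M" by (intro pb_intros PT_size pb_length assms)
 show "isize (fold (%y a. a @ y) (take i (f x)) []) <= ?M x" for x i unfolding fl append_Nil
 proof (rule isize_list_le')
  show "isize y <= isize (f x)" if "y : set (concat (take i (f x)))" for y using that by (auto dest!: in_set_takeD intro: order_trans[OF isize_mem isize_mem])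
  have "length (concat (take i (f x))) = sum_list (map length (take i (f x)))" by (simp add: length_concat)
  also have "... <= sum_list (map (%_. isize (f x)) (take i (f x)))" by (intro sum_list_mono) (auto dest!: in_set_takeD intro: order_trans[OF length_le_isize isize_mem])
  also have "... <= length (f x)*isize (f x)" by (simp add: sum_list_triv)
  finally show "length (concat (take i (f x))) <= length (f x)*isize (f x)" .
 qed
qed auto
thus ?thesis unfolding fl by simp
qed

lemma PT_concat_map: "PT D l ==> PT (ext D (%x. set (l x))) (%z. h (fst z) (snd z)) ==> PT D (%x. concat (map (h x) (l x)))" by (intro PT_concat PT_map)

lemma PT_filter:
assumes "PT D l" "PT (ext D (%x. set (l x))) (%z. P (fst z) (snd z))" shows "PT D (%x. filter (P x) (l x))"
proof -
have "filter Q xs = concat (map (%y. if Q y then [y] else []) xs)" for Q and xs :: "'b list" by (induction xs) auto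
thus ?thesis by (simp only:) (intro PT_concat_map assms PT_if' PT_Cons PT_snd PT_id PT_const)
qed

lemma PT_ball:
assumes "PT D l" "PT (ext D (%x. set (l x))) (%z. P (fst z) (snd z))" shows "PT D (%x. ALL y:set (l x). P x y)"
proof -
have "(ALL y:set xs. Q y) <-> filter (%y. ~ Q y) xs = []" for Q and xs :: "'b list" by (auto simp: filter_empty_conv)
thus ?thesis by (simp only:) (intro PT_isnil PT_filter PT_not assms)
qed

lemma PT_tl: assumes "PT D l" shows "PT D (%x. tl (l x))"
proof -
have "PT D (%x. if l x = [] then [] else tl (l x))" by (intro PT_if PT_isnil PT_const assms PT_tl0 PT_subset[OF assms]) auto
thus ?thesis by (rule PT_cong) auto
qed

lemma PT_drop: assumes "PT D n" "PT D l" shows "PT D (%x. drop (n x) (l x))"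
proof -
have tl: "(tl ^^ i) xs = drop i xs" for i and xs :: "'b list" by (induction i arbitrary: xs) (auto simp: drop_Suc tl_drop)
let ?n = "%x. if n x < length (l x) then n x else length (l x)"
have "PT D (%x. ((%a. tl a) ^^ ?n x) (l x))"
proof (rule PT_iter_dom[OF _ _ assms(2), where E = "%_. UNIV" and h = "%x a. tl a" and M = "%x. isize (l x)"])
 show "PT D ?n" by (intro PT_if' PT_nless assms PT_length)
 show "pb D ?n" by (rule pb_mono[OF pb_length[OF assms(2)]]) auto
 show "pb D (%x. isize (l x))" by (intro PT_size assms)
 show "PT (%_. UNIV) (%z. tl (snd z))" by (intro PT_tl PT_snd PT_id)
qed (auto simp: tl isize_drop)
thus ?thesis by (rule PT_cong) (auto simp: tl)
qed

lemma PT_take: "PT D n ==> PT D l ==> PT D (%x. take (n x) (l x))" by (rule PT_cong[OF PT_rev[OF PT_drop[OF PT_nsub[OF PT_length[of D l], of n] PT_rev[of D l]]]])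
 (auto simp: rev_drop not_le intro: take_all_iff[THEN iffD2, symmetric] split: nat_diff_split)

text \<open>Lookup is made total by a fixed default, so that its running time rule has no side
  condition; for integer vectors the default 0 also means extension by zeros.\<close>

definition nthd :: "'a => 'a list => nat => 'a" where
"nthd d xs i = (if i < length xs then xs ! i else d)"

lemma PT_nthd: assumes "PT D l" "PT D n" shows "PT D (%x. nthd d (l x) (n x))"
proof -
have "PT D (%x. if n x < length (l x) then hd (drop (n x) (l x)) else d)" by (intro PT_if PT_nless PT_length PT_const assms PT_hd PT_drop PT_subset[OF assms(1)] PT_subset[OF assms(2)]) auto
thus ?thesis by (rule PT_cong) (auto simp: nthd_def hd_drop_conv_nth)
qed

lemma PT_upt: assumes "PT D n" "pb D n" shows "PT D (%x. [0..<n x])"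
proof -
have it: "((%a. length a # a) ^^ i) [] = rev [0..<i]" for i by (induction i) auto
have "PT D (%x. ((%a. length a # a) ^^ n x) [])"
proof (rule PT_iter_dom[OF assms PT_const, where E = "%_. UNIV" and h = "%x a. length a # a" and M = "%x. n x*(3*n x+10)"])
 show "PT (%_. UNIV) (%z. length (snd z) # snd z)" by (intro PT_Cons PT_length PT_snd PT_id)
 show "pb D (%x. n x*(3*n x+10))" by (intro pb_intros assms)
 show "isize (((%a. length a # a) ^^ i) []) <= n x*(3*n x+10)" if "i <= n x" for x i unfolding it using that by (intro isize_list_le') (auto intro: order_trans[OF size_int_of_nat_le])
qed auto
from PT_rev[OF this] show ?thesis unfolding it by simp
qed

definition mk :: "nat => (nat => 'a) => 'a list" where "mk n f = map f [0..<n]"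

lemma length_mk [simp]: "length (mk n f) = n" by (simp add: mk_def)
lemma nthd_mk [simp]: "nthd d (mk n f) i = (if i < n then f i else d)" by (simp add: mk_def nthd_def)

lemma PT_mk: "PT D n ==> pb D n ==> PT (ext D (%x. {..<n x})) (%z. h (fst z) (snd z)) ==> PT D (%x. mk (n x) (h x))"
unfolding mk_def by (rule PT_map[OF PT_upt]) (auto simp: lessThan_atLeast0)

lemma PT_update:
assumes "PT D l" "PT D n" "PT D v" shows "PT D (%x. (l x)[n x := v x])"
proof -
have "PT D (%x. mk (length (l x)) (%i. if i = n x then v x else nthd undefined (l x) i))" by (intro PT_mk PT_length pb_length PT_if' PT_neq PT_nthd assms assms[THEN PT_lift] PT_snd PT_id)
thus ?thesis by (rule PT_cong) (auto simp: mk_def nthd_def nth_list_update intro!: nth_equalityI)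
qed

lemma PT_sum: assumes n: "PT D n" "pb D n" and F: "PT (ext D (%x. {..<n x})) (%z. F (fst z) (snd z))"
shows "PT D (%x. SUM i<n x. F x i :: int)"
proof -
have fl: "fold (%y a. a+y) xs a = a+sum_list xs" for xs and a :: int by (induction xs arbitrary: a) auto
have l: "PT D (%x. mk (n x) (F x))" by (intro PT_mk n F)
let ?l = "%x. mk (n x) (F x)"
have bd: "size_int (sum_list ys) <= e+length ys" if "!!y. y : set ys ==> size_int y <= e" for ys e
proof -
 have "abs (sum_list ys) <= int (length ys)*2^e" using that
 proof (induction ys)
  case (Cons y ys)
  have "abs y < 2^e" using Cons.prems[of y] by (simp add: size_int_le_iff)
  thus ?case using Cons by (force simp: distrib_right intro: order_trans[OF abs_triangle_ineq])
 qed simp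
 also have "int (length ys)*2^e < 2^length ys*2^e" by simp
 finally show ?thesis by (simp add: size_int_le_iff power_add mult.commute)
qed
have "PT D (%x. fold (%y a. a+y) (?l x) 0)"
proof (rule PT_fold_dom[OF l PT_const, where E = "%_. UNIV" and h = "%x y a. a+y" and M = "%x. isize (?l x)+length (?l x)"])
 show "PT (%_. UNIV) (%z. snd (snd z)+fst (snd z) :: int)" by (intro PT_add PT_fst PT_snd PT_id)
 show "pb D (%x. isize (?l x)+length (?l x))" by (intro pb_intros PT_size pb_length l)
 show "isize (fold (%y a. a+y) (take i (?l x)) 0) <= isize (?l x)+length (?l x)" for x i
  unfolding fl using bd[of "take i (?l x)" "isize (?l x)"] isize_mem[of _ "?l x"] by (fastforce dest: in_set_takeD)
qed auto
thus ?thesis unfolding fl by (simp add: mk_def sum_list_distinct_conv_sum_set lessThan_atLeast0)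
qed

lemma PT_prod: assumes n: "PT D n" "pb D n" and F: "PT (ext D (%x. {..<n x})) (%z. F (fst z) (snd z))"
shows "PT D (%x. PROD i<n x. F x i :: int)"
proof -
have fl: "fold (%y a. a*y) xs a = a*prod_list xs" for xs and a :: int by (induction xs arbitrary: a) auto
have l: "PT D (%x. mk (n x) (F x))" by (intro PT_mk n F)
let ?l = "%x. mk (n x) (F x)"
have bd: "size_int (prod_list ys) <= 1+length ys*e" if "!!y. y : set ys ==> size_int y <= e" for ys e using that
proof (induction ys)
 case (Cons y ys)
 have "size_int (prod_list (y # ys)) <= size_int y+size_int (prod_list ys)" using size_int_mult by simp
 also have "... <= e+(1+length ys*e)" using Cons by (intro add_mono) auto
 finally show ?case by simp
qed simp
have "PT D (%x. fold (%y a. a*y) (?l x) 1)"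
proof (rule PT_fold_dom[OF l PT_const, where E = "%_. UNIV" and h = "%x y a. a*y" and M = "%x. 1+length (?l x)*isize (?l x)"])
 show "PT (%_. UNIV) (%z. snd (snd z)*fst (snd z) :: int)" by (intro PT_mul PT_fst PT_snd PT_id)
 show "pb D (%x. 1+length (?l x)*isize (?l x))" by (intro pb_intros PT_size pb_length l)
 show "isize (fold (%y a. a*y) (take i (?l x)) 1) <= 1+length (?l x)*isize (?l x)" for x i
 proof -
  have "size_int (prod_list (take i (?l x))) <= 1+length (take i (?l x))*isize (?l x)" using isize_mem[of _ "?l x"] by (intro bd) (auto dest!: in_set_takeD)
  also have "... <= 1+length (?l x)*isize (?l x)" by (intro add_mono mult_le_mono) auto
  finally show ?thesis unfolding fl by simp
 qed
qed auto
moreover have "prod_list (map f [0..<k]) = (PROD i<k. f i :: int)" for f k by (induction k) (auto simp: mult.commute)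
ultimately show ?thesis unfolding fl by (simp add: mk_def)
qed

lemma PT_pow2: assumes "PT D n" "pb D n" shows "PT D (%x. 2^n x :: int)" using PT_prod[OF assms PT_const[of _ 2]] by simp

section \<open>Orthogonal projection in integer arithmetic\<close>

abbreviation el :: "int list => nat => int" where "el == nthd 0"
abbreviation rw :: "int list list => nat => int list" where "rw == nthd []"

definition ip where "ip n x y = (SUM i<n. el x i*el y i)"
definition mulv where "mulv n P x = mk n (%i. ip n (rw P i) x)"
text \<open>The state \<open>(d, P)\<close> represents the projection \<open>P / d\<close> onto the
  orthogonal complement of the vectors seen so far, where \<open>d\<close> is the Gram determinant
  of an independent subfamily. With \<open>v = P b\<close> the new determinant is the product of
  \<open>b\<close> and \<open>v\<close>, and the rank-one update of the projection divides exactly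
  by the old determinant, as in fraction-free elimination. Dependent vectors give 0 and are
  skipped.\<close>

definition pstep where "pstep n b s = (let v = mulv n (snd s) b; d = ip n b v in
 if d = 0 then s else (d, mk n (%i. mk n (%j. (d*el (rw (snd s) i) j - el v i*el v j) div fst s))))"
definition proj where "proj n bs = fold (pstep n) bs (1, mk n (%i. mk n (%j. if i = j then 1 else 0)))"

definition dl where "dl n bs = fst (proj n bs)"
definition pm where "pm n bs i j = el (rw (snd (proj n bs)) i) j"

section \<open>Real inner products\<close>

abbreviation ra :: "int list => nat => real" where "ra b i == ri (el b i)"
definition rip :: "nat => (nat => real) => (nat => real) => real" where "rip n x y = (SUM i<n. x i*y i)"

lemma ip_rip: "ri (ip n x y) = rip n (ra x) (ra y)" by (simp add: ip_def rip_def)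
lemma rip_commute: "rip n x y = rip n y x" by (simp add: rip_def mult.commute)
lemma rip_add_left: "rip n (%i. x i+y i) z = rip n x z+rip n y z" by (simp add: rip_def distrib_right sum.distrib)
lemma rip_add_right: "rip n z (%i. x i+y i) = rip n z x+rip n z y" by (simp add: rip_def distrib_left sum.distrib)
lemma rip_diff_left: "rip n (%i. x i - y i) z = rip n x z - rip n y z" by (simp add: rip_def left_diff_distrib sum_subtractf)
lemma rip_diff_right: "rip n z (%i. x i - y i) = rip n z x - rip n z y" by (simp add: rip_def right_diff_distrib sum_subtractf)
lemma rip_scale_left: "rip n (%i. c*x i) z = c*rip n x z" by (simp add: rip_def sum_distrib_left mult.assoc)
lemma rip_scale_right: "rip n z (%i. c*x i) = c*rip n z x" by (simp add: rip_def sum_distrib_left mult.left_commute)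
lemma rip_sum_left: "rip n (%i. SUM l:A. f l i) z = (SUM l:A. rip n (f l) z)" by (simp add: rip_def sum_distrib_right sum.swap[of _ A])
lemma rip_sum_right: "rip n z (%i. SUM l:A. f l i) = (SUM l:A. rip n z (f l))" by (simp add: rip_def sum_distrib_left sum.swap[of _ A])
lemma rip_cong: "(!!i. i < n ==> x i = x' i) ==> (!!i. i < n ==> y i = y' i) ==> rip n x y = rip n x' y'" by (simp add: rip_def)
lemma rip_nonneg: "rip n x x >= 0" by (simp add: rip_def sum_nonneg)
lemma rip_eq_0: "rip n x x = 0 <-> (ALL i<n. x i = 0)" by (auto simp: rip_def sum_nonneg_eq_0_iff)
lemma rip_zero_left: "(!!i. i < n ==> x i = 0) ==> rip n x y = 0" by (simp add: rip_def)
lemma sq_le_rip: "i < n ==> (x i)^2 <= rip n x x" unfolding rip_def power2_eq_square by (rule member_le_sum[of i "{..<n}" "%i. x i*x i"]) auto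
lemma rip_Cauchy: "(rip n x y)^2 <= rip n x x*rip n y y"
proof (cases "rip n y y = 0")
case True
hence "rip n x y = 0" by (auto simp: rip_eq_0 rip_commute[of n x] intro: rip_zero_left)
thus ?thesis using True by simp
next
case False
hence p: "rip n y y > 0" using rip_nonneg[of n y] by linarith
define t where "t = rip n x y/rip n y y"
have "0 <= rip n (%i. x i - t*y i) (%i. x i - t*y i)" by (rule rip_nonneg)
also have "... = rip n x x - 2*t*rip n x y+t^2*rip n y y" unfolding rip_diff_left rip_diff_right rip_scale_left rip_scale_right
 by (simp add: rip_commute[of n y x] power2_eq_square algebra_simps)
also have "... = rip n x x - (rip n x y)^2/rip n y y" using False by (simp add: t_def power2_eq_square field_simps)
finally show ?thesis using p by (simp add: field_simps)
qed

definition ap :: "nat => (nat => nat => real) => (nat => real) => nat => real" where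
"ap n Q x i = (SUM j<n. Q i j*x j)"

definition lc :: "(nat => real) => int list list => nat => real" where
"lc al cs i = (SUM l<length cs. al l*ra (cs ! l) i)"

text \<open>A description of the projection along the span of \<open>bs\<close> without a basis of
  the complement: it is symmetric, kills \<open>bs\<close>, and moves every vector by a combination
  of \<open>cs\<close> only. In the algorithm \<open>cs\<close> collects the vectors that were not
  skipped.\<close>

definition isproj where "isproj n bs cs Q <-> (ALL i<n. ALL j<n. Q i j = Q j i) &
 (ALL b:set bs. ALL i<n. ap n Q (ra b) i = 0) & set cs \<subseteq> set bs &
 (ALL x. EX al. ALL i<n. x i - ap n Q x i = lc al cs i)"

lemma ap_diff: "ap n Q (%i. x i - y i) i = ap n Q x i - ap n Q y i" by (simp add: ap_def right_diff_distrib sum_subtractf)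
lemma ap_lc: "ap n Q (lc al cs) i = (SUM l<length cs. al l*ap n Q (ra (cs ! l)) i)" by (simp add: ap_def lc_def sum_distrib_left mult.left_commute sum.swap[of _ "{..<length cs}"])
lemma ap_cong: "(!!i. i < n ==> x i = y i) ==> ap n Q x i = ap n Q y i" by (simp add: ap_def)
lemma ap_sym: "(!!i j. i < n ==> j < n ==> Q i j = Q j i) ==> rip n (ap n Q x) y = rip n x (ap n Q y)" unfolding rip_def ap_def sum_distrib_left sum_distrib_right
by (subst sum.swap) (auto intro!: sum.cong simp: mult_ac)

context
fixes n bs cs Q
assumes P: "isproj n bs cs Q"
begin

lemma isproj_sym: "rip n (ap n Q x) y = rip n x (ap n Q y)" using P by (intro ap_sym) (auto simp: isproj_def)

lemma isproj_rep: obtains al where "!!i. i < n ==> x i - ap n Q x i = lc al cs i" using P unfolding isproj_def by metis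

lemma isproj_ker: "b : set bs ==> rip n (ra b) (ap n Q x) = 0" using P unfolding isproj_sym[symmetric] by (auto simp: isproj_def intro: rip_zero_left)

lemma isproj_idem: "i < n ==> ap n Q (ap n Q x) i = ap n Q x i"
proof -
assume i: "i < n"
obtain al where a: "!!i. i < n ==> x i - ap n Q x i = lc al cs i" using isproj_rep[of x] by blast
have "ap n Q x i - ap n Q (ap n Q x) i = ap n Q (lc al cs) i" unfolding ap_diff[symmetric] using a by (intro ap_cong) auto
also have "... = 0" unfolding ap_lc using P i by (auto simp: isproj_def subset_iff intro!: sum.neutral)
finally show ?thesis by simp
qed

lemma isproj_norm: "rip n (ap n Q x) (ap n Q x) = rip n x (ap n Q x)" unfolding isproj_sym by (intro rip_cong) (auto simp: isproj_idem)

lemma isproj_contract: "rip n (ap n Q x) (ap n Q x) <= rip n x x"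
proof -
have "0 <= rip n (%i. x i - ap n Q x i) (%i. x i - ap n Q x i)" by (rule rip_nonneg)
thus ?thesis unfolding rip_diff_left rip_diff_right using isproj_norm[of x] rip_commute[of n x "ap n Q x"] by linarith
qed

lemma isproj_fix: assumes "!!b. b : set bs ==> rip n (ra b) x = 0" "i < n" shows "ap n Q x i = x i"
proof -
obtain al where a: "!!i. i < n ==> x i - ap n Q x i = lc al cs i" using isproj_rep[of x] by blast
have "rip n (lc al cs) (%i. x i - ap n Q x i) = (SUM l<length cs. al l*(rip n (ra (cs ! l)) x - rip n (ra (cs ! l)) (ap n Q x)))" unfolding lc_def rip_sum_left rip_scale_left rip_diff_right
 by (simp add: right_diff_distrib sum_subtractf)
also have "... = 0" using assms(1) isproj_ker P by (auto simp: isproj_def subset_iff intro!: sum.neutral)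
finally have "rip n (%i. x i - ap n Q x i) (%i. x i - ap n Q x i) = 0" using a by (simp add: rip_cong[of n "%i. x i - ap n Q x i" "lc al cs" "%i. x i - ap n Q x i" "%i. x i - ap n Q x i"])
thus ?thesis using assms(2) by (auto simp: rip_eq_0)
qed

lemma isproj_skip:
assumes "rip n (ra b) (ap n Q (ra b)) = 0" shows "isproj n (bs @ [b]) cs Q" using P assms unfolding isproj_norm[symmetric] rip_eq_0 by (auto simp: isproj_def)

lemma isproj_step:
assumes q: "rip n (ra b) (ap n Q (ra b)) ~= 0"
defines "v == ap n Q (ra b)"
shows "isproj n (bs @ [b]) (cs @ [b]) (%i j. Q i j - v i*v j/rip n (ra b) v)" (is "isproj _ _ _ ?Q")
proof -
have "(SUM j<n. (Q i j - v i*v j/c)*x j) = ap n Q x i - rip n v x/c*v i" for x c i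
proof -
 have "(SUM j<n. (Q i j - v i*v j/c)*x j) = (SUM j<n. Q i j*x j - v i/c*(v j*x j))" by (intro sum.cong) (auto simp: algebra_simps)
 thus ?thesis unfolding sum_subtractf sum_distrib_left[symmetric] ap_def rip_def by simp
qed
hence ap: "ap n ?Q x i = ap n Q x i - rip n v x/rip n (ra b) v*v i" for x i unfolding ap_def[of n ?Q] .
have "ap n ?Q (ra c) i = 0" if "c : set (bs @ [b])" "i < n" for c i
proof (cases "c = b")
 case True
 thus ?thesis unfolding ap using q by (simp add: v_def[symmetric] rip_commute[of n v])
next
 case False
 hence "c : set bs" using that by auto
 have "rip n v (ra c) = 0" using isproj_ker[OF \<open>c : set bs\<close>, of "ra b"] by (simp add: v_def rip_commute)
 moreover have "ap n Q (ra c) i = 0" using P that \<open>c : set bs\<close> by (simp add: isproj_def)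
 ultimately show ?thesis unfolding ap by simp
qed
moreover have "EX al. ALL i<n. x i - ap n ?Q x i = lc al (cs @ [b]) i" for x
proof -
 obtain al where a: "!!i. i < n ==> x i - ap n Q x i = lc al cs i" using isproj_rep[of x] by blast
 obtain be where b: "!!i. i < n ==> ra b i - v i = lc be cs i" unfolding v_def using isproj_rep[of "ra b"] by blast
 let ?t = "rip n v x/rip n (ra b) v"
 let ?ga = "%l. if l = length cs then ?t else al l - ?t*be l"
 have "x i - ap n ?Q x i = lc ?ga (cs @ [b]) i" if i: "i < n" for i
 proof -
  have "x i - ap n ?Q x i = lc al cs i + ?t*(ra b i - lc be cs i)" unfolding ap using a[OF i] b[OF i] by (simp add: algebra_simps)
  also have "... = lc ?ga (cs @ [b]) i" by (simp add: lc_def nth_append algebra_simps sum_subtractf sum_distrib_left)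
  finally show ?thesis .
 qed
 thus ?thesis by blast
qed
moreover have "?Q i j = ?Q j i" if "i < n" "j < n" for i j using P that by (simp add: isproj_def mult.commute)
ultimately show ?thesis using P by (auto simp: isproj_def)
qed

end

section \<open>Gram determinants and integrality of the scaled projection\<close>

definition gr where "gr n cs = mat (length cs) (length cs) (%(i, j). ip n (cs ! i) (cs ! j))"

definition rgr where "rgr n cs = map_mat ri (gr n cs)"

lemma det_rgr: "det (rgr n cs) = ri (det (gr n cs))" unfolding rgr_def by (simp add: of_int_hom.hom_det)

lemma rgr_carrier [simp]: "rgr n cs : carrier_mat (length cs) (length cs)" by (simp add: rgr_def gr_def)

text \<open>Bordered Gram determinant: add the combination of the first columns that clears the last one.\<close>
lemma det_gr_step:
assumes P: "isproj n bs cs Q"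
shows "det (rgr n (cs @ [b])) = det (rgr n cs)*rip n (ra b) (ap n Q (ra b))"
proof -
let ?k = "length cs"
obtain al where a: "!!i. i < n ==> ra b i - ap n Q (ra b) i = lc al cs i" using isproj_rep[OF P, of "ra b"] by blast
define U where "U = four_block_mat (1\<^sub>m ?k) (mat ?k 1 (%(i, j). - al i)) (0\<^sub>m 1 ?k) (1\<^sub>m 1)"
have U: "U : carrier_mat (?k+1) (?k+1)" "det U = 1" unfolding U_def by (auto simp: det_four_block_mat_lower_left_zero[where n = ?k and m = 1])
have s: "rip n (ra c) (ra b) - (SUM l<?k. al l*rip n (ra c) (ra (cs ! l))) = rip n (ra c) (ap n Q (ra b))" for c
proof -
 have "(SUM l<?k. al l*rip n (ra c) (ra (cs ! l))) = rip n (ra c) (lc al cs)" unfolding lc_def rip_sum_right rip_scale_right ..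
 also have "... = rip n (ra c) (%i. ra b i - ap n Q (ra b) i)" using a by (intro rip_cong) auto
 finally show ?thesis by (simp add: rip_diff_right)
qed
let ?r = "mat 1 ?k (%(i, j). rip n (ra b) (ra (cs ! j)))"
let ?q = "mat 1 1 (%_. rip n (ra b) (ap n Q (ra b)))"
have "rgr n (cs @ [b])*U = four_block_mat (rgr n cs) (0\<^sub>m ?k 1) ?r ?q" (is "?L = ?R")
proof (rule eq_matI)
 fix i j assume ij: "i < dim_row ?R" "j < dim_col ?R"
 hence i: "i < ?k+1" and j: "j < ?k+1" by (simp_all add: rgr_def gr_def)
 have e: "rgr n (cs @ [b]) $$ (i, l) = rip n (ra ((cs @ [b]) ! i)) (ra ((cs @ [b]) ! l))" if "l < ?k+1" for l using i that by (simp add: rgr_def gr_def ip_rip)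
 have "?L $$ (i, j) = (SUM l<?k+1. rgr n (cs @ [b]) $$ (i, l)*U $$ (l, j))" using i j U(1) by (simp add: scalar_prod_def rgr_def gr_def lessThan_atLeast0)
 also have "... = (SUM l<?k. rip n (ra ((cs @ [b]) ! i)) (ra (cs ! l))*U $$ (l, j))+rip n (ra ((cs @ [b]) ! i)) (ra b)*U $$ (?k, j)" using e by (simp add: nth_append)
 also have "... = ?R $$ (i, j)"
 proof (cases "j < ?k")
  case True
  have "(SUM l<?k. rip n (ra ((cs @ [b]) ! i)) (ra (cs ! l))*U $$ (l, j)) = (SUM l<?k. if l = j then rip n (ra ((cs @ [b]) ! i)) (ra (cs ! l)) else 0)"
   using True by (intro sum.cong) (auto simp: U_def)
  also have "... = rip n (ra ((cs @ [b]) ! i)) (ra (cs ! j))" using True by simp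
  finally show ?thesis using True i by (auto simp: U_def rgr_def gr_def ip_rip nth_append less_Suc_eq)
 next
  case False
  hence "j = ?k" using j by simp
  hence "(SUM l<?k. rip n (ra ((cs @ [b]) ! i)) (ra (cs ! l))*U $$ (l, j))+rip n (ra ((cs @ [b]) ! i)) (ra b)*U $$ (?k, j)
   = rip n (ra ((cs @ [b]) ! i)) (ra b) - (SUM l<?k. al l*rip n (ra ((cs @ [b]) ! i)) (ra (cs ! l)))" by (simp add: U_def sum_negf mult.commute)
  also have "... = rip n (ra ((cs @ [b]) ! i)) (ap n Q (ra b))" by (rule s)
  also have "... = ?R $$ (i, j)"
  proof (cases "i < ?k")
   case True
   hence "cs ! i : set bs" using P by (auto simp: isproj_def)
   thus ?thesis using True \<open>j = ?k\<close> isproj_ker[OF P] by (simp add: nth_append rgr_def gr_def)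
  next
   case False
   thus ?thesis using i \<open>j = ?k\<close> by (simp add: less_Suc_eq rgr_def gr_def)
  qed
  finally show ?thesis .
 qed
 finally show "?L $$ (i, j) = ?R $$ (i, j)" .
qed (use U(1) in "auto simp: rgr_def gr_def")
hence "det (rgr n (cs @ [b]))*det U = det ?R" using det_mult[of "rgr n (cs @ [b])" "?k+1" U] U(1) rgr_carrier[of n "cs @ [b]"] by simp
also have "... = det (rgr n cs)*det ?q" by (intro det_four_block_mat_upper_right_zero[where n = ?k and m = 1]) auto
finally show ?thesis using U(2) by (simp add: det_single)
qed

text \<open>Cramer's rule on the Gram matrix.\<close>
lemma isproj_integral:
assumes P: "isproj n bs cs Q" and i: "i < n" and j: "j < n"
shows "det (rgr n cs)*Q i j : \<int>"
proof -
let ?k = "length cs" and ?e = "%i. if i = j then 1 else 0 :: real"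
obtain al where a: "!!i. i < n ==> ?e i - ap n Q ?e i = lc al cs i" using isproj_rep[OF P, of ?e] by blast
have ape: "ap n Q ?e i = Q i j" using j by (simp add: ap_def if_distrib cong: if_cong)
define A where "A = adj_mat (gr n cs)"
have A: "A : carrier_mat ?k ?k" "A*gr n cs = det (gr n cs) \<cdot>\<^sub>m 1\<^sub>m ?k" unfolding A_def using adj_mat[of "gr n cs" ?k] by (auto simp: gr_def)
have G: "(SUM l<?k. ri (gr n cs $$ (i, l))*al l) = ra (cs ! i) j" if "i < ?k" for i
proof -
 have m: "cs ! i : set bs" using that P by (auto simp: isproj_def)
 have "(SUM l<?k. ri (gr n cs $$ (i, l))*al l) = rip n (ra (cs ! i)) (lc al cs)" unfolding lc_def rip_sum_right rip_scale_right using that by (simp add: gr_def ip_rip mult.commute)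
 also have "... = rip n (ra (cs ! i)) (%i. ?e i - ap n Q ?e i)" using a by (intro rip_cong) auto
 also have "... = rip n (ra (cs ! i)) ?e" unfolding rip_diff_right isproj_ker[OF P m] by simp
 also have "... = ra (cs ! i) j" using j by (simp add: rip_def if_distrib cong: if_cong)
 finally show ?thesis .
qed
have al: "det (rgr n cs)*al l : \<int>" if l: "l < ?k" for l
proof -
 have "(SUM i<?k. ri (A $$ (l, i))*ra (cs ! i) j) = (SUM i<?k. SUM m<?k. ri (A $$ (l, i)*gr n cs $$ (i, m))*al m)" using G by (simp add: G[symmetric] sum_distrib_left mult.assoc)
 also have "... = (SUM m<?k. (SUM i<?k. ri (A $$ (l, i)*gr n cs $$ (i, m)))*al m)" by (subst sum.swap) (simp add: sum_distrib_right)
 also have "... = (SUM m<?k. ri ((A*gr n cs) $$ (l, m))*al m)" using A(1) l by (intro sum.cong) (auto simp: scalar_prod_def gr_def lessThan_atLeast0)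
 also have "... = (SUM m<?k. if m = l then det (rgr n cs)*al m else 0)" unfolding A(2) using l by (intro sum.cong) (auto simp: det_rgr)
 also have "... = det (rgr n cs)*al l" using l by simp
 finally show ?thesis by (metis (no_types, lifting) Ints_of_int Ints_sum Ints_mult)
qed
have "det (rgr n cs)*Q i j = det (rgr n cs) * ?e i - (SUM l<?k. (det (rgr n cs)*al l)*ra (cs ! l) i)"
 using a[OF i] unfolding ape lc_def by (simp add: sum_distrib_left mult.assoc algebra_simps)
also have "... : \<int>"
proof -
 have dI: "det (rgr n cs) : \<int>" by (simp add: det_rgr)
 show ?thesis by (intro Ints_diff Ints_sum Ints_mult[OF dI] Ints_mult[OF al]) auto
qed
finally show ?thesis .
qed

text \<open>The bound has factors \<open>1 + ip n b b\<close> instead of \<open>ip n b b\<close> so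
  that it also survives the vectors skipped as dependent.\<close>

definition pinv where "pinv n bs cs de P <-> isproj n bs cs (%i j. ri (el (rw P i) j)/ri de) &
 det (rgr n cs) = ri de & de > 0 & ri de <= (PROD b<-bs. 1+ri (ip n b b))"

lemma pinv_step:
assumes "pinv n bs cs de P"
shows "EX cs'. pinv n (bs @ [b]) cs' (fst (pstep n b (de, P))) (snd (pstep n b (de, P)))"
proof -
let ?Q = "%i j. ri (el (rw P i) j)/ri de"
have I: "isproj n bs cs ?Q" "det (rgr n cs) = ri de" "de > 0"
 and bd: "ri de <= (PROD b<-bs. 1+ri (ip n b b))" using assms by (auto simp: pinv_def)
define v where "v = mulv n P b"
define d where "d = ip n b v"
have v: "ra v i = ri de*ap n ?Q (ra b) i" if "i < n" for i using that I(3) by (simp add: v_def mulv_def ap_def ip_def sum_distrib_left)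
have dq: "ri d = ri de*rip n (ra b) (ap n ?Q (ra b))" unfolding d_def ip_rip rip_scale_right[symmetric] by (intro rip_cong) (auto simp: v)
have ipn: "ip n b b >= 0" by (simp add: ip_def sum_nonneg)
have ple: "ri de*1 <= (PROD b<-bs. 1+ri (ip n b b))*(1+ri (ip n b b))" using bd I(3) ipn by (intro mult_mono) auto
show ?thesis
proof (cases "d = 0")
 case True
 hence "rip n (ra b) (ap n ?Q (ra b)) = 0" using dq I(3) by simp
 from isproj_skip[OF I(1) this] show ?thesis using True I ple by (intro exI[of _ cs]) (simp add: pstep_def v_def[symmetric] d_def[symmetric] pinv_def)
next
 case False
 define q where "q = rip n (ra b) (ap n ?Q (ra b))"
 have q: "q ~= 0" using False dq by (auto simp: q_def)
 have q0: "q > 0" using q isproj_norm[OF I(1), of "ra b"] rip_nonneg[of n "ap n ?Q (ra b)"] by (simp add: q_def)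
 let ?Q' = "%i j. ?Q i j - ap n ?Q (ra b) i*ap n ?Q (ra b) j/q"
 have P': "isproj n (bs @ [b]) (cs @ [b]) ?Q'" using isproj_step[OF I(1)] q unfolding q_def by simp
 have det': "det (rgr n (cs @ [b])) = ri d" using det_gr_step[OF I(1), of b] I(2) dq by simp
 define P2 where "P2 = mk n (%i. mk n (%j. (d*el (rw P i) j - el v i*el v j) div de))"
 have eq: "ri (el (rw P2 i) j)/ri d = ?Q' i j" if ij: "i < n" "j < n" for i j
 proof -
  \<comment> \<open>Integrality of the new determinant times the new projection is what makes the
    \<open>div\<close> in \<open>P2\<close> exact.\<close>
  obtain z where z: "ri d * ?Q' i j = ri z" using isproj_integral[OF P' ij] unfolding det' Ints_def by auto
  have "ri de*(ri d * ?Q' i j) = ri (d*el (rw P i) j - el v i*el v j)" using I(3) q v[OF ij(1)] v[OF ij(2)] dq unfolding q_def[symmetric] by (simp add: field_simps)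
  hence "ri (de*z) = ri (d*el (rw P i) j - el v i*el v j)" unfolding z by simp
  hence "d*el (rw P i) j - el v i*el v j = de*z" by (simp only: of_int_eq_iff)
  hence "el (rw P2 i) j = z" using ij I(3) by (simp add: P2_def)
  thus ?thesis using z False by (simp add: field_simps)
 qed
 have isp: "isproj n (bs @ [b]) (cs @ [b]) (%i j. ri (el (rw P2 i) j)/ri d)"
 proof -
  have "ap n (%i j. ri (el (rw P2 i) j)/ri d) x i = ap n ?Q' x i" if "i < n" for x i unfolding ap_def[where x = x] by (intro sum.cong refl arg_cong2[where f = "(*)"] eq[OF that]) auto
  thus ?thesis using P' eq unfolding isproj_def by simp
 qed
 have d0: "d > 0" using q0 I(3) dq unfolding q_def[symmetric] by (metis mult_pos_pos of_int_0_less_iff)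
 have "q <= rip n (ra b) (ra b)" using isproj_contract[OF I(1), of "ra b"] isproj_norm[OF I(1), of "ra b"] by (simp add: q_def)
 hence "ri d <= (PROD b<-bs. 1+ri (ip n b b))*(1+ri (ip n b b))" unfolding dq q_def[symmetric] using bd I(3) q0 by (intro mult_mono) (auto simp: ip_rip)
 thus ?thesis using isp det' d0 False by (intro exI[of _ "cs @ [b]"]) (simp add: pstep_def v_def[symmetric] d_def[symmetric] pinv_def P2_def)
qed
qed

lemma pinv_proj: "EX cs. pinv n bs cs (dl n bs) (snd (proj n bs))"
proof (induction bs rule: rev_induct)
case Nil
let ?Q = "%i j. ri (el (rw (snd (proj n [])) i) j)/ri 1"
have Q: "?Q i j = (if i = j then 1 else 0)" if "i < n" "j < n" for i j using that by (simp add: proj_def)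
have "ap n ?Q x i = x i" if "i < n" for x i
proof -
 have "ap n ?Q x i = (SUM j<n. if i = j then x j else 0)" unfolding ap_def using Q that by (intro sum.cong) auto
 thus ?thesis using that by simp
qed
hence "isproj n [] [] ?Q" unfolding isproj_def using Q by (simp add: lc_def)
moreover have "det (rgr n []) = 1" by (simp add: rgr_def gr_def det_dim_zero)
ultimately show ?case by (intro exI[of _ "[]"]) (auto simp: pinv_def dl_def proj_def)
next
case (snoc b bs)
then obtain cs where "pinv n bs cs (dl n bs) (snd (proj n bs))" by blast
from pinv_step[OF this, of b] show ?case by (simp add: dl_def proj_def)
qed

lemma dl_pos: "dl n bs > 0" using pinv_proj[of n bs] by (auto simp: pinv_def)

lemma dl_le: "dl n bs <= (PROD b<-bs. 1+ip n b b)"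
proof -
have "ri (dl n bs) <= (PROD b<-bs. 1+ri (ip n b b))" using pinv_proj[of n bs] by (auto simp: pinv_def)
also have "... = ri (PROD b<-bs. 1+ip n b b)" by (induction bs) auto
finally show ?thesis by linarith
qed

section \<open>The projection as a linear map on real vectors\<close>

definition pj where "pj n bs x i = (SUM j<n. ri (pm n bs i j)*x j)/ri (dl n bs)"

lemma pj_isproj: "EX cs Q. isproj n bs cs Q & pj n bs = ap n Q &
(ALL i j. Q i j = ri (pm n bs i j)/ri (dl n bs))"
proof -
obtain cs where "pinv n bs cs (dl n bs) (snd (proj n bs))" using pinv_proj by blast
thus ?thesis by (intro exI[of _ cs] exI[of _ "%i j. ri (pm n bs i j)/ri (dl n bs)"])
  (auto simp: pinv_def pm_def pj_def ap_def sum_divide_distrib fun_eq_iff)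
qed

lemma pm_sym: assumes "i < n" "j < n" shows "pm n bs i j = pm n bs j i"
proof -
obtain cs Q where Q: "isproj n bs cs Q" "!!i j. Q i j = ri (pm n bs i j)/ri (dl n bs)" using pj_isproj[of n bs] by blast
hence "Q i j = Q j i" using assms by (simp add: isproj_def)
thus ?thesis using dl_pos[of n bs] Q(2) by simp
qed

lemma pj_obtain: obtains cs Q where "isproj n bs cs Q" "pj n bs = ap n Q" using pj_isproj[of n bs] by blast

lemma pj_sym: "rip n (pj n bs x) y = rip n x (pj n bs y)" using isproj_sym by (cases rule: pj_obtain[of n bs]) auto
lemma pj_ker: "b : set bs ==> rip n (ra b) (pj n bs x) = 0" using isproj_ker by (cases rule: pj_obtain[of n bs]) auto
lemma pj_idem: "i < n ==> pj n bs (pj n bs x) i = pj n bs x i" using isproj_idem by (cases rule: pj_obtain[of n bs]) auto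
lemma pj_norm: "rip n (pj n bs x) (pj n bs x) = rip n x (pj n bs x)" unfolding pj_sym by (intro rip_cong) (auto simp: pj_idem)
lemma pj_contract: "rip n (pj n bs x) (pj n bs x) <= rip n x x" using isproj_contract by (cases rule: pj_obtain[of n bs]) auto
lemma pj_fix: "(!!b. b : set bs ==> rip n (ra b) x = 0) ==> i < n ==> pj n bs x i = x i" using isproj_fix by (cases rule: pj_obtain[of n bs]) auto
lemma pj_rep: obtains al where "!!i. i < n ==> x i - pj n bs x i = (SUM b:set bs. al b*ra b i)"
proof -
obtain cs Q where Q: "isproj n bs cs Q" "pj n bs = ap n Q" using pj_obtain[of n bs] by blast
obtain al where a: "!!i. i < n ==> x i - ap n Q x i = lc al cs i" using isproj_rep[OF Q(1), of x] by blast
have cs: "set cs \<subseteq> set bs" using Q(1) by (simp add: isproj_def)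
have "lc al cs i = (SUM b:set bs. (SUM l | l < length cs & cs ! l = b. al l)*ra b i)" for i
proof -
 have "lc al cs i = (SUM b:set bs. SUM l | l : {..<length cs} & cs ! l = b. al l*ra (cs ! l) i)" unfolding lc_def using cs by (intro sum.group[symmetric]) auto
 thus ?thesis by (simp add: sum_distrib_right)
qed
note lc = this
show ?thesis
proof (rule that)
 fix i assume "i < n"
 thus "x i - pj n bs x i = (SUM b:set bs. (SUM l | l < length cs & cs ! l = b. al l)*ra b i)" using a lc Q(2) by simp
qed
qed

lemma pj_cong: "(!!i. i < n ==> x i = y i) ==> pj n bs x i = pj n bs y i" by (simp add: pj_def)
lemma pj_add: "pj n bs (%i. x i+y i) i = pj n bs x i+pj n bs y i" by (simp add: pj_def distrib_left sum.distrib add_divide_distrib)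
lemma pj_scale: "pj n bs (%i. c*x i) i = c*pj n bs x i" by (simp add: pj_def sum_distrib_left mult.left_commute)
lemma pj_diff: "pj n bs (%i. x i - y i) i = pj n bs x i - pj n bs y i" using pj_add[of n bs x "%i. - 1*y i" i] unfolding pj_scale by simp
lemma pj_sum: "pj n bs (%i. SUM l:A. f l i) i = (SUM l:A. pj n bs (f l) i)" by (simp add: pj_def sum_distrib_left sum_divide_distrib sum.swap[of _ A])
lemma pj_kills: "b : set bs ==> i < n ==> pj n bs (ra b) i = 0" using pj_ker[of b bs n "ra b"] unfolding pj_norm[symmetric] rip_eq_0 by blast

lemma pj_unique:
assumes "!!b. b : set bs ==> rip n (ra b) y = 0" "!!i. i < n ==> x i - y i = (SUM b:set bs. al b*ra b i)" "i < n"
shows "pj n bs x i = y i"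
proof -
have "pj n bs x i - y i = pj n bs x i - pj n bs y i" using pj_fix[of bs n y i] assms by simp
also have "... = pj n bs (%i. SUM b:set bs. al b*ra b i) i" unfolding pj_diff[symmetric] using assms(2) by (intro pj_cong)
also have "... = 0" unfolding pj_sum pj_scale using pj_kills assms(3) by (intro sum.neutral) auto
finally show ?thesis by simp
qed

lemma pm_col: "j < n ==> ri (pm n bs i j) = ri (dl n bs)*pj n bs (%l. if l = j then 1 else 0) i" using dl_pos[of n bs] by (simp add: pj_def if_distrib cong: if_cong)

text \<open>Columns of the integer matrix are \<open>dl\<close> times projected unit vectors, and a
  projection does not increase the norm.\<close>

lemma pm_bound: assumes "i < n" "j < n" shows "abs (pm n bs i j) <= dl n bs"
proof -
let ?e = "%l. if l = j then 1 else 0 :: real"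
have "(pj n bs ?e i)^2 <= rip n (pj n bs ?e) (pj n bs ?e)" by (rule sq_le_rip) fact
also have "... <= rip n ?e ?e" by (rule pj_contract)
also have "... = 1" using assms(2) by (simp add: rip_def if_distrib cong: if_cong)
finally have "abs (pj n bs ?e i) <= 1" by (simp add: abs_le_square_iff[of _ 1, simplified])
hence "ri (dl n bs)*abs (pj n bs ?e i) <= ri (dl n bs)*1" using dl_pos[of n bs] by (intro mult_left_mono) auto
hence "abs (ri (pm n bs i j)) <= ri (dl n bs)" unfolding pm_col[OF assms(2)] abs_mult using dl_pos[of n bs] by simp
thus ?thesis by linarith
qed

lemma length_proj: "length (snd (proj n bs)) = n & (ALL r:set (snd (proj n bs)). length r = n)"
proof (induction bs rule: rev_induct)
case Nil
thus ?case by (auto simp: proj_def mk_def)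
next
case (snoc b bs)
thus ?case by (auto simp: proj_def pstep_def Let_def mk_def)
qed

section \<open>Elementary vectors of a polyhedral cone\<close>

definition ker where "ker n rs x <-> (ALL b:set rs. rip n (ra b) x = 0)"

definition nn :: "nat => (nat => real) => bool" where "nn n x <-> (ALL i<n. 0 <= x i)"

text \<open>With 0 and 1 as entries of \<open>D\<close> this switches columns off; with powers of
  two it is the rescaling of the linear programming algorithm.\<close>

definition scl where "scl n D rs = map (%b. mk n (%j. el b j*el D j)) rs"

text \<open>A Hadamard-type bound for all Gram determinants of the rows. It is monotone in the
  absolute values of the entries, so it remains valid after columns are switched off.\<close>

definition Del where "Del n rs = (PROD b<-rs. 1+ip n b b)"

text \<open>In the cone of nonnegative kernel vectors these span the extreme rays: the support
  determines the kernel vector up to a factor. Those with positive entry 0 are the vertices of the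
  dehomogenized polyhedron.\<close>

definition elem where "elem n rs e <-> ker n rs e & nn n e & (EX i<n. 0 < e i) &
 (ALL g. ker n rs g --> (ALL i<n. e i = 0 --> g i = 0) --> (EX c. ALL i<n. g i = c*e i))"

lemma elem_line: "elem n rs e ==> ker n rs g ==> (!!i. i < n ==> e i = 0 ==> g i = 0) ==> EX c. ALL i<n. g i = c*e i" unfolding elem_def by simp
lemma elemI: "ker n rs e ==> nn n e ==> EX i<n. 0 < e i ==>
(!!g. ker n rs g ==> ALL i<n. e i = 0 --> g i = 0 ==> EX c. ALL i<n. g i = c*e i) ==> elem n rs e" unfolding elem_def by simp
lemma elemD: "elem n rs e ==> ker n rs e" "elem n rs e ==> nn n e" "elem n rs e ==> EX i<n. 0 < e i" unfolding elem_def by simp_all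

lemma ker_add: "ker n rs x ==> ker n rs y ==> ker n rs (%i. x i+y i)" by (simp add: ker_def rip_add_right)
lemma ker_diff: "ker n rs x ==> ker n rs y ==> ker n rs (%i. x i - y i)" by (simp add: ker_def rip_diff_right)
lemma ker_scale: "ker n rs x ==> ker n rs (%i. c*x i)" by (simp add: ker_def rip_scale_right)
lemma ker_cong: "(!!i. i < n ==> x i = y i) ==> ker n rs x <-> ker n rs y" unfolding ker_def by (metis rip_cong)
lemma elem_cong: assumes "!!i. i < n ==> x i = y i" shows "elem n rs x <-> elem n rs y" unfolding elem_def nn_def using assms ker_cong[of n x y rs, OF assms] by auto
lemma elem_scale: assumes "elem n rs e" "c > 0" shows "elem n rs (%i. c*e i)"
proof (rule elemI)
show "ker n rs (%i. c*e i)" by (intro ker_scale elemD assms)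
show "nn n (%i. c*e i)" "EX i<n. 0 < c*e i" using elemD[OF assms(1)] assms(2) by (auto simp: nn_def)
fix g assume g: "ker n rs g" "ALL i<n. c*e i = 0 --> g i = 0"
have "EX d. ALL i<n. g i = d*e i" by (rule elem_line[OF assms(1) g(1)]) (use g(2) in simp)
then obtain d where "ALL i<n. g i = d*e i" ..
thus "EX d. ALL i<n. g i = d*(c*e i)" using assms(2) by (intro exI[of _ "d/c"]) simp
qed

lemma ker_scl: "ker n (scl n D rs) x <-> ker n rs (%i. ri (el D i)*x i)" by (auto simp: ker_def scl_def rip_def mult.assoc)

lemma Del_ge_1: "Del n rs >= 1"
proof -
have "1 <= 1+ip n b b" for b by (simp add: ip_def sum_nonneg)
thus ?thesis unfolding Del_def
proof (induction rs)
 case (Cons b rs)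
 hence "1*1 <= (1+ip n b b)*(PROD b<-rs. 1+ip n b b)" by (intro mult_mono) (auto simp: add_increasing)
 thus ?case by simp
qed simp
qed

lemma Del_mono:
assumes "length rs = length rs'" "!!k i. k < length rs ==> i < n ==> (abs (el (rs ! k) i)) <= abs (el (rs' ! k) i)"
shows "Del n rs <= Del n rs'" using assms
proof (induction rs rs' rule: list_induct2)
case (Cons b rs b' rs')
have "ip n b b <= ip n b' b'" unfolding ip_def using Cons.prems[of 0] by (intro sum_mono) (simp add: abs_le_square_iff power2_eq_square[symmetric])
moreover have "0 <= ip n b b" by (simp add: ip_def sum_nonneg)
moreover have "Del n rs <= Del n rs'" using Cons.prems[of "Suc _"] by (intro Cons.IH) auto
ultimately show ?case using Del_ge_1[of n rs] unfolding Del_def by (simp, intro mult_mono) auto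
qed simp

text \<open>The kernel restricted to the support of an elementary vector is a line, onto which the projection maps the unit vectors.\<close>
lemma elem_proj:
assumes e: "elem n rs e" and j: "j < n" "e j > 0"
 and m: "!!i. i < n ==> el m i = (if e i = 0 then 0 else 1)"
shows "EX c>0. ALL i<n. ri (pm n (scl n m rs) j i) = c*e i"
proof -
let ?R = "scl n m rs"
let ?u = "%j l. if l = j then 1 else 0 :: real"
have rip_u: "rip n x (?u i) = x i" "rip n (?u i) x = x i" if "i < n" for x i using that by (simp_all add: rip_def if_distrib if_distribR cong: if_cong)
have kerm: "ker n ?R x <-> ker n rs x" if "!!i. i < n ==> e i = 0 ==> x i = 0" for x unfolding ker_scl using that m by (intro ker_cong) auto
define q where "q = pj n ?R (?u j)"
have q0: "q i = 0" if i: "i < n" "e i = 0" for i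
proof -
 have "rip n (ra b) (?u i) = 0" if "b : set ?R" for b using that i m[of i] by (auto simp: rip_u scl_def)
 hence "rip n (?u j) (pj n ?R (?u i)) = rip n (?u j) (?u i)" by (intro rip_cong) (auto simp: pj_fix)
 thus ?thesis unfolding q_def using i j pj_sym[of n ?R "?u j" "?u i"] by (auto simp: rip_u)
qed
have "ker n ?R q" unfolding ker_def q_def using pj_ker by blast
hence "ker n rs q" using kerm q0 by blast
from elem_line[OF e this q0] obtain c where c: "!!i. i < n ==> q i = c*e i" by auto
have "ker n ?R e" using e kerm by (simp add: elem_def)
hence "rip n (?u j) (pj n ?R e) = rip n (?u j) e" by (intro rip_cong pj_fix) (auto simp: ker_def)
hence "rip n q e = e j" unfolding q_def pj_sym using j by (simp add: rip_u)
moreover have "rip n q e = c*rip n e e" unfolding rip_scale_left[symmetric] using c by (intro rip_cong) auto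
moreover have "rip n e e ~= 0" using rip_eq_0[of n e] j by auto
hence "rip n e e > 0" using rip_nonneg[of n e] by linarith
ultimately have "c > 0" using j(2) zero_less_mult_pos2[of c "rip n e e"] by simp
moreover have "ri (pm n ?R j i) = (ri (dl n ?R)*c)*e i" if "i < n" for i using pm_col[OF j(1), of ?R i] pm_sym[OF that j(1), of ?R] c[OF that] by (simp add: q_def)
ultimately show ?thesis using dl_pos[of n ?R] by (intro exI[of _ "ri (dl n ?R)*c"]) simp
qed

definition ielem where "ielem n rs v <-> elem n rs (ra v) & (ALL i<n. el v i <= Del n rs)"

lemma ielem_pos: "ielem n rs v ==> i < n ==> el v i >= 0" by (auto simp: ielem_def elem_def nn_def)

text \<open>A row of the integer projection matrix that belongs to the support is an integral
  multiple of \<open>e\<close>. Switching columns off only shrinks the rows, so the determinant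
  bound is that of the original system.\<close>

lemma elem_int:
assumes e: "elem n rs e" and j: "j < n" "e j > 0" and m: "!!i. i < n ==> el m i = (if e i = 0 then 0 else 1)"
 and v: "!!i. i < n ==> el v i = pm n (scl n m rs) j i"
shows "ielem n rs v & (EX c>0. ALL i<n. e i = c*ra v i)"
proof -
obtain c where c: "c > 0" "!!i. i < n ==> ri (pm n (scl n m rs) j i) = c*e i" using elem_proj[OF e j m] by blast
have "elem n rs (ra v)" using elem_scale[OF e c(1)] c v by (subst elem_cong[of _ _ "%i. c*e i"]) auto
moreover have "el v i <= Del n rs" if "i < n" for i
proof -
 have "el v i <= dl n (scl n m rs)" using pm_bound[OF j(1) that, of "scl n m rs"] v[OF that] by simp
 also have "... <= Del n (scl n m rs)" unfolding Del_def by (rule dl_le)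
 also have "... <= Del n rs" using m by (intro Del_mono) (auto simp: scl_def)
 finally show ?thesis .
qed
moreover have "e i = (1/c)*ra v i" if "i < n" for i using c v that by simp
ultimately show ?thesis using c(1) unfolding ielem_def by (intro conjI exI[of _ "1/c"]) auto
qed

text \<open>A nonzero solution of minimal support works. Subtracting from it the largest multiple of
  another kernel vector that preserves nonnegativity shrinks the support, so by minimality the
  difference vanishes.\<close>

lemma elem_ex:
assumes X: "ker n rs X" "nn n X" "i0 < n" "X i0 > 0"
shows "EX e. elem n rs e & (ALL i<n. X i = 0 --> e i = 0)"
proof -
let ?S = "%x. {i. i < n & x i ~= (0::real)}"
let ?P = "%x. ker n rs x & nn n x & (EX i<n. x i > 0) & (ALL i<n. X i = 0 --> x i = 0)"
have "?P X" using X by auto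
then obtain e where e: "?P e" and min: "!!y. ?P y ==> card (?S e) <= card (?S y)" using ex_has_least_nat[of ?P X "%x. card (?S x)"] by blast
have main: "EX c. ALL i<n. g i = c*e i" if g: "ker n rs g" "ALL i<n. e i = 0 --> g i = 0" and p: "EX i<n. g i > 0" for g
proof -
 let ?A = "{i. i < n & g i > 0}"
 define c where "c = Min ((%i. e i/g i) ` ?A)"
 have cle: "c <= e i/g i" if "i : ?A" for i unfolding c_def using that by (intro Min_le) auto
 have "c : (%i. e i/g i) ` ?A" unfolding c_def using p by (intro Min_in) auto
 then obtain k where k: "k < n" "g k > 0" "c = e k/g k" by auto
 have ek: "e k > 0" using e k g(2) unfolding nn_def by (metis less_irrefl order_le_less)
 have c0: "c > 0" using k ek by simp
 let ?y = "%i. e i - c*g i"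
 have ky: "ker n rs ?y" by (intro ker_diff ker_scale g) (use e in blast)
 have ny: "?y i >= 0" if "i < n" for i
 proof (cases "g i > 0")
  case True
  thus ?thesis using cle[of i] that by (simp add: pos_le_divide_eq)
 next
  case False
  hence "c*g i <= 0" using c0 by (simp add: mult_nonneg_nonpos)
  moreover have "0 <= e i" using e that by (simp add: nn_def)
  ultimately show ?thesis by linarith
 qed
 have sub: "?S ?y \<subset> ?S e"
 proof -
  have "k : ?S e" "k ~: ?S ?y" using k ek by auto
  moreover have "?S ?y \<subseteq> ?S e" using g(2) by auto
  ultimately show ?thesis by blast
 qed
 have "ALL i<n. ?y i = 0"
 proof (rule ccontr)
  assume "~ ?thesis"
  then obtain i where "i < n" "?y i ~= 0" by blast
  hence "EX i<n. ?y i > 0" using ny by (metis order_le_less)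
  hence "?P ?y" using ky ny e g(2) by (auto simp: nn_def)
  from min[OF this] psubset_card_mono[OF _ sub] show False by simp
 qed
 thus ?thesis using c0 by (intro exI[of _ "1/c"]) (auto simp: field_simps)
qed
have "EX c. ALL i<n. g i = c*e i" if g: "ker n rs g" "ALL i<n. e i = 0 --> g i = 0" for g
proof (cases "EX i<n. g i ~= 0")
 case True
 then consider "EX i<n. g i > 0" | "EX i<n. - g i > 0" by (metis neg_0_less_iff_less neqE)
 thus ?thesis
 proof cases
  case 1
  thus ?thesis using main g by blast
 next
  case 2
  have "ker n rs (%i. - g i)" using ker_scale[OF g(1), of "-1"] by simp
  from main[OF this _ 2] g(2) obtain c where "ALL i<n. - g i = c*e i" by auto
  thus ?thesis by (intro exI[of _ "- c"]) (auto simp: minus_equation_iff[of "g _"])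
 qed
next
 case False
 thus ?thesis by (intro exI[of _ 0]) auto
qed
hence "elem n rs e" using e by (intro elemI) auto
thus ?thesis using e by blast
qed

lemma ielem_ex:
assumes X: "ker n rs X" "nn n X" "i0 < n" "X i0 > 0"
shows "EX v. ielem n rs v & (ALL i<n. X i = 0 --> el v i = 0)"
proof -
obtain e where e: "elem n rs e" "!!i. i < n ==> X i = 0 ==> e i = 0" using elem_ex[OF X] by blast
then obtain j where j: "j < n" "e j > 0" by (auto simp: elem_def)
define m where "m = mk n (%i. if e i = 0 then 0 else 1 :: int)"
have "ielem n rs (mk n (pm n (scl n m rs) j)) & (EX c>0. ALL i<n. e i = c*ra (mk n (pm n (scl n m rs) j)) i)" by (rule elem_int[OF e(1) j]) (auto simp: m_def)
thus ?thesis using e(2) by (metis less_irrefl mult_eq_0_iff of_int_eq_0_iff)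
qed

text \<open>Splitting off the largest possible multiple of an elementary vector removes a coordinate
  from the support, so there are at most as many terms as support coordinates.\<close>

lemma decomp:
assumes "ker n rs X" "nn n X"
shows "EX L. length L <= card {i. i < n & X i ~= 0} &
 (ALL (t, v):set L. t > 0 & ielem n rs v & (ALL i<n. X i = 0 --> el v i = 0)) &
 (ALL i<n. X i = (SUM (t, v)<-L. t*ra v i))" using assms
proof (induction "card {i. i < n & X i ~= 0}" arbitrary: X rule: less_induct)
case less
show ?case
proof (cases "EX i<n. X i ~= 0")
 case False
 thus ?thesis by (intro exI[of _ "[]"]) auto
next
 case True
 then obtain i0 where "i0 < n" "X i0 > 0" using less.prems(2) unfolding nn_def by (metis order_le_less)
 from ielem_ex[OF less.prems this] obtain v where v: "ielem n rs v" "!!i. i < n ==> X i = 0 ==> el v i = 0" by blast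
 let ?A = "{i. i < n & el v i > 0}"
 have ne: "?A ~= {}" using v(1) by (auto simp: ielem_def elem_def)
 define c where "c = Min ((%i. X i/ra v i) ` ?A)"
 have cle: "c <= X i/ra v i" if "i : ?A" for i unfolding c_def using that by (intro Min_le) auto
 have "c : (%i. X i/ra v i) ` ?A" unfolding c_def using ne by (intro Min_in) auto
 then obtain k where k: "k < n" "el v k > 0" "c = X k/ra v k" by auto
 have Xk: "X k > 0" using less.prems(2) k v(2) unfolding nn_def by (metis less_irrefl order_le_less)
 have c0: "c > 0" using k Xk by simp
 let ?y = "%i. X i - c*ra v i"
 have ky: "ker n rs ?y" using v(1) by (intro ker_diff ker_scale less.prems) (simp add: ielem_def elem_def)
 have ny: "nn n ?y" unfolding nn_def
 proof (intro allI impI)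
  fix i assume i: "i < n"
  show "0 <= X i - c*ra v i"
  proof (cases "el v i > 0")
   case True
   thus ?thesis using cle[of i] i by (simp add: pos_le_divide_eq)
  next
   case False
   hence "el v i = 0" using ielem_pos[OF v(1) i] by simp
   thus ?thesis using less.prems(2) i by (simp add: nn_def)
  qed
 qed
 have sub: "{i. i < n & ?y i ~= 0} \<subset> {i. i < n & X i ~= 0}"
 proof -
  have "k : {i. i < n & X i ~= 0}" "k ~: {i. i < n & ?y i ~= 0}" using k Xk by auto
  moreover have "{i. i < n & ?y i ~= 0} \<subseteq> {i. i < n & X i ~= 0}" using v(2) by auto
  ultimately show ?thesis by blast
 qed
 hence lt: "card {i. i < n & ?y i ~= 0} < card {i. i < n & X i ~= 0}" by (intro psubset_card_mono) auto
 from less.hyps[OF lt ky ny] obtain L where L: "length L <= card {i. i < n & ?y i ~= 0}"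
  "ALL (t, v):set L. t > 0 & ielem n rs v & (ALL i<n. ?y i = 0 --> el v i = 0)"
  "ALL i<n. ?y i = (SUM (t, v)<-L. t*ra v i)" by blast
 have z: "?y i = 0" if "i < n" "X i = 0" for i using v(2) that by simp
 show ?thesis
 proof (intro exI[of _ "(c, v) # L"] conjI)
  show "ALL (t, v):set ((c, v) # L). t > 0 & ielem n rs v & (ALL i<n. X i = 0 --> el v i = 0)" using L(2) c0 v z by fastforce
  show "ALL i<n. X i = (SUM (t, v)<-(c, v) # L. t*ra v i)" using L(3) by (simp add: algebra_simps)
 qed (use L(1) lt in simp)
qed
qed

section \<open>Linear programming\<close>

definition picks where "picks n D z = filter (%i. 0 < el D i & el z i <= 0) [0..<n]"

text \<open>A perceptron step in the style of Chubanov's method: \<open>fst s\<close> counts how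
  often each unit vector was chosen, and \<open>snd s\<close> remains the integer projection matrix
  applied to these counts.\<close>

definition percstep where "percstep n P D s = (if picks n D (snd s) = [] then s else
 (mk n (%i. el (fst s) i+(if i = nthd 0 (picks n D (snd s)) 0 then 1 else 0)),
  mk n (%i. el (snd s) i+el (rw P (nthd 0 (picks n D (snd s)) 0)) i)))"

text \<open>After \<open>T = 4 * n^3\<close> unsuccessful steps some coordinate was chosen at least
  \<open>T / n = 4 * n^2\<close> times, which is twice the Cauchy-Schwarz bound
  \<open>sqrt (T * n) = 2 * n^2\<close>. This ratio 2 pays for halving a scale.\<close>

definition perc where "perc n P D = (percstep n P D ^^ (4*n^3)) (mk n (%_. 0), mk n (%_. 0))"

text \<open>If the perceptron made all active entries positive, the scaling is final. Otherwise the
  scale of an often chosen coordinate is halved; \<open>div 2\<close> turns the scale 1 into 0 and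
  thereby deactivates the coordinate.\<close>

definition chubstep where "chubstep n rs D = (let s = perc n (snd (proj n (scl n D rs))) D in
 if picks n D (snd s) = [] then D else
 (let k = nthd 0 (filter (%i. 4*int n^3 <= int n*el (fst s) i) [0..<n]) 0 in mk n (%i. if i = k then el D i div 2 else el D i)))"

text \<open>\<open>2^l\<close> exceeds the entries of all integral elementary vectors. The scales
  start with at most \<open>n * (l + 1)\<close> bits in total and each effective step removes one,
  whence the number of iterations.\<close>

definition feas where "feas n rs m t = (let l = size_int (Del n rs) in
 0 < el ((chubstep n rs ^^ (n*(l+1))) (mk n (%i. if el m i = 0 then 0 else 2^l))) t)"

lemma picks_hd: "picks n D z ~= [] ==> nthd 0 (picks n D z) 0 < n & 0 < el D (nthd 0 (picks n D z) 0) & el z (nthd 0 (picks n D z) 0) <= 0"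
using nth_mem[of 0 "picks n D z"] by (auto simp: picks_def nthd_def)
lemma picks_Nil: "picks n D z = [] ==> i < n ==> 0 < el D i ==> 0 < el z i" by (auto simp: picks_def filter_empty_conv)

definition pcinv where "pcinv n bs D t s <-> (ALL i<n. 0 <= el (fst s) i) & (ALL i<n. el D i <= 0 --> el (fst s) i = 0) &
 (ALL i<n. ra (snd s) i = ri (dl n bs)*pj n bs (ra (fst s)) i) &
 rip n (pj n bs (ra (fst s))) (pj n bs (ra (fst s))) <= real t &
 (picks n D (snd s) ~= [] --> (SUM i<n. el (fst s) i) = int t)"

text \<open>The picked coordinate of the projection is nonpositive, so the cross term of the new
  squared norm is too: the squared norm grows by at most 1 while the counts grow by exactly
  1.\<close>

lemma pcinv_step:
assumes I: "pcinv n bs D t s"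
shows "pcinv n bs D (Suc t) (percstep n (snd (proj n bs)) D s)"
proof (cases "picks n D (snd s) = []")
case True
thus ?thesis using I by (auto simp: percstep_def pcinv_def)
next
case False
define k where "k = nthd 0 (picks n D (snd s)) 0"
have k: "k < n" "0 < el D k" "el (snd s) k <= 0" using picks_hd[OF False] by (auto simp: k_def)
let ?u = "%l. if l = k then 1 else 0 :: real"
have rip_u: "rip n x ?u = x k" "rip n ?u x = x k" for x using k by (simp_all add: rip_def if_distrib if_distribR cong: if_cong)
define s' where "s' = percstep n (snd (proj n bs)) D s"
have s1: "el (fst s') i = el (fst s) i+(if i = k then 1 else 0)" if "i < n" for i using that False by (simp add: s'_def percstep_def k_def)
have s2: "el (snd s') i = el (snd s) i+pm n bs k i" if "i < n" for i using that False by (simp add: s'_def percstep_def k_def pm_def)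
have pj': "pj n bs (ra (fst s')) i = pj n bs (ra (fst s)) i+pj n bs ?u i" for i unfolding pj_add[symmetric] using s1 by (intro pj_cong) auto
have z: "ra (snd s) i = ri (dl n bs)*pj n bs (ra (fst s)) i" if "i < n" for i using I that by (simp add: pcinv_def)
have z': "ra (snd s') i = ri (dl n bs)*pj n bs (ra (fst s')) i" if "i < n" for i
 unfolding pj' using s2[OF that] z[OF that] pm_sym[OF k(1) that, of bs] pm_col[OF k(1), of bs i] by (simp add: distrib_left)
let ?p = "pj n bs (ra (fst s))" and ?q = "pj n bs ?u"
have "rip n (pj n bs (ra (fst s'))) (pj n bs (ra (fst s'))) = rip n (%i. ?p i + ?q i) (%i. ?p i + ?q i)" by (intro rip_cong) (auto simp: pj')
also have "... = rip n ?p ?p+2*rip n ?p ?q+rip n ?q ?q" unfolding rip_add_left rip_add_right by (simp add: rip_commute[of n ?q ?p])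
also have "rip n ?p ?q = ?p k"
proof -
 have "rip n ?p ?q = rip n (pj n bs ?p) ?u" by (rule pj_sym[symmetric])
 also have "... = ?p k" using k by (simp add: rip_u pj_idem)
 finally show ?thesis .
qed
also have "?p k <= 0"
proof (rule ccontr)
 assume "~ ?p k <= 0"
 hence "ri (dl n bs) * ?p k > 0" using dl_pos[of n bs] by (intro mult_pos_pos) auto
 thus False using z[OF k(1)] k(3) by simp
qed
also have "rip n ?q ?q <= 1" using pj_contract[of n bs ?u] by (simp add: rip_u)
finally have n': "rip n (pj n bs (ra (fst s'))) (pj n bs (ra (fst s'))) <= real (Suc t)" using I by (simp add: pcinv_def)
have "(SUM i<n. el (fst s') i) = (SUM i<n. el (fst s) i)+(SUM i<n. if i = k then 1 else 0)" unfolding sum.distrib[symmetric] using s1 by (intro sum.cong) auto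
also have "... = int (Suc t)" using I False k by (simp add: pcinv_def)
finally show ?thesis using I z' n' s1 k unfolding s'_def[symmetric] pcinv_def by auto
qed

lemma pcinv_perc: "pcinv n bs D (4*n^3) (perc n (snd (proj n bs)) D)"
proof -
have "pcinv n bs D t ((percstep n (snd (proj n bs)) D ^^ t) (mk n (%_. 0), mk n (%_. 0)))" for t
proof (induction t)
 case 0
 have "pj n bs (ra (mk n (%_. 0))) i = 0" for i by (simp add: pj_def)
 thus ?case by (simp add: pcinv_def rip_def)
next
 case (Suc t)
 thus ?case using pcinv_step by simp
qed
thus ?thesis unfolding perc_def .
qed

text \<open>The points over which the scaling is certified.\<close>
definition cand where "cand n rs m x <-> ker n rs x & nn n x & (ALL i<n. x i <= 1) & (ALL i<n. el m i = 0 --> x i = 0)"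

text \<open>\<open>D / 2^l\<close> is a certified upper bound for all candidates in the unit
  cube.\<close>

definition chinv where "chinv n rs m l D <-> (ALL i<n. el D i = 0 | (EX k<=l. el D i = 2^k)) & (ALL i<n. el m i = 0 --> el D i = 0) &
 (ALL x. cand n rs m x --> (ALL i<n. x i*2^l <= ra D i))"

lemma chinv_nonneg: "chinv n rs m l D ==> i < n ==> 0 <= el D i" by (auto simp: chinv_def)

text \<open>If a candidate is nonzero at \<open>j\<close>, so is one of its elementary parts. That
  part is integral with entries below \<open>2^l\<close>, so its multiple by \<open>1 / 2^l\<close>
  is again a candidate, with entry at least \<open>1 / 2^l\<close> at \<open>j\<close>, against
  \<open>h\<close>.\<close>

lemma cand_small_zero:
assumes l: "Del n rs < 2^l" and j: "j < n"
 and h: "!!x. cand n rs m x ==> x j*2^l <= 1/2" and x: "cand n rs m x"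
shows "x j = 0"
proof (rule ccontr)
assume "x j ~= 0"
have kx: "ker n rs x" "nn n x" using x by (auto simp: cand_def)
from decomp[OF kx] obtain L where L: "ALL (t, v):set L. t > 0 & ielem n rs v & (ALL i<n. x i = 0 --> el v i = 0)"
 "ALL i<n. x i = (SUM (t, v)<-L. t*ra v i)" by blast
have "EX (t, v):set L. el v j ~= 0"
proof (rule ccontr)
 assume "~ ?thesis"
 hence "(SUM (t, v)<-L. t*ra v j) = (SUM (t, v)<-L. 0)" by (intro arg_cong[of _ _ sum_list] map_cong) auto
 thus False using L(2) j \<open>x j ~= 0\<close> by (auto simp: case_prod_unfold)
qed
then obtain t v where v: "ielem n rs v" "ALL i<n. x i = 0 --> el v i = 0" "el v j ~= 0" using L(1) by fast
have vj: "el v j >= 1" using ielem_pos[OF v(1) j] v(3) by simp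
let ?y = "%i. (1/2^l)*ra v i"
have "cand n rs m ?y" unfolding cand_def
proof (intro conjI allI impI)
 show "ker n rs ?y" using v(1) by (intro ker_scale) (simp add: ielem_def elem_def)
 show "nn n ?y" using ielem_pos[OF v(1)] by (simp add: nn_def)
 fix i assume i: "i < n"
 have "ri (el v i) <= ri (2^l)" using v(1) i l unfolding ielem_def of_int_le_iff by fastforce
 thus "?y i <= 1" by simp
 assume "el m i = 0"
 thus "?y i = 0" using x i v(2) by (simp add: cand_def)
qed
from h[OF this] vj show False by simp
qed

lemma hd_filter: "EX x:set xs. P x ==> nthd d (filter P xs) 0 : set xs & P (nthd d (filter P xs) 0)" using nth_mem[of 0 "filter P xs"] by (auto simp: nthd_def filter_empty_conv)

text \<open>A candidate in rescaled coordinates lies in the kernel and in the unit cube. Its product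
  with the counts therefore equals its product with their projection and is at most
  \<open>sqrt (T * n)\<close>; so at the coordinate counted \<open>T / n\<close> times its entry is
  at most \<open>1/2\<close>.\<close>

lemma chubstep_inv:
assumes I: "chinv n rs m l D" and l: "Del n rs < 2^l" and n: "n > 0"
defines "D' == chubstep n rs D"
shows "chinv n rs m l D' & (D' = D & picks n D (snd (perc n (snd (proj n (scl n D rs))) D)) = [] |
 (SUM i<n. size_int (el D' i)) < (SUM i<n. size_int (el D i)))"
proof (cases "picks n D (snd (perc n (snd (proj n (scl n D rs))) D)) = []")
case True
thus ?thesis using I by (simp add: D'_def chubstep_def Let_def)
next
case False
let ?bs = "scl n D rs"
define s where "s = perc n (snd (proj n ?bs)) D"
define T where "T = 4*n^3"
have p: "pcinv n ?bs D T s" unfolding s_def T_def by (rule pcinv_perc)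
define k where "k = nthd 0 (filter (%i. 4*int n^3 <= int n*el (fst s) i) [0..<n]) 0"
have "EX i:set [0..<n]. 4*int n^3 <= int n*el (fst s) i"
proof (rule ccontr)
 assume "~ ?thesis"
 hence "(SUM i<n. int n*el (fst s) i) < (SUM i<n. 4*int n^3)" using n by (intro sum_strict_mono) (auto simp: not_le)
 moreover have "(SUM i<n. el (fst s) i) = int T" using p False by (simp add: pcinv_def s_def)
 ultimately show False by (simp add: sum_distrib_left[symmetric] T_def)
qed
from hd_filter[OF this, of 0] have k: "k < n" "4*int n^3 <= int n*el (fst s) k" by (auto simp: k_def)
have "0 < 4*int n^3" using n by simp
hence "0 < int n*el (fst s) k" using k(2) by linarith
hence yk: "el (fst s) k > 0" using n by (simp add: zero_less_mult_iff)
hence Dk: "el D k > 0" using p k(1) unfolding pcinv_def by force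
have D': "el D' i = (if i = k then el D i div 2 else el D i)" if "i < n" for i using that False by (simp add: D'_def chubstep_def Let_def s_def[symmetric] k_def[symmetric])
have half: "x k*2^l <= ra D k/2" if x: "cand n rs m x" for x
proof -
 define x' where "x' i = (if el D i = 0 then 0 else x i*2^l/ra D i)" for i
 have xD: "x i*2^l <= ra D i" if "i < n" for i using I x that by (simp add: chinv_def)
 have x0: "0 <= x i" if "i < n" for i using x that by (simp add: cand_def nn_def)
 have Dx: "ra D i*x' i = 2^l*x i" if "i < n" for i using xD[OF that] x0[OF that] zero_less_power[of "2 :: real" l] by (auto simp: x'_def mult_le_0_iff simp del: zero_less_power)
 have "ker n ?bs x'" unfolding ker_scl using ker_scale[of n rs x "2^l"] x Dx by (subst ker_cong[of n _ "%i. 2^l*x i"]) (auto simp: cand_def)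
 hence "pj n ?bs x' i = x' i" if "i < n" for i using that by (intro pj_fix) (auto simp: ker_def)
 hence "rip n (ra (fst s)) x' = rip n (pj n ?bs (ra (fst s))) x'" unfolding pj_sym by (intro rip_cong) auto
 hence "(rip n (ra (fst s)) x')^2 <= rip n (pj n ?bs (ra (fst s))) (pj n ?bs (ra (fst s)))*rip n x' x'" using rip_Cauchy[of n "pj n ?bs (ra (fst s))" x'] by simp
 also have "... <= real T*real n"
 proof (intro mult_mono rip_nonneg)
  show "rip n (pj n ?bs (ra (fst s))) (pj n ?bs (ra (fst s))) <= real T" using p by (simp add: pcinv_def)
  have "x' i*x' i <= 1*1" if "i < n" for i using xD[OF that] x0[OF that] chinv_nonneg[OF I that] by (intro mult_mono) (auto simp: x'_def)
  thus "rip n x' x' <= real n" unfolding rip_def using sum_mono[of "{..<n}" "%i. x' i*x' i" "%_. 1"] by simp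
 qed simp
 finally have le: "(rip n (ra (fst s)) x')^2 <= real T*real n" .
 have x'0: "0 <= x' i" if "i < n" for i using x0[OF that] chinv_nonneg[OF I that] by (simp add: x'_def)
 have y0: "0 <= ra (fst s) i" if "i < n" for i using p that by (simp add: pcinv_def)
 have "ra (fst s) k*x' k <= rip n (ra (fst s)) x'" unfolding rip_def using k(1) x'0 y0 by (intro member_le_sum[of k "{..<n}" "%i. ra (fst s) i*x' i"]) auto
 hence "(ra (fst s) k*x' k)^2 <= (rip n (ra (fst s)) x')^2" using k(1) x'0 y0 by (intro power_mono) auto
 hence A: "(ra (fst s) k*x' k)^2 <= real T*real n" using le by linarith
 have "ri (4*int n^3) <= ri (int n*el (fst s) k)" using k(2) by (simp only: of_int_le_iff)
 hence B: "real T <= real n*ra (fst s) k" by (simp add: T_def)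
 have "(real T*x' k)^2 <= (real n*ra (fst s) k*x' k)^2" using B x'0[OF k(1)] by (intro power_mono mult_right_mono) auto
 also have "... = (real n)^2*(ra (fst s) k*x' k)^2" by (simp add: power_mult_distrib mult.assoc)
 also have "... <= (real n)^2*(real T*real n)" by (intro mult_left_mono A) auto
 also have "... = (real T)^2/4" by (simp add: T_def power2_eq_square power3_eq_cube)
 also have "... = (real T*(1/2))^2" by (simp add: power2_eq_square)
 finally have "real T*x' k <= real T*(1/2)" by (rule power2_le_imp_le) simp
 hence "x' k <= 1/2" using n by (simp add: T_def)
 hence "ra D k*x' k <= ra D k*(1/2)" using Dk by (intro mult_left_mono) auto
 thus ?thesis using Dx[OF k(1)] by (simp add: mult.commute)
qed
obtain e where e: "e <= l" "el D k = 2^e" using I k(1) Dk by (auto simp: chinv_def)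
have new: "(el D' k = 0 | (EX j<=l. el D' k = 2^j)) & size_int (el D' k) < size_int (el D k) & (ALL x. cand n rs m x --> x k*2^l <= ra D' k)"
proof (cases e)
 \<comment> \<open>At scale 1 the halved scale is 0, which is sound because so small an entry is
   already 0 in every candidate.\<close>
 case 0
 have "x k*2^l <= ra D' k" if "cand n rs m x" for x
 proof -
  have "x k = 0" by (rule cand_small_zero[OF l k(1) _ that]) (use half 0 e in auto)
  thus ?thesis using D'[OF k(1)] e 0 by simp
 qed
 moreover have "el D' k = 0" "el D k = 1" using D'[OF k(1)] e 0 by auto
 ultimately show ?thesis by simp
next
 case (Suc e')
 hence d: "el D' k = 2^e'" using D'[OF k(1)] e by simp
 have "x k*2^l <= ra D' k" if "cand n rs m x" for x using half[OF that] d e Suc by simp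
 moreover have "e' <= l" using e Suc by simp
 moreover have "size_int (el D' k) < size_int (el D k)" unfolding d e(2) Suc size_int_pow2 by simp
 ultimately show ?thesis using d by auto
qed
have "chinv n rs m l D'" unfolding chinv_def
proof (intro conjI allI impI)
 fix i assume i: "i < n"
 show "el D' i = 0 | (EX k<=l. el D' i = 2^k)" using new D'[OF i] I i by (cases "i = k") (auto simp: chinv_def)
 show "el D' i = 0" if "el m i = 0" using D'[OF i] I i that by (auto simp: chinv_def)
 show "x i*2^l <= ra D' i" if "cand n rs m x" for x using new D'[OF i] I i that by (cases "i = k") (auto simp: chinv_def)
qed
moreover have "(SUM i<n. size_int (el D' i)) < (SUM i<n. size_int (el D i))" using new D' k(1) by (intro sum_strict_mono_ex1) (auto intro!: bexI[of _ k])
ultimately show ?thesis by simp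
qed

text \<open>At a fixpoint the perceptron has succeeded, and scaling its result gives a solution that
  is positive exactly on the support of \<open>D\<close>. The invariant confines every solution to
  this support, so \<open>D\<close> shows the maximal support and a single entry answers the
  question.\<close>

lemma feas_iff:
assumes n: "t < n"
shows "feas n rs m t <-> (EX x. ker n rs x & nn n x & (ALL i<n. el m i = 0 --> x i = 0) & 0 < x t)"
proof -
define l where "l = size_int (Del n rs)"
have l: "Del n rs < 2^l" using size_int_less[of "Del n rs"] by (simp add: l_def)
define D0 where "D0 = mk n (%i. if el m i = 0 then 0 else 2^l :: int)"
let ?D = "%k. (chubstep n rs ^^ k) D0"
let ?S = "%D. SUM i<n. size_int (el D i)"
have i0: "chinv n rs m l D0" by (auto simp: chinv_def D0_def cand_def)
have I: "chinv n rs m l (?D k)" for k using n by (induction k) (auto simp: i0 chubstep_inv[OF _ l])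
have stat: "?D k = ?D j" if "?D (Suc j) = ?D j" "k >= j" for j k using that(2) by (induction k rule: dec_induct) (use that(1) in auto)
have dec: "(EX j<k. ?D (Suc j) = ?D j) | ?S (?D k)+k <= ?S D0" for k
proof (induction k)
 case (Suc k)
 thus ?case using chubstep_inv[OF I[of k] l] n by (fastforce intro: less_SucI)
qed simp
define D where "D = ?D (n*(l+1))"
have S0: "?S D0 <= n*(l+1)" using sum_mono[of "{..<n}" "%i. size_int (el D0 i)" "%_. l+1"] by (simp add: D0_def size_int_pow2[unfolded One_nat_def])
have fx: "chubstep n rs D = D"
proof (rule ccontr)
 assume ne: "chubstep n rs D ~= D"
 have "~ (EX j<Suc (n*(l+1)). ?D (Suc j) = ?D j)"
 proof
  assume "EX j<Suc (n*(l+1)). ?D (Suc j) = ?D j"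
  then obtain j where j: "j <= n*(l+1)" "?D (Suc j) = ?D j" by (auto simp: less_Suc_eq_le)
  from stat[OF j(2), of "n*(l+1)"] stat[OF j(2), of "Suc (n*(l+1))"] j(1) have "?D (Suc (n*(l+1))) = ?D (n*(l+1))" by simp
  thus False using ne by (simp add: D_def)
 qed
 hence "?S (?D (Suc (n*(l+1))))+Suc (n*(l+1)) <= ?S D0" using dec[of "Suc (n*(l+1))"] by blast
 hence "Suc (n*(l+1)) <= n*(l+1)" using S0 by (meson le_trans le_add2)
 thus False by simp
qed
define s where "s = perc n (snd (proj n (scl n D rs))) D"
have ID: "chinv n rs m l D" unfolding D_def by (rule I)
have pk: "picks n D (snd s) = []" using chubstep_inv[OF ID l] fx n by (auto simp: s_def)
have fe: "feas n rs m t <-> 0 < el D t" unfolding feas_def Let_def D_def D0_def l_def ..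
show ?thesis unfolding fe
proof
 assume Dt: "0 < el D t"
 let ?x = "%i. ra D i*ra (snd s) i"
 have p: "pcinv n (scl n D rs) D (4*n^3) s" unfolding s_def by (rule pcinv_perc)
 have "ker n (scl n D rs) (ra (snd s))" using ker_scale[of n "scl n D rs" "pj n (scl n D rs) (ra (fst s))" "ri (dl n (scl n D rs))"] p pj_ker[of _ "scl n D rs" n "ra (fst s)"]
  by (subst ker_cong[of n _ "%i. ri (dl n (scl n D rs))*pj n (scl n D rs) (ra (fst s)) i"]) (auto simp: pcinv_def ker_def)
 hence "ker n rs ?x" unfolding ker_scl .
 moreover have "nn n ?x" unfolding nn_def
 proof (intro allI impI)
  fix i assume i: "i < n"
  show "0 <= ?x i" using picks_Nil[OF pk i] chinv_nonneg[OF ID i] by (cases "0 < el D i") auto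
 qed
 moreover have "ALL i<n. el m i = 0 --> ?x i = 0" using ID by (simp add: chinv_def)
 moreover have "0 < ?x t" using picks_Nil[OF pk n Dt] Dt by simp
 ultimately show "EX x. ker n rs x & nn n x & (ALL i<n. el m i = 0 --> x i = 0) & 0 < x t" by blast
next
 assume "EX x. ker n rs x & nn n x & (ALL i<n. el m i = 0 --> x i = 0) & 0 < x t"
 then obtain x where x: "ker n rs x" "nn n x" "ALL i<n. el m i = 0 --> x i = 0" "0 < x t" by blast
 define c where "c = 1/(SUM i<n. x i)"
 have xs: "x i <= (SUM i<n. x i)" if "i < n" for i using x(2) that by (intro member_le_sum) (auto simp: nn_def)
 have sp: "0 < (SUM i<n. x i)" using xs[OF n] x(4) by linarith
 have "ker n rs (%i. c*x i)" by (intro ker_scale x)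
 hence "cand n rs m (%i. c*x i)" using x xs sp by (auto simp: cand_def nn_def c_def)
 moreover have "ALL x. cand n rs m x --> (ALL i<n. x i*2^l <= ra D i)" using ID by (simp add: chinv_def)
 ultimately have "c*x t*2^l <= ra D t" using n by blast
 moreover have "0 < c*x t*2^l" using x(4) sp by (simp add: c_def)
 ultimately show "0 < el D t" by linarith
qed
qed

subsection \<open>Vertices on the good side of a halfspace\<close>

text \<open>The appended variable is the slack of the halfspace given by \<open>ob\<close>; the
  entry required to be positive is the homogenizing one, at index 0.\<close>

definition feasO where "feasO n rs ob m = feas (Suc n) (mk (Suc n) (%i. if i < n then el ob i else - 1) # map (%b. mk (Suc n) (%i. if i < n then el b i else 0)) rs)
 (mk (Suc n) (%i. if i < n then el m i else 1)) 0"

text \<open>Coordinates are switched off greedily as long as a solution remains; what is left is the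
  support of a vertex on the good side.\<close>

definition purify where "purify n rs ob = fold (%j m. if feasO n rs ob (m[j := 0]) then m[j := 0] else m) [0..<n] (mk n (%_. 1))"

definition lp where "lp n rs ob = (if feasO n rs ob (mk n (%_. 1)) then [rw (snd (proj n (scl n (purify n rs ob) rs))) 0] else [])"

lemma feasO_iff:
assumes n: "0 < n"
shows "feasO n rs ob m <-> (EX x. ker n rs x & nn n x & (ALL i<n. el m i = 0 --> x i = 0) & 0 < x 0 & 0 <= rip n (ra ob) x)"
proof -
have r1: "rip (Suc n) (ra (mk (Suc n) (%i. if i < n then el ob i else - 1))) x = rip n (ra ob) x - x n" for x by (simp add: rip_def)
have r2: "rip (Suc n) (ra (mk (Suc n) (%i. if i < n then el b i else 0))) x = rip n (ra b) x" for b x by (simp add: rip_def)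
have r3: "ker n rs (%i. if i < n then x i else y i) <-> ker n rs x" for x y by (rule ker_cong) simp
have r4: "rip n z (%i. if i < n then x i else y i) = rip n z x" for x y z by (rule rip_cong) auto
have "feasO n rs ob m <-> (EX x. rip n (ra ob) x = x n & ker n rs x & nn (Suc n) x & (ALL i<n. el m i = 0 --> x i = 0) & 0 < x 0)"
proof -
 have kk: "ker (Suc n) (mk (Suc n) (%i. if i < n then el ob i else - 1) # map (%b. mk (Suc n) (%i. if i < n then el b i else 0)) rs) x
  <-> rip n (ra ob) x = x n & ker n rs x" for x unfolding ker_def list.set set_map ball_simps(7) ball_simps(9) r1 r2 by auto
 have mm: "(ALL i<Suc n. el (mk (Suc n) (%i. if i < n then el m i else 1)) i = 0 --> x i = 0) <-> (ALL i<n. el m i = 0 --> x i = 0)" for x :: "nat => real" by (auto simp: less_Suc_eq)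
 show ?thesis unfolding feasO_def feas_iff[OF zero_less_Suc] kk mm by blast
qed
also have "... <-> (EX x. ker n rs x & nn n x & (ALL i<n. el m i = 0 --> x i = 0) & 0 < x 0 & 0 <= rip n (ra ob) x)" (is "?L <-> ?R")
proof
 assume ?L
 thus ?R by (auto simp: nn_def)
next
 assume ?R
 then obtain x where x: "ker n rs x" "nn n x" "ALL i<n. el m i = 0 --> x i = 0" "0 < x 0" "0 <= rip n (ra ob) x" by blast
 thus ?L using n by (intro exI[of _ "%i. if i < n then x i else rip n (ra ob) x"]) (auto simp: r3 r4 nn_def less_Suc_eq)
qed
finally show ?thesis .
qed

text \<open>A coordinate that was needed once stays needed, because later masks are smaller; one
  pass therefore reaches minimality.\<close>

lemma purify_props:
assumes n: "0 < n" and f: "feasO n rs ob (mk n (%_. 1))"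
defines "m == purify n rs ob"
shows "feasO n rs ob m" "!!i. i < n ==> el m i = 0 | el m i = 1"
 "!!j. j < n ==> el m j = 1 ==> ~ feasO n rs ob (m[j := 0])"
proof -
let ?f = "%j m. if feasO n rs ob (m[j := 0]) then m[j := 0] else m"
let ?m = "%k. fold ?f [0..<k] (mk n (%_. 1))"
have up: "el (m[j := 0]) i = (if i = j then 0 else el m i)" for m i j by (auto simp: nthd_def nth_list_update)
have mono: "feasO n rs ob m'" if "feasO n rs ob m" "!!i. i < n ==> el m' i = 0 ==> el m i = 0" for m m' using that unfolding feasO_iff[OF n] by blast
have A: "length (?m k) = n & feasO n rs ob (?m k) & (ALL i<n. el (?m k) i = 0 | el (?m k) i = 1) &
 (ALL j<k. el (?m k) j = 1 --> ~ feasO n rs ob ((?m k)[j := 0]))" if "k <= n" for k using that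
proof (induction k)
 case (Suc k)
 hence IH: "length (?m k) = n" "feasO n rs ob (?m k)" "ALL i<n. el (?m k) i = 0 | el (?m k) i = 1"
  "ALL j<k. el (?m k) j = 1 --> ~ feasO n rs ob ((?m k)[j := 0])" by auto
 show ?case
 proof (cases "feasO n rs ob ((?m k)[k := 0])")
  case True
  have "~ feasO n rs ob ((?m k)[k := 0, j := 0])" if "j < k" "el ((?m k)[k := 0]) j = 1" for j
  proof
   assume "feasO n rs ob ((?m k)[k := 0, j := 0])"
   hence "feasO n rs ob ((?m k)[j := 0])" by (rule mono) (auto simp: up split: if_splits)
   thus False using IH(4) that by (simp add: up split: if_splits)
  qed
  thus ?thesis using IH True by (auto simp: up less_Suc_eq)
 next
  case False
  thus ?thesis using IH by (auto simp: less_Suc_eq)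
 qed
qed (use f in auto)
have m: "m = ?m n" by (simp add: m_def purify_def)
show "feasO n rs ob m" "!!i. i < n ==> el m i = 0 | el m i = 1"
 "!!j. j < n ==> el m j = 1 ==> ~ feasO n rs ob (m[j := 0])" using A[of n] unfolding m by auto
qed

text \<open>The functional is summed over a conic decomposition of \<open>x\<close>, so it is
  nonnegative on some part. Boundedness excludes parts whose entry 0 vanishes.\<close>

lemma ielem_good_side:
assumes bd: "!!x. ker n rs x ==> nn n x ==> x 0 = 0 ==> ALL i<n. x i = 0" and n: "0 < n"
 and x: "ker n rs x" "nn n x" "0 < x 0" "0 <= rip n g x"
shows "EX v. ielem n rs v & 0 < el v 0 & 0 <= rip n g (ra v) & (ALL i<n. x i = 0 --> el v i = 0)"
proof -
from decomp[OF x(1,2)] obtain L where L: "ALL (t, v):set L. t > 0 & ielem n rs v & (ALL i<n. x i = 0 --> el v i = 0)"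
 "ALL i<n. x i = (SUM (t, v)<-L. t*ra v i)" by blast
have xe: "rip n g x = (SUM (t, v)<-L. t*rip n g (ra v))"
proof -
 have "rip n g x = rip n g (%i. SUM (t, v)<-L. t*ra v i)" using L(2) by (intro rip_cong) auto
 also have "... = (SUM (t, v)<-L. t*rip n g (ra v))" by (induction L) (auto simp: rip_def distrib_left sum.distrib sum_distrib_left mult.left_commute)
 finally show ?thesis .
qed
have "L ~= []" using L(2) x(3) n by force
have "EX (t, v):set L. 0 <= rip n g (ra v)"
proof (rule ccontr)
 assume neg: "~ ?thesis"
 hence "ALL (t, v):set L. t*rip n g (ra v) < 0" using L(1) by (fastforce intro: mult_pos_neg)
 hence "(SUM (t, v)<-L. t*rip n g (ra v)) < 0" using \<open>L ~= []\<close>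
 proof (induction L)
  case (Cons a L)
  thus ?case by (cases "L = []") (auto simp: case_prod_unfold add_neg_neg)
 qed simp
 thus False using xe x(4) by simp
qed
then obtain t v where v: "ielem n rs v" "0 <= rip n g (ra v)" "ALL i<n. x i = 0 --> el v i = 0" using L(1) by fast
have "el v 0 ~= 0"
proof
 assume "el v 0 = 0"
 hence "ALL i<n. ra v i = 0" using v(1) by (intro bd) (auto simp: ielem_def elem_def)
 thus False using v(1) by (auto simp: ielem_def elem_def)
qed
thus ?thesis using v ielem_pos[OF v(1) n] by (intro exI[of _ v]) auto
qed

text \<open>Minimality forces the vertex to have the whole mask as its support. The mask then
  determines the vertex up to a factor, and row 0 of the projection matrix for the masked system is
  a positive multiple of it, since index 0 lies in the support.\<close>

theorem lp_correct:
assumes bd: "!!x. ker n rs x ==> nn n x ==> x 0 = 0 ==> ALL i<n. x i = 0" and n: "0 < n"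
shows "(lp n rs ob = [] & (ALL x. ker n rs x & nn n x & 0 < x 0 --> rip n (ra ob) x < 0)) |
 (EX v. lp n rs ob = [v] & ielem n rs v & 0 < el v 0 & 0 <= rip n (ra ob) (ra v))"
proof (cases "feasO n rs ob (mk n (%_. 1))")
case False
thus ?thesis unfolding lp_def using feasO_iff[OF n, of rs ob "mk n (%_. 1)"] by (auto simp: not_le[symmetric])
next
case True
define m where "m = purify n rs ob"
note pu = purify_props[OF n True, folded m_def]
obtain x where x: "ker n rs x" "nn n x" "ALL i<n. el m i = 0 --> x i = 0" "0 < x 0" "0 <= rip n (ra ob) x" using pu(1) unfolding feasO_iff[OF n] by blast
from ielem_good_side[OF bd n x(1,2,4,5)] obtain v where v: "ielem n rs v" "0 < el v 0" "0 <= rip n (ra ob) (ra v)"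
 "ALL i<n. x i = 0 --> el v i = 0" by blast
have e: "elem n rs (ra v)" using v(1) by (simp add: ielem_def)
have mv: "el m i = (if ra v i = 0 then 0 else 1)" if i: "i < n" for i
proof (cases "el m i = 0")
 case True
 thus ?thesis using x(3) v(4) i by simp
next
 case False
 hence 1: "el m i = 1" using pu(2)[OF i] by simp
 have "el v i ~= 0"
 proof
  assume "el v i = 0"
  have up: "el (m[j := 0]) i = (if i = j then 0 else el m i)" for m i j by (auto simp: nthd_def nth_list_update)
  have "feasO n rs ob (m[i := 0])" unfolding feasO_iff[OF n] using v e x(3) \<open>el v i = 0\<close> by (intro exI[of _ "ra v"]) (auto simp: elem_def up)
  thus False using pu(3)[OF i 1] by simp
 qed
 thus ?thesis using 1 by simp
qed
define w where "w = rw (snd (proj n (scl n m rs))) 0"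
have "ielem n rs w & (EX c>0. ALL i<n. ra v i = c*ra w i)" by (rule elem_int[OF e n _ mv]) (use v(2) in "auto simp: w_def pm_def")
then obtain c where w: "ielem n rs w" "c > 0" "!!i. i < n ==> ra v i = c*ra w i" by blast
have "0 < ra w 0" using w(2) w(3)[OF n] v(2) zero_less_mult_pos[of c "ra w 0"] by simp
moreover have "0 <= rip n (ra ob) (ra w)"
proof -
 have "rip n (ra ob) (ra v) = c*rip n (ra ob) (ra w)" unfolding rip_scale_right[symmetric] using w(3) by (intro rip_cong) auto
 thus ?thesis using v(3) w(2) by (simp add: zero_le_mult_iff)
qed
ultimately show ?thesis using True w(1) unfolding lp_def m_def[symmetric] w_def[symmetric] by auto
qed

section \<open>Linear programming in polynomial time\<close>

named_theorems PT_rules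
text \<open>Running times of definitions without loops follow from their syntax by these rules. What
  remains to be argued is that the states of each loop have polynomial size.\<close>

lemmas [PT_rules] = PT_if' PT_nthd PT_mk PT_sum PT_prod PT_add PT_sub PT_mul PT_div PT_uminus PT_less
PT_le PT_eq PT_nless PT_neq PT_not PT_conj PT_disj PT_isnil PT_int PT_nadd PT_nmul PT_nsub PT_Suc
PT_length PT_upt PT_map PT_filter PT_pair PT_fst PT_snd PT_id PT_Cons PT_append PT_concat PT_size_int PT_update PT_const
PT_lift pb_lift pb_intros pb_length PT_max PT_nat PT_take PT_drop PT_rev PT_pow2 PT_ball

lemma PT_ip [PT_rules]: "PT D n ==> pb D n ==> PT D x ==> PT D y ==> PT D (%z. ip (n z) (x z) (y z))"
unfolding ip_def by (rule PT_sum) (assumption | intro PT_mul PT_nthd PT_snd PT_id | erule PT_lift)+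

lemma PT_mulv [PT_rules]: assumes "PT D n" "pb D n" "PT D P" "PT D y" shows "PT D (%z. mulv (n z) (P z) (y z))" unfolding mulv_def by (intro assms PT_rules)

lemma PT_pstep [PT_rules]: assumes "PT D n" "pb D n" "PT D b" "PT D s" shows "PT D (%z. pstep (n z) (b z) (s z))" unfolding pstep_def Let_def by (intro assms PT_rules)

lemma prod_list_nth: "(PROD b<-bs. f b) = (PROD i<length bs. f (rw bs i) :: int)"
proof (induction bs rule: rev_induct)
case (snoc b bs)
have "(PROD i<length bs. f (rw (bs @ [b]) i)) = (PROD i<length bs. f (rw bs i))" by (intro prod.cong) (auto simp: nthd_def nth_append)
thus ?case using snoc by (simp add: nthd_def)
qed simp

lemma PT_Del [PT_rules]: assumes "PT D n" "pb D n" "PT D bs" shows "PT D (%z. Del (n z) (bs z))" unfolding Del_def prod_list_nth by (intro assms PT_rules)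

lemma Del_append: "Del n (xs @ ys) = Del n xs*Del n ys" by (simp add: Del_def)
lemma Del_take: "Del n (take i bs) <= Del n bs"
proof -
have "Del n (take i bs)*1 <= Del n (take i bs)*Del n (drop i bs)" using Del_ge_1 order_trans[OF _ Del_ge_1[of n "take i bs"], of 0] by (intro mult_left_mono) auto
thus ?thesis by (simp add: Del_append[symmetric])
qed

lemma isize_vec: assumes "length xs <= n" "!!i. i < length xs ==> (abs (el xs i)) <= B" shows "isize xs <= n*(3*size_int B+10)"
proof (rule isize_list_le'[OF _ assms(1)])
fix x assume "x : set xs"
then obtain i where "i < length xs" "x = xs ! i" by (auto simp: in_set_conv_nth)
hence "abs x <= abs B" using assms(2)[of i] by (simp add: nthd_def)
thus "isize x <= size_int B" by (simp add: size_int_mono)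
qed

text \<open>Applied to every prefix of the rows, this is the size bound for the projection loop: no
  entry exceeds the current determinant, and \<open>Del\<close> bounds that for all
  prefixes.\<close>

lemma isize_proj: "isize (proj n bs) <= n*(3*(n*(3*size_int (Del n bs)+10))+10)+3*size_int (Del n bs)+10"
proof -
have d: "dl n bs <= Del n bs" using dl_le by (simp add: Del_def)
have *: "isize r <= n*(3*size_int (Del n bs)+10)" if r: "r : set (snd (proj n bs))" for r
proof (rule isize_vec)
 show "length r <= n" using r length_proj[of n bs] by simp
 obtain i where i: "i < n" "r = snd (proj n bs) ! i" using r length_proj[of n bs] by (auto simp: in_set_conv_nth)
 fix j assume j: "j < length r"
 hence "j < n" using r length_proj[of n bs] by simp
 from pm_bound[OF i(1) this, of bs] show "abs (el r j) <= Del n bs" using i d length_proj[of n bs] by (simp add: pm_def nthd_def[of "[]"])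
qed
hence "isize (snd (proj n bs)) <= n*(3*(n*(3*size_int (Del n bs)+10))+10)" using length_proj[of n bs] by (intro isize_list_le'[OF *]) simp_all
moreover have "size_int (dl n bs) <= size_int (Del n bs)" using d dl_pos[of n bs] by (intro size_int_mono) simp
ultimately show ?thesis using isize_pair[of "fst (proj n bs)" "snd (proj n bs)"] by (simp add: dl_def)
qed

lemma PT_proj [PT_rules]: assumes "PT D n" "pb D n" "PT D bs" shows "PT D (%z. proj (n z) (bs z))" unfolding proj_def
proof (rule PT_fold_dom[where E = "ext D (%_. UNIV)" and h = "%x b s. pstep (n x) b s" and
 M = "%x. n x*(3*(n x*(3*size_int (Del (n x) (bs x))+10))+10)+3*size_int (Del (n x) (bs x))+10"])
show "PT D (%x. (1, mk (n x) (%i. mk (n x) (%j. if i = j then 1 else 0))))" by (intro assms PT_rules)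
show "PT (ext D (%_. UNIV)) (%z. pstep (n (fst z)) (fst (snd z)) (snd (snd z)))" by (intro assms(1) assms(2) PT_rules)
have "pb D (%x. size_int (Del (n x) (bs x)))" using PT_size[OF PT_Del[OF assms]] by simp
thus "pb D (%x. n x*(3*(n x*(3*size_int (Del (n x) (bs x))+10))+10)+3*size_int (Del (n x) (bs x))+10)" by (intro pb_intros assms)
fix p x i assume "x : D p" "i <= length (bs x)"
have "size_int (Del (n x) (take i (bs x))) <= size_int (Del (n x) (bs x))" using Del_take[of "n x" i "bs x"] Del_ge_1[of "n x" "take i (bs x)"] by (intro size_int_mono) simp
thus "isize (fold (pstep (n x)) (take i (bs x)) (1, mk (n x) (%i. mk (n x) (%j. if i = j then 1 else 0))))
 <= n x*(3*(n x*(3*size_int (Del (n x) (bs x))+10))+10)+3*size_int (Del (n x) (bs x))+10" unfolding proj_def[symmetric] by (intro order_trans[OF isize_proj] add_mono mult_mono) auto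
qed (use assms in "auto simp: ext_def")

lemma PT_scl [PT_rules]: assumes "PT D n" "pb D n" "PT D m" "PT D bs" shows "PT D (%z. scl (n z) (m z) (bs z))" unfolding scl_def by (intro assms PT_rules)

lemma PT_picks [PT_rules]: assumes "PT D n" "pb D n" "PT D m" "PT D z" shows "PT D (%x. picks (n x) (m x) (z x))" unfolding picks_def by (intro assms PT_rules)

lemma PT_percstep [PT_rules]: assumes "PT D n" "pb D n" "PT D P" "PT D m" "PT D s"
shows "PT D (%x. percstep (n x) (P x) (m x) (s x))"
proof -
show ?thesis unfolding percstep_def by (intro assms PT_rules)
qed

lemma abs_el_le: "abs (el xs i) <= 2^isize xs"
proof (cases "i < length xs")
case True
hence "size_int (el xs i) <= isize xs" using isize_mem[of "xs ! i" xs] by (simp add: nthd_def)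
thus ?thesis by (simp add: size_int_le_iff)
qed (simp add: nthd_def)

lemma isize_rw: "isize (rw P i) <= isize P" using isize_mem[of "P ! i" P] by (cases "i < length P") (simp_all add: nthd_def)

lemma percstep_bd:
assumes "length (fst s) = n & length (snd s) = n & (ALL j. abs (el (fst s) j) <= a) & (ALL j. abs (el (snd s) j) <= b)"
 and "!!k j. abs (el (rw P k) j) <= c"
shows "length (fst (percstep n P m s)) = n & length (snd (percstep n P m s)) = n &
 (ALL j. abs (el (fst (percstep n P m s)) j) <= a+1) & (ALL j. abs (el (snd (percstep n P m s)) j) <= b+c)"
proof -
have "0 <= a" "0 <= b" "0 <= c" using assms abs_ge_zero order_trans by blast+
moreover have "abs (el (fst s) j+(if B then 1 else 0)) <= a+1" for j B
 using assms(1) abs_triangle_ineq[of "el (fst s) j" 1] by (cases B) (auto simp: add_increasing2 intro: order_trans[of _ "abs (el (fst s) j)+1"])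
moreover have "abs (el (snd s) j+el (rw P k) j) <= b+c" for j k using assms abs_triangle_ineq[of "el (snd s) j" "el (rw P k) j"] by (meson add_mono order_trans)
moreover have "abs (el (fst s) j) <= a+1" "abs (el (snd s) j) <= b+c" for j using assms(1) \<open>0 <= c\<close> by (auto intro: add_increasing2)
ultimately show ?thesis using assms(1) by (simp add: percstep_def)
qed

lemma PT_perc [PT_rules]: assumes "PT D n" "pb D n" "PT D P" "PT D m" shows "PT D (%x. perc (n x) (P x) (m x))" unfolding perc_def
proof (rule PT_iter_dom[where E = "ext D (%_. UNIV)" and
 M = "%x. n x*(3*(4*n x^3+isize (P x))+10)+3*(n x*(3*(4*n x^3)+10))+10"])
show "PT D (%x. 4*n x^3)" unfolding power3_eq_cube by (intro assms PT_rules)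
show "pb D (%x. 4*n x^3)" by (intro pb_intros assms)
show "PT D (%x. (mk (n x) (%_. 0), mk (n x) (%_. 0)))" by (intro assms PT_rules)
show "PT (ext D (%_. UNIV)) (%z. percstep (n (fst z)) (P (fst z)) (m (fst z)) (snd z))" by (intro assms(1,3,4) assms(2) PT_rules)
show "pb D (%x. n x*(3*(4*n x^3+isize (P x))+10)+3*(n x*(3*(4*n x^3)+10))+10)" by (intro assms PT_size[OF assms(3)] PT_rules)
fix p x i assume i: "i <= 4*n x^3"
let ?s = "(percstep (n x) (P x) (m x) ^^ i) (mk (n x) (%_. 0), mk (n x) (%_. 0))"
have s: "length (fst ?s) = n x & length (snd ?s) = n x & (ALL j. abs (el (fst ?s) j) <= int i) & (ALL j. abs (el (snd ?s) j) <= int i*2^isize (P x))"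
proof (induction i)
 case (Suc i)
 have e: "abs (el (rw (P x) k) j) <= 2^isize (P x)" for k j by (rule order_trans[OF abs_el_le]) (simp add: isize_rw)
 show ?case using percstep_bd[OF Suc e] by (simp add: distrib_right add.commute)
qed auto
have "isize (fst ?s) <= n x*(3*sk i+10)" "isize (snd ?s) <= n x*(3*size_int (int i*2^isize (P x))+10)" using s by (auto intro!: isize_vec)
moreover have "size_int (int i*2^isize (P x)) <= 4*n x^3+isize (P x)"
proof -
 have "int i*2^isize (P x) < 2^i*2^isize (P x)" by simp
 hence "size_int (int i*2^isize (P x)) <= i+isize (P x)" by (simp add: size_int_le_iff power_add)
 thus ?thesis using i by linarith
qed
hence "n x*(3*size_int (int i*2^isize (P x))+10) <= n x*(3*(4*n x^3+isize (P x))+10)" by (intro mult_mono) auto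
moreover have "n x*(3*sk i+10) <= n x*(3*(4*n x^3)+10)" using size_int_of_nat_le[of i] i by (intro mult_mono) auto
ultimately show "isize ?s <= n x*(3*(4*n x^3+isize (P x))+10)+3*(n x*(3*(4*n x^3)+10))+10" using isize_pair[of "fst ?s" "snd ?s"] unfolding prod.collapse by linarith
qed (auto simp: ext_def)

lemma PT_chubstep [PT_rules]: assumes "PT D n" "pb D n" "PT D rs" "PT D m" shows "PT D (%x. chubstep (n x) (rs x) (m x))" unfolding chubstep_def Let_def power3_eq_cube
by (intro assms PT_rules)

lemma length_chubstep: "length m = n ==> length (chubstep n rs m) = n" by (simp add: chubstep_def Let_def)
lemma chubstep_le: "abs (el (chubstep n rs m) i) <= abs (el m i)" by (auto simp: chubstep_def Let_def abs_div_le)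

lemma PT_feas [PT_rules]: assumes "PT D n" "pb D n" "PT D rs" "PT D m" "PT D t" shows "PT D (%x. feas (n x) (rs x) (m x) (t x))"
proof -
have l: "PT D (%x. size_int (Del (n x) (rs x)))" "pb D (%x. size_int (Del (n x) (rs x)))" using PT_size_int[OF PT_Del[OF assms(1-3)]] PT_size[OF PT_Del[OF assms(1-3)]] by simp_all
let ?g = "%x. mk (n x) (%i. if el (m x) i = 0 then 0 else 2^size_int (Del (n x) (rs x)) :: int)"
have "PT D (%x. (chubstep (n x) (rs x) ^^ (n x*(size_int (Del (n x) (rs x))+1))) (?g x))"
proof (rule PT_iter_dom[where E = "ext D (%_. UNIV)" and M = "%x. n x*(3*(size_int (Del (n x) (rs x))+1)+10)"])
 show "PT D ?g" by (intro assms l l(1) l(2) PT_rules)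
 show "PT (ext D (%_. UNIV)) (%z. chubstep (n (fst z)) (rs (fst z)) (snd z))" by (intro assms(1,3) assms(2) PT_rules)
 show "PT D (%x. n x*(size_int (Del (n x) (rs x))+1))" by (intro assms l PT_rules)
 show "pb D (%x. n x*(size_int (Del (n x) (rs x))+1))" "pb D (%x. n x*(3*(size_int (Del (n x) (rs x))+1)+10))" by (intro pb_intros assms l)+
 fix p x i
 have "length ((chubstep (n x) (rs x) ^^ i) (?g x)) = n x & (ALL j. abs (el ((chubstep (n x) (rs x) ^^ i) (?g x)) j) <= 2^size_int (Del (n x) (rs x)))"
  by (induction i) (auto simp: length_chubstep intro: order_trans[OF chubstep_le])
 thus "isize ((chubstep (n x) (rs x) ^^ i) (?g x)) <= n x*(3*(size_int (Del (n x) (rs x))+1)+10)" unfolding size_int_pow2[symmetric] by (intro isize_vec) auto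
qed (auto simp: ext_def)
thus ?thesis unfolding feas_def Let_def by (intro assms PT_rules)
qed

lemma PT_feasO [PT_rules]: assumes "PT D n" "pb D n" "PT D rs" "PT D ob" "PT D m" shows "PT D (%x. feasO (n x) (rs x) (ob x) (m x))" unfolding feasO_def by (intro assms PT_rules)

lemma PT_purify [PT_rules]: assumes "PT D n" "pb D n" "PT D rs" "PT D ob" shows "PT D (%x. purify (n x) (rs x) (ob x))" unfolding purify_def
proof (rule PT_fold_dom[where E = "ext D (%_. UNIV)" and M = "%x. n x*(3*size_int 1+10)" and
 h = "%x j m. if feasO (n x) (rs x) (ob x) (m[j := 0]) then m[j := 0] else m"])
show "PT D (%x. [0..<n x])" "PT D (%x. mk (n x) (%_. 1))" by (intro assms PT_rules)+
show "PT (ext D (%_. UNIV)) (%z. if feasO (n (fst z)) (rs (fst z)) (ob (fst z)) ((snd (snd z))[fst (snd z) := 0]) then (snd (snd z))[fst (snd z) := 0] else snd (snd z))"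
 by (intro assms(1,3,4) assms(2) PT_rules)
show "pb D (%x. n x*(3*size_int 1+10))" by (intro pb_intros assms)
fix p x i
have "length (fold (%j m. if feasO (n x) (rs x) (ob x) (m[j := 0]) then m[j := 0] else m) xs m) = length m &
 (ALL j. abs (el (fold (%j m. if feasO (n x) (rs x) (ob x) (m[j := 0]) then m[j := 0] else m) xs m) j) <= 1)"
 if "ALL j. abs (el m j) <= 1" for xs m using that
proof (induction xs arbitrary: m)
 case (Cons a xs)
 have "el (m[a := 0]) j = (if j = a then 0 else el m j)" for j by (auto simp: nthd_def nth_list_update)
 hence "ALL j. abs (el (m[a := 0]) j) <= 1" using Cons.prems by simp
 thus ?case using Cons by simp
qed simp
from this[of "mk (n x) (%_. 1)" "take i [0..<n x]"]
show "isize (fold (%j m. if feasO (n x) (rs x) (ob x) (m[j := 0]) then m[j := 0] else m) (take i [0..<n x]) (mk (n x) (%_. 1))) <= n x*(3*size_int 1+10)" by (intro isize_vec) auto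
qed (auto simp: ext_def)

lemma PT_lp [PT_rules]: assumes "PT D n" "pb D n" "PT D rs" "PT D ob" shows "PT D (%x. lp (n x) (rs x) (ob x))" unfolding lp_def by (intro assms PT_rules)

section \<open>Gram chains\<close>

lemma pj_set: assumes "set bs = set bs'" "i < n" shows "pj n bs x i = pj n bs' x i"
proof -
obtain al where a: "!!i. i < n ==> x i - pj n bs' x i = (SUM b:set bs'. al b*ra b i)" using pj_rep by blast
show ?thesis by (rule pj_unique[OF _ _ assms(2)]) (use a assms(1) pj_ker in auto)
qed

lemma pj_snoc:
assumes "i < n"
shows "pj n (bs @ [b]) x i = pj n bs x i - rip n (pj n bs (ra b)) x/rip n (pj n bs (ra b)) (pj n bs (ra b))*pj n bs (ra b) i"
proof -
let ?p = "pj n bs (ra b)"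
define c where "c = rip n ?p x/rip n ?p ?p"
obtain al where a: "!!i. i < n ==> x i - pj n bs x i = (SUM d:set bs. al d*ra d i)" using pj_rep[where x = x and n = n and bs = bs] by blast
obtain be where b: "!!i. i < n ==> ra b i - ?p i = (SUM d:set bs. be d*ra d i)" using pj_rep[where x = "ra b" and n = n and bs = bs] by blast
let ?ga = "%d. (if d : set bs then al d - c*be d else 0)+(if d = b then c else 0)"
show ?thesis
proof (rule pj_unique[OF _ _ assms, where al = ?ga])
 fix i assume i: "i < n"
 have "(SUM d:set (bs @ [b]). ?ga d*ra d i) = (SUM d:set (bs @ [b]). (if d : set bs then (al d - c*be d)*ra d i else 0))+(SUM d:set (bs @ [b]). if d = b then c*ra d i else 0)"
 proof -
  have "?ga d*ra d i = (if d : set bs then (al d - c*be d)*ra d i else 0)+(if d = b then c*ra d i else 0)" for d by (cases "d : set bs"; cases "d = b") (simp_all add: distrib_right)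
  thus ?thesis by (simp only: sum.distrib)
 qed
 also have "(SUM d:set (bs @ [b]). (if d : set bs then (al d - c*be d)*ra d i else 0)) = (SUM d:set bs. (al d - c*be d)*ra d i)" by (intro sum.mono_neutral_cong_right) auto
 also have "... = (x i - pj n bs x i) - c*(ra b i - ?p i)" unfolding a[OF i] b[OF i] by (simp add: left_diff_distrib sum_subtractf sum_distrib_left mult.assoc)
 also have "(SUM d:set (bs @ [b]). if d = b then c*ra d i else 0) = c*ra b i" by (subst sum.delta) simp_all
 finally show "x i - (pj n bs x i - rip n ?p x/rip n ?p ?p * ?p i) = (SUM d:set (bs @ [b]). ?ga d*ra d i)" unfolding c_def[symmetric] by (simp add: right_diff_distrib)
next
 fix d assume d: "d : set (bs @ [b])"
 show "rip n (ra d) (%i. pj n bs x i - rip n ?p x/rip n ?p ?p * ?p i) = 0"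
 proof (cases "d : set bs")
  case True
  thus ?thesis unfolding rip_diff_right rip_scale_right pj_ker[OF True] by simp
 next
  case False
  hence [simp]: "d = b" using d by simp
  have "rip n (ra b) (pj n bs x) = rip n ?p x" by (rule pj_sym[symmetric])
  moreover have "rip n (ra b) ?p = rip n ?p ?p" by (rule pj_norm[symmetric])
  moreover have "rip n ?p x = 0" if "rip n ?p ?p = 0" using that by (auto simp: rip_eq_0 intro: rip_zero_left)
  ultimately show ?thesis unfolding rip_diff_right rip_scale_right by (cases "rip n ?p ?p = 0") simp_all
 qed
qed
qed

definition nsq where "nsq n bs b = rip n (pj n bs (ra b)) (pj n bs (ra b))"

lemma nsq_nonneg: "nsq n bs b >= 0" by (simp add: nsq_def rip_nonneg)
lemma nsq_set: "set bs = set bs' ==> nsq n bs b = nsq n bs' b" unfolding nsq_def by (intro rip_cong pj_set)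
lemma nsq_le: "nsq n bs b <= ri (ip n b b)" unfolding nsq_def ip_rip by (rule pj_contract)

text \<open>The Gram determinant as product of squared Gram-Schmidt lengths. Unlike
  \<open>dl\<close> it vanishes on dependent families, so \<open>grm > 0\<close> expresses
  independence.\<close>

definition grm where "grm n bs = (PROD k<length bs. nsq n (take k bs) (bs ! k))"

lemma grm_Nil [simp]: "grm n [] = 1" by (simp add: grm_def)
lemma grm_snoc: "grm n (bs @ [b]) = grm n bs*nsq n bs b" by (simp add: grm_def nth_append)
lemma grm_nonneg: "grm n bs >= 0" by (simp add: grm_def prod_nonneg nsq_nonneg)
lemma grm_take: "grm n bs > 0 ==> grm n (take k bs) > 0"
proof (induction bs rule: rev_induct)
case (snoc b bs)
have "grm n bs > 0" using snoc.prems grm_nonneg[of n bs] nsq_nonneg[of n bs b] unfolding grm_snoc by (simp add: zero_less_mult_iff)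
thus ?case using snoc by (cases "k <= length bs") auto
qed simp

text \<open>The right-hand side is the two by two Gram determinant of the projections of
  \<open>a\<close> and \<open>b\<close>. Its symmetry makes \<open>grm\<close> invariant under
  exchanging neighbours.\<close>

lemma nsq_snoc: "nsq n bs a*nsq n (bs @ [a]) b = nsq n bs a*nsq n bs b - (rip n (pj n bs (ra a)) (pj n bs (ra b)))^2"
proof -
let ?p = "pj n bs (ra a)" and ?q = "pj n bs (ra b)"
let ?c = "rip n ?p ?q/rip n ?p ?p"
have pq: "rip n ?p (ra b) = rip n ?p ?q"
proof -
 have "rip n ?p ?q = rip n (pj n bs ?p) (ra b)" by (rule pj_sym[symmetric])
 also have "... = rip n ?p (ra b)" by (intro rip_cong) (auto simp: pj_idem)
 finally show ?thesis by simp
qed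
have "nsq n (bs @ [a]) b = rip n (%i. ?q i - ?c * ?p i) (%i. ?q i - ?c * ?p i)" unfolding nsq_def by (intro rip_cong) (auto simp: pj_snoc pq)
also have "... = rip n ?q ?q - 2 * ?c*rip n ?p ?q + ?c^2*rip n ?p ?p" unfolding rip_diff_left rip_diff_right rip_scale_left rip_scale_right
 by (simp add: rip_commute[of n ?q ?p] power2_eq_square algebra_simps)
finally have e: "nsq n (bs @ [a]) b = rip n ?q ?q - 2 * ?c*rip n ?p ?q + ?c^2*rip n ?p ?p" .
show ?thesis
proof (cases "rip n ?p ?p = 0")
 case True
 hence "rip n ?p ?q = 0" by (auto simp: rip_eq_0 intro: rip_zero_left)
 thus ?thesis using True by (simp add: nsq_def)
next
 case False
 thus ?thesis unfolding e nsq_def[of n bs] by (simp add: power2_eq_square field_simps)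
qed
qed

lemma grm_swap: "grm n (xs @ a # b # ys) = grm n (xs @ b # a # ys)"
proof (induction ys rule: rev_induct)
case Nil
have "grm n ((xs @ [a]) @ [b]) = grm n ((xs @ [b]) @ [a])" unfolding grm_snoc using nsq_snoc[of n xs a b] nsq_snoc[of n xs b a]
 by (simp add: rip_commute[of n "pj n xs (ra b)"] mult.commute mult.left_commute)
thus ?case by simp
next
case (snoc y ys)
have "nsq n (xs @ a # b # ys) y = nsq n (xs @ b # a # ys) y" by (rule nsq_set) auto
thus ?case using snoc grm_snoc[of n "xs @ a # b # ys" y] grm_snoc[of n "xs @ b # a # ys" y] by simp
qed

lemma grm_rotate: "grm n (xs @ a # ys) = grm n (xs @ ys @ [a])"
proof (induction ys arbitrary: xs)
case (Cons y ys)
thus ?case using Cons.IH[of "xs @ [y]"] grm_swap[of n xs a y ys] by simp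
qed simp

lemma grm_le: "grm n bs <= (PROD b<-bs. ri (ip n b b))"
proof (induction bs rule: rev_induct)
case (snoc b bs)
have "0 <= (PROD b<-bs. ri (ip n b b))" using snoc grm_nonneg[of n bs] by linarith
thus ?case unfolding grm_snoc using snoc nsq_le[of n bs b] nsq_nonneg[of n bs b] grm_nonneg[of n bs] by (simp, intro mult_mono) auto
qed simp

lemma dl_snoc: "ri (dl n (bs @ [b])) = (if nsq n bs b = 0 then ri (dl n bs) else ri (dl n bs)*nsq n bs b)"
proof -
let ?v = "mulv n (snd (proj n bs)) b"
have v: "ra ?v i = ri (dl n bs)*pj n bs (ra b) i" if "i < n" for i using that dl_pos[of n bs] by (simp add: mulv_def pj_def ip_def pm_def)
have "ri (ip n b ?v) = rip n (ra b) (%i. ri (dl n bs)*pj n bs (ra b) i)" unfolding ip_rip using v by (intro rip_cong) auto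
also have "... = ri (dl n bs)*nsq n bs b" unfolding rip_scale_right nsq_def pj_norm ..
finally have d: "ri (ip n b ?v) = ri (dl n bs)*nsq n bs b" .
hence "ip n b ?v = 0 <-> nsq n bs b = 0" using dl_pos[of n bs] by (metis mult_eq_0_iff of_int_eq_0_iff less_irrefl)
thus ?thesis using d unfolding dl_def proj_def by (auto simp: pstep_def Let_def)
qed

lemma dl_grm: "grm n bs > 0 ==> ri (dl n bs) = grm n bs"
proof (induction bs rule: rev_induct)
case Nil
thus ?case by (simp add: dl_def proj_def)
next
case (snoc b bs)
have "nsq n bs b ~= 0" "grm n bs > 0" using snoc.prems grm_nonneg[of n bs] unfolding grm_snoc by (auto simp: less_le)
thus ?case using snoc.IH by (simp add: dl_snoc grm_snoc)
qed

definition uv :: "nat => nat => real" where "uv i j = (if j = i then 1 else 0)"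
lemma rip_uv: "i < n ==> rip n x (uv i) = x i" "i < n ==> rip n (uv i) x = x i" by (simp_all add: rip_def uv_def if_distrib if_distribR cong: if_cong)

text \<open>Every independent vector takes away a rank-one projection of trace 1. Hence
  \<open>n\<close> independent vectors leave trace 0, that is, they span everything.\<close>

lemma pj_trace: "grm n bs > 0 ==> (SUM i<n. pj n bs (uv i) i) = real n - real (length bs)"
proof (induction bs rule: rev_induct)
case Nil
have "pj n [] (uv i) i = 1" if "i < n" for i using pj_fix[of "[]" n "uv i" i] that by (simp add: uv_def)
thus ?case by simp
next
case (snoc b bs)
let ?p = "pj n bs (ra b)"
have nz: "nsq n bs b ~= 0" "grm n bs > 0" using snoc.prems grm_nonneg[of n bs] unfolding grm_snoc by (auto simp: less_le)
have "(SUM i<n. pj n (bs @ [b]) (uv i) i) = (SUM i<n. pj n bs (uv i) i - ?p i * ?p i/rip n ?p ?p)" by (intro sum.cong) (auto simp: pj_snoc rip_uv)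
also have "... = (SUM i<n. pj n bs (uv i) i) - rip n ?p ?p/rip n ?p ?p" unfolding sum_subtractf sum_divide_distrib[symmetric] rip_def[symmetric] ..
also have "... = real n - real (length (bs @ [b]))" using snoc.IH nz by (simp add: nsq_def)
finally show ?case .
qed

lemma pj_full: assumes "grm n bs > 0" "length bs = n" "i < n" shows "pj n bs x i = 0"
proof -
have d: "pj n bs (uv i) i = rip n (pj n bs (uv i)) (pj n bs (uv i))" if "i < n" for i unfolding pj_norm using rip_uv that by simp
have "(SUM i<n. rip n (pj n bs (uv i)) (pj n bs (uv i))) = 0" using pj_trace[OF assms(1)] assms(2) d by simp
hence "rip n (pj n bs (uv i)) (pj n bs (uv i)) = 0" using assms(3) by (subst (asm) sum_nonneg_eq_0_iff) (auto simp: rip_nonneg)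
hence "rip n (pj n bs (uv i)) x = 0" by (auto simp: rip_eq_0 intro: rip_zero_left)
thus ?thesis unfolding pj_sym using assms(3) by (simp add: rip_uv)
qed

section \<open>Barycentric spanners\<close>

text \<open>A member \<open>(v, t)\<close> stands for the point \<open>v / t\<close>.\<close>

type_synonym sbase = "(int list \<times> int) list"

abbreviation sv :: "sbase => nat => int list" where "sv vs i == fst (nthd ([], 0) vs i)"
abbreviation st :: "sbase => nat => int" where "st vs i == snd (nthd ([], 0) vs i)"

definition oth :: "sbase => nat => int list list" where "oth vs i = map fst (take i vs @ drop (Suc i) vs)"
text \<open>A multiple of the functional dual to vector \<open>i\<close>: it vanishes on all the
  other vectors. Up to normalization it is the barycentric coordinate \<open>i\<close>.\<close>

definition gv where "gv M vs i = mulv M (snd (proj M (oth vs i))) (sv vs i)"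
definition dn where "dn M vs i = ip M (gv M vs i) (sv vs i)"
text \<open>On points with entry 0 equal to 1 this functional is nonnegative exactly if coordinate
  \<open>i\<close> times \<open>sg\<close> is at least 2, so the oracle searches for a replacement
  that at least doubles the volume.\<close>

definition qry where "qry M vs i sg = mk M (%j. sg*st vs i*el (gv M vs i) j - (if j = 0 then 2*dn M vs i else 0))"
definition spcand where "spcand M orc vs = concat (map (%i. map (%v. vs[i := (v, el v 0)]) (orc (qry M vs i 1) @ orc (qry M vs i (- 1)))) [0..<M])"
definition spstep where "spstep M orc vs = nthd vs (spcand M orc vs) 0"
text \<open>The artificial points \<open>e_i / K\<close> lie so close to 0 that a point of the set
  outside the span of the others would have a coordinate beyond 2 and replace them.\<close>

definition sinit :: "nat => int => sbase" where
"sinit M K = mk M (%i. (mk M (%j. if j = i then 1 else 0), K))"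
definition spn where "spn M K N orc = (spstep M orc ^^ N) (sinit M K)"

definition mu where "mu M vs i x = ri (st vs i)*rip M (ra (gv M vs i)) x/ri (dn M vs i)"

lemma gv_pj: "j < M ==> ra (gv M vs i) j = ri (dl M (oth vs i))*pj M (oth vs i) (ra (sv vs i)) j" using dl_pos[of M "oth vs i"] by (simp add: gv_def mulv_def pj_def ip_def pm_def)

lemma rip_gv: "rip M (ra (gv M vs i)) x = ri (dl M (oth vs i))*rip M (pj M (oth vs i) (ra (sv vs i))) x" unfolding rip_scale_left[symmetric] by (intro rip_cong) (auto simp: gv_pj)

lemma dn_nsq: "ri (dn M vs i) = ri (dl M (oth vs i))*nsq M (oth vs i) (sv vs i)" unfolding dn_def ip_rip rip_gv nsq_def pj_norm by (simp add: rip_commute)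

lemma split_at: "i < length vs ==> map fst vs = map fst (take i vs) @ sv vs i # map fst (drop (Suc i) vs)" by (subst id_take_nth_drop[of i vs]) (auto simp: nthd_def)

lemma grm_oth: assumes "i < length vs" shows "grm M (map fst vs) = grm M (oth vs i)*nsq M (oth vs i) (sv vs i)"
proof -
have "grm M (map fst vs) = grm M (oth vs i @ [sv vs i])" unfolding split_at[OF assms] grm_rotate by (simp add: oth_def)
thus ?thesis by (simp add: grm_snoc)
qed

lemma oth_update: "oth (vs[i := z]) i = oth vs i" by (simp add: oth_def)

lemma sv_oth: assumes "k < length vs" "k ~= i" shows "sv vs k : set (oth vs i)"
proof (cases "k < i")
case True
hence "vs ! k : set (take i vs)" using assms by (auto simp: in_set_conv_nth intro!: exI[of _ k])
thus ?thesis using assms by (auto simp: oth_def nthd_def)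
next
case False
hence "vs ! k : set (drop (Suc i) vs)" using assms by (auto simp: in_set_conv_nth intro!: exI[of _ "k - Suc i"])
thus ?thesis using assms by (auto simp: oth_def nthd_def)
qed

lemma mu_coords:
assumes g: "grm M (map fst vs) > 0" and len: "length vs = M" and ta: "!!i. i < M ==> st vs i > 0" and j: "j < M"
shows "x j = (SUM i<M. mu M vs i x*(ra (sv vs i) j/ri (st vs i)))"
proof -
let ?bs = "map fst vs"
obtain al where a: "!!i. i < M ==> x i - pj M ?bs x i = (SUM b:set ?bs. al b*ra b i)" using pj_rep[where x = x and n = M and bs = ?bs] by blast
have dn: "ri (dn M vs i) > 0" if "i < M" for i using g that len dl_pos[of M "oth vs i"] grm_nonneg[of M "oth vs i"] nsq_nonneg[of M "oth vs i" "sv vs i"]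
 unfolding dn_nsq grm_oth[OF that[folded len]] by (auto simp: zero_less_mult_iff)
have inj: "inj_on (sv vs) {..<M}"
proof (rule inj_onI, rule ccontr)
 fix i k assume ik: "i : {..<M}" "k : {..<M}" "sv vs i = sv vs k" "i ~= k"
 hence "sv vs i : set (oth vs i)" using sv_oth[of k vs i] len by auto
 hence "ri (dn M vs i) = 0" unfolding dn_nsq nsq_def using pj_kills by (auto intro!: rip_zero_left)
 thus False using dn[of i] ik by simp
qed
have sets: "set ?bs = sv vs ` {..<M}" using len by (force simp: set_conv_nth nthd_def)
have X: "x l = (SUM i<M. al (sv vs i)*ra (sv vs i) l)" if "l < M" for l using a[OF that] pj_full[OF g _ that, of x] len that unfolding sets by (simp add: sum.reindex[OF inj])
have mu: "mu M vs i x = ri (st vs i)*al (sv vs i)" if i: "i < M" for i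
proof -
 have "rip M (ra (gv M vs i)) x = rip M (ra (gv M vs i)) (%l. SUM k<M. al (sv vs k)*ra (sv vs k) l)" using X by (intro rip_cong) auto
 also have "... = (SUM k<M. al (sv vs k)*rip M (ra (gv M vs i)) (ra (sv vs k)))" unfolding rip_sum_right rip_scale_right ..
 also have "... = (SUM k<M. if k = i then al (sv vs i)*ri (dn M vs i) else 0)"
 proof (intro sum.cong refl)
  fix k assume k: "k : {..<M}"
  show "al (sv vs k)*rip M (ra (gv M vs i)) (ra (sv vs k)) = (if k = i then al (sv vs i)*ri (dn M vs i) else 0)"
  proof (cases "k = i")
   case False
   have "rip M (pj M (oth vs i) (ra (sv vs i))) (ra (sv vs k)) = 0" using pj_ker[OF sv_oth[of k vs i], of M "ra (sv vs i)"] k False len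
     rip_commute[of M "pj M (oth vs i) (ra (sv vs i))" "ra (sv vs k)"] by simp
   thus ?thesis using False by (simp add: rip_gv)
  qed (simp add: dn_def ip_rip)
 qed
 also have "... = al (sv vs i)*ri (dn M vs i)" using i by simp
 finally show ?thesis using dn[OF i] by (simp add: mu_def)
qed
have "(SUM i<M. mu M vs i x*(ra (sv vs i) j/ri (st vs i))) = (SUM i<M. al (sv vs i)*ra (sv vs i) j)" using mu ta by (intro sum.cong) (auto simp: less_imp_neq[symmetric])
thus ?thesis using X[OF j] by simp
qed

lemma dn_pos: assumes "grm M (map fst vs) > 0" "i < length vs" shows "dn M vs i > 0"
proof -
have "nsq M (oth vs i) (sv vs i) > 0" using assms(1) grm_nonneg[of M "oth vs i"] nsq_nonneg[of M "oth vs i" "sv vs i"] unfolding grm_oth[OF assms(2)] by (auto simp: zero_less_mult_iff)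
hence "ri (dn M vs i) > 0" unfolding dn_nsq using dl_pos[of M "oth vs i"] by simp
thus ?thesis by simp
qed

text \<open>By Cauchy-Schwarz the distance of \<open>v\<close> from the span of the others is at
  least its component along the direction in which the old vector leaves that span. A coordinate of
  absolute value 2 or more thus multiplies the squared volume of the scaled points by at least
  4.\<close>

lemma grm_replace:
assumes i: "i < length vs" and g: "grm M (map fst vs) > 0" and t: "0 < st vs i" "0 < el v 0"
 and q: "2*ri (dn M vs i)*ra v 0 <= ri (st vs i)*abs (rip M (ra (gv M vs i)) (ra v))"
shows "4*(grm M (map fst vs)/(ri (st vs i))^2) <= grm M (map fst (vs[i := (v, el v 0)]))/(ra v 0)^2"
 "grm M (map fst (vs[i := (v, el v 0)])) > 0"
proof -
let ?o = "oth vs i" and ?w = "vs[i := (v, el v 0)]"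
let ?p = "pj M ?o (ra (sv vs i))"
have sv': "sv ?w i = v" using i by (simp add: nthd_def)
have go: "grm M ?o > 0" "nsq M ?o (sv vs i) > 0" using g grm_nonneg[of M ?o] nsq_nonneg[of M ?o "sv vs i"] unfolding grm_oth[OF i] by (auto simp: zero_less_mult_iff)
have gw: "grm M (map fst ?w) = grm M ?o*nsq M ?o v" using grm_oth[of i ?w M] i sv' oth_update[of vs i "(v, el v 0)"] by simp
define a where "a = nsq M ?o (sv vs i)"
define b where "b = nsq M ?o v"
define r where "r = rip M ?p (ra v)"
define d where "d = ri (dl M ?o)"
have d: "d > 0" using dl_pos[of M ?o] by (simp add: d_def)
have "2*(d*a)*ra v 0 <= ri (st vs i)*(d*abs r)" using q d unfolding dn_nsq rip_gv by (simp add: a_def r_def d_def abs_mult)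
hence "d*(2*a*ra v 0) <= d*(ri (st vs i)*abs r)" by (simp add: mult_ac)
hence q': "2*a*ra v 0 <= ri (st vs i)*abs r" using d by simp
have a: "a > 0" using go by (simp add: a_def)
have "r = rip M ?p (pj M ?o (ra v))"
proof -
 have "rip M ?p (pj M ?o (ra v)) = rip M (pj M ?o ?p) (ra v)" by (rule pj_sym[symmetric])
 also have "... = r" unfolding r_def by (intro rip_cong pj_idem) auto
 finally show ?thesis by simp
qed
hence "r^2 <= a*b" using rip_Cauchy[of M ?p "pj M ?o (ra v)"] by (simp add: a_def b_def nsq_def)
moreover have "(2*a*ra v 0)^2 <= (ri (st vs i)*abs r)^2" using q' a t by (intro power_mono) auto
ultimately have "4*a^2*(ra v 0)^2 <= (ri (st vs i))^2*(a*b)"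
proof -
 assume 1: "r^2 <= a*b" and 2: "(2*a*ra v 0)^2 <= (ri (st vs i)*abs r)^2"
 have "4*a^2*(ra v 0)^2 <= (ri (st vs i))^2*r^2" using 2 by (simp add: power_mult_distrib)
 also have "... <= (ri (st vs i))^2*(a*b)" by (intro mult_left_mono 1) simp
 finally show ?thesis .
qed
hence "a*(4*a*(ra v 0)^2) <= a*((ri (st vs i))^2*b)" by (simp add: power2_eq_square mult_ac)
hence le: "4*a*(ra v 0)^2 <= (ri (st vs i))^2*b" using a by simp
hence "4*a/(ri (st vs i))^2 <= b/(ra v 0)^2" using t by (simp add: field_simps)
hence "grm M ?o*(4*a/(ri (st vs i))^2) <= grm M ?o*(b/(ra v 0)^2)" using go by (intro mult_left_mono) auto
thus "4*(grm M (map fst vs)/(ri (st vs i))^2) <= grm M (map fst ?w)/(ra v 0)^2" unfolding gw grm_oth[OF i] a_def b_def by (simp add: mult_ac)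
have "0 < 4*a*(ra v 0)^2" using a t by simp
hence "0 < (ri (st vs i))^2*b" using le by linarith
hence "0 < b" using t by (simp add: zero_less_mult_iff)
thus "grm M (map fst ?w) > 0" unfolding gw using go by (simp add: b_def)
qed

text \<open>The set \<open>X\<close> is accessed only through \<open>orc\<close>. \<open>Dl\<close>
  bounds the integer vectors that are returned and \<open>R\<close> the points they represent; the
  size of \<open>K\<close> is what forces artificial points out of every direction in which
  \<open>X\<close> extends.\<close>

locale spanner =
fixes M :: nat and orc :: "int list => int list list" and X :: "(nat => real) set" and Dl R K :: int
fixes good :: "int list => bool"
assumes M: "0 < M" and R: "1 <= R"
 and good_pos: "good v ==> 0 < el v 0"
 and good_mem: "good v ==> (%j. ra v j/ra v 0) : X"
 and good_Dl: "good v ==> j < M ==> (abs (el v j)) <= Dl"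
 and good_R: "good v ==> j < M ==> (abs (el v j)) <= R*el v 0"
 and orc: "(orc l = [] & (ALL x:X. rip M (ra l) x < 0)) | (EX v. orc l = [v] & good v & 0 <= rip M (ra l) (ra v))"
 and vert: "x : X ==> EX v. good v & rip M g x <= rip M g (%j. ra v j/ra v 0)"
 and X0: "x : X ==> x 0 = 1"
 and K: "2*Dl*(1+int M*Dl^2)^M <= K" and Dl: "1 <= Dl"
begin

definition sgood where "sgood vs <-> length vs = M & grm M (map fst vs) > 0 & (ALL i<M. 0 < st vs i &
 (good (sv vs i) & st vs i = el (sv vs i) 0 | sv vs i = mk M (%j. if j = i then 1 else 0) & st vs i = K))"

text \<open>The squared volume of the parallelepiped spanned by the points of the base.\<close>

definition pot where "pot vs = grm M (map fst vs)/(PROD i<M. (ri (st vs i))^2)"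

lemma K1: "2 <= K"
proof -
have "1 <= (1+int M*Dl^2)^M" by (rule one_le_power) simp
hence "2*Dl*1 <= 2*Dl*(1+int M*Dl^2)^M" using Dl by (intro mult_left_mono) auto
thus ?thesis using K Dl by linarith
qed

lemma qry_rip: "rip M (ra (qry M vs i sg)) x =
 ri (sg*st vs i)*rip M (ra (gv M vs i)) x - 2*ri (dn M vs i)*x 0"
proof -
have "rip M (ra (qry M vs i sg)) x = rip M (%j. ri (sg*st vs i)*ra (gv M vs i) j - 2*ri (dn M vs i)*uv 0 j) x" by (intro rip_cong) (auto simp: qry_def uv_def)
also have "... = ri (sg*st vs i)*rip M (ra (gv M vs i)) x - 2*ri (dn M vs i)*x 0" unfolding rip_diff_left rip_scale_left rip_uv(2)[OF M] ..
finally show ?thesis .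
qed

lemma sinit_good: "sgood (sinit M K)"
proof -
have s: "sv (sinit M K) i = mk M (%j. if j = i then 1 else 0)" "st (sinit M K) i = K" if "i < M" for i using that by (simp_all add: sinit_def)
have "grm M (map (%i. mk M (%j. if j = i then 1 else 0)) [0..<k]) = 1" if "k <= M" for k using that
proof (induction k)
 case (Suc k)
 let ?u = "%i. mk M (%j. if j = i then 1 else 0 :: int)"
 have u: "ra (?u i) j = uv i j" if "j < M" for i j using that by (simp add: uv_def)
 have "pj M (map ?u [0..<k]) (ra (?u k)) j = ra (?u k) j" if "j < M" for j
 proof (rule pj_fix[OF _ that])
  fix b assume "b : set (map ?u [0..<k])"
  then obtain i where i: "i < k" "b = ?u i" by auto
  have "rip M (ra b) (ra (?u k)) = rip M (uv i) (uv k)" unfolding i by (intro rip_cong u)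
  thus "rip M (ra b) (ra (?u k)) = 0" using i Suc.prems by (simp add: rip_uv uv_def)
 qed
 hence "nsq M (map ?u [0..<k]) (?u k) = rip M (uv k) (uv k)" unfolding nsq_def using u by (intro rip_cong) auto
 also have "... = 1" using Suc.prems by (simp add: rip_uv uv_def)
 finally show ?case using Suc by (simp add: grm_snoc)
qed simp
from this[of M] have "grm M (map fst (sinit M K)) = 1" by (simp add: sinit_def mk_def[of M "%i. (_ i, K)"] o_def)
thus ?thesis using s K1 by (auto simp: sgood_def sinit_def)
qed

lemma sgood_step:
assumes vs: "sgood vs" and ne: "spcand M orc vs ~= []"
shows "sgood (spstep M orc vs) & 4*pot vs <= pot (spstep M orc vs)"
proof -
have "spstep M orc vs : set (spcand M orc vs)" using ne by (simp add: spstep_def nthd_def)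
then obtain i v sg where i: "i < M" "spstep M orc vs = vs[i := (v, el v 0)]" "v : set (orc (qry M vs i sg))" "sg = 1 | sg = - 1" by (auto simp: spcand_def)
have v: "good v" "0 <= rip M (ra (qry M vs i sg)) (ra v)" using orc[of "qry M vs i sg"] i(3) by auto
have L: "length vs = M" "grm M (map fst vs) > 0" "0 < st vs i" using vs i(1) by (auto simp: sgood_def)
have "2*ri (dn M vs i)*ra v 0 <= ri (st vs i)*(ri sg*rip M (ra (gv M vs i)) (ra v))" using v(2) unfolding qry_rip by (simp add: mult_ac)
also have "... <= ri (st vs i)*abs (rip M (ra (gv M vs i)) (ra v))" using L(3) i(4) by (intro mult_left_mono) auto
finally have q: "2*ri (dn M vs i)*ra v 0 <= ri (st vs i)*abs (rip M (ra (gv M vs i)) (ra v))" .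
note rp = grm_replace[OF i(1)[folded L(1)] L(2,3) good_pos[OF v(1)] q]
let ?w = "vs[i := (v, el v 0)]"
have sw: "nthd ([], 0) ?w k = (if k = i then (v, el v 0) else nthd ([], 0) vs k)" for k using i(1) L(1) by (auto simp: nthd_def)
have "sgood ?w" using vs rp(2) v(1) good_pos[OF v(1)] unfolding sgood_def sw by auto
moreover have "4*pot vs <= pot ?w"
proof -
 define P where "P = (PROD k:{..<M} - {i}. (ri (st vs k))^2)"
 have P: "P > 0" unfolding P_def using vs by (intro prod_pos) (auto simp: sgood_def)
 have "(PROD k<M. (ri (st vs k))^2) = (ri (st vs i))^2*P" unfolding P_def using i(1) by (intro prod.remove) auto
 moreover have "(PROD k<M. (ri (st ?w k))^2) = (ra v 0)^2*P"
 proof -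
  have "(PROD k<M. (ri (st ?w k))^2) = (ri (st ?w i))^2*(PROD k:{..<M} - {i}. (ri (st ?w k))^2)" using i(1) by (intro prod.remove) auto
  also have "(PROD k:{..<M} - {i}. (ri (st ?w k))^2) = P" unfolding P_def by (intro prod.cong) (auto simp: sw)
  finally show ?thesis by (simp add: sw)
 qed
 ultimately have "pot vs = grm M (map fst vs)/(ri (st vs i))^2/P" "pot ?w = grm M (map fst ?w)/(ra v 0)^2/P" by (simp_all add: pot_def)
 thus ?thesis using divide_right_mono[OF rp(1), of P] P by simp
qed
ultimately show ?thesis by (simp add: i(2))
qed

lemma pot_le: assumes vs: "sgood vs" shows "pot vs <= ri (int M*R^2)^M"
proof -
have L: "length vs = M" using vs by (simp add: sgood_def)
have "grm M (map fst vs) <= (PROD b<-map fst vs. ri (ip M b b))" by (rule grm_le)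
also have "... = (PROD i<M. ri (ip M (sv vs i) (sv vs i)))"
proof -
 have "prod_list (map f vs) = (PROD i<length vs. f (nthd ([], 0) vs i))" for f :: "int list \<times> int => real"
 proof (induction vs rule: rev_induct)
  case (snoc b bs)
  have "(PROD i<length bs. f (nthd ([], 0) (bs @ [b]) i)) = (PROD i<length bs. f (nthd ([], 0) bs i))" by (intro prod.cong) (auto simp: nthd_def nth_append)
  thus ?case using snoc by (simp add: nthd_def)
 qed simp
 from this[of "%z. ri (ip M (fst z) (fst z))"] show ?thesis by (simp add: L o_def)
qed
also have "... <= (PROD i<M. ri (int M*R^2)*(ri (st vs i))^2)"
proof (intro prod_mono conjI)
 fix i assume "i : {..<M}"
 hence i: "i < M" by simp
 show "0 <= ri (ip M (sv vs i) (sv vs i))" by (simp add: ip_def sum_nonneg)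
 have b: "abs (el (sv vs i) j) <= R*st vs i" if "j < M" for j
 proof -
  consider "good (sv vs i)" "st vs i = el (sv vs i) 0" | "sv vs i = mk M (%j. if j = i then 1 else 0)" "st vs i = K" using vs i unfolding sgood_def by blast
  thus ?thesis
  proof cases
   case 2
   have "1*1 <= R*K" using R K1 by (intro mult_mono) auto
   thus ?thesis using 2 that by auto
  qed (use good_R that in auto)
 qed
 have "ip M (sv vs i) (sv vs i) <= (SUM j<M. (R*st vs i)^2)" unfolding ip_def power2_eq_square[symmetric] using b by (intro sum_mono) (force simp: abs_le_square_iff[symmetric])
 also have "... = int M*R^2*(st vs i)^2" by (simp add: power_mult_distrib)
 finally have "ri (ip M (sv vs i) (sv vs i)) <= ri (int M*R^2*(st vs i)^2)" by (simp only: of_int_le_iff)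
 thus "ri (ip M (sv vs i) (sv vs i)) <= ri (int M*R^2)*(ri (st vs i))^2" by simp
qed
also have "... = ri (int M*R^2)^M*(PROD i<M. (ri (st vs i))^2)" by (simp add: prod.distrib)
finally have "grm M (map fst vs) <= ri (int M*R^2)^M*(PROD i<M. (ri (st vs i))^2)" .
moreover have "(PROD i<M. (ri (st vs i))^2) > 0" using vs by (intro prod_pos) (auto simp: sgood_def)
ultimately show ?thesis by (simp add: pot_def pos_divide_le_eq)
qed

text \<open>The potential starts at no less than \<open>1 / K^(2 * M)\<close>, never exceeds
  \<open>(M * R^2)^M\<close>, and is multiplied by at least 4 in each effective step;
  \<open>N\<close> is the resulting number of steps, measured in bits.\<close>

lemma spn_stable:
assumes N: "M*(size_int K+size_int (int M*R^2)) <= N"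
shows "sgood (spn M K N orc)" "spcand M orc (spn M K N orc) = []"
proof -
let ?v = "%k. (spstep M orc ^^ k) (sinit M K)"
have fx: "spstep M orc v = v" if "spcand M orc v = []" for v using that by (simp add: spstep_def nthd_def)
have G: "sgood (?v k)" for k
proof (induction k)
 case (Suc k)
 thus ?case using sgood_step[OF Suc] fx[of "?v k"] by (cases "spcand M orc (?v k) = []") simp_all
qed (simp add: sinit_good)
have stat: "spcand M orc (?v k) = [] & ?v k = ?v j" if "spcand M orc (?v j) = []" "k >= j" for j k using that(2)
proof (induction k rule: dec_induct)
 case (step k)
 hence "spcand M orc (?v k) = []" by (simp only: that(1))
 thus ?case using step.IH fx by simp
qed (use that(1) in simp)
have grow: "(EX j<k. spcand M orc (?v j) = []) | 4^k*pot (sinit M K) <= pot (?v k)" for k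
proof (induction k)
 case (Suc k)
 show ?case
 proof (cases "EX j<Suc k. spcand M orc (?v j) = []")
  case False
  hence "4^k*pot (sinit M K) <= pot (?v k)" "spcand M orc (?v k) ~= []" using Suc by auto
  thus ?thesis using sgood_step[OF G[of k]] by simp
 qed simp
qed simp
show "sgood (spn M K N orc)" unfolding spn_def by (rule G)
show "spcand M orc (spn M K N orc) = []"
proof (rule ccontr)
 assume ne: "spcand M orc (spn M K N orc) ~= []"
 hence no: "~ (EX j<N. spcand M orc (?v j) = [])" using stat[of _ N] unfolding spn_def by (meson less_imp_le)
 hence "4^N*pot (sinit M K) <= pot (?v N)" using grow[of N] by blast
 also have "... <= ri (int M*R^2)^M" by (rule pot_le[OF G])
 finally have le: "4^N*pot (sinit M K) <= ri (int M*R^2)^M" .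
 have "pot (sinit M K) > 0" using sinit_good K1 unfolding pot_def sgood_def by (auto intro!: divide_pos_pos prod_pos)
 have s: "st (sinit M K) i = K" if "i < M" for i using that by (simp add: sinit_def)
 have g1: "grm M (map fst (sinit M K)) >= 1"
 proof -
  have "grm M (map fst (sinit M K)) > 0" using sinit_good by (simp add: sgood_def)
  from dl_grm[OF this] dl_pos[of M "map fst (sinit M K)"] show ?thesis by (metis of_int_1_le_iff int_one_le_iff_zero_less)
 qed
 have "pot (sinit M K) = grm M (map fst (sinit M K))/(ri K)\<^sup>2^M" using s by (simp add: pot_def)
 hence p: "1/(ri K)\<^sup>2^M <= pot (sinit M K)" using g1 K1 by (simp add: divide_right_mono)
 have "(ri K)\<^sup>2^M*ri (int M*R^2)^M < 4^N"
 proof -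
  have k: "(ri K)^2 < 4^size_int K"
  proof -
   have "K < 2^size_int K" using size_int_less[of K] K1 by simp
   hence "ri K < ri (2^size_int K)" by (simp only: of_int_less_iff)
   hence "(ri K)^2 < (2^size_int K)^2" using K1 by (intro power_strict_mono) auto
   also have "... = 4^size_int K" by (simp add: power_even_eq[symmetric] power_mult[symmetric] mult.commute[of _ 2] power_mult)
   finally show ?thesis .
  qed
  have m: "ri (int M*R^2) <= 4^size_int (int M*R^2)"
  proof -
   have "int M*R^2 < 2^size_int (int M*R^2)" using size_int_less[of "int M*R^2"] by simp
   hence "ri (int M*R^2) < ri (2^size_int (int M*R^2))" by (simp only: of_int_less_iff)
   also have "... <= 4^size_int (int M*R^2)" by (simp add: power_mono)
   finally show ?thesis by simp
  qed
  have "(ri K)\<^sup>2^M*ri (int M*R^2)^M < (4^size_int K)^M*(4^size_int (int M*R^2))^M" using k m M R K1 by (intro mult_less_le_imp_less power_strict_mono power_mono) auto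
  also have "... = 4^(M*(size_int K+size_int (int M*R^2)))" by (simp add: power_mult[symmetric] power_add[symmetric] mult.commute distrib_left)
  also have "... <= 4^N" using N by (intro power_increasing) auto
  finally show ?thesis .
 qed
 moreover have "4^N*(1/(ri K)\<^sup>2^M) <= ri (int M*R^2)^M" by (rule order_trans[OF mult_left_mono[OF p] le]) simp
 ultimately show False using K1 by (simp add: field_simps)
qed
qed

lemma art_dn:
assumes vs: "sgood vs" and i: "i < M" and a: "~ good (sv vs i) | st vs i ~= el (sv vs i) 0"
shows "st vs i = K" "dn M vs i <= (1+int M*Dl^2)^M"
proof -
have L: "length vs = M" using vs by (simp add: sgood_def)
have art: "st vs i = K" "sv vs i = mk M (%j. if j = i then 1 else 0)" using vs i a by (auto simp: sgood_def)
show "st vs i = K" by (rule art)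
show "dn M vs i <= (1+int M*Dl^2)^M"
proof -
 have nsq1: "nsq M (oth vs i) (sv vs i) <= 1"
 proof -
  have "ip M (sv vs i) (sv vs i) = (SUM j<M. if j = i then 1 else 0)" unfolding art ip_def by (intro sum.cong) auto
  hence "ip M (sv vs i) (sv vs i) = 1" using i by simp
  thus ?thesis using nsq_le[of M "oth vs i" "sv vs i"] by simp
 qed
 have "ri (dn M vs i) <= ri (dl M (oth vs i))" unfolding dn_nsq using nsq1 dl_pos[of M "oth vs i"] by (simp add: mult_left_le)
 hence "dn M vs i <= dl M (oth vs i)" by simp
 also have "... <= (PROD b<-oth vs i. 1+ip M b b)" by (rule dl_le)
 also have "... <= (1+int M*Dl^2)^length (oth vs i)"
 proof -
  have b: "ip M b b <= int M*Dl^2" if b: "b : set (oth vs i)" for b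
  proof -
   have "b : set (map fst vs)" using b by (auto simp: oth_def dest: in_set_takeD in_set_dropD)
   then obtain k where k: "k < M" "b = sv vs k" using L by (auto simp: in_set_conv_nth nthd_def)
   have "abs (el b j) <= Dl" if "j < M" for j
   proof -
    have "good b | b = mk M (%j. if j = k then 1 else 0)" using vs k by (auto simp: sgood_def)
    thus ?thesis using good_Dl that Dl by auto
   qed
   hence "ip M b b <= (SUM j<M. Dl^2)" unfolding ip_def power2_eq_square[symmetric] by (intro sum_mono) (force simp: abs_le_square_iff[symmetric])
   thus ?thesis by simp
  qed
  have "(PROD b<-xs. 1+ip M b b) <= (1+int M*Dl^2)^length xs" if "!!b. b : set xs ==> ip M b b <= int M*Dl^2" for xs using that
  proof (induction xs)
   case (Cons b xs)
   have "0 <= ip M b b" for b by (simp add: ip_def sum_nonneg)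
   hence "0 <= (PROD b<-xs. 1+ip M b b)" by (induction xs) auto
   thus ?case using Cons by (simp, intro mult_mono) auto
  qed simp
  thus ?thesis using b by blast
 qed
 also have "... <= (1+int M*Dl^2)^M" using i L by (intro power_increasing) (auto simp: oth_def)
 finally show ?thesis .
qed
qed

text \<open>Suppose that the functional of an artificial point does not vanish on \<open>X\<close>.
  Then it is nonzero at a good vector, where its integer value is at least 1 in absolute value.
  Division by entry 0 costs a factor \<open>Dl\<close>, and the weight \<open>K\<close> pushes the
  coordinate past 2, against stability. This dictates the lower bound on \<open>K\<close>.\<close>

lemma spanner_final:
assumes vs: "sgood vs" and st: "spcand M orc vs = []" and x: "x : X" and i: "i < M"
shows "abs (mu M vs i x) < 2" "~ good (sv vs i) | st vs i ~= el (sv vs i) 0 ==> rip M (ra (gv M vs i)) x = 0"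
proof -
have L: "length vs = M" "grm M (map fst vs) > 0" "0 < st vs i" using vs i by (auto simp: sgood_def)
have dnp: "dn M vs i > 0" using dn_pos L i by simp
have e: "orc (qry M vs i 1) = []" "orc (qry M vs i (- 1)) = []" using st i by (auto simp: spcand_def)
have lt: "abs (mu M vs i x) < 2" if x: "x : X" for x
proof -
 have "rip M (ra (qry M vs i 1)) x < 0" "rip M (ra (qry M vs i (- 1))) x < 0" using orc[of "qry M vs i 1"] orc[of "qry M vs i (- 1)"] e x by auto
 hence "abs (ri (st vs i)*rip M (ra (gv M vs i)) x) < 2*ri (dn M vs i)" unfolding qry_rip X0[OF x] by simp
 thus ?thesis using dnp by (simp add: mu_def pos_divide_less_eq)
qed
show "abs (mu M vs i x) < 2" by (rule lt[OF x])
assume a: "~ good (sv vs i) | st vs i ~= el (sv vs i) 0"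
hence art: "st vs i = K" "sv vs i = mk M (%j. if j = i then 1 else 0)" using vs i by (auto simp: sgood_def)
show "rip M (ra (gv M vs i)) x = 0"
proof (rule ccontr)
 assume nz: "rip M (ra (gv M vs i)) x ~= 0"
 \<comment> \<open>The sign makes the functional positive at \<open>x\<close>, hence positive at
   some good vector.\<close>
 define sg :: real where "sg = (if rip M (ra (gv M vs i)) x > 0 then 1 else - 1)"
 have sgx: "sg*rip M (ra (gv M vs i)) x > 0" using nz by (auto simp: sg_def)
 obtain v where v: "good v" "rip M (%j. sg*ra (gv M vs i) j) x <= rip M (%j. sg*ra (gv M vs i) j) (%j. ra v j/ra v 0)" using vert[OF x] by blast
 let ?r = "rip M (ra (gv M vs i)) (%j. ra v j/ra v 0)"
 have v0: "ra v 0 > 0" using good_pos[OF v(1)] by simp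
 have req: "?r = ri (ip M (gv M vs i) v)/ra v 0" unfolding ip_rip using rip_scale_right[of M "ra (gv M vs i)" "1/ra v 0" "ra v"] by simp
 have "0 < sg * ?r" using v(2) sgx unfolding rip_scale_left by linarith
 hence "ip M (gv M vs i) v ~= 0" using req by auto
 hence "1 <= abs (ip M (gv M vs i) v)" by linarith
 hence i1: "1 <= abs (ri (ip M (gv M vs i) v))" by (metis of_int_1_le_iff of_int_abs)
 have "abs (?r) = abs (ri (ip M (gv M vs i) v))/ra v 0" unfolding req using v0 by (simp add: abs_divide)
 also have "... >= 1/ri Dl"
 proof (rule frac_le)
  show "ra v 0 <= ri Dl" using good_Dl[OF v(1) M] by simp
 qed (use i1 v0 in auto)
 finally have rD: "1/ri Dl <= abs (?r)" .
 have "abs (mu M vs i (%j. ra v j/ra v 0)) < 2" by (rule lt[OF good_mem[OF v(1)]])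
 hence k: "ri K*abs (?r) < 2*ri (dn M vs i)" using dnp L(3) art by (simp add: mu_def abs_mult pos_divide_less_eq)
 have "ri K*(1/ri Dl) <= ri K*abs (?r)" using rD K1 by (intro mult_left_mono) auto
 hence "ri K <= ri Dl*(ri K*abs (?r))" using Dl by (simp add: pos_divide_le_eq mult.commute)
 also have "... < ri Dl*(2*ri (dn M vs i))" using k Dl by (intro mult_strict_left_mono) auto
 finally have "ri K < 2*ri (dn M vs i)*ri Dl" by (simp add: mult_ac)
 hence "ri K < ri (2*dn M vs i*Dl)" by simp
 hence Kl: "K < 2*dn M vs i*Dl" by (simp only: of_int_less_iff)
 have "dn M vs i <= (1+int M*Dl^2)^M" by (rule art_dn(2)[OF vs i a])
 hence "2*Dl*dn M vs i <= 2*Dl*(1+int M*Dl^2)^M" using Dl by (intro mult_left_mono) auto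
 thus False using K Kl by (simp add: mult_ac)
qed
qed

end

section \<open>Lattice basis reduction\<close>

definition gs where "gs M rs j = mulv M (snd (proj M (take j rs))) (rw rs j)"
text \<open>With \<open>A\<close> and \<open>B\<close> for the two inner products this is the floor
  of \<open>A / B + 1/2\<close>, the integer nearest to the Gram-Schmidt coefficient; for
  \<open>B = 0\<close> division by 0 makes it 0.\<close>

definition redc where "redc M rs j b = (2*ip M (gs M rs j) b+ip M (gs M rs j) (rw rs j)) div (2*ip M (gs M rs j) (rw rs j))"
definition red1 where "red1 M rs j b = mk M (%i. el b i - redc M rs j b*el (rw rs j) i)"
text \<open>The list is processed from its end because subtracting an earlier vector leaves the
  later Gram-Schmidt coefficients unchanged.\<close>

definition red where "red M rs b = fold (red1 M rs) (rev [0..<length rs]) (mk M (el b))"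
definition szred where "szred M bs = fold (%b rs. rs @ [red M rs b]) bs []"
text \<open>The potential of the LLL algorithm, a positive integer.\<close>

definition DD where "DD M bs = (PROD k<length bs. dl M (take (Suc k) bs))"
definition swp where "swp bs i = bs[i := rw bs (Suc i), Suc i := rw bs i]"
text \<open>The Lovasz condition in integer form: an exchange is due if it lowers the potential by
  more than the factor \<open>3/4\<close>.\<close>

definition swaps where "swaps M rs = filter (%i. 4*DD M (swp rs i) < 3*DD M rs) [0..<length rs - 1]"
definition lllstep where "lllstep M bs = (if swaps M (szred M bs) = [] then bs else swp (szred M bs) (nthd 0 (swaps M (szred M bs)) 0))"
text \<open>Three exchanges multiply the potential by less than \<open>27/64 < 1/2\<close>, so three
  rounds per bit of the initial potential suffice.\<close>

definition lll where "lll M bs = szred M ((lllstep M ^^ (3*size_int (DD M bs))) bs)"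

section \<open>Integer spans\<close>

primrec zs :: "nat => int list list => (nat => int) => bool" where
"zs n [] v <-> (ALL i<n. v i = 0)"
| "zs n (b # bs) v <-> (EX c. zs n bs (%i. v i - c*el b i))"

lemma zs_cong: "(!!i. i < n ==> v i = w i) ==> zs n bs v <-> zs n bs w"
proof (induction bs arbitrary: v w)
case (Cons b bs)
have "zs n bs (%i. v i - c*el b i) <-> zs n bs (%i. w i - c*el b i)" for c by (rule Cons.IH) (simp add: Cons.prems)
thus ?case by (simp only: zs.simps)
qed simp
lemma zs_add: "zs n bs v ==> zs n bs w ==> zs n bs (%i. v i+w i)"
proof (induction bs arbitrary: v w)
case (Cons b bs)
then obtain c d where "zs n bs (%i. v i - c*el b i)" "zs n bs (%i. w i - d*el b i)" by auto
from Cons.IH[OF this] have "zs n bs (%i. v i+w i - (c+d)*el b i)" by (rule zs_cong[THEN iffD1, rotated]) (simp add: algebra_simps)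
thus ?case by auto
qed simp
lemma zs_scale: "zs n bs v ==> zs n bs (%i. a*v i)"
proof (induction bs arbitrary: v)
case (Cons b bs)
then obtain c where "zs n bs (%i. v i - c*el b i)" by auto
from Cons.IH[OF this] have "zs n bs (%i. a*v i - (a*c)*el b i)" by (rule zs_cong[THEN iffD1, rotated]) (simp add: algebra_simps)
thus ?case by auto
qed simp
lemma zs_diff: "zs n bs v ==> zs n bs w ==> zs n bs (%i. v i - w i)" using zs_add[of n bs v "%i. - 1*w i"] zs_scale[of n bs w "- 1"] by simp
lemma zs_zero: "zs n bs (%_. 0)" by (induction bs) (auto intro: exI[of _ 0])
lemma zs_mem: "b : set bs ==> zs n bs (el b)"
proof (induction bs)
case (Cons a bs)
show ?case
proof (cases "b = a")
 case True
 thus ?thesis using zs_zero[of n bs] by (auto intro: exI[of _ 1])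
next
 case False
 thus ?thesis using Cons by (auto intro: exI[of _ 0])
qed
qed simp
lemma zs_append: "zs n (as @ bs) v <-> (EX w. zs n as w & zs n bs (%i. v i - w i))"
proof (induction as arbitrary: v)
case Nil
show ?case
proof
 assume "zs n ([] @ bs) v"
 thus "EX w. zs n [] w & zs n bs (%i. v i - w i)" by (intro exI[of _ "%_. 0"]) simp
next
 assume "EX w. zs n [] w & zs n bs (%i. v i - w i)"
 then obtain w where "ALL i<n. w i = 0" "zs n bs (%i. v i - w i)" by auto
 thus "zs n ([] @ bs) v" using zs_cong[of n v "%i. v i - w i" bs] by simp
qed
next
case (Cons a as)
show ?case
proof
 assume "zs n ((a # as) @ bs) v"
 then obtain c w where "zs n as w" "zs n bs (%i. v i - c*el a i - w i)" using Cons by auto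
 thus "EX w. zs n (a # as) w & zs n bs (%i. v i - w i)" by (intro exI[of _ "%i. c*el a i+w i"]) (auto simp: diff_diff_add intro!: exI[of _ c])
next
 assume "EX w. zs n (a # as) w & zs n bs (%i. v i - w i)"
 then obtain c w where w: "zs n as (%i. w i - c*el a i)" "zs n bs (%i. v i - w i)" by auto
 have "zs n bs (%i. v i - c*el a i - (w i - c*el a i))" using w(2) by simp
 thus "zs n ((a # as) @ bs) v" unfolding append_Cons zs.simps Cons.IH using w(1) by (intro exI[of _ c] exI[of _ "%i. w i - c*el a i"]) simp
qed
qed
lemma zs_snoc: "zs n (bs @ [b]) v <-> (EX c. zs n bs (%i. v i - c*el b i))"
proof -
have "(EX w. zs n bs w & zs n [b] (%i. v i - w i)) <-> (EX c. zs n bs (%i. v i - c*el b i))"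
proof
 assume "EX w. zs n bs w & zs n [b] (%i. v i - w i)"
 then obtain w c where w: "zs n bs w" "ALL i<n. v i - w i - c*el b i = 0" by auto
 thus "EX c. zs n bs (%i. v i - c*el b i)" using zs_cong[of n w "%i. v i - c*el b i" bs] by (intro exI[of _ c]) (auto simp: algebra_simps)
next
 assume "EX c. zs n bs (%i. v i - c*el b i)"
 then obtain c where "zs n bs (%i. v i - c*el b i)" by blast
 thus "EX w. zs n bs w & zs n [b] (%i. v i - w i)" by (intro exI[of _ "%i. v i - c*el b i"]) (auto intro: exI[of _ c])
qed
thus ?thesis unfolding zs_append .
qed

lemma gs_pj: "j < M ==> ra (gs M rs k) j = ri (dl M (take k rs))*pj M (take k rs) (ra (rw rs k)) j" using dl_pos[of M "take k rs"] by (simp add: gs_def mulv_def pj_def ip_def pm_def)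
lemma ip_gs: "ri (ip M (gs M rs k) b) = ri (dl M (take k rs))*rip M (pj M (take k rs) (ra (rw rs k))) (ra b)"
unfolding ip_rip rip_scale_left[symmetric] by (intro rip_cong) (auto simp: gs_pj)
lemma ip_gs_self: "ri (ip M (gs M rs k) (rw rs k)) = ri (dl M (take k rs))*nsq M (take k rs) (rw rs k)" unfolding ip_gs nsq_def pj_norm by (simp add: rip_commute)

abbreviation gso :: "nat => int list list => nat => nat => real" where
"gso M rs k == pj M (take k rs) (ra (rw rs k))"

lemma rip_gso_before: "j < k ==> j < length rs ==> rip M (gso M rs k) (ra (rw rs j)) = 0"
proof -
assume "j < k" "j < length rs"
hence "rw rs j : set (take k rs)" by (auto simp: nthd_def in_set_conv_nth intro!: exI[of _ j])
thus ?thesis using pj_ker rip_commute by metis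
qed

lemma red1_props:
assumes j: "j < length rs" and y: "y = red1 M rs j b"
shows "abs (rip M (gso M rs j) (ra y)) <= nsq M (take j rs) (rw rs j)/2"
 "j < k ==> rip M (gso M rs k) (ra y) = rip M (gso M rs k) (ra b)"
 "!!i. i < M ==> el y i = el b i - redc M rs j b*el (rw rs j) i"
proof -
show e: "!!i. i < M ==> el y i = el b i - redc M rs j b*el (rw rs j) i" by (simp add: y red1_def)
have r: "rip M z (ra y) = rip M z (ra b) - ri (redc M rs j b)*rip M z (ra (rw rs j))" for z unfolding rip_scale_right[symmetric] rip_diff_right[symmetric] using e by (intro rip_cong) auto
show "rip M (gso M rs k) (ra y) = rip M (gso M rs k) (ra b)" if "j < k" unfolding r using rip_gso_before[OF that j] by simp
define d where "d = dl M (take j rs)"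
define q where "q = nsq M (take j rs) (rw rs j)"
define p where "p = rip M (gso M rs j) (ra b)"
have d: "ri d > 0" using dl_pos by (simp add: d_def)
have qe: "rip M (gso M rs j) (ra (rw rs j)) = q" unfolding q_def nsq_def pj_norm by (simp add: rip_commute)
show "abs (rip M (gso M rs j) (ra y)) <= q/2"
proof (cases "q = 0")
 case True
 hence "ALL i<M. gso M rs j i = 0" unfolding q_def nsq_def rip_eq_0 .
 thus ?thesis using True by (auto intro: rip_zero_left)
next
 case False
 define A where "A = ip M (gs M rs j) b"
 define B where "B = ip M (gs M rs j) (rw rs j)"
 have A: "ri A = ri d*p" unfolding A_def ip_gs d_def p_def ..
 have B: "ri B = ri d*q" unfolding B_def ip_gs_self d_def q_def ..
 have q: "q > 0" using False nsq_nonneg[of M "take j rs" "rw rs j"] by (simp add: q_def)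
 hence "ri B > 0" using B d by simp
 hence B0: "B > 0" by simp
 define c where "c = (2*A+B) div (2*B)"
 have "2*B*c+(2*A+B) mod (2*B) = 2*A+B" unfolding c_def by (rule mult_div_mod_eq)
 moreover have "0 <= (2*A+B) mod (2*B)" "(2*A+B) mod (2*B) < 2*B" using B0 by simp_all
 ultimately have "2*B*c <= 2*A+B" "2*A+B < 2*B*c+2*B" by linarith+
 hence "abs (2*A - 2*B*c) <= B" by linarith
 hence "ri (abs (2*A - 2*B*c)) <= ri B" by (simp only: of_int_le_iff)
 hence "abs (2*(ri d*p) - 2*(ri d*q)*ri c) <= ri d*q" by (simp add: A B)
 hence "ri d*(2*abs (p - ri c*q)) <= ri d*q" using d abs_mult_pos[of "2*ri d" "p - ri c*q"] by (simp add: algebra_simps)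
 hence "2*abs (p - ri c*q) <= q" using d by simp
 moreover have "redc M rs j b = c" by (simp add: redc_def c_def A_def B_def)
 ultimately show ?thesis unfolding r qe by (simp add: p_def)
qed
qed

lemma zs_pj: "zs M bs v ==> set bs \<subseteq> set rs ==> i < M ==> pj M rs (%i. ri (v i)) i = 0"
proof (induction bs arbitrary: v)
case Nil
thus ?case by (simp add: pj_def)
next
case (Cons a bs)
then obtain c where "zs M bs (%i. v i - c*el a i)" by auto
from Cons.IH[OF this] Cons.prems have "pj M rs (%i. ri (v i) - ri c*ra a i) i = 0" by simp
thus ?case unfolding pj_diff pj_scale using pj_kills[of a rs i M] Cons.prems by simp
qed

lemma red_props:
assumes y: "y = red M rs b"
shows "j < length rs ==> (abs (rip M (gso M rs j) (ra y))) <= nsq M (take j rs) (rw rs j)/2"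
 "zs M rs (%i. el b i - el y i)" "length y = M"
 "i < M ==> pj M rs (ra y) i = pj M rs (ra b) i"
proof -
let ?f = "%k. fold (red1 M rs) (rev [k..<length rs]) (mk M (el b))"
have A: "(ALL j. k <= j & j < length rs --> (abs (rip M (gso M rs j) (ra (?f k)))) <= nsq M (take j rs) (rw rs j)/2) &
 zs M rs (%i. el b i - el (?f k) i) & length (?f k) = M" if "k <= length rs" for k using that
proof (induction k rule: inc_induct)
 case base
 thus ?case using zs_zero[of M rs] zs_cong[of M "%_. 0" "%i. el b i - (if i < M then el b i else 0)" rs] by simp
next
 case (step k)
 have f: "?f k = red1 M rs k (?f (Suc k))" using step.hyps by (simp add: upt_conv_Cons)
 note p = red1_props[OF step.hyps(2) f]
 have ih: "zs M rs (%i. el b i - el (?f (Suc k)) i)"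
  "!!j. Suc k <= j ==> j < length rs ==> (abs (rip M (gso M rs j) (ra (?f (Suc k))))) <= nsq M (take j rs) (rw rs j)/2" using step.IH by blast+
 have mem: "rw rs k : set rs" using step.hyps(2) by (simp add: nthd_def)
 have "zs M rs (%i. (el b i - el (?f (Suc k)) i)+redc M rs k (?f (Suc k))*el (rw rs k) i)" by (intro zs_add zs_scale zs_mem ih(1) mem)
 hence "zs M rs (%i. el b i - el (?f k) i)" by (rule zs_cong[THEN iffD1, rotated]) (simp add: p(3))
 moreover have "abs (rip M (gso M rs j) (ra (?f k))) <= nsq M (take j rs) (rw rs j)/2" if "k <= j" "j < length rs" for j
 proof (cases "k = j")
  case True
  thus ?thesis using p(1) by simp
 next
  case False
  thus ?thesis using p(2)[of j] ih(2)[of j] that by simp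
 qed
 moreover have "length (?f k) = M" unfolding f by (simp add: red1_def)
 ultimately show ?case by blast
qed
have y0: "y = ?f 0" by (simp add: y red_def)
show "j < length rs ==> (abs (rip M (gso M rs j) (ra y))) <= nsq M (take j rs) (rw rs j)/2"
 "zs M rs (%i. el b i - el y i)" "length y = M" using A[of 0] unfolding y0 by auto
hence z: "zs M rs (%i. el b i - el y i)" by blast
show "i < M ==> pj M rs (ra y) i = pj M rs (ra b) i" using zs_pj[OF z order_refl] pj_diff[of M rs "ra b" "ra y" i] by simp
qed

lemma rip_pj_snoc: "rip n (pj n (bs @ [b]) x) (pj n (bs @ [b]) x) =
 rip n (pj n bs x) (pj n bs x) - (rip n (pj n bs (ra b)) x)^2/nsq n bs b"
proof -
let ?p = "pj n bs (ra b)"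
have "rip n (pj n (bs @ [b]) x) (pj n (bs @ [b]) x) = rip n x (pj n (bs @ [b]) x)" by (rule pj_norm)
also have "... = rip n x (%i. pj n bs x i - rip n ?p x/nsq n bs b * ?p i)" unfolding nsq_def by (intro rip_cong pj_snoc) auto
also have "... = rip n (pj n bs x) (pj n bs x) - rip n ?p x/nsq n bs b*rip n ?p x" unfolding rip_diff_right rip_scale_right pj_norm by (simp add: rip_commute)
finally show ?thesis by (simp add: power2_eq_square)
qed

text \<open>Pythagoras along the Gram-Schmidt directions: a component of at most half a Gram-Schmidt
  vector contributes at most a quarter of its squared length, and the projection term is the part
  outside the span.\<close>

lemma rip_le_gs:
assumes "!!j. j < length rs ==> (abs (rip M (gso M rs j) x)) <= nsq M (take j rs) (rw rs j)/2"
shows "rip M x x <= rip M (pj M rs x) (pj M rs x)+(SUM j<length rs. nsq M (take j rs) (rw rs j))/4" using assms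
proof (induction rs rule: rev_induct)
case Nil
have "rip M (pj M [] x) (pj M [] x) = rip M x x" by (intro rip_cong pj_fix) auto
thus ?case by simp
next
case (snoc b rs)
let ?q = "nsq M rs b"
have t: "take j (rs @ [b]) = take j rs" "rw (rs @ [b]) j = rw rs j" if "j < length rs" for j using that by (auto simp: nthd_def nth_append)
have e: "take (length rs) (rs @ [b]) = rs" "rw (rs @ [b]) (length rs) = b" by (auto simp: nthd_def)
have IH: "rip M x x <= rip M (pj M rs x) (pj M rs x)+(SUM j<length rs. nsq M (take j rs) (rw rs j))/4" using snoc.prems t by (intro snoc.IH) (metis length_append_singleton less_SucI)
have b: "abs (rip M (pj M rs (ra b)) x) <= ?q/2" using snoc.prems[of "length rs"] e by simp
have "(rip M (pj M rs (ra b)) x)^2 / ?q <= ?q/4"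
proof (cases "?q = 0")
 case False
 hence q: "?q > 0" using nsq_nonneg[of M rs b] by simp
 have "(rip M (pj M rs (ra b)) x)^2 <= (?q/2)^2" using b by (rule abs_le_square_iff[THEN iffD1, OF order_trans]) (use q in simp)
 also have "... = ?q/4 * ?q" by (simp add: power2_eq_square)
 finally show ?thesis using q by (simp add: pos_divide_le_eq)
qed simp
moreover have "(SUM j<length (rs @ [b]). nsq M (take j (rs @ [b])) (rw (rs @ [b]) j)) = (SUM j<length rs. nsq M (take j rs) (rw rs j)) + ?q" using t e by simp
ultimately show ?case using IH unfolding rip_pj_snoc by (simp add: add_divide_distrib)
qed

lemma szred_snoc: "szred M (bs @ [b]) = szred M bs @ [red M (szred M bs) b]" by (simp add: szred_def)
lemma length_szred [simp]: "length (szred M bs) = length bs" by (induction bs rule: rev_induct) (simp_all add: szred_snoc, simp add: szred_def)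
lemma szred_take: "take k (szred M bs) = szred M (take k bs)"
proof (induction bs rule: rev_induct)
case (snoc b bs)
thus ?case by (cases "k <= length bs") (simp_all add: szred_snoc)
qed (simp add: szred_def)

text \<open>Size reduction changes each vector by a combination of its predecessors only, so all
  prefixes keep their spans and therefore all Gram-Schmidt data.\<close>

lemma szred_pj: "i < M ==> pj M (szred M bs) x i = pj M bs x i"
proof (induction bs arbitrary: x i rule: rev_induct)
case (snoc b bs)
have e: "pj M (szred M bs) (ra (red M (szred M bs) b)) i = pj M bs (ra b) i" if "i < M" for i using red_props(4)[OF refl that] snoc.IH[OF that] by simp
have r: "rip M (pj M (szred M bs) (ra (red M (szred M bs) b))) z = rip M (pj M bs (ra b)) z" for z using e by (intro rip_cong) auto
have r': "rip M (pj M bs (ra b)) (pj M (szred M bs) (ra (red M (szred M bs) b))) = rip M (pj M bs (ra b)) (pj M bs (ra b))" using e by (intro rip_cong) auto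
show ?case unfolding szred_snoc pj_snoc[OF snoc.prems] r r' e[OF snoc.prems] snoc.IH[OF snoc.prems] ..
qed (simp add: szred_def)

lemma szred_nsq: "k < length bs ==> nsq M (take k (szred M bs)) (rw (szred M bs) k) = nsq M (take k bs) (rw bs k)"
proof -
assume k: "k < length bs"
have "szred M (take (Suc k) bs) = szred M (take k bs) @ [red M (szred M (take k bs)) (bs ! k)]" using k by (simp add: take_Suc_conv_app_nth szred_snoc)
hence "take (Suc k) (szred M bs) ! k = red M (szred M (take k bs)) (bs ! k)" using k unfolding szred_take by (simp add: nth_append)
hence w: "rw (szred M bs) k = red M (szred M (take k bs)) (bs ! k)" using k by (simp add: nthd_def)
have w': "bs ! k = rw bs k" using k by (simp add: nthd_def)
have "pj M (take k (szred M bs)) (ra (rw (szred M bs) k)) i = pj M (take k bs) (ra (rw bs k)) i" if "i < M" for i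
 unfolding w szred_take using red_props(4)[OF refl that, of "szred M (take k bs)" "bs ! k"] szred_pj[OF that, of "take k bs"] w' by simp
thus ?thesis unfolding nsq_def by (intro rip_cong) auto
qed

lemma szred_red: "j < k ==> k < length bs ==>
 abs (rip M (gso M (szred M bs) j) (ra (rw (szred M bs) k))) <= nsq M (take j (szred M bs)) (rw (szred M bs) j)/2"
proof (induction bs rule: rev_induct)
case (snoc b bs)
have t: "take j (szred M (bs @ [b])) = take j (szred M bs)" "rw (szred M (bs @ [b])) j = rw (szred M bs) j" using snoc.prems by (auto simp: szred_snoc nthd_def nth_append)
show ?case
proof (cases "k = length bs")
 case True
 hence "rw (szred M (bs @ [b])) k = red M (szred M bs) b" by (simp add: szred_snoc nthd_def nth_append)
 thus ?thesis using red_props(1)[OF refl, of j "szred M bs" M b] snoc.prems True t by simp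
next
 case False
 hence "rw (szred M (bs @ [b])) k = rw (szred M bs) k" using snoc.prems by (auto simp: szred_snoc nthd_def nth_append)
 thus ?thesis using snoc False t by simp
qed
qed simp

lemma szred_zs: "zs M (szred M bs) v <-> zs M bs v"
proof (induction bs arbitrary: v rule: rev_induct)
case (snoc b bs)
let ?r = "red M (szred M bs) b"
have z: "zs M (szred M bs) (%i. el b i - el ?r i)" by (rule red_props(2)[OF refl])
have "zs M (szred M bs) (%i. v i - c*el ?r i) <-> zs M (szred M bs) (%i. v i - c*el b i)" for c
proof
 assume "zs M (szred M bs) (%i. v i - c*el ?r i)"
 from zs_diff[OF this zs_scale[OF z, of c]] show "zs M (szred M bs) (%i. v i - c*el b i)" by (rule zs_cong[THEN iffD1, rotated]) (simp add: algebra_simps)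
next
 assume "zs M (szred M bs) (%i. v i - c*el b i)"
 from zs_add[OF this zs_scale[OF z, of c]] show "zs M (szred M bs) (%i. v i - c*el ?r i)" by (rule zs_cong[THEN iffD1, rotated]) (simp add: algebra_simps)
qed
thus ?case unfolding szred_snoc zs_snoc snoc.IH by simp
qed (simp add: szred_def)

lemma szred_dl: "dl M (szred M bs) = dl M bs"
proof (induction bs rule: rev_induct)
case (snoc b bs)
have "nsq M (szred M bs) (red M (szred M bs) b) = nsq M bs b" unfolding nsq_def by (intro rip_cong) (auto simp: red_props(4) szred_pj)
hence "ri (dl M (szred M (bs @ [b]))) = ri (dl M (bs @ [b]))" unfolding szred_snoc dl_snoc using snoc.IH by simp
thus ?case by simp
qed (simp add: szred_def)

lemma szred_grm: "grm M (szred M bs) = grm M bs" unfolding grm_def using szred_nsq by (intro prod.cong) (auto simp: nthd_def)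

lemma szred_DD: "DD M (szred M bs) = DD M bs" unfolding DD_def by (simp add: szred_take szred_dl)

lemma DD_ge: "k < length bs ==> dl M (take (Suc k) bs) <= DD M bs"
proof -
assume k: "k < length bs"
have "1 <= dl M (take (Suc j) bs)" for j using dl_pos[of M "take (Suc j) bs"] by simp
hence "1 <= (PROD j:{..<length bs} - {k}. dl M (take (Suc j) bs))" by (intro prod_ge_1) auto
hence "dl M (take (Suc k) bs)*1 <= dl M (take (Suc k) bs)*(PROD j:{..<length bs} - {k}. dl M (take (Suc j) bs))" using dl_pos[of M "take (Suc k) bs"] by (intro mult_left_mono) auto
thus ?thesis using k by (simp add: DD_def prod.remove[of _ k])
qed
lemma DD_pos: "DD M bs > 0" unfolding DD_def by (intro prod_pos) (simp add: dl_pos)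

lemma nsq_le_DD: "k < length bs ==> nsq M (take k bs) (rw bs k) <= ri (DD M bs)"
proof -
assume k: "k < length bs"
have t: "take (Suc k) bs = take k bs @ [rw bs k]" using k by (simp add: take_Suc_conv_app_nth nthd_def)
let ?q = "nsq M (take k bs) (rw bs k)"
have "?q <= ri (dl M (take (Suc k) bs))"
proof (cases "?q = 0")
 case True
 thus ?thesis using dl_pos[of M "take (Suc k) bs"] by simp
next
 case False
 have "1 <= ri (dl M (take k bs))" using dl_pos[of M "take k bs"] by simp
 hence "1 * ?q <= ri (dl M (take k bs)) * ?q" by (intro mult_right_mono nsq_nonneg)
 thus ?thesis using False unfolding t dl_snoc by simp
qed
also have "... <= ri (DD M bs)" using DD_ge[OF k] by simp
finally show ?thesis .
qed

text \<open>The potential never increases, so this single bound controls the numbers in all rounds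
  of the basis reduction.\<close>

lemma szred_bound:
assumes "k < length bs" "i < M" shows "abs (el (rw (szred M bs) k) i) <= (int (length bs)+1)*DD M bs"
proof -
let ?rs = "szred M bs" and ?x = "ra (rw (szred M bs) k)"
let ?d = "ri (DD M bs)"
have "rip M ?x ?x <= rip M (pj M (take k ?rs) ?x) (pj M (take k ?rs) ?x)+(SUM j<length (take k ?rs). nsq M (take j (take k ?rs)) (rw (take k ?rs) j))/4"
 using szred_red[of _ k bs M] assms(1) by (intro rip_le_gs) (simp add: nthd_def min_def)
also have "... <= ?d+(SUM j<length (take k ?rs). ?d)/4"
proof (intro add_mono divide_right_mono sum_mono)
 show "rip M (pj M (take k ?rs) ?x) (pj M (take k ?rs) ?x) <= ?d" using nsq_le_DD[of k ?rs M] assms(1) by (simp add: nsq_def szred_DD)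
 fix j assume "j : {..<length (take k ?rs)}"
 hence j: "j < k" by simp
 thus "nsq M (take j (take k ?rs)) (rw (take k ?rs) j) <= ?d" using nsq_le_DD[of j ?rs M] assms(1) by (simp add: nthd_def szred_DD min_def)
qed simp
also have "... <= ?d+real (length bs) * ?d" using assms(1) DD_pos[of M bs] mult_right_mono[of "real k/4" "real (length bs)" ?d] by simp
also have "... = ri ((int (length bs)+1)*DD M bs)" by (simp add: algebra_simps)
finally have "(?x i)^2 <= ri ((int (length bs)+1)*DD M bs)" using sq_le_rip[OF assms(2), of ?x] by linarith
hence s: "(el (rw ?rs k) i)^2 <= (int (length bs)+1)*DD M bs" by (simp only: of_int_le_iff flip: of_int_power)
\<comment> \<open>An integer is bounded in absolute value by its square.\<close>
have "abs (el (rw ?rs k) i)*1 <= abs (el (rw ?rs k) i)*abs (el (rw ?rs k) i)"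
 using mult_left_mono[of 1 "abs (el (rw ?rs k) i)" "abs (el (rw ?rs k) i)"] by (cases "el (rw ?rs k) i = 0") simp_all
thus ?thesis using s by (simp add: power2_eq_square abs_mult_self_eq)
qed

lemma swp_split: "Suc i < length rs ==> rs = take i rs @ rw rs i # rw rs (Suc i) # drop (Suc (Suc i)) rs" by (simp add: nthd_def Cons_nth_drop_Suc)
lemma swp_eq: "Suc i < length rs ==> swp rs i = take i rs @ rw rs (Suc i) # rw rs i # drop (Suc (Suc i)) rs"
proof -
assume i: "Suc i < length rs"
obtain xs ys where rs: "rs = xs @ rw rs i # rw rs (Suc i) # ys" "length xs = i" using swp_split[OF i] i by (metis length_take min.absorb2 Suc_lessD less_imp_le)
define a b where "a = rw rs i" and "b = rw rs (Suc i)"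
have "rs[i := b, Suc i := a] = xs @ b # a # ys" using rs unfolding a_def[symmetric] b_def[symmetric] by (simp add: list_update_append)
moreover have "take i rs = xs" "drop (Suc (Suc i)) rs = ys" using rs(2) unfolding a_def[symmetric] b_def[symmetric] by (subst rs(1), simp)+
ultimately show ?thesis by (simp add: swp_def a_def b_def)
qed
lemma length_swp [simp]: "length (swp rs i) = length rs" by (simp add: swp_def)

lemma zs_swp: "Suc i < length rs ==> zs M (swp rs i) v <-> zs M rs v"
proof -
assume i: "Suc i < length rs"
have "zs M (a # b # xs) w <-> zs M (b # a # xs) w" for a b xs w
proof -
 have "zs M (b # a # xs) w" if z: "zs M (a # b # xs) w" for a b w
 proof -
  obtain c d where "zs M xs (%i. w i - c*el a i - d*el b i)" using z unfolding zs.simps by blast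
  hence "zs M xs (%i. w i - d*el b i - c*el a i)" by (simp add: algebra_simps)
  thus ?thesis by auto
 qed
 thus ?thesis by blast
qed
hence "zs M (swp rs i) v <-> zs M (take i rs @ rw rs i # rw rs (Suc i) # drop (Suc (Suc i)) rs) v" unfolding swp_eq[OF i] zs_append by simp
thus ?thesis using swp_split[OF i] by simp
qed

lemma grm_swp: "Suc i < length rs ==> grm M (swp rs i) = grm M rs"
using grm_swap[of M "take i rs" "rw rs (Suc i)" "rw rs i" "drop (Suc (Suc i)) rs"] swp_split[of i rs] swp_eq[of i rs] by simp

lemma swaps_hd: "swaps M rs ~= [] ==> Suc (nthd 0 (swaps M rs) 0) < length rs & 4*DD M (swp rs (nthd 0 (swaps M rs) 0)) < 3*DD M rs"
using nth_mem[of 0 "swaps M rs"] by (auto simp: swaps_def nthd_def)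

lemma lllstep_props:
"zs M (lllstep M bs) v <-> zs M bs v" "grm M (lllstep M bs) = grm M bs" "length (lllstep M bs) = length bs"
"swaps M (szred M bs) ~= [] ==> 4*DD M (lllstep M bs) < 3*DD M bs" using swaps_hd[of M "szred M bs"] by (auto simp: lllstep_def zs_swp szred_zs grm_swp szred_grm szred_DD)

lemma lll_iter:
fixes M :: nat
defines "s == %bs k. (lllstep M ^^ k) bs"
shows "zs M (s bs k) v <-> zs M bs v" "grm M (s bs k) = grm M bs" "length (s bs k) = length bs" "DD M (s bs k) <= DD M bs"
proof -
show "zs M (s bs k) v <-> zs M bs v" "grm M (s bs k) = grm M bs" "length (s bs k) = length bs" by (induction k) (auto simp: s_def lllstep_props)
have "DD M (lllstep M bs) <= DD M bs" for bs using lllstep_props(4)[of M bs] DD_pos[of M bs] by (cases "swaps M (szred M bs) = []") (auto simp: lllstep_def)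
thus "DD M (s bs k) <= DD M bs" by (induction k) (auto simp: s_def intro: order_trans)
qed

lemma lll_done: "swaps M (lll M bs) = []"
proof (rule ccontr)
let ?s = "%k. (lllstep M ^^ k) bs"
define N where "N = 3*size_int (DD M bs)"
assume ne: "swaps M (lll M bs) ~= []"
have fx: "lllstep M b = b" if "swaps M (szred M b) = []" for b using that by (simp add: lllstep_def)
have st: "?s k = ?s j" if "swaps M (szred M (?s j)) = []" "j <= k" for j k using that(2) by (induction k rule: dec_induct) (use fx that(1) in auto)
have all: "swaps M (szred M (?s j)) ~= []" if "j <= N" for j using st[of j N] that ne by (auto simp: lll_def N_def)
have "4^k*DD M (?s k) <= 3^k*DD M bs" if "k <= N" for k using that
proof (induction k)
 case (Suc k)
 have "4*DD M (?s (Suc k)) <= 3*DD M (?s k)" using lllstep_props(4)[OF all[of k]] Suc.prems by simp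
 hence "4^k*(4*DD M (?s (Suc k))) <= 4^k*(3*DD M (?s k))" by (intro mult_left_mono) auto
 also have "... <= 3*(3^k*DD M bs)" using Suc by simp
 finally show ?case by simp
qed simp
from this[OF order_refl] have "4^N*DD M (?s N) <= 3^N*DD M bs" .
moreover have "4^N*1 <= 4^N*DD M (?s N)" using DD_pos[of M "?s N"] by (intro mult_left_mono) auto
moreover have "3^N*DD M bs < 3^N*2^size_int (DD M bs)" using size_int_less[of "DD M bs"] by simp
moreover have "(3::int)^N*2^size_int (DD M bs) <= 4^N"
proof -
 have "(3::int)^N*2^size_int (DD M bs) = (3^3*2)^size_int (DD M bs)" unfolding N_def power_mult power_mult_distrib ..
 also have "... <= (4^3)^size_int (DD M bs)" by (intro power_mono) auto
 finally show ?thesis by (simp add: N_def power_mult)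
qed
ultimately show False by linarith
qed

text \<open>Exchanging neighbours affects only one factor of the potential: shorter prefixes contain
  neither vector and longer ones contain both. No possible drop therefore means that
  \<open>3/4\<close> of the squared Gram-Schmidt length at \<open>k\<close> is at most the squared
  distance of the next vector from the same span; size reduction subtracts at most
  \<open>1/4\<close>, leaving the factor \<open>1/2\<close>.\<close>

lemma lll_props:
assumes g: "grm M bs > 0"
defines "rs == lll M bs"
shows "length rs = length bs" "grm M rs > 0" "zs M rs v <-> zs M bs v"
 "Suc k < length rs ==> nsq M (take k rs) (rw rs k) <= 2*nsq M (take (Suc k) rs) (rw rs (Suc k))"
 "j < k ==> k < length rs ==> (abs (rip M (gso M rs j) (ra (rw rs k)))) <= nsq M (take j rs) (rw rs j)/2"
proof -
obtain bs' where rs: "rs = szred M bs'" and b': "length bs' = length bs" "grm M bs' = grm M bs" "!!v. zs M bs' v <-> zs M bs v" unfolding rs_def lll_def using lll_iter by blast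
show len: "length rs = length bs" "grm M rs > 0" "zs M rs v <-> zs M bs v" using g by (simp_all add: rs b' szred_grm szred_zs)
show rd: "j < k ==> k < length rs ==> (abs (rip M (gso M rs j) (ra (rw rs k)))) <= nsq M (take j rs) (rw rs j)/2" for j k unfolding rs by (rule szred_red) simp_all
assume k: "Suc k < length rs"
let ?t = "take k rs" and ?a = "rw rs k" and ?b = "rw rs (Suc k)"
have tk: "take (Suc k) rs = ?t @ [?a]" using k by (simp add: take_Suc_conv_app_nth nthd_def)
have tk2: "take (Suc (Suc k)) rs = take (Suc k) rs @ [?b]" using k by (simp add: take_Suc_conv_app_nth nthd_def)
have ga: "grm M (take (Suc k) rs) > 0" "grm M (take (Suc (Suc k)) rs) > 0" "grm M ?t > 0" by (rule grm_take[OF len(2)])+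
have na: "nsq M ?t ?a > 0" using ga(1,3) nsq_nonneg[of M ?t ?a] unfolding tk grm_snoc by (auto simp: zero_less_mult_iff)
have nb': "nsq M (?t @ [?a]) ?b > 0" using ga(1,2) nsq_nonneg[of M "?t @ [?a]" ?b] unfolding tk2 grm_snoc tk[symmetric] by (auto simp: zero_less_mult_iff)
have eq: "nsq M (?t @ [?a]) ?b = nsq M ?t ?b - (rip M (pj M ?t (ra ?a)) (ra ?b))^2/nsq M ?t ?a" unfolding nsq_def[of M "?t @ [?a]"] rip_pj_snoc by (simp add: nsq_def)
have "(rip M (pj M ?t (ra ?a)) (ra ?b))^2 <= (nsq M ?t ?a/2)^2" using rd[of k "Suc k"] k na by (intro abs_le_square_iff[THEN iffD1]) simp
hence mub: "(rip M (pj M ?t (ra ?a)) (ra ?b))^2/nsq M ?t ?a <= nsq M ?t ?a/4" using na by (simp add: pos_divide_le_eq power2_eq_square)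
have "0 <= (rip M (pj M ?t (ra ?a)) (ra ?b))^2/nsq M ?t ?a" using na by simp
hence nb: "nsq M ?t ?b > 0" using nb' eq by linarith
have "k ~: set (swaps M rs)" using lll_done[of M bs] by (simp add: rs_def)
hence DDk: "3*DD M rs <= 4*DD M (swp rs k)" using k by (auto simp: swaps_def not_less)
define P where "P = (PROD j:{..<length rs} - {k}. dl M (take (Suc j) rs))"
have P0: "P > 0" unfolding P_def by (intro prod_pos) (simp add: dl_pos)
have other: "dl M (take (Suc j) (swp rs k)) = dl M (take (Suc j) rs)" if j: "j < length rs" "j ~= k" for j
proof (cases "j < k")
 case True
 hence "take (Suc j) (swp rs k) = take (Suc j) rs" using k by (simp add: swp_eq)
 thus ?thesis by simp
next
 case False
 hence kj: "Suc k < length (take (Suc j) rs)" using j k by simp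
 have "take (Suc j) (swp rs k) = swp (take (Suc j) rs) k" using j k False by (intro nth_equalityI) (auto simp: swp_def nthd_def nth_list_update)
 hence "grm M (take (Suc j) (swp rs k)) = grm M (take (Suc j) rs)" using grm_swp[OF kj] by simp
 moreover have "grm M (take (Suc j) rs) > 0" by (rule grm_take[OF len(2)])
 ultimately have "ri (dl M (take (Suc j) (swp rs k))) = ri (dl M (take (Suc j) rs))" by (simp add: dl_grm)
 thus ?thesis by simp
qed
have "DD M rs = dl M (?t @ [?a])*P" using k unfolding DD_def P_def tk[symmetric] by (intro prod.remove) auto
moreover have "DD M (swp rs k) = dl M (?t @ [?b])*P"
proof -
 have "DD M (swp rs k) = dl M (take (Suc k) (swp rs k))*(PROD j:{..<length rs} - {k}. dl M (take (Suc j) (swp rs k)))" using k unfolding DD_def length_swp by (intro prod.remove) auto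
 also have "(PROD j:{..<length rs} - {k}. dl M (take (Suc j) (swp rs k))) = P" unfolding P_def using other by (intro prod.cong) auto
 also have "take (Suc k) (swp rs k) = ?t @ [?b]" using k by (simp add: swp_eq)
 finally show ?thesis .
qed
ultimately have "P*(3*dl M (?t @ [?a])) <= P*(4*dl M (?t @ [?b]))" using DDk by (simp add: mult_ac)
hence "3*dl M (?t @ [?a]) <= 4*dl M (?t @ [?b])" using P0 by simp
hence "ri (3*dl M (?t @ [?a])) <= ri (4*dl M (?t @ [?b]))" by (simp only: of_int_le_iff)
hence "ri (dl M ?t)*(3*nsq M ?t ?a) <= ri (dl M ?t)*(4*nsq M ?t ?b)" using na nb by (simp add: dl_snoc mult_ac)
hence "3*nsq M ?t ?a <= 4*nsq M ?t ?b" using dl_pos[of M ?t] by simp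
thus "nsq M (take k rs) (rw rs k) <= 2*nsq M (take (Suc k) rs) (rw rs (Suc k))" using eq mub unfolding tk by linarith
qed

section \<open>Lattice reduction and spanners in polynomial time\<close>

lemma PT_swp [PT_rules]: assumes "PT D bs" "PT D i" shows "PT D (%x. swp (bs x) (i x))" unfolding swp_def by (intro assms PT_rules)

lemma PT_gs [PT_rules]: assumes "PT D M" "pb D M" "PT D rs" "PT D j" shows "PT D (%x. gs (M x) (rs x) (j x))" unfolding gs_def by (intro assms PT_rules)

lemma PT_redc [PT_rules]: assumes "PT D M" "pb D M" "PT D rs" "PT D j" "PT D b" shows "PT D (%x. redc (M x) (rs x) (j x) (b x))" unfolding redc_def by (intro assms PT_rules)

lemma PT_red1 [PT_rules]: assumes "PT D M" "pb D M" "PT D rs" "PT D j" "PT D b" shows "PT D (%x. red1 (M x) (rs x) (j x) (b x))" unfolding red1_def by (intro assms PT_rules)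

definition projsz where "projsz n bs = n*(3*(n*(3*size_int (Del n bs)+10))+10)+3*size_int (Del n bs)+10"

lemma size_Del_take: "size_int (Del n (take i bs)) <= size_int (Del n bs)" using Del_take[of n i bs] Del_ge_1[of n "take i bs"] by (intro size_int_mono) simp

lemma isize_proj_take: "isize (snd (proj n (take j bs))) <= projsz n bs"
proof -
have "isize (snd (proj n (take j bs))) <= isize (proj n (take j bs))" by (rule isize_snd)
also have "... <= projsz n (take j bs)" unfolding projsz_def by (rule isize_proj)
also have "... <= projsz n bs" unfolding projsz_def using size_Del_take[of n j bs] by (intro add_mono mult_mono) auto
finally show ?thesis .
qed

lemma pb_projsz [PT_rules]: assumes "PT D n" "pb D n" "PT D bs" shows "pb D (%x. projsz (n x) (bs x))"
proof -
have "pb D (%x. size_int (Del (n x) (bs x)))" using PT_size[OF PT_Del[OF assms]] by simp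
thus ?thesis unfolding projsz_def by (intro pb_intros assms)
qed

lemma abs_ip_le:
assumes "!!i. abs (el x i) <= a" "!!i. abs (el y i) <= b" shows "abs (ip n x y) <= int n*(a*b)"
proof -
have "abs (ip n x y) <= (SUM i<n. abs (el x i*el y i))" unfolding ip_def by (rule sum_abs)
also have "... <= (SUM i<n. a*b)"
proof (rule sum_mono)
 fix i
 have "0 <= a" using assms(1)[of i] abs_ge_zero order_trans by blast
 thus "abs (el x i*el y i) <= a*b" unfolding abs_mult using assms by (intro mult_mono) auto
qed
finally show ?thesis by simp
qed

lemma abs_rw_el_le: "abs (el (rw P k) j) <= 2^isize P" by (rule order_trans[OF abs_el_le]) (simp add: isize_rw)

text \<open>One reduction step multiplies the entries by a power of two that depends on
  \<open>rs\<close> but not on \<open>b\<close>; over the whole loop the number of bits therefore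
  grows only linearly.\<close>

lemma red1_le:
assumes b: "!!i. abs (el b i) <= Y" and Y: "1 <= Y"
shows "abs (el (red1 M rs j b) i) <= Y*2^(3+2*M+projsz M rs+3*isize rs)"
proof -
define r :: int where "r = 2^isize rs"
define Q :: int where "Q = 2^projsz M rs"
define m where "m = int M"
have r: "1 <= r" and Q: "1 <= Q" and m: "0 <= m" by (simp_all add: r_def Q_def m_def)
have rw: "abs (el (rw rs k) i) <= r" for k i unfolding r_def by (rule abs_rw_el_le)
have P: "abs (el (rw (snd (proj M (take j rs))) k) i) <= Q" for k i
 using order_trans[OF abs_rw_el_le[of "snd (proj M (take j rs))" k i] power_increasing[OF isize_proj_take[of M j rs], of "2::int"]] by (simp add: Q_def)
have g: "abs (el (gs M rs j) i) <= m*(Q*r)" for i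
proof (cases "i < M")
 case True
 thus ?thesis unfolding gs_def mulv_def m_def using abs_ip_le[OF P rw] by simp
next
 case False
 thus ?thesis using r Q m by (simp add: gs_def mulv_def nthd_def[of "0::int"] mk_def)
qed
define G where "G = m*(m*(Q*r))"
have G0: "0 <= G" using r Q m by (simp add: G_def)
have c: "abs (redc M rs j b) <= 3*(G*(r*Y))"
proof -
 have "abs (redc M rs j b) <= abs (2*ip M (gs M rs j) b+ip M (gs M rs j) (rw rs j))" unfolding redc_def by (rule abs_div_le)
 also have "... <= 2*(G*Y)+G*r" using abs_ip_le[OF g b, of M] abs_ip_le[OF g rw, of M j] by (simp add: G_def m_def mult.assoc)
 also have "... <= 2*(G*(r*Y))+G*(r*Y)" using r Y G0 mult_right_mono[of 1 r Y] mult_left_mono[of 1 Y r] by (intro add_mono mult_left_mono) auto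
 finally show ?thesis by (simp add: mult_ac)
qed
have "abs (el (red1 M rs j b) i) <= Y+3*(G*(r*Y))*r"
proof (cases "i < M")
 case True
 hence "abs (el (red1 M rs j b) i) <= abs (el b i)+abs (redc M rs j b*el (rw rs j) i)" by (simp add: red1_def)
 also have "... <= Y+3*(G*(r*Y))*r" unfolding abs_mult using b c rw by (intro add_mono mult_mono) (auto simp: G0 r Y order_trans[OF _ r] order_trans[OF _ Y])
 finally show ?thesis .
next
 case False
 have "0 <= 3*(G*(r*Y))*r" using G0 r Y by simp
 thus ?thesis using False Y by (simp add: red1_def nthd_def[of "0::int"] mk_def)
qed
also have "... = Y*(1+3*(m*m*(Q*r^3)))" by (simp add: G_def algebra_simps power3_eq_cube)
also have "... <= Y*(8*(2^(2*M)*(Q*r^3)))"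
proof (rule mult_left_mono)
 have "m*m <= 2^M*2^M" unfolding m_def by (intro mult_mono) (auto simp: less_imp_le)
 hence "m*m <= 2^(2*M)" by (simp add: mult_2 power_add)
 hence "m*m*(Q*r^3) <= 2^(2*M)*(Q*r^3)" using Q r by (intro mult_right_mono) auto
 moreover have "1*(1*1) <= (2^(2*M)*(Q*r^3) :: int)" using Q r by (intro mult_mono one_le_power) auto
 ultimately show "1+3*(m*m*(Q*r^3)) <= 8*(2^(2*M)*(Q*r^3))" by linarith
qed (use Y in simp)
also have "8*(2^(2*M)*(Q*r^3)) = 2^(3+2*M+projsz M rs+3*isize rs)" by (simp add: power_add Q_def r_def power_mult[symmetric] mult.commute[of 3])
finally show ?thesis .
qed

lemma PT_red [PT_rules]: assumes "PT D M" "pb D M" "PT D rs" "PT D b" shows "PT D (%x. red (M x) (rs x) (b x))" unfolding red_def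
proof (rule PT_fold_dom[where E = "ext D (%_. UNIV)" and h = "%x. red1 (M x) (rs x)" and
 M = "%x. M x*(3*(isize (b x)+length (rs x)*(3+2*M x+projsz (M x) (rs x)+3*isize (rs x))+1)+10)"])
show "PT D (%x. rev [0..<length (rs x)])" by (intro assms PT_rules)
show "PT D (%x. mk (M x) (el (b x)))" by (intro assms PT_rules)
show "PT (ext D (%_. UNIV)) (%z. red1 (M (fst z)) (rs (fst z)) (fst (snd z)) (snd (snd z)))" by (intro assms(1,3,4) assms(2) PT_rules)
show "pb D (%x. M x*(3*(isize (b x)+length (rs x)*(3+2*M x+projsz (M x) (rs x)+3*isize (rs x))+1)+10))" by (intro PT_size assms PT_rules)
fix p x i assume "i <= length (rev [0..<length (rs x)])"
hence i: "i <= length (rs x)" by simp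
define T where "T = 3+2*M x+projsz (M x) (rs x)+3*isize (rs x)"
have A: "length (fold (red1 (M x) (rs x)) js y) = M x & (ALL i. abs (el (fold (red1 (M x) (rs x)) js y) i) <= Y*2^(length js*T))"
 if "length y = M x" "ALL i. abs (el y i) <= Y" "1 <= Y" for js y Y using that
proof (induction js arbitrary: y Y)
 case (Cons j js)
 have "1*1 <= Y*2^T" using Cons.prems(3) by (intro mult_mono) auto
 moreover have "length (red1 (M x) (rs x) j y) = M x" by (simp add: red1_def)
 moreover have "ALL i. abs (el (red1 (M x) (rs x) j y) i) <= Y*2^T" using red1_le[of y Y "M x" "rs x" j] Cons.prems by (simp add: T_def)
 ultimately show ?case using Cons.IH[of "red1 (M x) (rs x) j y" "Y*2^T"] by (simp add: power_add mult.assoc)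
qed simp
let ?s = "fold (red1 (M x) (rs x)) (take i (rev [0..<length (rs x)])) (mk (M x) (el (b x)))"
have li: "length (take i (rev [0..<length (rs x)])) = i" using i by simp
have "ALL i. abs (el (mk (M x) (el (b x))) i) <= 2^isize (b x)"
proof
 fix i
 have "abs (el (mk (M x) (el (b x))) i) <= abs (el (b x) i)" by (cases "i < M x") (simp, simp add: nthd_def)
 thus "abs (el (mk (M x) (el (b x))) i) <= 2^isize (b x)" using abs_el_le order_trans by blast
qed
from A[OF length_mk this, of "take i (rev [0..<length (rs x)])"] have s: "length ?s = M x" "!!j. abs (el ?s j) <= 2^isize (b x)*2^(i*T)" using li by (simp_all add: mult_ac)
hence "abs (el ?s j) <= 2^(isize (b x)+length (rs x)*T)" for j using order_trans[OF s(2)[of j], of "2^(isize (b x)+length (rs x)*T)"] i by (simp add: power_add)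
hence "isize ?s <= M x*(3*size_int (2^(isize (b x)+length (rs x)*T))+10)" using s(1) by (intro isize_vec) auto
thus "isize ?s <= M x*(3*(isize (b x)+length (rs x)*(3+2*M x+projsz (M x) (rs x)+3*isize (rs x))+1)+10)" by (simp add: T_def size_int_pow2)
qed (auto simp: ext_def)

lemma DD_take: "DD M (take i bs) <= DD M bs"
proof (cases "i <= length bs")
case True
hence s: "{..<length bs} = {..<i} \<union> {i..<length bs}" by auto
have "1 <= dl M (take (Suc j) bs)" for j using dl_pos[of M "take (Suc j) bs"] by simp
hence "1 <= (PROD j:{i..<length bs}. dl M (take (Suc j) bs))" by (intro prod_ge_1) auto
moreover have d: "DD M (take i bs) = (PROD j<i. dl M (take (Suc j) bs))" using True unfolding DD_def by (intro prod.cong) (auto simp: min_def)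
moreover have "DD M bs = (PROD j<i. dl M (take (Suc j) bs))*(PROD j:{i..<length bs}. dl M (take (Suc j) bs))" unfolding DD_def s by (rule prod.union_disjoint) auto
ultimately show ?thesis using DD_pos[of M "take i bs"] mult_left_mono[of 1 _ "DD M (take i bs)"] by simp
qed simp

definition lllsz where "lllsz M bs = length bs*(3*(M*(3*size_int ((int (length bs)+1)*DD M bs)+10))+10)"

lemma length_szred_row: "k < length bs ==> length (rw (szred M bs) k) = M"
proof (induction bs rule: rev_induct)
case (snoc b bs)
thus ?case using red_props(3)[OF refl, of M "szred M bs" b] by (auto simp: szred_snoc nthd_def nth_append)
qed simp

lemma isize_szred: "isize (szred M bs) <= lllsz M bs" unfolding lllsz_def
proof (rule isize_list_le')
fix x assume "x : set (szred M bs)"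
then obtain k where k: "k < length bs" "x = rw (szred M bs) k" by (auto simp: in_set_conv_nth nthd_def)
show "isize x <= M*(3*size_int ((int (length bs)+1)*DD M bs)+10)" unfolding k(2) by (rule isize_vec) (use k length_szred_row[OF k(1), of M] szred_bound[of k bs _ M] in auto)
qed simp

lemma PT_DD [PT_rules]: assumes "PT D M" "pb D M" "PT D bs" shows "PT D (%x. DD (M x) (bs x))" unfolding DD_def dl_def by (intro assms PT_rules)

lemma lllsz_mono: "length bs' <= length bs ==> DD M bs' <= DD M bs ==> lllsz M bs' <= lllsz M bs"
proof -
assume a: "length bs' <= length bs" "DD M bs' <= DD M bs"
have "(int (length bs')+1)*DD M bs' <= (int (length bs)+1)*DD M bs" using a DD_pos[of M bs'] by (intro mult_mono) auto
moreover have "0 <= (int (length bs')+1)*DD M bs'" using DD_pos[of M bs'] by simp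
ultimately have "size_int ((int (length bs')+1)*DD M bs') <= size_int ((int (length bs)+1)*DD M bs)" by (intro size_int_mono) simp
thus ?thesis unfolding lllsz_def using a(1) by (intro add_mono mult_mono) auto
qed

lemma pb_lllsz [PT_rules]: assumes "PT D M" "pb D M" "PT D bs" shows "pb D (%x. lllsz (M x) (bs x))"
proof -
have "PT D (%x. (int (length (bs x))+1)*DD (M x) (bs x))" by (intro assms PT_rules)
from PT_size[OF this] have "pb D (%x. size_int ((int (length (bs x))+1)*DD (M x) (bs x)))" by simp
thus ?thesis unfolding lllsz_def by (intro pb_intros assms pb_length)
qed

lemma PT_szred [PT_rules]: assumes "PT D M" "pb D M" "PT D bs" shows "PT D (%x. szred (M x) (bs x))" unfolding szred_def
proof (rule PT_fold_dom[where E = "ext D (%_. UNIV)" and M = "%x. lllsz (M x) (bs x)" and h = "%x b rs. rs @ [red (M x) rs b]"])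
show "PT (ext D (%_. UNIV)) (%z. snd (snd z) @ [red (M (fst z)) (snd (snd z)) (fst (snd z))])" by (intro assms(1) assms(2) PT_rules)
show "pb D (%x. lllsz (M x) (bs x))" by (intro pb_lllsz assms)
fix p x i
show "isize (fold (%b rs. rs @ [red (M x) rs b]) (take i (bs x)) []) <= lllsz (M x) (bs x)"
 unfolding szred_def[symmetric] by (rule order_trans[OF isize_szred lllsz_mono]) (auto simp: DD_take)
qed (use assms in "auto simp: ext_def intro: PT_const")

lemma PT_swaps [PT_rules]: assumes "PT D M" "pb D M" "PT D bs" shows "PT D (%x. swaps (M x) (bs x))" unfolding swaps_def by (intro assms PT_rules)

lemma PT_lllstep [PT_rules]: assumes "PT D M" "pb D M" "PT D bs" shows "PT D (%x. lllstep (M x) (bs x))" unfolding lllstep_def by (intro assms PT_rules)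

lemma isize_swp: "Suc i < length rs ==> (!!x. x : set rs ==> isize x <= e) ==> isize (swp rs i) <= length rs*(3*e+10)"
proof (rule isize_list_le')
fix x assume i: "Suc i < length rs" and e: "!!x. x : set rs ==> isize x <= e" and "x : set (swp rs i)"
hence "x : set rs" unfolding swp_eq[OF i] using set_take_subset[of i rs] set_drop_subset[of "Suc (Suc i)" rs] by (auto simp: nthd_def)
thus "isize x <= e" by (rule e)
qed simp

lemma isize_lllstep: "isize (lllstep M bs) <= max (isize bs) (lllsz M bs)"
proof (cases "swaps M (szred M bs) = []")
case False
let ?i = "nthd 0 (swaps M (szred M bs)) 0"
have "isize (swp (szred M bs) ?i) <= length (szred M bs)*(3*(M*(3*size_int ((int (length bs)+1)*DD M bs)+10))+10)"
proof (rule isize_swp)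
 show "Suc ?i < length (szred M bs)" using swaps_hd[OF False] by blast
 fix x assume "x : set (szred M bs)"
 then obtain k where k: "k < length bs" "x = rw (szred M bs) k" by (auto simp: in_set_conv_nth nthd_def)
 show "isize x <= M*(3*size_int ((int (length bs)+1)*DD M bs)+10)" unfolding k(2) by (rule isize_vec) (use k length_szred_row[OF k(1), of M] szred_bound[of k bs _ M] in auto)
qed
thus ?thesis using False by (simp add: lllstep_def lllsz_def)
qed (simp add: lllstep_def)

lemma PT_lll [PT_rules]: assumes "PT D M" "pb D M" "PT D bs" shows "PT D (%x. lll (M x) (bs x))"
proof -
have l: "PT D (%x. size_int (DD (M x) (bs x)))" "pb D (%x. size_int (DD (M x) (bs x)))" using PT_size_int[OF PT_DD[OF assms]] PT_size[OF PT_DD[OF assms]] by simp_all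
have "PT D (%x. (lllstep (M x) ^^ (3*size_int (DD (M x) (bs x)))) (bs x))"
proof (rule PT_iter_dom[where E = "ext D (%_. UNIV)" and M = "%x. max (isize (bs x)) (lllsz (M x) (bs x))"])
 show "PT D (%x. 3*size_int (DD (M x) (bs x)))" by (intro l PT_rules)
 show "pb D (%x. 3*size_int (DD (M x) (bs x)))" by (intro pb_intros l)
 show "PT (ext D (%_. UNIV)) (%z. lllstep (M (fst z)) (snd z))" by (intro assms(1) assms(2) PT_rules)
 show "pb D (%x. max (isize (bs x)) (lllsz (M x) (bs x)))" by (intro assms PT_size PT_rules)
 fix p x i
 let ?s = "%i. (lllstep (M x) ^^ i) (bs x)"
 show "isize (?s i) <= max (isize (bs x)) (lllsz (M x) (bs x))"
 proof (induction i)
  case (Suc i)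
  have "lllsz (M x) (?s i) <= lllsz (M x) (bs x)" by (intro lllsz_mono) (simp_all add: lll_iter)
  thus ?case using Suc isize_lllstep[of "M x" "?s i"] by simp
 qed simp
qed (use assms in "auto simp: ext_def")
thus ?thesis unfolding lll_def by (intro assms PT_rules)
qed

lemma PT_oth [PT_rules]: assumes "PT D vs" "PT D i" shows "PT D (%x. oth (vs x) (i x))" unfolding oth_def by (intro assms PT_rules)
lemma PT_gv [PT_rules]: assumes "PT D M" "pb D M" "PT D vs" "PT D i" shows "PT D (%x. gv (M x) (vs x) (i x))" unfolding gv_def by (intro assms PT_rules)
lemma PT_dn [PT_rules]: assumes "PT D M" "pb D M" "PT D vs" "PT D i" shows "PT D (%x. dn (M x) (vs x) (i x))" unfolding dn_def by (intro assms PT_rules)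
lemma PT_qry [PT_rules]: assumes "PT D M" "pb D M" "PT D vs" "PT D i" "PT D sg" shows "PT D (%x. qry (M x) (vs x) (i x) (sg x))" unfolding qry_def by (intro assms PT_rules)

text \<open>Discarding large answers makes the running time of the spanner independent of the correctness of the oracle.\<close>

definition clip where "clip M B vs = filter (%v. ALL j:set [0..<M]. abs (el v j) <= B) (map (%v. mk M (el v)) vs)"

lemma clip_size: "v : set (clip M B vs) ==> length v = M & (ALL j<M. abs (el v j) <= B)" by (auto simp: clip_def)

lemma PT_abs_le [PT_rules]: assumes "PT D f" "PT D g" shows "PT D (%x. abs (f x) <= (g x :: int))" unfolding abs_le_iff by (intro assms PT_rules)

lemma PT_clip [PT_rules]: assumes "PT D M" "pb D M" "PT D B" "PT D vs" shows "PT D (%x. clip (M x) (B x) (vs x))" unfolding clip_def by (intro assms PT_rules)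

text \<open>The running time rule for \<open>nthd\<close> needs a constant default, so the default
  \<open>vs\<close> is turned into a case distinction.\<close>

lemma spstep_eq: "spstep M orc vs = (if spcand M orc vs = [] then vs else nthd [] (spcand M orc vs) 0)" by (simp add: spstep_def nthd_def)

lemma PT_spn:
assumes M: "PT D M" "pb D M" and K: "PT D K" and N: "PT D N" "pb D N" and B: "PT D B"
 and orc: "PT (ext D (%_. UNIV)) (%z. orc (fst z) (snd z))"
shows "PT D (%x. spn (M x) (K x) (N x) (%q. clip (M x) (B x) (orc x q)))" unfolding spn_def
proof (rule PT_iter_dom[where E = "ext D (%_. UNIV)" and
 M = "%x. M x*(3*(size_int (K x)+(size_int 1+size_int (B x))+3*(M x*(3*(size_int 1+size_int (B x))+10))+10)+10)"])
show "PT D (%x. sinit (M x) (K x))" unfolding sinit_def by (intro M K M(1) M(2) PT_rules)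
have o: "PT (ext (ext D A) C) (%z. clip (M (fst (fst z))) (B (fst (fst z))) (orc (fst (fst z)) (q z)))" if "PT (ext (ext D A) C) q" for A C q
proof -
 have "PT (ext (ext D A) C) (%z. (fst (fst z), q z))" by (intro that PT_rules)
 from PT_comp[OF orc this] have "PT (ext (ext D A) C) (%z. orc (fst (fst z)) (q z))" by (auto simp: ext_def)
 thus ?thesis by (intro M(1) M(2) B PT_rules)
qed
show "PT (ext D (%_. UNIV)) (%z. spstep (M (fst z)) (%q. clip (M (fst z)) (B (fst z)) (orc (fst z) q)) (snd z))" unfolding spstep_eq spcand_def by (intro o M(1) M(2) PT_rules)
have "pb D (%x. size_int (K x))" "pb D (%x. size_int (B x))" using PT_size[OF K] PT_size[OF B] by simp_all
thus "pb D (%x. M x*(3*(size_int (K x)+(size_int 1+size_int (B x))+3*(M x*(3*(size_int 1+size_int (B x))+10))+10)+10))" by (intro pb_intros M)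
fix p x i
let ?orc = "%q. clip (M x) (B x) (orc x q)"
have "length ((spstep (M x) ?orc ^^ i) (sinit (M x) (K x))) = M x & (ALL (v, t) : set ((spstep (M x) ?orc ^^ i) (sinit (M x) (K x))).
  length v = M x & (ALL j. abs (el v j) <= max 1 (abs (B x))) & (t = K x | t = el v 0))" (is "?P ((spstep (M x) ?orc ^^ i) (sinit (M x) (K x)))")
proof (induction i)
 case 0
 have "abs (el (mk (M x) (%j. if j = k then 1 else 0)) j) <= max 1 (abs (B x))" for j k by (simp add: nthd_def[of "0::int"] mk_def le_max_iff_disj)
 thus ?case by (simp add: sinit_def mk_def)
next
 case (Suc i)
 let ?s = "(spstep (M x) ?orc ^^ i) (sinit (M x) (K x))"
 show ?case
 proof (cases "spcand (M x) ?orc ?s = []")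
  case True
  hence "spstep (M x) ?orc ?s = ?s" by (simp add: spstep_eq)
  thus ?thesis using Suc by simp
 next
  case False
  hence "spstep (M x) ?orc ?s : set (spcand (M x) ?orc ?s)" unfolding spstep_eq by (simp only: if_False) (simp add: nthd_def)
  then obtain k v l where v: "v : set (?orc l)" "spstep (M x) ?orc ?s = ?s[k := (v, el v 0)]" by (auto simp: spcand_def)
  have Bv: "abs (el v j) <= max 1 (abs (B x))" for j using clip_size[OF v(1)] by (cases "j < M x") (auto simp: nthd_def[of "0::int"] le_max_iff_disj intro: order_trans[OF _ abs_ge_self])
  let ?Q = "%y. length (fst y) = M x & (ALL j. abs (el (fst y) j) <= max 1 (abs (B x))) & (snd y = K x | snd y = el (fst y) 0)"
  have "ALL y:set ?s. ?Q y" using Suc by (simp add: case_prod_beta)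
  moreover have "?Q (v, el v 0)" using Bv clip_size[OF v(1)] by simp
  ultimately have "ALL y:set (?s[k := (v, el v 0)]). ?Q y" using set_update_subset_insert[of ?s k "(v, el v 0)"] by blast
  thus ?thesis using v(2) Suc by (simp add: case_prod_beta)
 qed
qed
hence s: "?P ((spstep (M x) ?orc ^^ i) (sinit (M x) (K x)))" .
have mx: "size_int (max 1 (abs (B x))) <= size_int 1+size_int (B x)" by (simp add: max_def size_int_mono)
show "isize ((spstep (M x) ?orc ^^ i) (sinit (M x) (K x))) <=
  M x*(3*(size_int (K x)+(size_int 1+size_int (B x))+3*(M x*(3*(size_int 1+size_int (B x))+10))+10)+10)"
proof (rule isize_list_le')
 fix y assume "y : set ((spstep (M x) ?orc ^^ i) (sinit (M x) (K x)))"
 then obtain v t where y: "y = (v, t)" "length v = M x" "ALL j. abs (el v j) <= max 1 (abs (B x))" "t = K x | t = el v 0" using s by (cases y) auto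
 have "isize v <= M x*(3*size_int (max 1 (abs (B x)))+10)" using y by (intro isize_vec) auto
 also have "... <= M x*(3*(size_int 1+size_int (B x))+10)" using mx by (intro mult_mono) auto
 finally have v: "isize v <= M x*(3*(size_int 1+size_int (B x))+10)" .
 have "size_int t <= size_int (K x)+(size_int 1+size_int (B x))" using y(3)[rule_format, of 0] y(4) mx size_int_mono[of t "max 1 (abs (B x))"] by (auto simp: max_def)
 thus "isize y <= size_int (K x)+(size_int 1+size_int (B x))+3*(M x*(3*(size_int 1+size_int (B x))+10))+10" using v isize_pair[of v t] y(1) by simp
qed (use s in simp)
qed (use N in "auto simp: ext_def")

section \<open>Linear images of lattices and spans\<close>

lemma nsq_0_iff: "nsq n bs b = 0 <-> (ALL i<n. pj n bs (ra b) i = 0)" by (simp add: nsq_def rip_eq_0)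

lemma grm_pos_iff: "grm n bs > 0 <-> (ALL k<length bs. nsq n (take k bs) (rw bs k) ~= 0)"
proof -
have "grm n bs > 0 <-> grm n bs ~= 0" using grm_nonneg[of n bs] by linarith
thus ?thesis by (auto simp: grm_def nthd_def)
qed

text \<open>Membership in a span is restated by orthogonal test vectors; in this form it passes
  through linear maps by transposition.\<close>

lemma span_iff: "(ALL i<n. pj n bs v i = 0) <-> (ALL g. (ALL b:set bs. rip n (ra b) g = 0) --> rip n v g = 0)"
proof (intro iffI allI impI)
fix g assume "ALL i<n. pj n bs v i = 0" and g: "ALL b:set bs. rip n (ra b) g = 0"
moreover have "rip n v g = rip n v (pj n bs g)" by (intro rip_cong pj_fix[symmetric]) (use g in auto)
ultimately show "rip n v g = 0" unfolding pj_sym[symmetric] by (simp add: rip_zero_left)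
next
fix i assume a: "ALL g. (ALL b:set bs. rip n (ra b) g = 0) --> rip n v g = 0" and "i < n"
thus "pj n bs v i = 0" using a[rule_format, of "pj n bs v"] pj_ker pj_norm[of n bs v] by (auto simp: rip_eq_0)
qed

lemma rip_lin: "rip m (%i. SUM j<p. B i j*v j) g = rip p v (%j. SUM i<m. B i j*g i)"
unfolding rip_def sum_distrib_left sum_distrib_right by (subst sum.swap) (intro sum.cong, simp_all add: mult_ac)

lemma lin_span:
assumes U: "!!u. u : set U ==> EX w:set W. ALL i<m. ra w i = (SUM j<p. B i j*ra u j)"
 and v: "ALL i<p. pj p U v i = 0" and w: "!!i. i < m ==> w i = (SUM j<p. B i j*v j)"
shows "ALL i<m. pj m W w i = 0" unfolding span_iff
proof (intro allI impI)
fix g assume g: "ALL b:set W. rip m (ra b) g = 0"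
have "rip p (ra u) (%j. SUM i<m. B i j*g i) = 0" if uU: "u : set U" for u
proof -
 obtain w' where w': "w' : set W" "ALL i<m. ra w' i = (SUM j<p. B i j*ra u j)" using U[OF uU] by blast
 hence "rip m (ra w') g = rip m (%i. SUM j<p. B i j*ra u j) g" by (intro rip_cong) auto
 thus ?thesis using g w' by (simp add: rip_lin)
qed
hence "rip p v (%j. SUM i<m. B i j*g i) = 0" using v unfolding span_iff by blast
hence "rip m (%i. SUM j<p. B i j*v j) g = 0" by (simp add: rip_lin)
thus "rip m w g = 0" using w rip_cong[of m w "%i. SUM j<p. B i j*v j" g g] by simp
qed

text \<open>A dependency among the vectors of \<open>U\<close> would be mapped to one among their
  images. It is applied to the change of coordinates at a node in both directions.\<close>

lemma grm_lin:
assumes len: "length W = length U" and im: "!!k i. k < length U ==> i < m ==> ra (rw W k) i = (SUM j<p. B i j*ra (rw U k) j)"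
 and g: "grm m W > 0"
shows "grm p U > 0" unfolding grm_pos_iff
proof (intro allI impI notI)
fix k assume k: "k < length U" and 0: "nsq p (take k U) (rw U k) = 0"
have "ALL i<m. pj m (take k W) (ra (rw W k)) i = 0"
proof (rule lin_span)
 show "ALL i<p. pj p (take k U) (ra (rw U k)) i = 0" using 0 by (simp add: nsq_0_iff)
 show "ra (rw W k) i = (SUM j<p. B i j*ra (rw U k) j)" if "i < m" for i using im k that by simp
 fix u assume "u : set (take k U)"
 then obtain l where l: "l < k" "u = rw U l" using k by (auto simp: in_set_conv_nth nthd_def)
 hence "rw W l : set (take k W)" using k len by (auto simp: in_set_conv_nth nthd_def intro!: exI[of _ l])
 thus "EX w:set (take k W). ALL i<m. ra w i = (SUM j<p. B i j*ra u j)" using im l k by (intro bexI[of _ "rw W l"]) auto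
qed
thus False using g len k unfolding grm_pos_iff nsq_0_iff by auto
qed

lemma nthd_Suc: "nthd d (x # xs) (Suc k) = nthd d xs k" by (simp add: nthd_def)

lemma zs_lin_aux:
assumes "length W = length U" "!!k i. k < length U ==> i < m ==> el (rw W k) i = (SUM j<p. B i j*el (rw U k) j)"
shows "(ALL w. zs m W w --> (EX v. zs p U v & (ALL i<m. w i = (SUM j<p. B i j*v j)))) &
 (ALL v. zs p U v --> zs m W (%i. SUM j<p. B i j*v j))" using assms
proof (induction W U rule: list_induct2)
case Nil
thus ?case by (auto intro!: exI[of _ "%_. 0"])
next
case (Cons a W u U)
have h: "el a i = (SUM j<p. B i j*el u j)" if "i < m" for i using Cons.prems[of 0 i] that by (simp add: nthd_def)
have t: "el (rw W k) i = (SUM j<p. B i j*el (rw U k) j)" if "k < length U" "i < m" for k i using Cons.prems[of "Suc k" i] that by (simp add: nthd_Suc)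
note IH = Cons.IH[OF t]
have "EX v. zs p (u # U) v & (ALL i<m. w i = (SUM j<p. B i j*v j))" if z: "zs m (a # W) w" for w
proof -
 obtain c where "zs m W (%i. w i - c*el a i)" using z by auto
 with IH obtain v where v: "zs p U v" "!!i. i < m ==> w i - c*el a i = (SUM j<p. B i j*v j)" by blast
 have "w i = (SUM j<p. B i j*(v j+c*el u j))" if "i < m" for i using v(2)[OF that] h[OF that] by (simp add: distrib_left sum.distrib sum_distrib_left mult_ac)
 moreover have "zs p (u # U) (%j. v j+c*el u j)" using v(1) by (auto intro!: exI[of _ c])
 ultimately show ?thesis by blast
qed
moreover have "zs m (a # W) (%i. SUM j<p. B i j*v j)" if z: "zs p (u # U) v" for v
proof -
 obtain c where "zs p U (%i. v i - c*el u i)" using z by auto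
 with IH have "zs m W (%i. SUM j<p. B i j*(v j - c*el u j))" by simp
 hence "zs m W (%i. (SUM j<p. B i j*v j) - c*el a i)" by (rule zs_cong[THEN iffD1, rotated]) (simp add: h right_diff_distrib sum_subtractf sum_distrib_left mult_ac)
 thus ?thesis by auto
qed
ultimately show ?case by blast
qed

lemma zs_lin:
assumes "length W = length U" "!!k i. k < length U ==> i < m ==> el (rw W k) i = (SUM j<p. B i j*el (rw U k) j)"
shows "zs m W w ==> EX v. zs p U v & (ALL i<m. w i = (SUM j<p. B i j*v j))"
 "zs p U v ==> zs m W (%i. SUM j<p. B i j*v j)" using zs_lin_aux[OF assms] by blast+

lemma zs_trans: "(!!b. b : set V ==> zs n U (el b)) ==> zs n V w ==> zs n U w"
proof (induction V arbitrary: w)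
case Nil
thus ?case using zs_zero[of n U] zs_cong[of n w "%_. 0" U] by simp
next
case (Cons b V)
then obtain c where "zs n V (%i. w i - c*el b i)" by auto
hence "zs n U (%i. (w i - c*el b i)+c*el b i)" using Cons by (intro zs_add zs_scale) auto
thus ?case by simp
qed

section \<open>Spanners of polytopes\<close>

definition spK where "spK M B = 2*B*(PROD i<M. 1+int M*(B*B))"
definition spN where "spN M B R = M*(size_int (spK M B)+size_int (int M*(R*R)))"
definition slp where "slp M n rs R = spn M (spK M (Del n rs)) (spN M (Del n rs) R) (%l. clip M (Del n rs) (lp n rs (mk M (el l))))"

lemma rip_prefix:
assumes "!!i. m <= i ==> el b i = 0" "m <= n" shows "rip n (ra b) x = rip m (ra b) x" unfolding rip_def using assms by (intro sum.mono_neutral_right) auto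

lemma el_len: "length b <= i ==> el b i = 0" by (simp add: nthd_def)

text \<open>Boundedness in homogeneous form: no nonzero solution lies at infinity. Like the box
  condition, it is inherited when rows are added, so slices need no new argument.\<close>

definition ball_lp where "ball_lp n rs <-> (ALL x. ker n rs x --> nn n x --> x 0 = 0 --> (ALL i<n. x i = 0))"
definition box_lp where "box_lp n rs M R <-> (ALL x. ker n rs x --> nn n x --> (ALL i<M. x i <= ri R*x 0))"

lemma ker_append: "ker n (as @ bs) x <-> ker n as x & ker n bs x" by (auto simp: ker_def)
lemma ball_lp_append: "ball_lp n as ==> ball_lp n (as @ bs)" by (simp add: ball_lp_def ker_append)
lemma box_lp_append: "box_lp n as M R ==> box_lp n (as @ bs) M R" by (simp add: box_lp_def ker_append)

text \<open>The point is an average of vertices, and a functional cannot be smaller at all of them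
  than at their average.\<close>

lemma lp_vert:
assumes b: "ball_lp n rs" and n: "0 < n" and x: "ker n rs x" "nn n x" "x 0 = 1" and M: "M <= n"
shows "EX v. ielem n rs v & 0 < el v 0 & rip M g x <= rip M g (%j. ra v j/ra v 0)"
proof (rule ccontr)
assume a: "~ ?thesis"
obtain L where L: "ALL (t, v):set L. t > 0 & ielem n rs v" "ALL i<n. x i = (SUM (t, v)<-L. t*ra v i)" using decomp[OF x(1,2)] by (auto simp: case_prod_beta)
have pos: "0 < el v 0" if v: "ielem n rs v" for v
proof (rule ccontr)
 assume "~ 0 < el v 0"
 hence "ra v 0 = 0" using ielem_pos[OF v n] by simp
 moreover have "elem n rs (ra v)" using v by (simp add: ielem_def)
 ultimately have "ALL i<n. ra v i = 0" using b unfolding ball_lp_def by (auto dest: elemD)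
 thus False using elemD(3)[OF \<open>elem n rs (ra v)\<close>] by auto
qed
have "rip M g (ra v) < ra v 0*rip M g x" if v: "ielem n rs v" for v
proof -
 have "rip M g (%j. ra v j/ra v 0) < rip M g x" using a pos[OF v] v by (auto simp: not_le)
 moreover have "rip M g (%j. ra v j/ra v 0) = rip M g (ra v)/ra v 0" using rip_scale_right[of M g "1/ra v 0" "ra v"] by simp
 ultimately show ?thesis using pos[OF v] by (simp add: pos_divide_less_eq mult.commute)
qed
hence lt: "ALL (t, v):set L. t*rip M g (ra v) < t*ra v 0*rip M g x" using L(1) by auto
have "rip M g x = rip M g (%i. SUM (t, v)<-L. t*ra v i)" using L(2) M by (intro rip_cong) auto
also have "... = (SUM (t, v)<-L. t*rip M g (ra v))" by (induction L) (auto simp: rip_add_right rip_scale_right, simp add: rip_def)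
finally have 1: "rip M g x = (SUM (t, v)<-L. t*rip M g (ra v))" .
have "1 = (SUM (t, v)<-L. t*ra v 0)" using L(2) n x(3) by auto
moreover have "(SUM (t, v)<-L. t*ra v 0*rip M g x) = (SUM (t, v)<-L. t*ra v 0)*rip M g x" by (induction L) (auto simp: distrib_right)
ultimately have 2: "rip M g x = (SUM (t, v)<-L. t*ra v 0*rip M g x)" by simp
have "L ~= []" using L(2) n x(3) by auto
hence "(SUM (t, v)<-L. t*rip M g (ra v)) < (SUM (t, v)<-L. t*ra v 0*rip M g x)" using lt
proof (induction L rule: list_nonempty_induct)
 case (cons y xs)
 thus ?case by (cases y) (simp add: add_strict_mono)
qed auto
thus False using 1 2 by simp
qed

definition good_lp where "good_lp M n rs v <-> (EX v'. v = mk M (el v') & ielem n rs v' & 0 < el v' 0)"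
definition X_lp where "X_lp M n rs = {x. EX x'. (ALL j<M. x j = x' j) & ker n rs x' & nn n x' & x' 0 = 1}"

lemma ielem_point: "ielem n rs v ==> 0 < el v 0 ==> ker n rs (%j. ra v j/ra v 0) & nn n (%j. ra v j/ra v 0)"
proof -
assume v: "ielem n rs v" "0 < el v 0"
hence "elem n rs (ra v)" by (simp add: ielem_def)
hence "ker n rs (ra v)" "nn n (ra v)" by (auto dest: elemD)
thus ?thesis using ker_scale[of n rs "ra v" "1/ra v 0"] v(2) by (simp add: nn_def)
qed

text \<open>Shared by the continuous and the mixed integer case: the points live in \<open>N\<close>
  coordinates but the spanner only in the first \<open>M\<close>, so queries are padded by zeros and
  answers are truncated.\<close>

lemma spanner_proj:
assumes M: "0 < M" "M <= N" and RD: "1 <= R" "1 <= D"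
 and good: "!!v. G v ==> 0 < el v 0 & P (%j. ra v j/ra v 0)" "!!v j. G v ==> j < N ==> 0 <= el v j & el v j <= D"
 and box: "!!x. P x ==> x 0 = 1 & (ALL j<M. x j <= ri R)"
 and orc: "!!l. (f l = [] & (ALL x. P x --> rip N (ra l) x < 0)) | (EX v. f l = [v] & G v & 0 <= rip N (ra l) (ra v))"
 and vert: "!!x g. P x ==> EX v. G v & rip M g x <= rip M g (%j. ra v j/ra v 0)"
shows "spanner M (%l. clip M D (f (mk M (el l)))) {x. EX x'. (ALL j<M. x j = x' j) & P x'} D R (spK M D) (%v. EX v'. v = mk M (el v') & G v')"
proof
show "0 < M" "1 <= R" "1 <= D" by fact+
show "2*D*(1+int M*D^2)^M <= spK M D" by (simp add: spK_def power2_eq_square)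
fix v assume "EX v'. v = mk M (el v') & G v'"
then obtain v' where v: "v = mk M (el v')" "G v'" by blast
note g = good(1)[OF v(2)]
show "0 < el v 0" using v g M by simp
show "(%j. ra v j/ra v 0) : {x. EX x'. (ALL j<M. x j = x' j) & P x'}" using g v(1) M by (intro CollectI exI[of _ "%j. ra v' j/ra v' 0"]) auto
fix j assume j: "j < M"
show "abs (el v j) <= D" using v j M good(2)[OF v(2), of j] by simp
have "ra v' j/ra v' 0 <= ri R" using g box j by blast
then have "ra v' j <= ri R*ra v' 0" using g by (simp add: pos_divide_le_eq)
then have "el v' j <= R*el v' 0" by (simp flip: of_int_mult)
then show "abs (el v j) <= R*el v 0" using v j M good(2)[OF v(2), of j] by simp
next
fix l
have r: "rip N (ra (mk M (el l))) x = rip M (ra l) x" for x using rip_prefix[of M "mk M (el l)" N x] M(2) rip_cong[of M "ra (mk M (el l))" "ra l" x x] by (simp add: el_len)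
from orc[of "mk M (el l)", unfolded r]
show "(clip M D (f (mk M (el l))) = [] & (ALL x:{x. EX x'. (ALL j<M. x j = x' j) & P x'}. rip M (ra l) x < 0)) |
 (EX v. clip M D (f (mk M (el l))) = [v] & (EX v'. v = mk M (el v') & G v') & 0 <= rip M (ra l) (ra v))"
proof
 assume o: "f (mk M (el l)) = [] & (ALL x. P x --> rip M (ra l) x < 0)"
 have "rip M (ra l) x < 0" if x: "ALL j<M. x j = x' j" "P x'" for x x'
 proof -
  have "rip M (ra l) x = rip M (ra l) x'" using x by (intro rip_cong) auto
  moreover have "rip M (ra l) x' < 0" using o x by blast
  ultimately show ?thesis by linarith
 qed
 then show ?thesis using o by (auto simp: clip_def)
next
 assume "EX v. f (mk M (el l)) = [v] & G v & 0 <= rip M (ra l) (ra v)"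
 then obtain v where v: "f (mk M (el l)) = [v]" "G v" "0 <= rip M (ra l) (ra v)" by blast
 have "abs (el v j) <= D" if "j < M" for j using good(2)[OF v(2), of j] that M by simp
 then have "clip M D [v] = [mk M (el v)]" by (simp add: clip_def)
 moreover have "rip M (ra l) (ra (mk M (el v))) = rip M (ra l) (ra v)" by (intro rip_cong) auto
 ultimately show ?thesis using v by auto
qed
next
fix x g assume "x : {x. EX x'. (ALL j<M. x j = x' j) & P x'}"
then obtain x' where x': "ALL j<M. x j = x' j" "P x'" by blast
show "x 0 = 1" using x' M box by simp
obtain v where v: "G v" "rip M g x' <= rip M g (%j. ra v j/ra v 0)" using vert[OF x'(2)] by blast
have "rip M g x = rip M g x'" "rip M g (%j. ra (mk M (el v)) j/ra (mk M (el v)) 0) = rip M g (%j. ra v j/ra v 0)" using x' M by (auto intro!: rip_cong)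
then show "EX v. (EX v'. v = mk M (el v') & G v') & rip M g x <= rip M g (%j. ra v j/ra v 0)" using v by (intro exI[of _ "mk M (el v)"]) auto
qed

lemma slp_spanner:
assumes b: "ball_lp n rs" and box: "box_lp n rs M R" and M: "0 < M" "M <= n" and R: "1 <= R"
shows "spanner M (%l. clip M (Del n rs) (lp n rs (mk M (el l)))) (X_lp M n rs) (Del n rs) R (spK M (Del n rs)) (good_lp M n rs)" unfolding X_lp_def good_lp_def
proof (rule spanner_proj[OF M R Del_ge_1])
have n: "0 < n" using M by simp
show "0 < el v 0 & ker n rs (%j. ra v j/ra v 0) & nn n (%j. ra v j/ra v 0) & ra v 0/ra v 0 = 1" if "ielem n rs v & 0 < el v 0" for v using ielem_point that by auto
show "0 <= el v j & el v j <= Del n rs" if "ielem n rs v & 0 < el v 0" "j < n" for v j using ielem_pos that by (auto simp: ielem_def)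
show "x 0 = 1 & (ALL j<M. x j <= ri R)" if "ker n rs x & nn n x & x 0 = 1" for x using box that by (auto simp: box_lp_def)
show "EX v. (ielem n rs v & 0 < el v 0) & rip M g x <= rip M g (%j. ra v j/ra v 0)" if "ker n rs x & nn n x & x 0 = 1" for x g using lp_vert[OF b n _ _ _ M(2)] that by blast
fix l
show "(lp n rs l = [] & (ALL x. ker n rs x & nn n x & x 0 = 1 --> rip n (ra l) x < 0)) |
  (EX v. lp n rs l = [v] & (ielem n rs v & 0 < el v 0) & 0 <= rip n (ra l) (ra v))" using lp_correct[of n rs l] b n unfolding ball_lp_def by auto
qed

section \<open>Lenstra's algorithm\<close>

text \<open>These rows say that the first \<open>p\<close> variables differ from \<open>ob\<close>
  by a vector in the real span of \<open>U\<close>; they cut the polytope down to the affine hull of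
  the coset of a node.\<close>

definition eqr where "eqr p ob U = mk p (%i. (- ip p (rw (snd (proj p U)) i) ob) # mk p (el (rw (snd (proj p U)) i)))"
definition lreal where "lreal vs i <-> st vs i = el (sv vs i) 0"
definition lpi where "lpi M vs = (PROD i<M. dn M vs i)"
text \<open>A common scale: it clears the denominators of all barycentric coordinates and also those
  of the centroid of the real spanner points.\<close>

definition lth where "lth M vs = lpi M vs*max 1 (SUM i<M. if lreal vs i then 1 else 0)"
definition lE where "lE M vs i = mk M (%j. st vs i*(lth M vs div dn M vs i)*el (gv M vs i) j)"
text \<open>Scaled barycentric coordinates, with \<open>t = 1\<close> for points and
  \<open>t = 0\<close> for lattice directions.\<close>

definition lbv where "lbv M vs t v = mk M (%i. ip M (lE M vs i) (t # v))"
definition lT where "lT M vs = (PROD i<M. st vs i)"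
text \<open>The inverse of the passage to scaled barycentric coordinates; on images of integer
  vectors the division is exact.\<close>

definition lback where "lback M vs b = mk (M - 1) (%k. (SUM i<M. el b i*(el (sv vs i) (Suc k)*(lT M vs div st vs i))) div (lth M vs*lT M vs))"
text \<open>The centroid of the real spanner points: the scale divided by their number is
  \<open>lpi\<close>.\<close>

definition lcen where "lcen M vs = mk M (%i. if lreal vs i then lpi M vs else 0)"
text \<open>Nearest plane rounding of the offset between the coset and the centroid, modulo the
  reduced lattice.\<close>

definition lres where "lres M vs ob bs = red M bs (mk M (%i. el (lbv M vs 1 ob) i - el (lcen M vs) i))"
definition lz where "lz M vs ob bs = lback M vs (mk M (%i. el (lcen M vs) i+el (lres M vs ob bs) i))"
text \<open>The number of translates to be tried comes from the Cauchy-Schwarz estimate in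
  \<open>node_complete\<close>. It depends only on \<open>M = p + 1\<close>, hence is constant for
  fixed \<open>p\<close>.\<close>

definition lC where "lC M = 9*M*M*M*M*M*2^M+1"
text \<open>Fixing the coefficient of the last reduced vector splits the coset into translates of a
  sublattice of smaller rank; all coefficients from \<open>- lC M\<close> to \<open>lC M\<close> are
  tried.\<close>

definition lchild where "lchild M vs z bs = (if bs = [] then [] else
 map (%c. (mk (M - 1) (%k. el z k+(int c - int (lC M))*el (lback M vs (rw bs (length bs - 1))) k),
  map (lback M vs) (take (length bs - 1) bs))) [0..<2*lC M+1])"
definition lnode where "lnode p n rs R nd = (let vs = slp (Suc p) n (rs @ eqr p (fst nd) (snd nd)) R;
 bs = lll (Suc p) (map (lbv (Suc p) vs 0) (snd nd)); z = lz (Suc p) vs (fst nd) bs in (z, lchild (Suc p) vs z bs))"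

definition lfeas where "lfeas p n rs z <-> (EX x. ker n rs x & nn n x & x 0 = 1 & (ALL k<p. x (Suc k) = ri (z k)))"

lemma ker_eqr:
assumes "p < n"
shows "ker n (eqr p ob U) x <-> (ALL i<p. pj p U (%j. x (Suc j) - ra ob j*x 0) i = 0)"
proof -
have r: "rip n (ra (rw (eqr p ob U) i)) x = ri (dl p U)*pj p U (%j. x (Suc j) - ra ob j*x 0) i" if i: "i < p" for i
proof -
 let ?P = "rw (snd (proj p U)) i"
 have "rip n (ra (rw (eqr p ob U) i)) x = rip (Suc p) (ra (rw (eqr p ob U) i)) x" by (rule rip_prefix) (use assms i in "auto simp: eqr_def el_len")
 also have "... = - ri (ip p ?P ob)*x 0+(SUM j<p. ra ?P j*x (Suc j))" using i unfolding rip_def sum.lessThan_Suc_shift by (simp add: eqr_def nthd_Suc, simp add: nthd_def)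
 also have "... = (SUM j<p. ra ?P j*(x (Suc j) - ra ob j*x 0))" by (simp add: ip_def right_diff_distrib sum_subtractf sum_distrib_right mult.assoc)
 also have "... = ri (dl p U)*pj p U (%j. x (Suc j) - ra ob j*x 0) i" using dl_pos[of p U] by (simp add: pj_def pm_def)
 finally show ?thesis .
qed
have "ker n (eqr p ob U) x <-> (ALL i<p. rip n (ra (rw (eqr p ob U) i)) x = 0)"
proof -
 have "set rs = (%i. rw rs i) ` {..<length rs}" for rs :: "int list list" by (auto simp: in_set_conv_nth nthd_def image_iff)
 thus ?thesis unfolding ker_def by (auto simp: eqr_def)
qed
also have "... <-> (ALL i<p. pj p U (%j. x (Suc j) - ra ob j*x 0) i = 0)" using r dl_pos[of p U] by auto
finally show ?thesis .
qed

section \<open>A node of the search in barycentric coordinates\<close>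

locale lvs =
fixes p :: nat and M :: nat and vs :: sbase
assumes Mp: "M = Suc p" and len: "length vs = M" and grm: "grm M (map fst vs) > 0" and stp: "!!i. i < M ==> 0 < st vs i"
begin

abbreviation "Th == lth M vs"
definition "B i j = el (lE M vs i) (Suc j)"
definition "av (t::int) (v::nat => int) i = el (lE M vs i) 0*t+(SUM j<p. B i j*v j)"

lemma dnp: "i < M ==> 0 < dn M vs i" using dn_pos grm len by blast
lemma pip: "0 < lpi M vs" unfolding lpi_def using dnp by (intro prod_pos) auto
lemma thp: "0 < Th" unfolding lth_def using pip by (intro mult_pos_pos) auto
lemma dn_dvd: "i < M ==> dn M vs i dvd Th" unfolding lth_def lpi_def by (intro dvd_mult2 dvd_prodI) auto
lemma Tp: "0 < lT M vs" unfolding lT_def using stp by (intro prod_pos) auto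

lemma sumM: "(SUM i<M. f i :: 'a::comm_monoid_add) = f 0+(SUM j<p. f (Suc j))" by (simp only: Mp sum.lessThan_Suc_shift)

lemma lE_mu: "i < M ==> rip M (ra (lE M vs i)) x = ri Th*mu M vs i x"
proof -
assume i: "i < M"
have "ri (Th div dn M vs i) = ri Th/ri (dn M vs i)" using dn_dvd[OF i] by (rule real_of_int_div)
moreover have "rip M (ra (lE M vs i)) x = ri (st vs i)*ri (Th div dn M vs i)*rip M (ra (gv M vs i)) x" unfolding rip_scale_left[symmetric] by (intro rip_cong) (auto simp: lE_def)
ultimately show ?thesis by (simp add: mu_def)
qed

lemma rip_lE: "rip M (ra (lE M vs i)) x = ra (lE M vs i) 0*x 0+(SUM j<p. ri (B i j)*x (Suc j))" unfolding rip_def sumM by (simp add: B_def)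

lemma av_mu: "i < M ==> ri (av t v i) = ri Th*mu M vs i (case_nat (ri t) (%j. ri (v j)))" unfolding lE_mu[symmetric] rip_lE av_def by simp

lemma lbv_av: "i < M ==> el (lbv M vs t v) i = av t (el v) i"
proof -
have "ip M e (t # v) = el e 0*t+(SUM j<p. el e (Suc j)*el v j)" for e unfolding ip_def sumM nthd_Suc by (simp add: nthd_def)
thus "i < M ==> el (lbv M vs t v) i = av t (el v) i" by (simp add: lbv_def av_def B_def)
qed

lemma lback_av:
assumes "!!i. i < M ==> el b i = av t v i" "k < p" shows "el (lback M vs b) k = v k"
proof -
let ?x = "case_nat (ri t) (%j. ri (v j))" and ?T = "lT M vs"
have "ri (el b i*(el (sv vs i) (Suc k)*(?T div st vs i))) =
  ri (Th * ?T)*(mu M vs i ?x*(ra (sv vs i) (Suc k)/ri (st vs i)))" if i: "i < M" for i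
proof -
 have "st vs i dvd ?T" unfolding lT_def using i by (intro dvd_prodI) auto
 hence "ri (?T div st vs i) = ri ?T/ri (st vs i)" by (rule real_of_int_div)
 thus ?thesis using assms(1)[OF i] av_mu[OF i, of t v] by simp
qed
hence "ri (SUM i<M. el b i*(el (sv vs i) (Suc k)*(?T div st vs i))) =
  ri (Th * ?T)*(SUM i<M. mu M vs i ?x*(ra (sv vs i) (Suc k)/ri (st vs i)))" unfolding of_int_sum sum_distrib_left by (intro sum.cong) auto
also have "(SUM i<M. mu M vs i ?x*(ra (sv vs i) (Suc k)/ri (st vs i))) = ?x (Suc k)" by (rule mu_coords[symmetric]) (use grm len stp assms(2) Mp in auto)
finally have "ri (SUM i<M. el b i*(el (sv vs i) (Suc k)*(?T div st vs i))) = ri (Th * ?T*v k)" by simp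
hence "(SUM i<M. el b i*(el (sv vs i) (Suc k)*(?T div st vs i))) = Th * ?T*v k" by (simp only: of_int_eq_iff)
thus ?thesis using thp Tp assms(2) Mp by (simp add: lback_def)
qed

lemma av_diff: "av 1 v i - av 1 w i = (SUM j<p. B i j*(v j - w j))" by (simp add: av_def right_diff_distrib sum_subtractf)

lemma grm_lbv: assumes "grm p U > 0" shows "grm M (map (lbv M vs 0) U) > 0"
proof (rule grm_lin)
fix k i assume k: "k < length (map (lbv M vs 0) U)" "i < p"
let ?b = "lbv M vs 0 (rw U k)"
have w: "rw (map (lbv M vs 0) U) k = ?b" using k by (simp add: nthd_def)
let ?x = "case_nat 0 (ra (rw U k))"
have "?x (Suc i) = (SUM l<M. mu M vs l ?x*(ra (sv vs l) (Suc i)/ri (st vs l)))" by (rule mu_coords) (use grm len stp k Mp in auto)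
moreover have "ra ?b l = ri Th*mu M vs l ?x" if "l < M" for l using av_mu[OF that, of 0 "el (rw U k)"] lbv_av[OF that] by simp
ultimately have "ra (rw U k) i = (SUM l<M. ra ?b l/ri Th*(ra (sv vs l) (Suc i)/ri (st vs l)))" using thp by (simp del: nthd_mk)
thus "ra (rw U k) i = (SUM l<M. (ra (sv vs l) (Suc i)/ri (st vs l)/ri Th)*ra (rw (map (lbv M vs 0) U) k) l)" unfolding w by (simp add: mult_ac)
qed (use assms in simp_all)

end

locale lnd = lvs p "Suc p" vs for p n :: nat and rs :: "int list list" and R :: int and ob :: "int list" and U :: "int list list" and vs :: sbase +
fixes bs :: "int list list" and z :: "int list"
assumes pn: "p < n" and bd: "ball_lp n rs" and box: "box_lp n rs (Suc p) R" and R1: "1 <= R" and gU: "grm p U > 0"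
 and mu2: "!!x i. x : X_lp (Suc p) n (rs @ eqr p ob U) ==> i < Suc p ==> (abs (mu (Suc p) vs i x)) < 2"
 and art0: "!!x i. x : X_lp (Suc p) n (rs @ eqr p ob U) ==> i < Suc p ==> ~ lreal vs i ==> rip (Suc p) (ra (gv (Suc p) vs i)) x = 0"
 and artK: "!!i. i < Suc p ==> ~ lreal vs i ==> dn (Suc p) vs i <= st vs i"
 and realX: "!!i. i < Suc p ==> lreal vs i ==> (%j. ra (sv vs i) j/ra (sv vs i) 0) : X_lp (Suc p) n (rs @ eqr p ob U)"
 and bs: "bs = lll (Suc p) (map (lbv (Suc p) vs 0) U)" and z: "z = lz (Suc p) vs ob bs"
begin

declare sum.lessThan_Suc [simp del] of_nat_Suc [simp del]

abbreviation "M == Suc p"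
abbreviation "XX == X_lp M n (rs @ eqr p ob U)"
definition "rr i = el (lres M vs ob bs) i"
definition "aa i = el (lcen M vs) i"

lemma bs_props:
"length bs = length U" "grm M bs > 0" "zs M bs v <-> zs M (map (lbv M vs 0) U) v"
"Suc k < length bs ==> nsq M (take k bs) (rw bs k) <= 2*nsq M (take (Suc k) bs) (rw bs (Suc k))" using lll_props[OF grm_lbv[OF gU]] by (simp_all add: bs)

lemma lbv0: "k < length U ==> i < M ==> el (rw (map (lbv M vs 0) U) k) i = (SUM j<p. B i j*el (rw U k) j)" by (simp add: nthd_def[of "[]"] lbv_av[unfolded av_def])

lemma zs_bs: "zs M bs w <-> (EX v. zs p U v & (ALL i<M. w i = (SUM j<p. B i j*v j)))"
proof
assume "zs M bs w"
thus "EX v. zs p U v & (ALL i<M. w i = (SUM j<p. B i j*v j))" unfolding bs_props by (rule zs_lin(1)[rotated 2]) (use lbv0 in auto)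
next
assume "EX v. zs p U v & (ALL i<M. w i = (SUM j<p. B i j*v j))"
then obtain v where v: "zs p U v" "ALL i<M. w i = (SUM j<p. B i j*v j)" by blast
have "zs M (map (lbv M vs 0) U) (%i. SUM j<p. B i j*v j)" by (rule zs_lin(2)[OF _ _ v(1)]) (use lbv0 in auto)
thus "zs M bs w" unfolding bs_props using zs_cong[of M w "%i. SUM j<p. B i j*v j"] v(2) by auto
qed

lemma z_props: "zs p U (%k. el z k - el ob k)" "i < M ==> av 1 (el z) i = aa i+rr i"
proof -
let ?y = "mk M (%i. el (lbv M vs 1 ob) i - el (lcen M vs) i)"
have "zs M bs (%i. el ?y i - rr i)" unfolding rr_def lres_def by (rule red_props(2)[OF refl])
then obtain v where v: "zs p U v" "!!i. i < M ==> el ?y i - rr i = (SUM j<p. B i j*v j)" unfolding zs_bs by blast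
have a: "aa i+rr i = av 1 (%j. el ob j - v j) i" if "i < M" for i using v(2)[OF that] that lbv_av[OF that, of 1 ob] by (simp add: av_def right_diff_distrib sum_subtractf aa_def)
have zk: "el z k = el ob k - v k" if "k < p" for k unfolding z lz_def by (rule lback_av[OF _ that, of _ 1]) (simp add: a[symmetric] aa_def rr_def)
show "zs p U (%k. el z k - el ob k)" using zs_scale[OF v(1), of "- 1"] zk by (auto elim: zs_cong[THEN iffD1, rotated])
show "i < M ==> av 1 (el z) i = aa i+rr i" using zk a by (simp add: av_def)
qed

lemma back_bs: assumes "k < length bs"
shows "zs p U (el (lback M vs (rw bs k)))" "!!i. i < M ==> el (rw bs k) i = (SUM j<p. B i j*el (lback M vs (rw bs k)) j)"
proof -
have "rw bs k : set bs" using assms by (simp add: nthd_def)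
from zs_mem[OF this, of M] obtain u where u: "zs p U u" "!!i. i < M ==> el (rw bs k) i = (SUM j<p. B i j*u j)" unfolding zs_bs by blast
have b: "el (lback M vs (rw bs k)) j = u j" if "j < p" for j by (rule lback_av[OF _ that, of _ 0]) (simp add: u(2) av_def)
show "zs p U (el (lback M vs (rw bs k)))" using u(1) b zs_cong[of p u "el (lback M vs (rw bs k))" U] by simp
show "!!i. i < M ==> el (rw bs k) i = (SUM j<p. B i j*el (lback M vs (rw bs k)) j)" using u(2) b by simp
qed

lemma child_props:
assumes "(ob', U') : set (lchild M vs z bs)"
shows "grm p U' > 0" "Suc (length U') = length U" "zs p U' w ==> zs p U w" "zs p U (%k. el ob' k - el ob k)"
proof -
define l where "l = length bs - 1"
have ne: "bs ~= []" using assms by (auto simp: lchild_def split: if_splits)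
hence l: "l < length bs" by (simp add: l_def)
obtain c where o': "ob' = mk p (%k. el z k+(int c - int (lC M))*el (lback M vs (rw bs l)) k)"
 and U': "U' = map (lback M vs) (take l bs)" using assms unfolding lchild_def l_def[symmetric] if_not_P[OF ne] set_map by fastforce
have r: "rw U' k = lback M vs (rw bs k)" "rw (take l bs) k = rw bs k" if "k < l" for k using that l by (simp_all add: U' nthd_def)
show "Suc (length U') = length U" using l bs_props(1) by (simp add: U' l_def)
show "grm p U' > 0"
proof (rule grm_lin)
 show "grm M (take l bs) > 0" by (rule grm_take) (rule bs_props)
 show "length (take l bs) = length U'" by (simp add: U')
 fix k i assume "k < length U'" "i < M"
 thus "ra (rw (take l bs) k) i = (SUM j<p. ri (B i j)*ra (rw U' k) j)" using r back_bs(2)[of k i] l by (simp add: U')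
qed
have m: "zs p U (el u)" if uU: "u : set U'" for u
proof -
 obtain k where "k < length U'" "u = rw U' k" using uU by (auto simp: in_set_conv_nth nthd_def)
 hence "k < l" "u = lback M vs (rw bs k)" using r by (auto simp: U')
 thus ?thesis using back_bs(1)[of k] l by simp
qed
thus "zs p U' w ==> zs p U w" by (rule zs_trans)
have "zs p U (%k. (el z k - el ob k)+(int c - int (lC M))*el (lback M vs (rw bs l)) k)" by (intro zs_add zs_scale z_props back_bs l)
thus "zs p U (%k. el ob' k - el ob k)" by (rule zs_cong[THEN iffD1, rotated]) (simp add: o')
qed

lemma slice:
assumes y: "zs p U (%k. y k - el ob k)" and x: "ker n rs x" "nn n x" "x 0 = 1" "!!k. k < p ==> x (Suc k) = ri (y k)"
shows "x : XX"
proof -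
have "ker n (eqr p ob U) x" unfolding ker_eqr[OF pn]
proof (intro allI impI)
 fix i assume i: "i < p"
 have "pj p U (%j. x (Suc j) - ra ob j*x 0) i = pj p U (%j. ri (y j - el ob j)) i" using x by (intro pj_cong) simp
 also have "... = 0" by (rule zs_pj[OF y order_refl i])
 finally show "pj p U (%j. x (Suc j) - ra ob j*x 0) i = 0" .
qed
thus ?thesis using x by (auto simp: X_lp_def ker_append)
qed

lemma XX_span: assumes "x : XX" shows "ALL i<p. pj p U (%j. x (Suc j) - ra ob j) i = 0" "x 0 = 1"
proof -
obtain x' where x': "ALL j<M. x j = x' j" "ker n (eqr p ob U) x'" "x' 0 = 1" using assms by (auto simp: X_lp_def ker_append)
thus "x 0 = 1" by simp
have "pj p U (%j. x (Suc j) - ra ob j) i = pj p U (%j. x' (Suc j) - ra ob j*x' 0) i" if "i < p" for i using x' by (intro pj_cong) auto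
thus "ALL i<p. pj p U (%j. x (Suc j) - ra ob j) i = 0" using x'(2) ker_eqr[OF pn] by simp
qed

lemma mu_sum: "x j = (SUM i<M. mu M vs i x*(ra (sv vs i) j/ri (st vs i)))" if "j < M" using mu_coords[OF grm len _ that] stp by simp

lemma mu_at: assumes "i < M" "k < M" "lreal vs k"
shows "mu M vs i (%j. ra (sv vs k) j/ra (sv vs k) 0) = (if i = k then 1 else 0)"
proof -
have s: "rip M g (%j. ra (sv vs k) j/ra (sv vs k) 0) = rip M g (ra (sv vs k))/ra (sv vs k) 0" for g using rip_scale_right[of M g "1/ra (sv vs k) 0" "ra (sv vs k)"] by simp
have st: "ra (sv vs k) 0 = ri (st vs k)" using assms(3) by (simp add: lreal_def)
show ?thesis
proof (cases "i = k")
 case True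
 have "ri (st vs k) > 0" "ri (dn M vs k) > 0" using stp dnp assms by auto
 thus ?thesis using True unfolding mu_def s by (simp add: st ip_rip[symmetric] dn_def[symmetric])
next
 case False
 hence "sv vs k : set (oth vs i)" using sv_oth[of k vs i] assms len by simp
 hence "rip M (ra (gv M vs i)) (ra (sv vs k)) = 0" unfolding rip_gv using pj_ker rip_commute[of M "pj M (oth vs i) (ra (sv vs i))" "ra (sv vs k)"] by simp
 thus ?thesis using False unfolding mu_def s by simp
qed
qed

lemma ker_sum: "(!!i. i : A ==> ker k as (f i)) ==> ker k as (%j. SUM i:A. f i j)" by (simp add: ker_def rip_sum_right)

lemma aa_le: "i < M ==> 0 <= aa i & aa i <= Th"
proof -
assume i: "i < M"
have "lpi M vs*1 <= Th" unfolding lth_def using pip by (intro mult_left_mono) auto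
thus ?thesis using i pip thp by (simp add: aa_def lcen_def)
qed

lemma aa_real: "i < M ==> lreal vs i ==> Th <= int M*aa i"
proof -
assume i: "i < M" "lreal vs i"
have "(SUM i<M. if lreal vs i then 1 else 0 :: int) <= (SUM i<M. 1)" by (intro sum_mono) auto
hence "max 1 (SUM i<M. if lreal vs i then 1 else 0 :: int) <= int M" by simp
hence "Th <= lpi M vs*int M" unfolding lth_def using pip by (intro mult_left_mono) auto
thus ?thesis using i by (simp add: aa_def lcen_def mult.commute)
qed

lemma rr_red: "j < length bs ==> (abs (rip M (gso M bs j) (%i. ri (rr i)))) <= nsq M (take j bs) (rw bs j)/2" unfolding rr_def lres_def by (rule red_props(1)[OF refl])

text \<open>The centroid lies in the affine hull of the coset, so the vector to be rounded lies in
  the real span of the lattice image. Nothing of the residual is left outside that span, and the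
  rounding error is governed by Gram-Schmidt lengths alone.\<close>

lemma rr_span:
assumes x: "x : XX" and i: "i < M"
shows "pj M bs (%i. ri (rr i)) i = 0"
proof -
define d where "d = (SUM i<M. if lreal vs i then 1 else 0 :: int)"
define P where "P k j = ra (sv vs k) j/ra (sv vs k) 0" for k j
\<comment> \<open>Artificial coordinates vanish on the slice, so without a real point every point of
  the slice would be 0, against entry 0 being 1.\<close>
have "EX k<M. lreal vs k"
proof (rule ccontr)
 assume a: "~ (EX k<M. lreal vs k)"
 have "mu M vs k x = 0" if "k < M" for k unfolding mu_def using art0[OF x that] a that by simp
 hence "x 0 = 0" using mu_sum[of 0 x] by simp
 thus False using XX_span(2)[OF x] by simp
qed
then obtain k0 where k0: "k0 < M" "lreal vs k0" by blast
have "(if lreal vs k0 then 1 else 0) <= d" unfolding d_def by (rule member_le_sum) (use k0 in auto)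
hence d: "1 <= d" "Th = lpi M vs*d" using k0 by (simp_all add: lth_def d_def[symmetric] del: sum.lessThan_Suc)
define c where "c j = (SUM k<M. (if lreal vs k then 1/ri d else 0)*P k j)" for j
have muc: "mu M vs l c = (if lreal vs l then 1/ri d else 0)" if l: "l < M" for l
proof -
 have "rip M (ra (gv M vs l)) c = (SUM k<M. (if lreal vs k then 1/ri d else 0)*rip M (ra (gv M vs l)) (P k))" unfolding c_def rip_sum_right rip_scale_right ..
 hence "mu M vs l c = (SUM k<M. (if lreal vs k then 1/ri d else 0)*mu M vs l (P k))" unfolding mu_def by (simp add: sum_distrib_left sum_divide_distrib mult_ac)
 also have "... = (SUM k<M. if k = l then (if lreal vs l then 1/ri d else 0) else 0)" using mu_at[OF l, folded P_def] by (intro sum.cong) auto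
 finally show ?thesis using l by simp
qed
have P0: "P k 0 = 1" "ALL i<p. pj p U (%j. P k (Suc j) - ra ob j) i = 0" if "k < M" "lreal vs k" for k using XX_span[OF realX[OF that]] by (auto simp: P_def)
have sd: "(SUM k<M. if lreal vs k then 1/ri d else 0) = 1"
proof -
 have "(SUM k<M. if lreal vs k then 1/ri d else 0) = (SUM k<M. ri (if lreal vs k then 1 else 0))/ri d" unfolding sum_divide_distrib by (intro sum.cong) auto
 also have "... = ri d/ri d" unfolding d_def of_int_sum ..
 finally show ?thesis using d by simp
qed
have "c 0 = (SUM k<M. if lreal vs k then 1/ri d else 0)" unfolding c_def using P0 by (intro sum.cong) auto
hence c0: "c 0 = 1" using sd by simp
have co: "c (Suc j) - ra ob j = (SUM k<M. (if lreal vs k then 1/ri d else 0)*(P k (Suc j) - ra ob j))" for j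
 unfolding c_def right_diff_distrib sum_subtractf sum_distrib_right[symmetric] sd by simp
have pc: "ALL i<p. pj p U (%j. - (c (Suc j) - ra ob j)) i = 0"
proof (intro allI impI)
 fix i assume "i < p"
 hence "pj p U (%j. c (Suc j) - ra ob j) i = 0" unfolding co pj_sum pj_scale using P0 by (intro sum.neutral) auto
 thus "pj p U (%j. - (c (Suc j) - ra ob j)) i = 0" using pj_scale[of p U "- 1" "%j. c (Suc j) - ra ob j" i] by simp
qed
let ?y = "mk M (%i. el (lbv M vs 1 ob) i - el (lcen M vs) i)"
have y: "ra ?y i = (SUM j<p. ri (B i j) * - (c (Suc j) - ra ob j))" if i: "i < M" for i
proof -
 have "ri (aa i) = ri Th*mu M vs i c" using i d muc[OF i] by (simp add: aa_def lcen_def)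
 also have "... = ra (lE M vs i) 0+(SUM j<p. ri (B i j)*c (Suc j))" unfolding lE_mu[OF i, symmetric] rip_lE c0 by simp
 finally have "ra ?y i = ri (av 1 (el ob) i) - (ra (lE M vs i) 0+(SUM j<p. ri (B i j)*c (Suc j)))" using i by (simp add: lbv_av aa_def)
 also have "... = (SUM j<p. ri (B i j) * - (c (Suc j) - ra ob j))" by (simp add: av_def right_diff_distrib sum_subtractf)
 finally show ?thesis .
qed
have "ALL i<M. pj M (map (lbv M vs 0) U) (ra ?y) i = 0"
proof (rule lin_span[OF _ pc y])
 fix u assume "u : set U"
 thus "EX w:set (map (lbv M vs 0) U). ALL i<M. ra w i = (SUM j<p. ri (B i j)*ra u j)" by (intro bexI[of _ "lbv M vs 0 u"]) (auto simp: lbv_av[unfolded av_def])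
qed
moreover have "ALL i<M. pj M bs (ra b) i = 0" if "b : set (map (lbv M vs 0) U)" for b using zs_pj[OF _ order_refl, of M bs "el b"] zs_mem[OF that, of M] bs_props(3) by blast
ultimately have "ALL i<M. pj M bs (ra ?y) i = 0" unfolding span_iff by blast
thus ?thesis unfolding rr_def lres_def using red_props(4)[OF refl i, of bs ?y] i by simp
qed

text \<open>If all Gram-Schmidt lengths are at most \<open>Th / M^2\<close>, the residual stays
  below \<open>Th / M\<close> in each coordinate, whereas the real coordinates of the centroid are
  at least \<open>Th / M\<close>. So the rounded point has nonnegative coordinates and is a convex
  combination of real spanner points.\<close>

lemma babai:
assumes x: "x : XX" and small: "!!j. j < length bs ==> nsq M (take j bs) (rw bs j)*real M^4 <= (ri Th)^2" and lb: "length bs <= M"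
shows "lfeas p n rs (el z)"
proof -
have th: "0 < ri Th" using thp by simp
have rs: "abs (ri (rr i))*real M < ri Th" if i: "i < M" for i
proof -
 let ?r = "%i. ri (rr i)"
 have p0: "rip M (pj M bs ?r) (pj M bs ?r) = 0" unfolding rip_eq_0 using rr_span[OF x] by blast
 have "(?r i)^2*real M^4 <= rip M ?r ?r*real M^4" using sq_le_rip[OF i, of ?r] by (intro mult_right_mono) auto
 also have "... <= (SUM j<length bs. nsq M (take j bs) (rw bs j))/4*real M^4" using rip_le_gs[of bs M ?r] rr_red p0 by (intro mult_right_mono) auto
 also have "... = (SUM j<length bs. nsq M (take j bs) (rw bs j)*real M^4)/4" by (simp add: sum_distrib_right)
 also have "... <= (SUM j<length bs. (ri Th)^2)/4" using small by (intro divide_right_mono sum_mono) auto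
 also have "... <= real M*(ri Th)^2/4" using lb by (simp add: mult_right_mono)
 also have "... < real M*(ri Th)^2" using th by simp
 also have "... <= real M*real M*(ri Th)^2" using mult_right_mono[of 1 "real M" "real M*(ri Th)^2"] by (simp add: mult_ac)
 finally have "(real M)^2*(?r i*real M)^2 < (real M)^2*(ri Th)^2" by (simp add: power_mult_distrib power2_eq_square power4_eq_xxxx mult_ac)
 hence "(?r i*real M)^2 < (ri Th)^2" by simp
 hence "abs (?r i*real M) < abs (ri Th)" using th power2_less_imp_less[of "abs (?r i*real M)" "ri Th"] by simp
 thus ?thesis using th by (simp add: abs_mult)
qed
let ?z = "case_nat 1 (%j. ra z j)"
define m where "m i = mu M vs i ?z" for i
have m: "ri Th*m i = ri (aa i)+ri (rr i)" if i: "i < M" for i using av_mu[OF i, of 1 "el z"] z_props(2)[OF i] by (simp add: m_def)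
have mr: "0 <= m i" if i: "i < M" "lreal vs i" for i
proof -
 have "ri Th <= ri (int M*aa i)" using aa_real[OF i] by (simp only: of_int_le_iff)
 hence "real M*abs (ri (rr i)) <= real M*ri (aa i)" using rs[OF i(1)] unfolding mult.commute[of _ "real M"] of_int_mult of_int_of_nat_eq by linarith
 hence "0 <= ri (aa i)+ri (rr i)" by (simp add: abs_if split: if_splits)
 hence "0 <= ri Th*m i" using m[OF i(1)] by simp
 thus ?thesis using th by (simp add: zero_le_mult_iff)
qed
\<comment> \<open>At an artificial coordinate the value is an integer multiple of
  \<open>st / dn\<close>, hence at least 1 in absolute value if nonzero; the residual is too small
  for that.\<close>
have ma: "m i = 0" if i: "i < M" "~ lreal vs i" for i
proof (rule ccontr)
 assume "m i ~= 0"
 have e: "rip M (ra (gv M vs i)) ?z = ri (ip M (gv M vs i) (1 # z))" unfolding ip_rip rip_def sumM nthd_Suc by (simp add: nthd_def)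
 have sd: "0 < ri (dn M vs i)" "ri (dn M vs i) <= ri (st vs i)" using dnp artK i by auto
 have "ip M (gv M vs i) (1 # z) ~= 0" using \<open>m i ~= 0\<close> e by (auto simp: m_def mu_def)
 hence "1 <= abs (ip M (gv M vs i) (1 # z))" by linarith
 hence "ri 1 <= ri (abs (ip M (gv M vs i) (1 # z)))" by (simp only: of_int_le_iff)
 hence "ri (dn M vs i)*1 <= ri (st vs i)*abs (ri (ip M (gv M vs i) (1 # z)))" using sd by (intro mult_mono) auto
 hence "1 <= abs (m i)" using sd unfolding m_def mu_def e by (simp add: abs_mult)
 hence "ri Th*1 <= ri Th*abs (m i)" using th by (intro mult_left_mono) auto
 also have "... = abs (ri Th*m i)" using th by (simp add: abs_mult)
 also have "... = abs (ri (rr i))" using m[OF i(1)] i by (simp add: aa_def lcen_def)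
 also have "... <= abs (ri (rr i))*real M" using mult_left_mono[of 1 "real M" "abs (ri (rr i))"] by simp
 finally show False using rs[OF i(1)] by simp
qed
have "EX X. ALL i<M. lreal vs i --> (ALL j<M. ra (sv vs i) j/ra (sv vs i) 0 = X i j) & ker n rs (X i) & nn n (X i)" using realX by (intro choice allI) (auto simp: X_lp_def ker_append)
then obtain X where X: "!!i j. i < M ==> lreal vs i ==> j < M ==> ra (sv vs i) j/ra (sv vs i) 0 = X i j"
 "!!i. i < M ==> lreal vs i ==> ker n rs (X i) & nn n (X i)" by blast
define I where "I = {i. i < M & lreal vs i}"
define w where "w j = (SUM i:I. m i*X i j)" for j
have wz: "w j = ?z j" if j: "j < M" for j
proof -
 have "?z j = (SUM i<M. m i*(ra (sv vs i) j/ri (st vs i)))" unfolding m_def by (rule mu_sum[OF j])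
 also have "... = (SUM i:I. m i*(ra (sv vs i) j/ri (st vs i)))" using ma by (intro sum.mono_neutral_right) (auto simp: I_def)
 also have "... = w j" unfolding w_def using X(1)[OF _ _ j] by (intro sum.cong) (auto simp: I_def lreal_def)
 finally show ?thesis by simp
qed
have "ker n rs w" unfolding w_def using X(2) by (intro ker_sum ker_scale) (auto simp: I_def)
moreover have "nn n w" unfolding w_def nn_def using X(2) mr by (auto simp: I_def nn_def intro!: sum_nonneg mult_nonneg_nonneg)
ultimately show ?thesis unfolding lfeas_def using wz by (intro exI[of _ w]) auto
qed

lemma nsq_chain: "j <= l ==> l < length bs ==> nsq M (take j bs) (rw bs j) <= 2^(l - j)*nsq M (take l bs) (rw bs l)"
proof (induction l rule: dec_induct)
case (step l)
have "2^(l - j)*nsq M (take l bs) (rw bs l) <= 2^(l - j)*(2*nsq M (take (Suc l) bs) (rw bs (Suc l)))" using bs_props(4)[of l] step by (intro mult_left_mono) auto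
also have "... = 2^(Suc l - j)*nsq M (take (Suc l) bs) (rw bs (Suc l))" using step.hyps by (simp add: Suc_diff_le)
finally show ?case using step.IH step.prems by linarith
qed simp

lemma length_U: "length U <= p"
proof -
have "0 <= pj p U (uv i) i" if "i < p" for i using pj_norm[of p U "uv i"] rip_nonneg[of p "pj p U (uv i)"] that by (simp add: rip_uv)
hence "0 <= (SUM i<p. pj p U (uv i) i)" by (intro sum_nonneg) auto
thus ?thesis using pj_trace[OF gU] by simp
qed

text \<open>If rounding fails, some Gram-Schmidt vector is long, and by the LLL inequalities so is
  the last one, up to a factor \<open>2^M\<close> in the square. The slice has bounded barycentric
  coordinates, so only boundedly many translates in that direction can meet it: the slice is
  thin.\<close>

lemma node_complete:
assumes y: "zs p U (%k. y k - el ob k)" and fy: "lfeas p n rs y" and nz: "~ lfeas p n rs (el z)"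
shows "EX (ob', U'):set (lchild M vs z bs). zs p U' (%k. y k - el ob' k)"
proof -
obtain x where x: "ker n rs x" "nn n x" "x 0 = 1" "!!k. k < p ==> x (Suc k) = ri (y k)" using fy by (auto simp: lfeas_def)
have xX: "x : XX" by (rule slice[OF y x])
have th: "0 < ri Th" using thp by simp
have lM: "length bs <= p" using length_U bs_props(1) by simp
define l where "l = length bs - 1"
obtain j where j: "j < length bs" "(ri Th)^2 < nsq M (take j bs) (rw bs j)*real M^4" using babai[OF xX] nz lM by (auto simp: not_le[symmetric])
hence l: "l < length bs" "j <= l" by (auto simp: l_def)
define q where "q = nsq M (take l bs) (rw bs l)"
have q0: "0 <= q" by (simp add: q_def nsq_nonneg)
have "nsq M (take j bs) (rw bs j) <= 2^(l - j)*q" unfolding q_def by (rule nsq_chain) fact+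
also have "... <= 2^M*q" using q0 l lM by (intro mult_right_mono power_increasing) auto
finally have "nsq M (take j bs) (rw bs j)*real M^4 <= 2^M*q*real M^4" by (intro mult_right_mono) auto
hence thq: "(ri Th)^2 < 2^M*real M^4*q" using j(2) unfolding mult.commute[of "2^M*q"] mult.commute[of _ q] mult.assoc by (simp only: mult_ac)
hence q1: "0 < q" using q0 by (cases "q = 0") auto
define b where "b = rw bs l"
define w where "w i = av 1 y i - av 1 (el z) i" for i
have wB: "w i = (SUM j<p. B i j*(y j - el z j))" for i unfolding w_def by (rule av_diff)
have "zs p U (%k. (y k - el ob k) - (el z k - el ob k))" by (intro zs_diff y z_props)
hence "zs M bs w" unfolding zs_bs wB by auto
hence "zs M (take l bs @ [b]) w" using l take_Suc_conv_app_nth[of l bs] by (simp add: b_def nthd_def l_def)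
then obtain c where c: "zs M (take l bs) (%i. w i - c*el b i)" unfolding zs_snoc by blast
let ?g = "gso M bs l"
have gb: "rip M ?g (ra b) = q" unfolding q_def b_def nsq_def pj_norm by (simp add: rip_commute)
have "rip M ?g (%i. ri (w i - c*el b i)) = 0" unfolding pj_sym using zs_pj[OF c order_refl] by (subst rip_commute) (auto intro: rip_zero_left)
hence gw: "rip M ?g (%i. ri (w i)) = ri c*q" using gb rip_diff_right[of M ?g "%i. ri (w i)" "%i. ri c*ra b i"] rip_scale_right[of M ?g "ri c" "ra b"] by simp
define u where "u i = ri (av 1 y i) - ri (aa i)" for i
have uw: "rip M ?g (%i. ri (w i)) = rip M ?g u - rip M ?g (%i. ri (rr i))" unfolding rip_diff_right[symmetric] by (intro rip_cong) (auto simp: w_def u_def z_props(2))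
\<comment> \<open>Points of the slice have coordinates below 2 in absolute value and the centroid
  has coordinates between 0 and 1, which gives 3 per coordinate.\<close>
have ub: "(u i)^2 <= 9*(ri Th)^2" if i: "i < M" for i
proof -
 have "mu M vs i (case_nat 1 (%j. ri (y j))) = mu M vs i x" unfolding mu_def using x by (intro arg_cong2[where f = divide] arg_cong2[where f = times] rip_cong refl) (auto split: nat.splits)
 hence "abs (ri (av 1 y i)) <= ri Th*2" using mu2[OF xX i] av_mu[OF i, of 1 y] th by (simp add: abs_mult)
 moreover have "0 <= ri (aa i)" "ri (aa i) <= ri Th" using aa_le[OF i] by auto
 ultimately have "abs (u i) <= 3*ri Th" unfolding u_def by linarith
 hence "abs (u i)^2 <= (3*ri Th)^2" by (intro power_mono) auto
 thus ?thesis by (simp add: power_mult_distrib)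
qed
have p5: "x^5 = x*x*x*x*x" for x :: real by (simp add: eval_nat_numeral)
define C where "C = 9*real M^5*2^M"
have C1: "1 <= C" unfolding C_def
proof -
 have "1 <= real M^5" by (intro one_le_power) simp
 moreover have "1 <= (2::real)^M" by (intro one_le_power) simp
 ultimately show "1 <= 9*real M^5*2^M" using mult_mono[of 1 "9*real M^5" 1 "2^M"] by linarith
qed
have "(rip M ?g u)^2 <= rip M ?g ?g*rip M u u" by (rule rip_Cauchy)
also have "... <= q*(real M*(9*(ri Th)^2))"
proof (rule mult_mono)
 have "rip M u u <= (SUM i<M. 9*(ri Th)^2)" unfolding rip_def power2_eq_square[symmetric] using ub by (intro sum_mono) (auto simp: power2_eq_square)
 thus "rip M u u <= real M*(9*(ri Th)^2)" by simp
qed (use q0 in "auto simp: q_def nsq_def rip_nonneg")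
also have "... <= q*(real M*(9*(2^M*real M^4*q)))" using thq q0 by (intro mult_left_mono) auto
also have "... = C*q^2" by (simp add: C_def p5 power4_eq_xxxx power2_eq_square mult_ac)
also have "... <= C^2*q^2" using C1 mult_left_mono[of 1 C C] by (intro mult_right_mono) (auto simp: power2_eq_square)
finally have "abs (rip M ?g u)^2 <= (C*q)^2" by (simp add: power_mult_distrib)
hence "abs (rip M ?g u) <= C*q" by (rule power2_le_imp_le) (use C1 q0 in simp)
moreover have "abs (rip M ?g (%i. ri (rr i))) <= q/2" unfolding q_def by (rule rr_red) fact
ultimately have "abs (ri c*q) <= C*q+q/2" using gw uw by linarith
hence "abs (ri c)*q <= (C+1)*q" using q1 by (simp add: abs_mult algebra_simps)
hence "abs (ri c) <= C+1" using q1 by simp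
also have "C+1 = ri (int (lC M))" by (simp only: C_def lC_def p5 of_int_of_nat_eq of_nat_add of_nat_mult of_nat_power of_nat_numeral of_nat_1
   of_int_add of_int_mult of_int_power of_int_numeral of_int_1 mult.assoc)
finally have cC: "abs c <= int (lC M)" by linarith
define o' where "o' = mk p (%k. el z k+c*el (lback M vs b) k)"
define U' where "U' = map (lback M vs) (take l bs)"
have "(o', U') : set (lchild M vs z bs)"
proof -
 have "nat (c+int (lC M)) : set [0..<2*lC M+1]" "int (nat (c+int (lC M))) - int (lC M) = c" using cC by auto
 thus ?thesis using l unfolding lchild_def l_def[symmetric] b_def[symmetric] o'_def U'_def by (auto simp: image_iff simp del: set_upt upt_Suc intro!: bexI[of _ "nat (c+int (lC M))"])
qed
moreover have "zs p U' (%k. y k - el o' k)"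
proof -
 have "EX v. zs p U' v & (ALL i<M. w i - c*el b i = (SUM j<p. B i j*v j))"
 proof (rule zs_lin(1)[OF _ _ c])
  fix k i assume "k < length U'" "i < M"
  thus "el (rw (take l bs) k) i = (SUM j<p. B i j*el (rw U' k) j)" using back_bs(2)[of k i] l(1) by (simp add: U'_def nthd_def[of "[]"])
 qed (simp add: U'_def)
 then obtain v where v: "zs p U' v" "!!i. i < M ==> w i - c*el b i = (SUM j<p. B i j*v j)" by blast
 have "v k = y k - el o' k" if k: "k < p" for k
 proof -
  let ?e = "mk M (%i. w i - c*el b i)"
  have "el (lback M vs ?e) k = v k" by (rule lback_av[OF _ k, of _ 0]) (simp add: v(2) av_def)
  moreover have "el (lback M vs ?e) k = y k - el z k - c*el (lback M vs b) k"
  proof (rule lback_av[OF _ k, of _ 0])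
   fix i assume i: "i < M"
   have "w i - c*el b i = (SUM j<p. B i j*(y j - el z j - c*el (lback M vs b) j))"
    unfolding wB using back_bs(2)[OF l(1) i] by (simp add: b_def right_diff_distrib sum_subtractf sum_distrib_left mult_ac)
   thus "el ?e i = av 0 (%j. y j - el z j - c*el (lback M vs b) j) i" using i by (simp add: av_def)
  qed
  ultimately show ?thesis using k by (simp add: o'_def)
 qed
 thus ?thesis using v(1) zs_cong[of p v "%k. y k - el o' k" U'] by simp
qed
ultimately show ?thesis by (auto intro!: bexI[of _ "(o', U')"])
qed

end

text \<open>An artificial vector has entry 0 at most 1 but weight \<open>K >= 2\<close>, so the test
  \<open>lreal\<close> recognizes exactly the members that came from the oracle.\<close>

lemma (in spanner) result:
assumes N: "M*(size_int K+size_int (int M*R^2)) <= N"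
defines "vs == spn M K N orc"
shows "length vs = M" "grm M (map fst vs) > 0" "i < M ==> 0 < st vs i" "x : X ==> i < M ==> (abs (mu M vs i x)) < 2"
 "x : X ==> i < M ==> ~ lreal vs i ==> rip M (ra (gv M vs i)) x = 0" "i < M ==> ~ lreal vs i ==> dn M vs i <= st vs i"
 "i < M ==> lreal vs i ==> good (sv vs i)"
proof -
have sg: "sgood vs" and fin: "spcand M orc vs = []" unfolding vs_def by (rule spn_stable[OF N])+
show "length vs = M" "grm M (map fst vs) > 0" "i < M ==> 0 < st vs i" using sg by (auto simp: sgood_def)
show "x : X ==> i < M ==> (abs (mu M vs i x)) < 2" by (rule spanner_final(1)[OF sg fin])
show "x : X ==> i < M ==> ~ lreal vs i ==> rip M (ra (gv M vs i)) x = 0" using spanner_final(2)[OF sg fin] by (simp add: lreal_def)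
show "dn M vs i <= st vs i" if i: "i < M" "~ lreal vs i"
proof -
 have "1*(1+int M*Dl^2)^M <= 2*Dl*(1+int M*Dl^2)^M" using Dl by (intro mult_right_mono) auto
 thus ?thesis using art_dn[OF sg i(1) disjI2[OF i(2)[unfolded lreal_def]]] K by linarith
qed
show "good (sv vs i)" if i: "i < M" "lreal vs i"
proof (rule ccontr)
 assume "~ good (sv vs i)"
 hence "sv vs i = mk M (%j. if j = i then 1 else 0)" "st vs i = K" using sg i by (auto simp: sgood_def)
 hence "K <= 1" using i M by (simp add: lreal_def split: if_splits)
 thus False using K1 by simp
qed
qed

lemma lnode_lnd:
fixes p n rs R ob U
assumes "p < n" "ball_lp n rs" "box_lp n rs (Suc p) R" "1 <= R" "grm p U > 0"
defines "vs == slp (Suc p) n (rs @ eqr p ob U) R"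
defines "bs == lll (Suc p) (map (lbv (Suc p) vs 0) U)"
shows "lnd p n rs R ob U vs bs (lz (Suc p) vs ob bs)"
 "lnode p n rs R (ob, U) = (lz (Suc p) vs ob bs, lchild (Suc p) vs (lz (Suc p) vs ob bs) bs)"
proof -
let ?M = "Suc p" and ?rs = "rs @ eqr p ob U"
show "lnode p n rs R (ob, U) = (lz ?M vs ob bs, lchild ?M vs (lz ?M vs ob bs) bs)" by (simp add: lnode_def Let_def vs_def bs_def)
interpret S: spanner ?M "%l. clip ?M (Del n ?rs) (lp n ?rs (mk ?M (el l)))" "X_lp ?M n ?rs" "Del n ?rs" R "spK ?M (Del n ?rs)" "good_lp ?M n ?rs"
 using assms by (intro slp_spanner ball_lp_append box_lp_append) auto
have N: "?M*(size_int (spK ?M (Del n ?rs))+size_int (int ?M*R^2)) <= spN ?M (Del n ?rs) R" by (simp add: spN_def power2_eq_square)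
note res = S.result[OF N, folded slp_def, folded vs_def]
show "lnd p n rs R ob U vs bs (lz ?M vs ob bs)" by unfold_locales (use assms(1-5) res S.good_mem in "auto simp: bs_def")
qed

text \<open>A basis of \<open>2 * Z^p\<close>, so that the coset of \<open>ob\<close> is its parity
  class.\<close>

definition ubas :: "nat => int list list" where "ubas p = mk p (%i. mk p (%j. if j = i then 2 else 0))"
definition lstep where "lstep p n rs R s = (fst s @ map (%nd. fst (lnode p n rs R nd)) (snd s), concat (map (%nd. snd (lnode p n rs R nd)) (snd s)))"
text \<open>The rank drops with each level, so \<open>p + 1\<close> levels exhaust the tree. Rounded
  points are collected untested; testing them is left to \<open>orcl\<close>.\<close>

definition milp where "milp p n rs R ob = fst ((lstep p n rs R ^^ Suc p) ([], [(ob, ubas p)]))"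

lemma grm_ubas: "grm p (ubas p) > 0" unfolding grm_pos_iff
proof (intro allI impI)
fix k assume k: "k < length (ubas p)"
hence k': "k < p" by (simp add: ubas_def)
have rw: "rw (ubas p) l = mk p (%j. if j = l then 2 else 0)" if "l < p" for l using that by (simp add: ubas_def)
have "pj p (take k (ubas p)) (ra (rw (ubas p) k)) k = ra (rw (ubas p) k) k"
proof (rule pj_fix[OF _ k'])
 fix b assume "b : set (take k (ubas p))"
 then obtain l where l: "l < k" "b = rw (ubas p) l" using k by (auto simp: in_set_conv_nth nthd_def)
 show "rip p (ra b) (ra (rw (ubas p) k)) = 0" unfolding rip_def using l k' by (intro sum.neutral) (auto simp: rw)
qed
thus "nsq p (take k (ubas p)) (rw (ubas p) k) ~= 0" using k' unfolding nsq_0_iff by (auto simp: rw intro!: exI[of _ k])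
qed

lemma zs_ubas: "zs p (ubas p) v <-> (ALL k<p. even (v k))"
proof
have "ALL k<p. even (v k)" if "ALL b:set bs. ALL k<p. even (el b k)" "zs p bs v" for bs v using that
proof (induction bs arbitrary: v)
 case (Cons b bs)
 then obtain c where c: "zs p bs (%i. v i - c*el b i)" by auto
 have "ALL k<p. even (v k - c*el b k)" by (rule Cons.IH[OF _ c]) (use Cons.prems in simp)
 thus ?case using Cons.prems(1) by simp
qed simp
moreover have "ALL b:set (ubas p). ALL k<p. even (el b k)" by (auto simp: ubas_def mk_def[of p "%i. mk p (f i)" for f])
ultimately show "zs p (ubas p) v ==> ALL k<p. even (v k)" by blast
next
assume v: "ALL k<p. even (v k)"
have "zs p (map (%i. mk p (%j. if j = i then 2 else 0)) [0..<m]) (%k. if k < m then v k else 0)" if "m <= p" for m using that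
proof (induction m)
 case 0
 thus ?case by simp
next
 case (Suc m)
 have "zs p (map (%i. mk p (%j. if j = i then 2 else 0)) [0..<m]) (%k. (if k < Suc m then v k else 0) - (v m div 2)*el (mk p (%j. if j = m then 2 else 0)) k)"
  using Suc v by (intro zs_cong[THEN iffD1, OF _ Suc.IH]) (auto simp: less_Suc_eq)
 thus ?case by (simp add: zs_snoc) blast
qed
from this[OF order_refl] show "zs p (ubas p) v" unfolding ubas_def mk_def by (rule zs_cong[THEN iffD1, rotated]) simp
qed

theorem milp_correct:
assumes a: "p < n" "ball_lp n rs" "box_lp n rs (Suc p) R" "1 <= R"
shows "z : set (milp p n rs R ob) ==> ALL k<p. even (el z k - el ob k)"
 "lfeas p n rs y ==> ALL k<p. even (y k - el ob k) ==> EX z:set (milp p n rs R ob). lfeas p n rs (el z)"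
proof -
let ?s = "%k. (lstep p n rs R ^^ k) ([], [(ob, ubas p)])" and ?U = "ubas p"
have inv: "(ALL z:set (fst (?s k)). zs p ?U (%i. el z i - el ob i)) &
 (ALL (o', U):set (snd (?s k)). grm p U > 0 & length U+k = p & (ALL w. zs p U w --> zs p ?U w) & zs p ?U (%i. el o' i - el ob i)) &
 (ALL y. lfeas p n rs y & zs p ?U (%i. y i - el ob i) --> (EX z:set (fst (?s k)). lfeas p n rs (el z)) |
  (EX (o', U):set (snd (?s k)). zs p U (%i. y i - el o' i)))" for k
proof (induction k)
 case 0
 thus ?case using grm_ubas zs_zero by (simp add: ubas_def)
next
 case (Suc k)
 define z' where "z' nd = fst (lnode p n rs R nd)" for nd
 define ch where "ch nd = snd (lnode p n rs R nd)" for nd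
 have s: "fst (?s (Suc k)) = fst (?s k) @ map z' (snd (?s k))" "snd (?s (Suc k)) = concat (map ch (snd (?s k)))"
  unfolding funpow.simps o_apply lstep_def[of _ _ _ _ "?s k"] fst_conv snd_conv z'_def ch_def by (rule refl)+
 have node: "zs p ?U (%i. el (z' (o', U)) i - el ob i) &
   (ALL (o'', U'):set (ch (o', U)). grm p U' > 0 & length U'+Suc k = p & (ALL w. zs p U' w --> zs p ?U w) & zs p ?U (%i. el o'' i - el ob i)) &
   (ALL y. lfeas p n rs y & zs p U (%i. y i - el o' i) --> lfeas p n rs (el (z' (o', U))) | (EX (o'', U'):set (ch (o', U)). zs p U' (%i. y i - el o'' i)))"
  if nd: "(o', U) : set (snd (?s k))" for o' U
 proof -
  have g: "grm p U > 0" "length U+k = p" "!!w. zs p U w ==> zs p ?U w" "zs p ?U (%i. el o' i - el ob i)" using Suc nd by auto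
  define vs where "vs = slp (Suc p) n (rs @ eqr p o' U) R"
  define bs where "bs = lll (Suc p) (map (lbv (Suc p) vs 0) U)"
  define z where "z = lz (Suc p) vs o' bs"
  interpret L: lnd p n rs R o' U vs bs z unfolding z_def bs_def vs_def by (rule lnode_lnd(1)) (fact a g)+
  have e: "z' (o', U) = z" "ch (o', U) = lchild (Suc p) vs z bs" using lnode_lnd(2)[OF a g(1), of o'] by (simp_all add: z'_def ch_def z_def bs_def vs_def)
  have add: "zs p ?U (%i. el x i - el ob i)" if "zs p U (%i. el x i - el o' i)" for x using zs_add[OF g(3)[OF that] g(4)] by simp
  have "zs p ?U (%i. el z i - el ob i)" by (rule add[OF L.z_props(1)])
  moreover have "ALL (o'', U'):set (lchild (Suc p) vs z bs). grm p U' > 0 & length U'+Suc k = p & (ALL w. zs p U' w --> zs p ?U w) & zs p ?U (%i. el o'' i - el ob i)"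
   using L.child_props add g(2,3) by fastforce
  moreover have "lfeas p n rs (el z) | (EX (o'', U'):set (lchild (Suc p) vs z bs). zs p U' (%i. y i - el o'' i))"
   if "lfeas p n rs y" "zs p U (%i. y i - el o' i)" for y using L.node_complete[OF that(2,1)] by blast
  ultimately show ?thesis unfolding e by blast
 qed
 show ?case unfolding s
 proof (intro conjI allI impI)
  show "ALL z:set (fst (?s k) @ map z' (snd (?s k))). zs p ?U (%i. el z i - el ob i)" using Suc node by auto
  show "ALL (o', U):set (concat (map ch (snd (?s k)))). grm p U > 0 & length U+Suc k = p & (ALL w. zs p U w --> zs p ?U w) & zs p ?U (%i. el o' i - el ob i)" using node by fastforce
  fix y assume y: "lfeas p n rs y & zs p ?U (%i. y i - el ob i)"
  then consider "EX z:set (fst (?s k)). lfeas p n rs (el z)" | o' U where "(o', U) : set (snd (?s k))" "zs p U (%i. y i - el o' i)" using Suc by blast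
  thus "(EX z:set (fst (?s k) @ map z' (snd (?s k))). lfeas p n rs (el z)) |
  (EX (o', U):set (concat (map ch (snd (?s k)))). zs p U (%i. y i - el o' i))"
  proof cases
   case 1
   thus ?thesis by auto
  next
   case 2
   hence "lfeas p n rs (el (z' (o', U))) | (EX (o'', U'):set (ch (o', U)). zs p U' (%i. y i - el o'' i))" using node y by blast
   thus ?thesis using 2(1) by fastforce
  qed
 qed
qed
show "ALL k<p. even (el z k - el ob k)" if z: "z : set (milp p n rs R ob)" unfolding zs_ubas[symmetric] using inv[of "Suc p"] z unfolding milp_def by blast
show "EX z:set (milp p n rs R ob). lfeas p n rs (el z)" if y: "lfeas p n rs y" "ALL k<p. even (y k - el ob k)"
proof -
 have "zs p ?U (%i. y i - el ob i)" unfolding zs_ubas by (rule y)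
 \<comment> \<open>A node surviving \<open>p + 1\<close> levels would satisfy
   \<open>length U + Suc p = p\<close>.\<close>
 moreover have "~ (EX (o', U):set (snd (?s (Suc p))). zs p U (%i. y i - el o' i))" using inv[of "Suc p"] by fastforce
 ultimately show ?thesis using inv[of "Suc p"] y(1) unfolding milp_def by blast
qed
qed

subsection \<open>Optimization over mixed integer points\<close>

definition fixr where "fixr p z = mk p (%k. mk (Suc (Suc k)) (%j. if j = 0 then - el z k else if j = Suc k then 1 else 0))"
definition rowq where "rowq n q = mk (Suc n) (%j. if j = n then - 1 else el q j)"
text \<open>The halfspace becomes a row with a nonnegative slack variable, Lenstra's candidates are
  tested by linear programming on their fibers, and one more linear program on a feasible fiber
  yields a vertex instead of an arbitrary point.\<close>

definition orcl where "orcl p n rs R ob q = (let cs = filter (%z. lp (Suc n) ((rs @ [rowq n q]) @ fixr p z) [] ~= []) (milp p (Suc n) (rs @ [rowq n q]) R ob)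
 in if cs = [] then [] else lp n (rs @ fixr p (nthd [] cs 0)) q)"

definition mint where "mint p n rs ob x <-> ker n rs x & nn n x & x 0 = 1 & (EX y. ALL k<p. x (Suc k) = ri (y k) & even (y k - el ob k))"
text \<open>Vertices of fibers over fixed integer parts: they are mixed integer points, their size
  is bounded by determinants, and linear functionals are maximized at them.\<close>

definition mgood where "mgood p n rs ob v <-> (EX z. (ALL k<p. even (el z k - el ob k)) & ielem n (rs @ fixr p z) v & 0 < el v 0)"

lemma ker_rows: "ker n rs x <-> (ALL i<length rs. rip n (ra (rw rs i)) x = 0)"
proof -
have "set rs = (%i. rw rs i) ` {..<length rs}" by (auto simp: in_set_conv_nth nthd_def image_iff)
thus ?thesis unfolding ker_def by auto
qed

lemma ker_fixr: assumes "p < n" shows "ker n (fixr p z) x <-> (ALL k<p. x (Suc k) = ra z k*x 0)"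
proof -
have "rip n (ra (rw (fixr p z) k)) x = x (Suc k) - ra z k*x 0" if k: "k < p" for k
proof -
 have "rip n (ra (rw (fixr p z) k)) x = (SUM j:{0, Suc k}. ra (rw (fixr p z) k) j*x j)" unfolding rip_def using assms k by (intro sum.mono_neutral_right) (auto simp: fixr_def)
 thus ?thesis using k by (simp add: fixr_def)
qed
thus ?thesis unfolding ker_rows by (auto simp: fixr_def)
qed

lemma lp_ok:
assumes "ball_lp n rs" "0 < n"
shows "(lp n rs ob = [] & (ALL x. ker n rs x & nn n x & 0 < x 0 --> rip n (ra ob) x < 0)) |
 (EX v. lp n rs ob = [v] & ielem n rs v & 0 < el v 0 & 0 <= rip n (ra ob) (ra v))" by (rule lp_correct) (use assms in "auto simp: ball_lp_def")

lemma lp_Nil: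
assumes "ball_lp n rs" "0 < n" shows "lp n rs [] ~= [] <-> (EX x. ker n rs x & nn n x & x 0 = 1)"
proof -
have r0: "rip n (ra []) x = 0" for x by (simp add: rip_def nthd_def)
note lp = lp_ok[OF assms, of "[]"]
show ?thesis
proof
 assume "lp n rs [] ~= []"
 then obtain v where "ielem n rs v" "0 < el v 0" using lp by blast
 thus "EX x. ker n rs x & nn n x & x 0 = 1" using ielem_point by (intro exI[of _ "%j. ra v j/ra v 0"]) auto
next
 assume "EX x. ker n rs x & nn n x & x 0 = 1"
 then obtain x where "ker n rs x" "nn n x" "x 0 = 1" by blast
 hence "ker n rs x & nn n x & 0 < x 0" by simp
 hence a: "(ALL x. ker n rs x & nn n x & 0 < x 0 --> rip n (ra []) x < 0) ==> False" unfolding r0 by (metis less_irrefl)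
 from lp show "lp n rs [] ~= []" by (rule disjE) (erule conjE, drule a, simp, auto)
qed
qed

lemma lfeas_lp:
assumes "ball_lp n rs" "p < n" shows "lp n (rs @ fixr p z) [] ~= [] <-> lfeas p n rs (el z)" using lp_Nil[OF ball_lp_append[OF assms(1), of "fixr p z"]] assms(2)
by (auto simp: lfeas_def ker_append ker_fixr)

lemma ker_rowq:
assumes "ALL b:set rs. length b <= n"
shows "ker (Suc n) (rs @ [rowq n q]) x <-> ker n rs x & x n = rip n (ra q) x"
proof -
have "rip (Suc n) (ra b) x = rip n (ra b) x" if "b : set rs" for b by (rule rip_prefix) (use assms that in "auto intro: el_len order_trans")
moreover have "rip (Suc n) (ra (rowq n q)) x = rip n (ra q) x - x n" unfolding rip_def sum.lessThan_Suc by (simp add: rowq_def)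
ultimately show ?thesis by (auto simp: ker_def)
qed

theorem orcl_correct:
assumes a: "p < n" "ball_lp n rs" "box_lp n rs (Suc p) R" "1 <= R" and len: "ALL b:set rs. length b <= n"
shows "(orcl p n rs R ob q = [] & (ALL x. mint p n rs ob x --> rip n (ra q) x < 0)) |
 (EX v. orcl p n rs R ob q = [v] & mgood p n rs ob v & 0 <= rip n (ra q) (ra v))"
proof -
let ?r = "rs @ [rowq n q]"
have nns: "nn (Suc n) x <-> nn n x & 0 <= x n" for x by (auto simp: nn_def less_Suc_eq)
have b: "ball_lp (Suc n) ?r" using a(2) unfolding ball_lp_def ker_rowq[OF len] nns by (auto simp: less_Suc_eq rip_def)
have bx: "box_lp (Suc n) ?r (Suc p) R" using a(3) unfolding box_lp_def ker_rowq[OF len] nns by auto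
have pn: "p < Suc n" using a(1) by simp
define cs where "cs = filter (%z. lp (Suc n) (?r @ fixr p z) [] ~= []) (milp p (Suc n) ?r R ob)"
have cs: "set cs = {z : set (milp p (Suc n) ?r R ob). lfeas p (Suc n) ?r (el z)}" unfolding cs_def using lfeas_lp[OF b pn] by auto
have o: "orcl p n rs R ob q = (if cs = [] then [] else lp n (rs @ fixr p (nthd [] cs 0)) q)" by (simp add: orcl_def Let_def cs_def)
show ?thesis
proof (cases "cs = []")
 case True
 have "rip n (ra q) x < 0" if x: "mint p n rs ob x" for x
 proof (rule ccontr)
  assume "~ rip n (ra q) x < 0"
  obtain y where y: "!!k. k < p ==> x (Suc k) = ri (y k) & even (y k - el ob k)" using x by (auto simp: mint_def)
  let ?x = "x(n := rip n (ra q) x)"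
  have k: "ker n rs ?x <-> ker n rs x" "nn n ?x <-> nn n x" "rip n (ra q) ?x = rip n (ra q) x" by (rule ker_cong, simp) (auto simp: nn_def intro!: rip_cong)
  have "lfeas p (Suc n) ?r y" unfolding lfeas_def ker_rowq[OF len] nns by (intro exI[of _ ?x]) (use x y a(1) k \<open>~ rip n (ra q) x < 0\<close> in "auto simp: mint_def")
  hence "EX z:set (milp p (Suc n) ?r R ob). lfeas p (Suc n) ?r (el z)" using y by (intro milp_correct(2)[OF pn b bx a(4)]) auto
  thus False using True cs by auto
 qed
 thus ?thesis using True o by simp
next
 case False
 define z where "z = nthd [] cs 0"
 have "z : set cs" using False by (simp add: z_def nthd_def)
 hence z: "lfeas p (Suc n) ?r (el z)" "ALL k<p. even (el z k - el ob k)" using cs milp_correct(1)[OF pn b bx a(4)] by auto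
 obtain x where x: "ker n rs x" "nn n x" "0 <= rip n (ra q) x" "x 0 = 1" "ALL k<p. x (Suc k) = ri (el z k)" using z(1) unfolding lfeas_def ker_rowq[OF len] nns by auto
 have kz: "ker n (rs @ fixr p z) x" using x by (simp add: ker_append ker_fixr[OF a(1)])
 have bz: "ball_lp n (rs @ fixr p z)" by (rule ball_lp_append[OF a(2)])
 have "~ (ALL x. ker n (rs @ fixr p z) x & nn n x & 0 < x 0 --> rip n (ra q) x < 0)"
 proof
  assume "ALL x. ker n (rs @ fixr p z) x & nn n x & 0 < x 0 --> rip n (ra q) x < 0"
  from this[THEN spec, of x] show False using kz x by simp
 qed
 then obtain v where "lp n (rs @ fixr p z) q = [v]" "ielem n (rs @ fixr p z) v" "0 < el v 0" "0 <= rip n (ra q) (ra v)" using lp_ok[OF bz, of q] a(1) by auto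
 thus ?thesis using False z(2) o by (auto simp: mgood_def z_def)
qed
qed

lemma mgood_mint:
assumes "p < n" "mgood p n rs ob v" shows "mint p n rs ob (%j. ra v j/ra v 0)" "0 < el v 0" "i < n ==> 0 <= el v i"
proof -
obtain z where z: "ALL k<p. even (el z k - el ob k)" "ielem n (rs @ fixr p z) v" "0 < el v 0" using assms(2) by (auto simp: mgood_def)
show "0 < el v 0" "i < n ==> 0 <= el v i" using z ielem_pos by auto
have "ker n (rs @ fixr p z) (%j. ra v j/ra v 0)" "nn n (%j. ra v j/ra v 0)" using ielem_point[OF z(2,3)] by auto
thus "mint p n rs ob (%j. ra v j/ra v 0)" using z(1,3) by (auto simp: mint_def ker_append ker_fixr[OF assms(1)])
qed

definition DelR where "DelR p n rs R = Del n (rs @ fixr p (mk p (%_. R)))"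

text \<open>In the box the integer parts are at most \<open>R\<close> in absolute value and
  \<open>Del\<close> is monotone in the entries, so one bound serves all fibers.\<close>

lemma mgood_le:
assumes "p < n" "box_lp n rs (Suc p) R" "mgood p n rs ob v" "i < n" shows "el v i <= DelR p n rs R"
proof -
obtain z where z: "ielem n (rs @ fixr p z) v" "0 < el v 0" using assms(3) by (auto simp: mgood_def)
let ?x = "%j. ra v j/ra v 0"
have x: "ker n rs ?x" "ker n (fixr p z) ?x" "nn n ?x" "?x 0 = 1" using ielem_point[OF z] z(2) by (auto simp: ker_append)
have zb: "abs (el z k) <= abs R" if k: "k < p" for k
proof -
 have "?x (Suc k) = ra z k * ?x 0" using x(2) k unfolding ker_fixr[OF assms(1)] by blast
 moreover have "?x (Suc k) <= ri R * ?x 0" using assms(2) x k by (auto simp: box_lp_def)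
 moreover have "0 <= ?x (Suc k)" using x(3) k assms(1) by (simp add: nn_def)
 ultimately have "0 <= ra z k" "ra z k <= ri R" unfolding x(4) by linarith+
 thus ?thesis by simp
qed
have "el v i <= Del n (rs @ fixr p z)" using z(1) assms(4) by (simp add: ielem_def)
also have "... <= DelR p n rs R" unfolding DelR_def
proof (rule Del_mono)
 fix k i assume k: "k < length (rs @ fixr p z)" "i < n"
 have nd: "(rs @ xs) ! k = (if k < length rs then rs ! k else xs ! (k - length rs))" for xs by (simp add: nth_append)
 have f: "fixr p z' ! l = mk (Suc (Suc l)) (%j. if j = 0 then - el z' l else if j = Suc l then 1 else 0)" if "l < p" for z' l using that by (simp add: fixr_def mk_def)
 show "abs (el ((rs @ fixr p z) ! k) i) <= abs (el ((rs @ fixr p (mk p (%_. R))) ! k) i)"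
 proof (cases "k < length rs")
  case False
  hence l: "k - length rs < p" using k by (simp add: fixr_def)
  thus ?thesis using False zb[OF l] by (simp add: nd f)
 qed (simp add: nd)
qed (simp add: fixr_def)
finally show ?thesis .
qed

text \<open>Here the assumption of fixed \<open>p\<close> pays off: if the number of rounds is
  bounded in terms of \<open>p\<close>, the states need no separate size bound, because a bounded
  composition of polynomial-time functions is polynomial, with an exponent that depends on
  \<open>p\<close>.\<close>

lemma PT_iter_const:
fixes h :: "'a::enc => 'b::enc => 'b"
assumes n: "PT D n" "!!p x. x : D p ==> n x <= N p" and g: "PT D g" and h: "PT (ext D (%_. UNIV)) (%z. h (fst z) (snd z))"
shows "PT D (%x. (h x ^^ n x) (g x))"
proof -
have f: "PT D (%x. (h x ^^ i) (g x))" for i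
proof (induction i)
 case 0
 thus ?case using g by simp
next
 case (Suc i)
 have "PT D (%x. (x, (h x ^^ i) (g x)))" by (intro Suc PT_rules)
 from PT_comp[OF h this] show ?case by (simp add: ext_def)
qed
have pbs: "pb D (%x. SUM i<=m. isize ((h x ^^ i) (g x)))" for m
 by (induction m) (simp_all add: pb_intros PT_size[OF f] PT_size[OF f[of 0], simplified] pb_add PT_size[OF f[of "Suc _"], simplified])
have pM: "pb D (%x. SUM i<=n x. isize ((h x ^^ i) (g x)))"
proof (rule pbI)
 fix p
 obtain d where d: "ALL x:D p. (SUM i<=N p. isize ((h x ^^ i) (g x))) <= (isize x+2)^d" using pbs[of "N p"] unfolding pb_def by blast
 have "(SUM i<=n x. isize ((h x ^^ i) (g x))) <= (SUM i<=N p. isize ((h x ^^ i) (g x)))" if "x : D p" for x using n(2)[OF that] by (intro sum_mono2) auto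
 thus "EX d. ALL x:D p. (SUM i<=n x. isize ((h x ^^ i) (g x))) <= (isize x+2)^d" using d order_trans by blast
qed
show ?thesis
proof (rule PT_iter_dom[OF n(1) pb_pconst[OF n(2)] g h pM])
 fix p x i assume "i <= n x"
 thus "isize ((h x ^^ i) (g x)) <= (SUM i<=n x. isize ((h x ^^ i) (g x)))" by (intro member_le_sum[of i "{..n x}" "%i. isize ((h x ^^ i) (g x))"]) auto
qed (auto simp: ext_def)
qed

section \<open>Running time of Lenstra's algorithm and of the mixed integer oracle\<close>

lemma PT_eqr [PT_rules]: assumes "PT D p" "pb D p" "PT D ob" "PT D U" shows "PT D (%x. eqr (p x) (ob x) (U x))" unfolding eqr_def by (intro assms PT_rules)

lemma PT_lreal [PT_rules]: assumes "PT D vs" "PT D i" shows "PT D (%x. lreal (vs x) (i x))" unfolding lreal_def by (intro assms PT_rules)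
lemma PT_lpi [PT_rules]: assumes "PT D M" "pb D M" "PT D vs" shows "PT D (%x. lpi (M x) (vs x))" unfolding lpi_def by (intro assms PT_rules)
lemma PT_lth [PT_rules]: assumes "PT D M" "pb D M" "PT D vs" shows "PT D (%x. lth (M x) (vs x))" unfolding lth_def by (intro assms PT_rules)
lemma PT_lE [PT_rules]: assumes "PT D M" "pb D M" "PT D vs" "PT D i" shows "PT D (%x. lE (M x) (vs x) (i x))" unfolding lE_def by (intro assms PT_rules)
lemma PT_lbv [PT_rules]: assumes "PT D M" "pb D M" "PT D vs" "PT D t" "PT D v" shows "PT D (%x. lbv (M x) (vs x) (t x) (v x))" unfolding lbv_def by (intro assms PT_rules)
lemma PT_lT [PT_rules]: assumes "PT D M" "pb D M" "PT D vs" shows "PT D (%x. lT (M x) (vs x))" unfolding lT_def by (intro assms PT_rules)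
lemma PT_lback [PT_rules]: assumes "PT D M" "pb D M" "PT D vs" "PT D b" shows "PT D (%x. lback (M x) (vs x) (b x))" unfolding lback_def by (intro assms PT_rules)
lemma PT_lcen [PT_rules]: assumes "PT D M" "pb D M" "PT D vs" shows "PT D (%x. lcen (M x) (vs x))" unfolding lcen_def by (intro assms PT_rules)
lemma PT_lres [PT_rules]: assumes "PT D M" "pb D M" "PT D vs" "PT D ob" "PT D bs" shows "PT D (%x. lres (M x) (vs x) (ob x) (bs x))" unfolding lres_def by (intro assms PT_rules)
lemma PT_lz [PT_rules]: assumes "PT D M" "pb D M" "PT D vs" "PT D ob" "PT D bs" shows "PT D (%x. lz (M x) (vs x) (ob x) (bs x))" unfolding lz_def by (intro assms PT_rules)

text \<open>Recast over the integers, where the running time rule for powers of two applies.\<close>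

lemma lC_nat: "lC M = nat (9*int M*int M*int M*int M*int M*2^M+1)" unfolding lC_def by (rule nat_int[symmetric, THEN trans]) (simp add: algebra_simps)

lemma PT_lC [PT_rules]: assumes "PT D M" "pb D M" shows "PT D (%x. lC (M x))" unfolding lC_nat by (intro assms PT_rules)

lemma pb_lC: assumes "!!q x. x : D q ==> M x = Suc q" shows "pb D (%x. lC (M x))" by (rule pb_pconst[where h = "%q. lC (Suc q)"]) (simp add: assms)

lemma PT_lchild [PT_rules]: assumes "PT D M" "pb D M" "PT D vs" "PT D z" "PT D bs" "!!q x. x : D q ==> M x = Suc q"
shows "PT D (%x. lchild (M x) (vs x) (z x) (bs x))" unfolding lchild_def by (intro pb_lC assms PT_rules)

lemma PT_spK [PT_rules]: assumes "PT D M" "pb D M" "PT D B" shows "PT D (%x. spK (M x) (B x))" unfolding spK_def by (intro assms PT_rules)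

lemma PT_spN [PT_rules]: assumes "PT D M" "pb D M" "PT D B" "PT D R" shows "PT D (%x. spN (M x) (B x) (R x))" "pb D (%x. spN (M x) (B x) (R x))"
proof -
show "PT D (%x. spN (M x) (B x) (R x))" unfolding spN_def by (intro assms PT_rules)
have "PT D (%x. int (M x)*(R x*R x))" by (intro assms PT_rules)
from PT_size[OF this] PT_size[OF PT_spK[OF assms(1-3)]]
have "pb D (%x. size_int (int (M x)*(R x*R x)))" "pb D (%x. size_int (spK (M x) (B x)))" by simp_all
thus "pb D (%x. spN (M x) (B x) (R x))" unfolding spN_def by (intro pb_intros assms)
qed

lemma PT_slp [PT_rules]: assumes "PT D M" "pb D M" "PT D n" "pb D n" "PT D rs" "PT D R" shows "PT D (%x. slp (M x) (n x) (rs x) (R x))" unfolding slp_def by (intro PT_spn assms PT_rules)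

lemma PT_lnode:
assumes "PT D p" "pb D p" "PT D n" "pb D n" "PT D rs" "PT D R" "PT D nd" and pq: "!!q x. x : D q ==> p x = q"
shows "PT D (%x. lnode (p x) (n x) (rs x) (R x) (nd x))"
proof -
have M: "PT D (%x. Suc (p x))" "pb D (%x. Suc (p x))" by (intro assms PT_rules)+
have vs: "PT D (%x. slp (Suc (p x)) (n x) (rs x @ eqr (p x) (fst (nd x)) (snd (nd x))) (R x))" by (intro M assms PT_rules)
have bs: "PT D (%x. lll (Suc (p x)) (map (lbv (Suc (p x)) (slp (Suc (p x)) (n x) (rs x @ eqr (p x) (fst (nd x)) (snd (nd x))) (R x)) 0) (snd (nd x))))"
 by (intro M M(1) M(2) vs assms PT_rules)
show ?thesis unfolding lnode_def Let_def by (intro M vs bs assms PT_rules) (simp add: pq)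
qed

lemma PT_lstep:
assumes "PT D p" "pb D p" "PT D n" "pb D n" "PT D rs" "PT D R" "PT D s" and pq: "!!q x. x : D q ==> p x = q"
shows "PT D (%x. lstep (p x) (n x) (rs x) (R x) (s x))"
proof -
have "PT (ext D A) (%z. lnode (p (fst z)) (n (fst z)) (rs (fst z)) (R (fst z)) (snd z))" for A
 by (rule PT_lnode[OF assms(1)[THEN PT_lift] assms(2)[THEN pb_lift] assms(3)[THEN PT_lift] assms(4)[THEN pb_lift] assms(5,6)[THEN PT_lift]])
  (intro PT_rules, auto simp: ext_def pq)
thus ?thesis unfolding lstep_def by (intro assms PT_rules)
qed

lemma PT_ubas [PT_rules]: assumes "PT D p" "pb D p" shows "PT D (%x. ubas (p x))" unfolding ubas_def by (intro assms PT_rules)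

lemma PT_milp [PT_rules]:
assumes "PT D p" "pb D p" "PT D n" "pb D n" "PT D rs" "PT D R" "PT D ob" and pq: "!!q x. x : D q ==> p x = q"
shows "PT D (%x. milp (p x) (n x) (rs x) (R x) (ob x))" unfolding milp_def
proof (intro PT_fst PT_iter_const)
show "PT (ext D (%_. UNIV)) (%z. lstep (p (fst z)) (n (fst z)) (rs (fst z)) (R (fst z)) (snd z))"
 by (rule PT_lstep[OF assms(1)[THEN PT_lift] assms(2)[THEN pb_lift] assms(3)[THEN PT_lift] assms(4)[THEN pb_lift] assms(5,6)[THEN PT_lift]])
  (intro PT_rules, auto simp: ext_def pq)
show "PT D (%x. ([], [(ob x, ubas (p x))]))" by (intro assms PT_rules)
qed (auto intro: PT_Suc assms simp: pq)

lemma PT_fixr [PT_rules]: assumes "PT D p" "pb D p" "PT D z" shows "PT D (%x. fixr (p x) (z x))"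
proof -
have "pb (ext D (%x. {..<p x})) (%z. p (fst z))" by (rule pb_lift[OF assms(2)])
hence a: "pb (ext D (%x. {..<p x})) (%z. Suc (Suc (snd z)))" by (intro pb_Suc) (rule pb_mono, auto simp: ext_def)
show ?thesis unfolding fixr_def by (intro a assms PT_rules)
qed

lemma PT_rowq [PT_rules]: assumes "PT D n" "pb D n" "PT D q" shows "PT D (%x. rowq (n x) (q x))" unfolding rowq_def by (intro assms PT_rules)

lemma PT_orcl [PT_rules]:
assumes "PT D p" "pb D p" "PT D n" "pb D n" "PT D rs" "PT D R" "PT D ob" "PT D q" and pq: "!!q x. x : D q ==> p x = q"
shows "PT D (%x. orcl (p x) (n x) (rs x) (R x) (ob x) (q x))" unfolding orcl_def Let_def by (intro assms PT_rules)

lemma PT_DelR [PT_rules]: assumes "PT D p" "pb D p" "PT D n" "pb D n" "PT D rs" "PT D R" shows "PT D (%x. DelR (p x) (n x) (rs x) (R x))" unfolding DelR_def by (intro assms PT_rules)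

section \<open>Quadratic functions on the hull of a spanner\<close>

definition qf :: "nat => (nat => nat => real) => (nat => real) => (nat => real) => real" where
"qf n H h x = (SUM i<n. SUM j<n. H i j*x i*x j)+(SUM i<n. h i*x i)"
definition qb :: "nat => (nat => nat => real) => (nat => real) => (nat => real) => real" where
"qb n H x y = (SUM i<n. SUM j<n. H i j*x i*y j)"

lemma qf_cong: "(!!k. k < n ==> x k = y k) ==> qf n H h x = qf n H h y" by (simp add: qf_def)
lemma qf_qb: "qf n H h x = qb n H x x+rip n h x" by (simp add: qf_def qb_def rip_def)
lemma qb_rip: "qb n H x y = rip n x (%i. rip n (H i) y)" unfolding qb_def rip_def sum_distrib_left by (intro sum.cong refl) (simp add: mult_ac)
lemma qb_sum: "qb n H (%k. SUM i:A. m i*a i k) y = (SUM i:A. m i*qb n H (a i) y)"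
"qb n H y (%k. SUM i:A. m i*a i k) = (SUM i:A. m i*qb n H y (a i))" unfolding qb_rip rip_sum_left rip_sum_right rip_scale_left rip_scale_right by simp_all
lemma qb_add: "qb n H (%k. a k+b k) y = qb n H a y+qb n H b y" "qb n H y (%k. a k+b k) = qb n H y a+qb n H y b" unfolding qb_rip rip_add_left rip_add_right by simp_all
lemma qb_scale: "qb n H (%k. c*a k) y = c*qb n H a y" "qb n H y (%k. c*a k) = c*qb n H y a" unfolding qb_rip rip_scale_left rip_scale_right by simp_all

text \<open>With \<open>m\<close> the least value at spanner points and midpoints and
  \<open>S\<close> an upper bound, this limits how far below \<open>S\<close> the quadratic can fall
  on the hull. The constant is a product of three factors: at most \<open>M^2\<close> pairs, weights
  of at most \<open>2 * 2\<close>, and deviations of at most \<open>2 * (S - m)\<close>.\<close>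

lemma quad_hull:
fixes a :: "nat => nat => real"
assumes fin: "finite I" and card: "card I <= M" and one: "(SUM i:I. mm i) = 1" and mu: "!!i. i : I ==> (abs (mm i)) <= 2"
 and mid: "!!i j. i : I ==> j : I ==> m <= qf n H h (%k. (a i k+a j k)/2) & qf n H h (%k. (a i k+a j k)/2) <= S"
 and x: "!!k. k < n ==> x k = (SUM i:I. mm i*a i k)"
shows "S - qf n H h x <= 8*(real M)^2*(S - m)"
proof -
let ?f = "qf n H h"
define md where "md i j = ?f (%k. (a i k+a j k)/2)" for i j
have md: "md i j = (qb n H (a i) (a i)+qb n H (a i) (a j)+qb n H (a j) (a i)+qb n H (a j) (a j))/4+(rip n h (a i)+rip n h (a j))/2" for i j
proof -
 have e: "(%k. (a i k+a j k)/2) = (%k. 1/2*(a i k+a j k))" by auto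
 show ?thesis unfolding md_def qf_qb e qb_scale rip_scale_right qb_add rip_add_right by (simp add: field_simps)
qed
\<comment> \<open>By polarization, \<open>2 * md i j - (md i i + md j j) / 2\<close> is the
  symmetrized contribution of the pair to the value at \<open>x\<close>. The weights
  \<open>mm i * mm j\<close> sum to 1, so \<open>S\<close> can be moved inside the double
  sum.\<close>
define ps where "ps i j = S - (2*md i j - (md i i+md j j)/2)" for i j
have ps: "abs (ps i j) <= 2*(S - m)" if "i : I" "j : I" for i j
proof -
 have f: "m <= md i j" "md i j <= S" "m <= md i i" "md i i <= S" "m <= md j j" "md j j <= S" using mid[folded md_def] that by blast+
 have "S - (2*A - (B+C)/2) <= 2*(S - m)" "- (S - (2*A - (B+C)/2)) <= 2*(S - m)"
  if "m <= A" "A <= S" "m <= B" "B <= S" "m <= C" "C <= S" for A B C :: real using that by (simp_all add: field_simps)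
 from this[OF f] show ?thesis unfolding ps_def by (rule abs_leI)
qed
obtain i0 where "i0 : I" using one by (cases "I = {}") auto
hence Sm: "0 <= S - m" using mid[of i0 i0] by simp
have "?f x = qb n H (%k. SUM i:I. mm i*a i k) (%k. SUM i:I. mm i*a i k)+rip n h (%k. SUM i:I. mm i*a i k)" unfolding qf_qb qb_def rip_def using x by simp
also have "... = (SUM i:I. SUM j:I. mm i*mm j*qb n H (a i) (a j))+(SUM i:I. mm i*rip n h (a i))" unfolding qb_sum rip_sum_right rip_scale_right by (simp add: sum_distrib_left mult.assoc)
finally have f: "?f x = (SUM i:I. SUM j:I. mm i*mm j*qb n H (a i) (a j))+(SUM i:I. mm i*rip n h (a i))" .
have sw: "(SUM i:I. SUM j:I. mm i*mm j*qb n H (a j) (a i)) = (SUM i:I. SUM j:I. mm i*mm j*qb n H (a i) (a j))" by (subst sum.swap) (simp add: mult.commute[of "mm _" "mm _"])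
have l: "(SUM i:I. SUM j:I. mm i*mm j*g i) = (SUM i:I. mm i*g i)" "(SUM i:I. SUM j:I. mm i*mm j*g j) = (SUM i:I. mm i*g i)" for g
proof -
 have "(SUM i:I. SUM j:I. mm i*mm j*g i) = (SUM i:I. mm i*g i*(SUM j:I. mm j))" by (simp add: sum_distrib_left mult_ac)
 thus "(SUM i:I. SUM j:I. mm i*mm j*g i) = (SUM i:I. mm i*g i)" using one by simp
 have "(SUM i:I. SUM j:I. mm i*mm j*g j) = (SUM i:I. mm i*(SUM j:I. mm j*g j))" by (simp add: sum_distrib_left mult_ac)
 thus "(SUM i:I. SUM j:I. mm i*mm j*g j) = (SUM i:I. mm i*g i)" using one by (simp add: sum_distrib_right[symmetric])
qed
have "(SUM i:I. SUM j:I. mm i*mm j*ps i j) = (SUM i:I. SUM j:I. mm i*mm j*S - (mm i*mm j*qb n H (a i) (a j)/2+mm i*mm j*qb n H (a j) (a i)/2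
  + (mm i*mm j*rip n h (a i)/2+mm i*mm j*rip n h (a j)/2)))" unfolding ps_def md by (intro sum.cong refl) (simp add: field_simps)
also have "... = S - ?f x" unfolding sum_subtractf sum.distrib sum_divide_distrib[symmetric] sw l f using l(1)[of "%_. S"] one by (simp add: sum_distrib_right[symmetric])
finally have "S - ?f x = (SUM i:I. SUM j:I. mm i*mm j*ps i j)" by simp
also have "... <= (SUM i:I. SUM j:I. 2*2*(2*(S - m)))"
proof (intro sum_mono)
 fix i j assume ij: "i : I" "j : I"
 have "mm i*mm j*ps i j <= abs (mm i)*abs (mm j)*abs (ps i j)" using abs_ge_self[of "mm i*mm j*ps i j"] by (simp add: abs_mult)
 also have "... <= 2*2*(2*(S - m))" using ij mu ps by (intro mult_mono) auto
 finally show "mm i*mm j*ps i j <= 2*2*(2*(S - m))" .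
qed
also have "... = 8*(real (card I))^2*(S - m)" by (simp add: power2_eq_square)
also have "... <= 8*(real M)^2*(S - m)" using card Sm by (intro mult_right_mono mult_left_mono power_mono) auto
finally show ?thesis .
qed

section \<open>Approximate minimization in a box\<close>

definition mspn where "mspn p M N rs R ob = spn M (spK M (DelR p N rs R)) (spN M (DelR p N rs R) R)
 (%l. clip M (DelR p N rs R) (orcl p N rs R ob (mk M (el l))))"
definition mgoodM where "mgoodM p M N rs ob v <-> (EX v'. v = mk M (el v') & mgood p N rs ob v')"
definition mX where "mX p M N rs ob = {x. EX x'. (ALL j<M. x j = x' j) & mint p N rs ob x'}"

text \<open>The parity class is infinite in its continuous directions, but every point lies in a
  fiber, and a functional is at least as large at some vertex of that fiber.\<close>

lemma mspanner:
assumes a: "p < M" "M <= N" "ball_lp N rs" "box_lp N rs M R" "1 <= R" and len: "ALL b:set rs. length b <= N"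
shows "spanner M (%l. clip M (DelR p N rs R) (orcl p N rs R ob (mk M (el l)))) (mX p M N rs ob) (DelR p N rs R) R
 (spK M (DelR p N rs R)) (mgoodM p M N rs ob)" unfolding mX_def mgoodM_def
proof (rule spanner_proj[OF _ a(2,5)])
have pN: "p < N" using a by simp
have bxp: "box_lp N rs (Suc p) R" using a(4) a(1) by (auto simp: box_lp_def)
show "0 < M" "1 <= DelR p N rs R" using a by (auto simp: DelR_def Del_ge_1)
show "0 < el v 0 & mint p N rs ob (%j. ra v j/ra v 0)" "j < N ==> 0 <= el v j & el v j <= DelR p N rs R" if "mgood p N rs ob v" for v j
 using mgood_mint[OF pN that] mgood_le[OF pN bxp that] by auto
show "x 0 = 1 & (ALL j<M. x j <= ri R)" if "mint p N rs ob x" for x using a(4) that by (auto simp: box_lp_def mint_def)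
show "(orcl p N rs R ob l = [] & (ALL x. mint p N rs ob x --> rip N (ra l) x < 0)) |
  (EX v. orcl p N rs R ob l = [v] & mgood p N rs ob v & 0 <= rip N (ra l) (ra v))" for l by (rule orcl_correct[OF pN a(3) bxp a(5) len])
fix x g assume x: "mint p N rs ob x"
obtain y where y: "!!k. k < p ==> x (Suc k) = ri (y k) & even (y k - el ob k)" using x by (auto simp: mint_def)
let ?r = "rs @ fixr p (mk p y)"
have k: "ker N ?r x" "nn N x" "x 0 = 1" using x y by (auto simp: mint_def ker_append ker_fixr[OF pN])
obtain v where v: "ielem N ?r v" "0 < el v 0" "rip M g x <= rip M g (%j. ra v j/ra v 0)" using lp_vert[OF ball_lp_append[OF a(3)] _ k a(2)] pN by auto
then have "mgood p N rs ob v" unfolding mgood_def using y by (intro exI[of _ "mk p y"]) auto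
then show "EX v. mgood p N rs ob v & rip M g x <= rip M g (%j. ra v j/ra v 0)" using v by blast
qed

text \<open>The midpoint in homogeneous form, with entry 0 equal to twice the product of the two
  denominators. Pairs with equal members give the spanner points themselves.\<close>

definition midp where "midp M u v = mk M (%k. el u k*el v 0+el v k*el u 0)"
definition mcls where "mcls p M N rs R ob = (let us = map fst (filter (%w. snd w = el (fst w) 0) (mspn p M N rs R ob))
 in concat (map (%u. map (%v. midp M u v) us) us))"
definition pcls :: "nat => int list list" where
"pcls p = ((%bs. map (%b. 0 # b) bs @ map (%b. 1 # b) bs) ^^ p) [[]]"
definition mcand where "mcand p M N rs R = concat (map (%ob. mcls p M N rs R ob) (pcls p))"

lemma pcls_ex: "EX ob:set (pcls p). ALL k<p. even (y k - el ob k)"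
proof (induction p arbitrary: y)
case 0
thus ?case by (simp add: pcls_def)
next
case (Suc p)
obtain ob where ob: "ob : set (pcls p)" "ALL k<p. even (y (Suc k) - el ob k)" using Suc[of "%k. y (Suc k)"] by blast
have "y 0 mod 2 = 0 | y 0 mod 2 = 1" by presburger
hence "(y 0 mod 2) # ob : set (pcls (Suc p))" using ob(1) by (auto simp: pcls_def)
moreover have "even (y k - el ((y 0 mod 2) # ob) k)" if "k < Suc p" for k using that ob(2) by (cases k) (auto simp: nthd_Suc nthd_def[of 0 "_ # _" 0])
ultimately show ?case by blast
qed

definition mpt where "mpt p N rs x <-> ker N rs x & nn N x & x 0 = 1 & (ALL k<p. x (Suc k) : \<int>)"

lemma mpt_mint: "p < N ==> mpt p N rs x <-> (EX ob:set (pcls p). mint p N rs ob x)"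
proof
assume x: "mpt p N rs x"
hence "ALL k<p. EX y. x (Suc k) = ri y" by (auto simp: mpt_def Ints_def)
then obtain y where y: "!!k. k < p ==> x (Suc k) = ri (y k)" by metis
thus "EX ob:set (pcls p). mint p N rs ob x" using x pcls_ex[of p y] unfolding mpt_def mint_def by blast
qed (auto simp: mpt_def mint_def)

text \<open>Two mixed integer points whose integer parts agree modulo 2 have a mixed integer midpoint.\<close>

lemma mint_mid: "mint p N rs ob x ==> mint p N rs ob y ==> mpt p N rs (%j. (x j+y j)/2)"
proof -
assume x: "mint p N rs ob x" and y: "mint p N rs ob y"
obtain a where a: "!!k. k < p ==> x (Suc k) = ri (a k) & even (a k - el ob k)" using x by (auto simp: mint_def)
obtain b where b: "!!k. k < p ==> y (Suc k) = ri (b k) & even (b k - el ob k)" using y by (auto simp: mint_def)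
have "(x (Suc k)+y (Suc k))/2 : \<int>" if k: "k < p" for k
proof -
 have "even (a k+b k)" using a[OF k] b[OF k] by auto
 then obtain c where "a k+b k = 2*c" by blast
 hence "(x (Suc k)+y (Suc k))/2 = ri c" using a[OF k] b[OF k] by (simp flip: of_int_add)
 thus ?thesis by simp
qed
moreover have "ker N rs (%j. 1/2*(x j+y j))" using x y by (intro ker_scale ker_add) (auto simp: mint_def)
ultimately show ?thesis using x y by (simp add: mpt_def mint_def nn_def)
qed

text \<open>A mixed integer point belongs to some parity class and is an affine combination of the
  real spanner points of that class with coefficients below 2, so \<open>quad_hull\<close> applies.
  The map \<open>G\<close> translates the box back to the original variables.\<close>

lemma mcand_correct:
assumes a: "p < M" "M <= N" "ball_lp N rs" "box_lp N rs M R" "1 <= R" and len: "ALL b:set rs. length b <= N"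
shows "u : set (mcand p M N rs R) ==> 0 < el u 0 & (EX x. mpt p N rs x & (ALL j<M. x j = ra u j/ra u 0))"
 "mpt p N rs x ==> mcand p M N rs R ~= []"
 "mpt p N rs x ==> (!!u. u : set (mcand p M N rs R) ==> b <= qf n H h (%j. G j (ra u (Suc j)/ra u 0)) &
  qf n H h (%j. G j (ra u (Suc j)/ra u 0)) <= S) ==> (!!j t. G j t = t - r) ==> n < M ==>
  S - qf n H h (%j. G j (x (Suc j))) <= 8*(real M)^2*(S - b)"
proof -
let ?D = "DelR p N rs R"
have pN: "p < N" and M0: "0 < M" using a by simp_all
have N: "M*(size_int (spK M ?D)+size_int (int M*R^2)) <= spN M ?D R" by (simp add: spN_def power2_eq_square)
define us where "us ob = map fst (filter (%w. snd w = el (fst w) 0) (mspn p M N rs R ob))" for ob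
note res = spanner.result[OF mspanner[OF a len] N, folded mspn_def]
have us: "u : set (us ob) <-> (EX i<M. lreal (mspn p M N rs R ob) i & u = sv (mspn p M N rs R ob) i)" for u ob
proof -
 have "set vs = (%i. nthd ([], 0) vs i) ` {..<length vs}" for vs :: sbase
 proof -
  have "(%i. nthd ([], 0) vs i) ` {..<length vs} = (!) vs ` {0..<length vs}" by (intro image_cong) (auto simp: nthd_def)
  thus ?thesis by (simp only: nth_image[OF order_refl] take_all[OF order_refl])
 qed
 from this[of "mspn p M N rs R ob"] show ?thesis unfolding us_def set_map set_filter using res(1)[of ob] by (auto simp: lreal_def)
qed
have set: "set (mcand p M N rs R) = (UN ob:set (pcls p). UN u:set (us ob). UN v:set (us ob). {midp M u v})" unfolding mcand_def mcls_def us_def[symmetric] Let_def by fastforce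
have good: "0 < el u 0 & (EX x. mint p N rs ob x & (ALL j<M. x j = ra u j/ra u 0))" if u: "u : set (us ob)" for u ob
proof -
 obtain i where i: "i < M" "lreal (mspn p M N rs R ob) i" "u = sv (mspn p M N rs R ob) i" using u us by blast
 obtain u' where "u = mk M (el u')" "mgood p N rs ob u'" using res(7)[OF i(1,2)] i(3) unfolding mgoodM_def by blast
 thus ?thesis using mgood_mint[OF pN, of rs ob u'] M0 by (intro conjI exI[of _ "%j. ra u' j/ra u' 0"]) auto
qed
have mid: "0 < el (midp M u v) 0" "j < M ==> ra (midp M u v) j/ra (midp M u v) 0 = (ra u j/ra u 0+ra v j/ra v 0)/2"
 if "0 < el u 0" "0 < el v 0" for u v j using that M0 by (simp_all add: midp_def field_simps add_pos_pos)
show "0 < el u 0 & (EX x. mpt p N rs x & (ALL j<M. x j = ra u j/ra u 0))" if u: "u : set (mcand p M N rs R)"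
proof -
 obtain ob v w where v: "v : set (us ob)" "w : set (us ob)" "u = midp M v w" using u set by blast
 obtain x y where xy: "mint p N rs ob x" "ALL j<M. x j = ra v j/ra v 0" "mint p N rs ob y" "ALL j<M. y j = ra w j/ra w 0" using good[OF v(1)] good[OF v(2)] by blast
 thus ?thesis using mid good[OF v(1)] good[OF v(2)] mint_mid[OF xy(1,3)] v(3) by (intro conjI exI[of _ "%j. (x j+y j)/2"]) auto
qed
have rep: "EX I. finite I & card I <= M & I \<subseteq> {..<M} & (ALL i:I. sv (mspn p M N rs R ob) i : set (us ob)) &
  (EX mm. (ALL i:I. abs (mm i) <= 2) & (ALL j<M. x j = (SUM i:I. mm i*(ra (sv (mspn p M N rs R ob) i) j/ra (sv (mspn p M N rs R ob) i) 0))))"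
 if x: "mint p N rs ob x" for ob x
proof -
 let ?vs = "mspn p M N rs R ob"
 define I where "I = {i. i < M & lreal ?vs i}"
 have I: "I \<subseteq> {..<M}" by (auto simp: I_def)
 have xX: "x : mX p M N rs ob" using x by (auto simp: mX_def)
 have m0: "mu M ?vs i x = 0" if "i < M" "i ~: I" for i using res(5)[OF xX that(1)] that by (simp add: mu_def I_def)
 have "x j = (SUM i:I. mu M ?vs i x*(ra (sv ?vs i) j/ra (sv ?vs i) 0))" if j: "j < M" for j
 proof -
  have "x j = (SUM i<M. mu M ?vs i x*(ra (sv ?vs i) j/ri (st ?vs i)))" by (rule mu_coords) (use res j in auto)
  also have "... = (SUM i:I. mu M ?vs i x*(ra (sv ?vs i) j/ri (st ?vs i)))" using m0 I by (intro sum.mono_neutral_right) auto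
  also have "... = (SUM i:I. mu M ?vs i x*(ra (sv ?vs i) j/ra (sv ?vs i) 0))" by (intro sum.cong) (auto simp: I_def lreal_def)
  finally show ?thesis .
 qed
 moreover have "abs (mu M ?vs i x) <= 2" if "i : I" for i using res(4)[OF xX, of i] that by (simp add: I_def)
 moreover have "sv ?vs i : set (us ob)" if "i : I" for i using that us by (auto simp: I_def)
 moreover have "card I <= M" using card_mono[OF _ I] by simp
 ultimately show ?thesis using I finite_subset[OF I] by (intro exI[of _ I] conjI exI[of _ "%i. mu M ?vs i x"]) blast+
qed
{
 assume "mpt p N rs x"
 then obtain ob where ob: "ob : set (pcls p)" "mint p N rs ob x" using mpt_mint[OF pN] by blast
 obtain I mm where I: "finite I" "card I <= M" "!!i. i : I ==> sv (mspn p M N rs R ob) i : set (us ob)" "!!i. i : I ==> (abs (mm i)) <= 2"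
  "!!j. j < M ==> x j = (SUM i:I. mm i*(ra (sv (mspn p M N rs R ob) i) j/ra (sv (mspn p M N rs R ob) i) 0))" using rep[OF ob(2)] by blast
 define v where "v i = sv (mspn p M N rs R ob) i" for i
 have x0: "x 0 = 1" using ob by (simp add: mint_def)
 have v: "v i : set (us ob)" "0 < el (v i) 0" if "i : I" for i using I(3)[OF that] good by (auto simp: v_def)
 \<comment> \<open>This is entry 0 of the representation of \<open>x\<close>: homogeneous
   coordinates turn linear combinations into affine ones.\<close>
 have one: "(SUM i:I. mm i) = 1"
 proof -
  have "(SUM i:I. mm i*(ra (v i) 0/ra (v i) 0)) = (SUM i:I. mm i)" using v(2) by (intro sum.cong refl) (metis divide_self less_irrefl mult.right_neutral of_int_eq_0_iff)
  thus ?thesis using I(5)[OF M0] x0 by (simp add: v_def)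
 qed
 have c: "midp M (v i) (v j) : set (mcand p M N rs R)" if "i : I" "j : I" for i j using v that ob(1) set by blast
 obtain i0 where "i0 : I" using one by (cases "I = {}") auto
 thus "mcand p M N rs R ~= []" using c by fastforce
 assume bS: "!!u. u : set (mcand p M N rs R) ==> b <= qf n H h (%j. G j (ra u (Suc j)/ra u 0)) &
  qf n H h (%j. G j (ra u (Suc j)/ra u 0)) <= S" and G: "!!j t. G j t = t - r" and n: "n < M"
 show "S - qf n H h (%j. G j (x (Suc j))) <= 8*(real M)^2*(S - b)"
 proof (rule quad_hull[OF I(1,2) one I(4)])
  fix i j assume ij: "i : I" "j : I"
  have "qf n H h (%k. G k (ra (midp M (v i) (v j)) (Suc k)/ra (midp M (v i) (v j)) 0)) =
    qf n H h (%k. (G k (ra (v i) (Suc k)/ra (v i) 0)+G k (ra (v j) (Suc k)/ra (v j) 0))/2)"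
  proof (rule qf_cong)
   fix k assume "k < n"
   hence "ra (midp M (v i) (v j)) (Suc k)/ra (midp M (v i) (v j)) 0 = (ra (v i) (Suc k)/ra (v i) 0+ra (v j) (Suc k)/ra (v j) 0)/2" using n by (intro mid(2) v ij) simp
   thus "G k (ra (midp M (v i) (v j)) (Suc k)/ra (midp M (v i) (v j)) 0) = (G k (ra (v i) (Suc k)/ra (v i) 0)+G k (ra (v j) (Suc k)/ra (v j) 0))/2"
    unfolding G by (simp only:) (simp add: field_simps)
  qed
  thus "b <= qf n H h (%k. (G k (ra (v i) (Suc k)/ra (v i) 0)+G k (ra (v j) (Suc k)/ra (v j) 0))/2) &
    qf n H h (%k. (G k (ra (v i) (Suc k)/ra (v i) 0)+G k (ra (v j) (Suc k)/ra (v j) 0))/2) <= S" using bS[OF c[OF ij]] by simp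
 next
  fix k assume "k < n"
  hence "x (Suc k) = (SUM i:I. mm i*(ra (v i) (Suc k)/ra (v i) 0))" using I(5)[of "Suc k"] n by (simp add: v_def)
  thus "G k (x (Suc k)) = (SUM i:I. mm i*G k (ra (v i) (Suc k)/ra (v i) 0))" using one by (simp add: G right_diff_distrib sum_subtractf sum_distrib_right[symmetric])
 qed
}
qed

text \<open>The numerator of the objective over the square of entry 0, after undoing the shift by
  \<open>r\<close>; values are then compared by cross-multiplication.\<close>

definition fval where "fval n H h r v = (SUM i<n. SUM j<n. el (rw H i) j*(el v (Suc i) - r*el v 0)*(el v (Suc j) - r*el v 0)) +
 el v 0*(SUM i<n. el h i*(el v (Suc i) - r*el v 0))"
definition best where "best n H h r cs = fold (%v b. if fval n H h r v*(el b 0*el b 0) < fval n H h r b*(el v 0*el v 0) then v else b) cs (nthd [] cs 0)"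

lemma fval_qf: "0 < el v 0 ==> ri (fval n H h r v)/(ra v 0)^2 =
 qf n (%i j. ra (rw H i) j) (ra h) (%j. ra v (Suc j)/ra v 0 - ri r)"
proof -
assume v: "0 < el v 0"
let ?t = "ra v 0"
have e: "ra v (Suc j) / ?t - ri r = (ra v (Suc j) - ri r * ?t) / ?t" for j using v by (simp add: diff_divide_distrib)
show ?thesis unfolding e qf_def fval_def using v by (simp add: add_divide_distrib sum_divide_distrib sum_distrib_left power2_eq_square mult_ac)
qed

lemma best_mem: "cs ~= [] ==> best n H h r cs : set cs"
proof -
have "fold (%v b. if P v b then v else b) xs b : insert b (set xs)" for P xs and b :: "int list"
proof (induction xs arbitrary: b)
 case (Cons v xs)
 show ?case using Cons[of "if P v b then v else b"] by (auto split: if_splits)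
qed simp
thus "cs ~= [] ==> best n H h r cs : set cs" proof -
 assume "cs ~= []"
 hence "insert (nthd [] cs 0) (set cs) = set cs" by (auto simp: nthd_def)
 thus ?thesis unfolding best_def using \<open>!!xs b P. fold (%v b. if P v b then v else b) xs b : insert b (set xs)\<close>[of _ cs "nthd [] cs 0"] by simp
qed
qed

lemma best_le:
assumes ne: "cs ~= []" and pos: "!!v. v : set cs ==> 0 < el v 0" and u: "u : set cs"
shows "ri (fval n H h r (best n H h r cs))/(ra (best n H h r cs) 0)^2 <= ri (fval n H h r u)/(ra u 0)^2"
proof -
let ?g = "%v. ri (fval n H h r v)/(ra v 0)^2"
let ?s = "%v b. if fval n H h r v*(el b 0*el b 0) < fval n H h r b*(el v 0*el v 0) then v else b"
have c: "fval n H h r v*(el b 0*el b 0) < fval n H h r b*(el v 0*el v 0) <-> ?g v < ?g b" if "0 < el v 0" "0 < el b 0" for v b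
proof -
 have "?g v < ?g b <-> ri (fval n H h r v)*(ra b 0)^2 < ri (fval n H h r b)*(ra v 0)^2" using that by (simp add: divide_less_eq less_divide_eq mult.commute)
 also have "... <-> ri (fval n H h r v*(el b 0*el b 0)) < ri (fval n H h r b*(el v 0*el v 0))" by (simp add: power2_eq_square)
 finally show ?thesis by (simp only: of_int_less_iff)
qed
have "?g (fold ?s xs b) <= ?g b & (ALL u:set xs. ?g (fold ?s xs b) <= ?g u)" if "ALL v:insert b (set xs). 0 < el v 0" for xs b using that
proof (induction xs arbitrary: b)
 case (Cons v xs)
 have "?g (?s v b) <= ?g b & ?g (?s v b) <= ?g v" using c[of v b] Cons.prems by auto
 moreover have "ALL w:insert (?s v b) (set xs). 0 < el w 0" using Cons.prems by auto
 ultimately show ?case using Cons.IH[of "?s v b"] by fastforce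
qed simp
moreover have "ALL v:insert (nthd [] cs 0) (set cs). 0 < el v 0" using ne pos by (auto simp: nthd_def)
ultimately show ?thesis unfolding best_def using u by blast
qed

section \<open>Reduction to a box\<close>

text \<open>The blocks of variables are the homogenizing entry, \<open>y + r\<close>,
  \<open>r - y\<close> and the slacks. Their nonnegativity expresses the constraints together with
  the box of radius \<open>r\<close>.\<close>

definition rsm where "rsm n m W w r = mk n (%i. mk (Suc (2*n+m)) (%j. if j = 0 then - (2*r) else if j = Suc i | j = Suc (n+i) then 1 else 0)) @
 mk m (%k. mk (Suc (2*n+m)) (%j. if j = 0 then - (el w k+r*(SUM i<n. el (rw W k) i))
  else if j < Suc n then el (rw W k) (j - 1) else if j = Suc (2*n+k) then 1 else 0))"
text \<open>The same constraints without a box, with \<open>y\<close> split into positive and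
  negative part. This system is never solved; its elementary vectors only determine the radius of
  the box.\<close>

definition rsd where "rsd n m W w = mk m (%k. mk (Suc (2*n+m)) (%j. if j = 0 then - el w k else if j < Suc n then el (rw W k) (j - 1)
 else if j < Suc (2*n) then - el (rw W k) (j - 1 - n) else if j = Suc (2*n+k) then 1 else 0))"
text \<open>A conic decomposition has at most as many terms as variables, each reduced to a
  coefficient of at most 1 on a vector with entries at most \<open>Del\<close>.\<close>

definition Rb where "Rb n m W w = int (Suc (2*n+m))*Del (Suc (2*n+m)) (rsd n m W w)"

definition rfeas where "rfeas p n m W w y <-> (ALL k<m. (SUM j<n. ra (rw W k) j*y j) <= ra w k) & (ALL k<p. y k : \<int>)"

lemma sum_col: fixes n l :: nat assumes "n <= l" shows "(SUM j<l. if j < n then f j else 0 :: 'a::comm_monoid_add) = (SUM j<n. f j)"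
proof -
have "(SUM j<l. if j < n then f j else 0) = (SUM j<n. if j < n then f j else 0)" by (rule sum.mono_neutral_right) (use assms in auto)
thus ?thesis by simp
qed

lemma ker_rsm: "ker (Suc (2*n+m)) (rsm n m W w r) x <-> (ALL i<n. x (Suc i)+x (Suc (n+i)) = 2*ri r*x 0) &
 (ALL k<m. (SUM j<n. ra (rw W k) j*(x (Suc j) - ri r*x 0))+x (Suc (2*n+k)) = ra w k*x 0)"
proof -
have 1: "rip (Suc (2*n+m)) (ra (rw (rsm n m W w r) i)) x = x (Suc i)+x (Suc (n+i)) - 2*ri r*x 0" if i: "i < n" for i
proof -
 have "rw (rsm n m W w r) i = mk (Suc (2*n+m)) (%j. if j = 0 then - (2*r) else if j = Suc i | j = Suc (n+i) then 1 else 0)"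
  using i by (simp add: rsm_def nthd_def nth_append) (simp add: mk_def)
 hence "rip (Suc (2*n+m)) (ra (rw (rsm n m W w r) i)) x = - (2*ri r)*x 0+(SUM j<2*n+m. (if j = i then x (Suc j) else 0)+(if j = n+i then x (Suc j) else 0))"
  unfolding rip_def sum.lessThan_Suc_shift using i by (simp, intro sum.cong) auto
 also have "... = x (Suc i)+x (Suc (n+i)) - 2*ri r*x 0" using i unfolding sum.distrib by simp
 finally show ?thesis .
qed
have 2: "rip (Suc (2*n+m)) (ra (rw (rsm n m W w r) (n+k))) x = (SUM j<n. ra (rw W k) j*(x (Suc j) - ri r*x 0))+x (Suc (2*n+k)) - ra w k*x 0"
 if k: "k < m" for k
proof -
 have "rw (rsm n m W w r) (n+k) = mk (Suc (2*n+m)) (%j. if j = 0 then - (el w k+r*(SUM i<n. el (rw W k) i))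
  else if j < Suc n then el (rw W k) (j - 1) else if j = Suc (2*n+k) then 1 else 0)" using k by (simp add: rsm_def nthd_def[of _ "_ @ _"] nth_append) (simp add: mk_def)
 hence "rip (Suc (2*n+m)) (ra (rw (rsm n m W w r) (n+k))) x = - (ra w k+ri r*(SUM i<n. ra (rw W k) i))*x 0 +
   (SUM j<2*n+m. (if j < n then ra (rw W k) j*x (Suc j) else 0)+(if j = 2*n+k then x (Suc j) else 0))" unfolding rip_def sum.lessThan_Suc_shift using k by (simp, intro sum.cong) auto
 also have "... = - (ra w k+ri r*(SUM i<n. ra (rw W k) i))*x 0+((SUM j<n. ra (rw W k) j*x (Suc j))+x (Suc (2*n+k)))" using k unfolding sum.distrib by (simp add: sum_col)
 also have "... = (SUM j<n. ra (rw W k) j*(x (Suc j) - ri r*x 0))+x (Suc (2*n+k)) - ra w k*x 0"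
  by (simp add: right_diff_distrib sum_subtractf sum_distrib_left sum_distrib_right mult_ac distrib_right)
 finally show ?thesis .
qed
have "length (rsm n m W w r) = n+m" by (simp add: rsm_def)
moreover have "(ALL i<n+m. P i) <-> (ALL i<n. P i) & (ALL k<m. P (n+k))" for P by (metis add_diff_inverse_nat nat_add_left_cancel_less trans_less_add1)
ultimately show ?thesis unfolding ker_rows by (simp add: 1 2)
qed

lemma ker_rsd: "ker (Suc (2*n+m)) (rsd n m W w) x <->
 (ALL k<m. (SUM j<n. ra (rw W k) j*(x (Suc j) - x (Suc (n+j))))+x (Suc (2*n+k)) = ra w k*x 0)"
proof -
have "rip (Suc (2*n+m)) (ra (rw (rsd n m W w) k)) x = (SUM j<n. ra (rw W k) j*(x (Suc j) - x (Suc (n+j))))+x (Suc (2*n+k)) - ra w k*x 0"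
 if k: "k < m" for k
proof -
 have "rip (Suc (2*n+m)) (ra (rw (rsd n m W w) k)) x = - ra w k*x 0+(SUM j<2*n+m.
   (if j < n then ra (rw W k) j*x (Suc j) else 0) - (if j < n then 0 else if j < 2*n then ra (rw W k) (j - n)*x (Suc j) else 0)+(if j = 2*n+k then x (Suc j) else 0))"
  unfolding rip_def sum.lessThan_Suc_shift using k by (simp add: rsd_def, intro sum.cong) auto
 also have "... = - ra w k*x 0+((SUM j<n. ra (rw W k) j*x (Suc j)) - (SUM j<2*n+m. if j < n then 0 else if j < 2*n then ra (rw W k) (j - n)*x (Suc j) else 0)+x (Suc (2*n+k)))"
  using k unfolding sum.distrib sum_subtractf by (simp add: sum_col)
 also have "(SUM j<2*n+m. if j < n then 0 else if j < 2*n then ra (rw W k) (j - n)*x (Suc j) else 0) = (SUM j<n. ra (rw W k) j*x (Suc (n+j)))"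
 proof -
  have "(SUM j<2*n+m. if j < n then 0 else if j < 2*n then ra (rw W k) (j - n)*x (Suc j) else 0) = (SUM j:{n..<n+n}. ra (rw W k) (j - n)*x (Suc j))"
   by (rule sum.mono_neutral_cong_right) auto
  also have "... = (SUM j<n. ra (rw W k) j*x (Suc (n+j)))" using sum.shift_bounds_nat_ivl[of "%j. ra (rw W k) (j - n)*x (Suc j)" 0 n n] by (simp add: lessThan_atLeast0 add.commute)
  finally show ?thesis .
 qed
 finally show ?thesis by (simp add: right_diff_distrib sum_subtractf)
qed
thus ?thesis unfolding ker_rows by (simp add: rsd_def)
qed

lemma rsm_lp: assumes "1 <= r"
shows "ball_lp (Suc (2*n+m)) (rsm n m W w r)" "box_lp (Suc (2*n+m)) (rsm n m W w r) (Suc n) (2*r)"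
 "ALL b:set (rsm n m W w r). length b <= Suc (2*n+m)"
proof -
show "ALL b:set (rsm n m W w r). length b <= Suc (2*n+m)" by (auto simp: rsm_def mk_def)
show "box_lp (Suc (2*n+m)) (rsm n m W w r) (Suc n) (2*r)" unfolding box_lp_def
proof (intro allI impI)
 fix x i assume x: "ker (Suc (2*n+m)) (rsm n m W w r) x" "nn (Suc (2*n+m)) x" and i: "i < Suc n"
 show "x i <= ri (2*r)*x 0"
 proof (cases i)
  case 0
  have "1*x 0 <= ri (2*r)*x 0" using assms x(2) by (intro mult_right_mono) (auto simp: nn_def)
  thus ?thesis using 0 by simp
 next
  case (Suc j)
  hence "x (Suc j)+x (Suc (n+j)) = 2*ri r*x 0" "0 <= x (Suc (n+j))" using x i by (auto simp: ker_rsm nn_def)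
  thus ?thesis using Suc by simp
 qed
qed
show "ball_lp (Suc (2*n+m)) (rsm n m W w r)" unfolding ball_lp_def
proof (intro allI impI)
 fix x i assume x: "ker (Suc (2*n+m)) (rsm n m W w r) x" "nn (Suc (2*n+m)) x" "x 0 = 0" and i: "i < Suc (2*n+m)"
 have p: "0 <= x j" if "j < Suc (2*n+m)" for j using x(2) that by (simp add: nn_def)
 have b: "x (Suc j) = 0 & x (Suc (n+j)) = 0" if "j < n" for j using x(1,3) that p[of "Suc j"] p[of "Suc (n+j)"] by (auto simp: ker_rsm)
 have s: "x (Suc (2*n+k)) = 0" if "k < m" for k using x(1,3) that b by (simp add: ker_rsm)
 consider "i = 0" | j where "i = Suc j" "j < n" | j where "i = Suc (n+j)" "j < n" | k where "i = Suc (2*n+k)" "k < m"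
 proof (cases i)
  case (Suc j)
  thus ?thesis using that(2)[of j] that(3)[of "j - n"] that(4)[of "j - 2*n"] i by (cases "j < n"; cases "j < 2*n") auto
 qed (use that in auto)
 thus "x i = 0" using x(3) b s by cases auto
qed
qed

lemma mpt_rsm:
assumes "p <= n"
shows "mpt p (Suc (2*n+m)) (rsm n m W w r) x ==> rfeas p n m W w (%j. x (Suc j) - ri r)"
 "rfeas p n m W w y ==> (!!j. j < n ==> (abs (y j)) <= ri r) ==>
  EX x. mpt p (Suc (2*n+m)) (rsm n m W w r) x & (ALL j<n. x (Suc j) - ri r = y j)"
proof -
show "rfeas p n m W w (%j. x (Suc j) - ri r)" if x: "mpt p (Suc (2*n+m)) (rsm n m W w r) x" unfolding rfeas_def
proof (intro conjI allI impI)
 fix k assume k: "k < m"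
 hence "(SUM j<n. ra (rw W k) j*(x (Suc j) - ri r*1))+x (Suc (2*n+k)) = ra w k" "0 <= x (Suc (2*n+k))" using x by (auto simp: mpt_def ker_rsm nn_def)
 thus "(SUM j<n. ra (rw W k) j*(x (Suc j) - ri r)) <= ra w k" by simp
qed (use x in "auto simp: mpt_def")
assume y: "rfeas p n m W w y" "!!j. j < n ==> (abs (y j)) <= ri r"
define x where "x i = (if i = 0 then 1 else if i < Suc n then y (i - 1)+ri r else if i < Suc (2*n) then ri r - y (i - 1 - n)
  else ra w (i - 1 - 2*n) - (SUM j<n. ra (rw W (i - 1 - 2*n)) j*y j))" for i
have x: "x 0 = 1" "!!j. j < n ==> x (Suc j) = y j+ri r" "!!j. j < n ==> x (Suc (n+j)) = ri r - y j"
 "!!k. x (Suc (2*n+k)) = ra w k - (SUM j<n. ra (rw W k) j*y j)" by (auto simp: x_def)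
have "nn (Suc (2*n+m)) x" unfolding nn_def
proof (intro allI impI)
 fix i assume i: "i < Suc (2*n+m)"
 have "0 <= y (i - 1)+ri r" if "i ~= 0" "i < Suc n" using y(2)[of "i - 1"] that by (cases i) (auto simp: abs_le_iff)
 moreover have "0 <= ri r - y (i - 1 - n)" if "~ i < Suc n" "i < Suc (2*n)" using y(2)[of "i - 1 - n"] that by (simp add: abs_le_iff)
 moreover have "(SUM j<n. ra (rw W (i - 1 - 2*n)) j*y j) <= ra w (i - 1 - 2*n)" if "~ i < Suc (2*n)" using y(1) i that by (simp add: rfeas_def)
 ultimately show "0 <= x i" unfolding x_def by auto
qed
moreover have "ker (Suc (2*n+m)) (rsm n m W w r) x" unfolding ker_rsm by (simp add: x)
ultimately show "EX x. mpt p (Suc (2*n+m)) (rsm n m W w r) x & (ALL j<n. x (Suc j) - ri r = y j)" using x y(1) assms by (intro exI[of _ x]) (auto simp: mpt_def rfeas_def)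
qed

lemma Rb_ge_1: "1 <= Rb n m W w" using mult_mono[of 1 "int (Suc (2*n+m))" 1 "Del (Suc (2*n+m)) (rsd n m W w)"] Del_ge_1 by (simp add: Rb_def)

lemma sum_list_pair: "(SUM (t, v)<-L. f t v+g t v :: real) = (SUM (t, v)<-L. f t v)+(SUM (t, v)<-L. g t v)"
"(SUM (t, v)<-L. c*f t v) = c*(SUM (t, v)<-L. f t v)" "(SUM (t, v)<-L. SUM j:A. h j t v :: real) = (SUM j:A. SUM (t, v)<-L. h j t v)" by (induction L) (auto simp: algebra_simps sum.distrib)

text \<open>Subtract the integral parts of the recession directions in a conic decomposition of \<open>y\<close>.\<close>

lemma box_reduce:
assumes y: "rfeas p n m W w y" and pn: "p <= n"
shows "EX a u. (ALL j<n. y j = a j+u j) & rfeas p n m W w a & (ALL j<n. abs (a j) <= ri (Rb n m W w)) &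
 (ALL j. u j : \<int>) & (ALL k<m. (SUM j<n. ra (rw W k) j*u j) <= 0)"
proof -
let ?N = "Suc (2*n+m)" and ?rs = "rsd n m W w"
define X where "X i = (if i = 0 then 1 else if i < Suc n then max 0 (y (i - 1)) else if i < Suc (2*n) then max 0 (- y (i - 1 - n))
  else ra w (i - 1 - 2*n) - (SUM j<n. ra (rw W (i - 1 - 2*n)) j*y j))" for i
have X: "X 0 = 1" "!!j. j < n ==> X (Suc j) = max 0 (y j)" "!!j. j < n ==> X (Suc (n+j)) = max 0 (- y j)"
 "!!k. X (Suc (2*n+k)) = ra w k - (SUM j<n. ra (rw W k) j*y j)" by (auto simp: X_def)
have Xy: "X (Suc j) - X (Suc (n+j)) = y j" if "j < n" for j using that by (simp add: X max_def)
have "ker ?N ?rs X" unfolding ker_rsd using Xy X(1) by (simp add: X(4))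
moreover have "nn ?N X" unfolding nn_def
proof (intro allI impI)
 fix i assume i: "i < ?N"
 have "(SUM j<n. ra (rw W (i - 1 - 2*n)) j*y j) <= ra w (i - 1 - 2*n)" if "~ i < Suc (2*n)" using y(1) i that by (simp add: rfeas_def)
 thus "0 <= X i" unfolding X_def by auto
qed
ultimately obtain L where L: "length L <= card {i. i < ?N & X i ~= 0}"
 "ALL (t, v):set L. t > 0 & ielem ?N ?rs v & (ALL i<?N. X i = 0 --> el v i = 0)" "ALL i<?N. X i = (SUM (t, v)<-L. t*ra v i)" using decomp by blast
have "card {i. i < ?N & X i ~= 0} <= card {..<?N}" by (intro card_mono) auto
hence lL: "length L <= ?N" using L(1) by simp
\<comment> \<open>Only recession directions, those with entry 0 equal to 0, lose an integral
  multiple. The remaining coefficients are at most 1 anyway, since the decomposition sums to 1 at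
  index 0.\<close>
define fl where "fl t v = (if 0 < el v 0 then 0 else ri \<lfloor>t\<rfloor>)" for t :: real and v :: "int list"
define dv where "dv v j = ra v (Suc j) - ra v (Suc (n+j))" for v j
define u where "u j = (SUM (t, v)<-L. fl t v*dv v j)" for j
define a where "a j = (SUM (t, v)<-L. (t - fl t v)*dv v j)" for j
have au: "y j = a j+u j" if j: "j < n" for j
proof -
 have "y j = (SUM (t, v)<-L. t*ra v (Suc j)) - (SUM (t, v)<-L. t*ra v (Suc (n+j)))" using Xy[OF j] L(3) j by simp
 also have "... = a j+u j" unfolding a_def u_def dv_def by (induction L) (auto simp: algebra_simps)
 finally show ?thesis .
qed
have uZ: "u j : \<int>" for j unfolding u_def dv_def fl_def by (induction L) (auto intro!: Ints_add Ints_mult Ints_diff)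
have dvW: "(SUM j<n. ra (rw W k) j*dv v j) <= ra w k*ra v 0" if v: "ielem ?N ?rs v" and k: "k < m" for v k
proof -
 have "ker ?N ?rs (ra v)" using v by (auto simp: ielem_def dest: elemD)
 hence "(SUM j<n. ra (rw W k) j*dv v j)+ra v (Suc (2*n+k)) = ra w k*ra v 0" using k by (simp add: ker_rsd dv_def)
 moreover have "0 <= ra v (Suc (2*n+k))" using ielem_pos[OF v, of "Suc (2*n+k)"] k by simp
 ultimately show ?thesis by linarith
qed
have t1: "t*ra v 0 <= 1" if tv: "(t, v) : set L" for t v
proof -
 have "t*ra v 0 <= (SUM (t, v)<-L. t*ra v 0)"
 proof (rule member_le_sum_list[of "t*ra v 0" "map (%(t, v). t*ra v 0) L", simplified])
  show "t*ra v 0 : (%(t, v). t*ra v 0) ` set L" using tv by (force simp: image_iff)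
  show "!!x. x : (%(t, v). t*ra v 0) ` set L ==> 0 <= x" using L(2) ielem_pos[of ?N ?rs _ 0] by fastforce
 qed
 thus ?thesis using L(3) X(1) by auto
qed
have fr: "0 <= t - fl t v & t - fl t v <= 1" if tv: "(t, v) : set L" for t v
proof (cases "0 < el v 0")
 case True
 have "0 < t" using L(2) tv by blast
 hence "t*1 <= t*ra v 0" using True by (intro mult_left_mono) auto
 hence "t <= 1" using t1[OF tv] by linarith
 thus ?thesis using True \<open>0 < t\<close> by (simp add: fl_def)
next
 case False
 thus ?thesis by (simp add: fl_def) linarith
qed
have dvD: "abs (dv v j) <= ri (Del ?N ?rs)" if "(t, v) : set L" "j < n" for t v j
proof -
 have v: "ielem ?N ?rs v" using L(2) that by blast
 have "0 <= el v i & el v i <= Del ?N ?rs" if "i < ?N" for i using v ielem_pos[OF v that] that by (simp add: ielem_def)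
 from this[of "Suc j"] this[of "Suc (n+j)"] show ?thesis using that(2) by (simp add: dv_def abs_le_iff)
qed
have aR: "abs (a j) <= ri (Rb n m W w)" if j: "j < n" for j
proof -
 have "abs ((SUM (t, v)<-K. (t - fl t v)*dv v j)) <= real (length K)*ri (Del ?N ?rs)" if "set K \<subseteq> set L" for K using that
 proof (induction K)
  case (Cons tv K)
  obtain t v where tv: "tv = (t, v)" by (cases tv)
  have "abs ((t - fl t v)*dv v j) <= 1*ri (Del ?N ?rs)" unfolding abs_mult using Cons.prems fr[of t v] dvD[of t v j] j tv by (intro mult_mono) auto
  thus ?case using Cons tv by (simp add: algebra_simps)
 qed simp
 from this[OF order_refl] have "abs (a j) <= real (length L)*ri (Del ?N ?rs)" by (simp add: a_def)
 also have "... <= real ?N*ri (Del ?N ?rs)" using lL Del_ge_1[of ?N ?rs] by (intro mult_right_mono) auto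
 finally show ?thesis by (simp add: Rb_def)
qed
have Wsum: "(SUM j<n. ra (rw W k) j*(SUM (t, v)<-L. g t v*dv v j)) = (SUM (t, v)<-L. g t v*(SUM j<n. ra (rw W k) j*dv v j))" for g k
 unfolding sum_list_pair(2)[symmetric] sum_list_pair(3)[symmetric] by (induction L) (auto simp: sum_distrib_left sum.distrib algebra_simps)
have uW: "(SUM j<n. ra (rw W k) j*u j) <= 0" if k: "k < m" for k
proof -
 have "fl t v*(SUM j<n. ra (rw W k) j*dv v j) <= 0" if tv: "(t, v) : set L" for t v
 proof (cases "0 < el v 0")
  case False
  have v: "ielem ?N ?rs v" "0 < t" using L(2) tv by blast+
  hence "el v 0 = 0" using False ielem_pos[OF v(1), of 0] by simp
  hence "(SUM j<n. ra (rw W k) j*dv v j) <= 0" using dvW[OF v(1) k] by simp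
  thus ?thesis using False v(2) by (simp add: fl_def mult_nonneg_nonpos)
 qed (simp add: fl_def)
 hence "(SUM (t, v)<-L. fl t v*(SUM j<n. ra (rw W k) j*dv v j)) <= 0" by (intro sum_list_nonpos) auto
 thus ?thesis unfolding u_def Wsum .
qed
have aW: "(SUM j<n. ra (rw W k) j*a j) <= ra w k" if k: "k < m" for k
proof -
 have "(t - fl t v)*(SUM j<n. ra (rw W k) j*dv v j) <= ra w k*(t*ra v 0)" if tv: "(t, v) : set L" for t v
 proof -
  have v: "ielem ?N ?rs v" using L(2) tv by blast
  have "(t - fl t v)*(SUM j<n. ra (rw W k) j*dv v j) <= (t - fl t v)*(ra w k*ra v 0)" using fr[OF tv] dvW[OF v k] by (intro mult_left_mono) auto
  also have "... = ra w k*(t*ra v 0)" using ielem_pos[OF v, of 0] by (auto simp: fl_def)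
  finally show ?thesis .
 qed
 hence "(SUM (t, v)<-L. (t - fl t v)*(SUM j<n. ra (rw W k) j*dv v j)) <= (SUM (t, v)<-L. ra w k*(t*ra v 0))" by (intro sum_list_mono) auto
 also have "... = ra w k" using L(3) X(1) unfolding sum_list_pair by auto
 finally show ?thesis unfolding a_def Wsum .
qed
have "a k : \<int>" if "k < p" for k
proof -
 have "a k = y k - u k" using au[of k] that pn by simp
 thus ?thesis using y uZ[of k] that by (auto simp: rfeas_def intro: Ints_diff)
qed
hence "rfeas p n m W w a" using aW by (simp add: rfeas_def)
thus ?thesis using au aR uZ uW by (intro exI[of _ a] exI[of _ u]) auto
qed

lemma qf_line: "qf n H h (%j. a j+c*u j) = qf n H h a+c*(qb n H a u+qb n H u a+rip n h u)+c^2*qb n H u u"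
unfolding qf_qb qb_add qb_scale rip_add_right rip_scale_right by (simp add: power2_eq_square algebra_simps)

text \<open>Along the ray the objective is a quadratic polynomial in \<open>k\<close>; being bounded
  on all natural numbers it is constant. The upper bound is available in the only nontrivial case,
  that of a finite supremum.\<close>

lemma qf_recession:
assumes "!!k::nat. lo <= qf n H h (%j. a j+real k*u j) & qf n H h (%j. a j+real k*u j) <= hi"
shows "qf n H h (%j. a j+u j) = qf n H h a"
proof -
define B where "B = qb n H a u+qb n H u a+rip n h u"
define C where "C = qb n H u u"
define K where "K = hi - lo"
have f: "qf n H h (%j. a j+c*u j) = qf n H h a+(c*B+c^2*C)" for c unfolding qf_line B_def C_def by simp
have b: "abs (real k*B+(real k)^2*C) <= K" for k using assms[of k] assms[of 0] unfolding f K_def by (simp add: abs_le_iff)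
have small: "x = 0" if "!!k::nat. real k*abs x <= Q" for x Q :: real
proof (rule ccontr)
 assume "x ~= 0"
 then obtain k :: nat where "Q < real k*abs x" using reals_Archimedean3[of "abs x"] by auto
 thus False using that[of k] by simp
qed
\<comment> \<open>With \<open>g\<close> the change of the objective along the ray,
  \<open>g (2 * k) - 2 * g k\<close> isolates the quadratic coefficient.\<close>
have "C = 0"
proof (rule small)
 fix k :: nat
 have "2*(real k)^2*C = (real (2*k)*B+(real (2*k))^2*C) - 2*(real k*B+(real k)^2*C)" by (simp add: power2_eq_square algebra_simps)
 moreover have "abs z <= 3*K" if "z = q - 2*s" "abs s <= K" "abs q <= K" for z s q using that by linarith
 ultimately have "abs (2*(real k)^2*C) <= 3*K" using b[of k] b[of "2*k"] by blast
 hence "2*(real k)^2*abs C <= 3*K" by (simp add: abs_mult)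
 moreover have "real k*abs C <= 2*(real k)^2*abs C" by (rule mult_right_mono) (cases k; simp add: power2_eq_square algebra_simps)+
 ultimately show "real k*abs C <= 3*K" by linarith
qed
moreover have "B = 0"
proof (rule small)
 fix k :: nat
 show "real k*abs B <= K" using b[of k] \<open>C = 0\<close> by (simp add: abs_mult)
qed
ultimately show ?thesis using f[of 1] by simp
qed

definition mall where "mall p n m W w = mcand p (Suc n) (Suc (2*n+m)) (rsm n m W w (Rb n m W w)) (2*Rb n m W w)"

text \<open>An arbitrary feasible \<open>y\<close> is moved into the box by removing an integral
  recession vector. All its multiples keep feasibility, so the objective does not change, and the
  estimate for the box carries over to the whole feasible region.\<close>

theorem mall_correct:
fixes n m p W w H h
assumes pn: "p <= n"
defines "r == Rb n m W w" and "cs == mall p n m W w" and "F == qf n (%i j. ra (rw H i) j) (ra h)"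
defines "b == best n H h r cs"
defines "yb == %j. ra b (Suc j)/ra b 0 - ri r"
shows "rfeas p n m W w y ==> cs ~= []"
 "cs ~= [] ==> 0 < el b 0 & rfeas p n m W w yb"
 "rfeas p n m W w y ==> (!!x. rfeas p n m W w x ==> lo <= F x & F x <= S) ==> S - F y <= 8*(real (Suc n))^2*(S - F yb)"
proof -
let ?N = "Suc (2*n+m)" and ?rs = "rsm n m W w r"
have r: "1 <= r" "1 <= 2*r" using Rb_ge_1[of n m W w] by (auto simp: r_def)
note mc = mcand_correct[of p "Suc n" ?N ?rs "2*r", OF _ _ rsm_lp(1,2)[OF r(1)] r(2) rsm_lp(3)[OF r(1)], folded mall_def[of p n m W w, folded r_def], folded cs_def]
have cp: "0 < el u 0" "rfeas p n m W w (%j. ra u (Suc j)/ra u 0 - ri r)" if u: "u : set cs" for u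
proof -
 have "0 < el u 0 & (EX x. mpt p ?N ?rs x & (ALL j<Suc n. x j = ra u j/ra u 0))" using u pn by (intro mc(1)) auto
 then obtain x where x: "0 < el u 0" "mpt p ?N ?rs x" "ALL j<Suc n. x j = ra u j/ra u 0" by blast
 have "rfeas p n m W w (%j. x (Suc j) - ri r)" by (rule mpt_rsm(1)[OF pn x(2)])
 thus "0 < el u 0" "rfeas p n m W w (%j. ra u (Suc j)/ra u 0 - ri r)" using x pn by (auto simp: rfeas_def)
qed
show "cs ~= [] ==> 0 < el b 0 & rfeas p n m W w yb" using cp best_mem unfolding b_def yb_def by blast
assume y: "rfeas p n m W w y"
obtain a u where au: "ALL j<n. y j = a j+u j" "rfeas p n m W w a" "ALL j<n. abs (a j) <= ri r" "ALL j. u j : \<int>" "ALL k<m. (SUM j<n. ra (rw W k) j*u j) <= 0"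
 using box_reduce[OF y pn] unfolding r_def by blast
obtain x where x: "mpt p ?N ?rs x" "ALL j<n. x (Suc j) - ri r = a j" using mpt_rsm(2)[OF pn au(2)] au(3) by blast
show ne: "cs ~= []" by (rule mc(2)[OF _ _ x(1)]) (use pn in auto)
assume bd: "!!x. rfeas p n m W w x ==> lo <= F x & F x <= S"
have "F y = F (%j. a j+u j)" unfolding F_def using au(1) by (intro qf_cong) auto
also have "... = F a" unfolding F_def
proof (rule qf_recession)
 fix k :: nat
 have "rfeas p n m W w (%j. a j+real k*u j)" unfolding rfeas_def
 proof (intro conjI allI impI)
  fix i assume i: "i < m"
  have "(SUM j<n. ra (rw W i) j*(a j+real k*u j)) = (SUM j<n. ra (rw W i) j*a j)+real k*(SUM j<n. ra (rw W i) j*u j)"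
   unfolding distrib_left sum.distrib sum_distrib_left by (simp add: mult_ac)
  also have "... <= ra w i+0" using au(2,5) i by (intro add_mono) (auto simp: rfeas_def mult_nonneg_nonpos)
  finally show "(SUM j<n. ra (rw W i) j*(a j+real k*u j)) <= ra w i" by simp
 qed (use au in "auto simp: rfeas_def intro!: Ints_add Ints_mult")
 thus "lo <= qf n (%i j. ra (rw H i) j) (ra h) (%j. a j+real k*u j) & qf n (%i j. ra (rw H i) j) (ra h) (%j. a j+real k*u j) <= S" using bd by (simp add: F_def)
qed
also have "F a = F (%j. x (Suc j) - ri r)" unfolding F_def using x(2) by (intro qf_cong) auto
finally have Fy: "F y = F (%j. x (Suc j) - ri r)" .
show "S - F y <= 8*(real (Suc n))^2*(S - F yb)" unfolding Fy unfolding F_def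
proof (rule mc(3)[where G = "%j t. t - ri r" and r = "ri r", OF _ _ x(1)])
 fix u assume u: "u : set cs"
 have "ri (fval n H h r b)/(ra b 0)^2 <= ri (fval n H h r u)/(ra u 0)^2" unfolding b_def by (rule best_le[OF ne cp(1) u])
 hence "F yb <= F (%j. ra u (Suc j)/ra u 0 - ri r)" using fval_qf[of b n H h r] fval_qf[of u n H h r] cp(1)[OF u] cp(1)[OF best_mem[OF ne, of n H h r]] by (simp add: F_def yb_def b_def)
 thus "qf n (%i j. ra (rw H i) j) (ra h) yb <= qf n (%i j. ra (rw H i) j) (ra h) (%j. ra u (Suc j)/ra u 0 - ri r) &
   qf n (%i j. ra (rw H i) j) (ra h) (%j. ra u (Suc j)/ra u 0 - ri r) <= S" using bd[OF cp(2)[OF u]] by (simp add: F_def)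
qed (use pn in auto)
qed

section \<open>The algorithm on lists\<close>

lemma PT_mspn [PT_rules]:
assumes "PT D p" "pb D p" "PT D M" "pb D M" "PT D N" "pb D N" "PT D rs" "PT D R" "PT D ob" and pq: "!!q x. x : D q ==> p x = q"
shows "PT D (%x. mspn (p x) (M x) (N x) (rs x) (R x) (ob x))"
proof -
have DR: "PT D (%x. DelR (p x) (N x) (rs x) (R x))" by (intro assms PT_rules)
have o: "PT (ext D (%_. UNIV)) (%z. orcl (p (fst z)) (N (fst z)) (rs (fst z)) (R (fst z)) (ob (fst z)) (mk (M (fst z)) (el (snd z))))"
proof (rule PT_orcl)
 show "PT (ext D (%_. UNIV)) (%z. mk (M (fst z)) (el (snd z)))" by (intro assms(3) assms(4) PT_rules)
qed (intro assms(1,5,7-9)[THEN PT_lift] assms(2,6)[THEN pb_lift] | auto simp: ext_def pq)+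
show ?thesis unfolding mspn_def by (rule PT_spn) (intro assms DR o PT_rules)+
qed

lemma PT_midp [PT_rules]: assumes "PT D M" "pb D M" "PT D u" "PT D v" shows "PT D (%x. midp (M x) (u x) (v x))" unfolding midp_def by (intro assms PT_rules)

lemma PT_mcls:
assumes "PT D p" "pb D p" "PT D M" "pb D M" "PT D N" "pb D N" "PT D rs" "PT D R" "PT D ob" and pq: "!!q x. x : D q ==> p x = q"
shows "PT D (%x. mcls (p x) (M x) (N x) (rs x) (R x) (ob x))"
proof -
have us: "PT D (%x. map fst (filter (%w. snd w = el (fst w) 0) (mspn (p x) (M x) (N x) (rs x) (R x) (ob x))))" by (intro assms PT_rules) (auto simp: pq)
show ?thesis unfolding mcls_def Let_def by (intro us assms(3) assms(4) PT_rules)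
qed

lemma PT_pcls [PT_rules]: assumes "PT D p" and pq: "!!q x. x : D q ==> p x = q" shows "PT D (%x. pcls (p x))" unfolding pcls_def
by (rule PT_iter_const[where N = "%q. q"]) (intro PT_rules assms | simp add: pq)+

lemma PT_mcand [PT_rules]:
assumes "PT D p" "pb D p" "PT D M" "pb D M" "PT D N" "pb D N" "PT D rs" "PT D R" and pq: "!!q x. x : D q ==> p x = q"
shows "PT D (%x. mcand (p x) (M x) (N x) (rs x) (R x))"
proof -
have "PT (ext D A) (%z. mcls (p (fst z)) (M (fst z)) (N (fst z)) (rs (fst z)) (R (fst z)) (snd z))" for A
 by (rule PT_mcls) (intro assms(1,3,5,7,8)[THEN PT_lift] assms(2,4,6)[THEN pb_lift] PT_snd PT_id | auto simp: ext_def pq)+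
thus ?thesis unfolding mcand_def by (intro assms(1) PT_rules) (auto simp: pq)
qed

lemma PT_rsm [PT_rules]: assumes "PT D n" "pb D n" "PT D m" "pb D m" "PT D W" "PT D w" "PT D r"
shows "PT D (%x. rsm (n x) (m x) (W x) (w x) (r x))" unfolding rsm_def by (intro assms PT_rules)

lemma PT_rsd [PT_rules]: assumes "PT D n" "pb D n" "PT D m" "pb D m" "PT D W" "PT D w"
shows "PT D (%x. rsd (n x) (m x) (W x) (w x))" unfolding rsd_def by (intro assms PT_rules)

lemma PT_Rb [PT_rules]: assumes "PT D n" "pb D n" "PT D m" "pb D m" "PT D W" "PT D w"
shows "PT D (%x. Rb (n x) (m x) (W x) (w x))" unfolding Rb_def by (intro assms PT_rules)

lemma PT_mall [PT_rules]: assumes "PT D p" "PT D n" "pb D n" "PT D m" "pb D m" "PT D W" "PT D w" and pq: "!!q x. x : D q ==> p x = q"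
shows "PT D (%x. mall (p x) (n x) (m x) (W x) (w x))" unfolding mall_def by (intro PT_mcand PT_rsm PT_Rb PT_rules pb_intros assms pb_pconst[where h = "%q. q"]) (simp add: pq)

lemma PT_fval [PT_rules]: assumes "PT D n" "pb D n" "PT D H" "PT D h" "PT D r" "PT D v"
shows "PT D (%x. fval (n x) (H x) (h x) (r x) (v x))" unfolding fval_def by (intro assms PT_rules)

lemma PT_best [PT_rules]: assumes "PT D n" "pb D n" "PT D H" "PT D h" "PT D r" "PT D cs"
shows "PT D (%x. best (n x) (H x) (h x) (r x) (cs x))" unfolding best_def
proof (rule PT_fold_dom[where E = "ext D (%_. UNIV)" and M = "%x. isize (cs x)" and
 h = "%x v b. if fval (n x) (H x) (h x) (r x) v*(el b 0*el b 0) < fval (n x) (H x) (h x) (r x) b*(el v 0*el v 0) then v else b"])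
show "PT (ext D (%_. UNIV)) (%z. if fval (n (fst z)) (H (fst z)) (h (fst z)) (r (fst z)) (fst (snd z))*(el (snd (snd z)) 0*el (snd (snd z)) 0)
  < fval (n (fst z)) (H (fst z)) (h (fst z)) (r (fst z)) (snd (snd z))*(el (fst (snd z)) 0*el (fst (snd z)) 0) then fst (snd z) else snd (snd z))" by (intro assms(1,3-5) assms(2) PT_rules)
show "PT D (%x. nthd [] (cs x) 0)" by (intro assms PT_rules)
show "pb D (%x. isize (cs x))" by (rule PT_size) fact
fix p x i
have "fold (%v b. if P v b then v else b) xs b : insert b (set xs)" for P xs and b :: "int list"
proof (induction xs arbitrary: b)
 case (Cons v xs)
 show ?case using Cons[of "if P v b then v else b"] by (auto split: if_splits)
qed simp
from this[of "%v b. fval (n x) (H x) (h x) (r x) v*(el b 0*el b 0) < fval (n x) (H x) (h x) (r x) b*(el v 0*el v 0)" "take i (cs x)" "nthd [] (cs x) 0"]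
have "fold (%v b. if fval (n x) (H x) (h x) (r x) v*(el b 0*el b 0) < fval (n x) (H x) (h x) (r x) b*(el v 0*el v 0) then v else b)
  (take i (cs x)) (nthd [] (cs x) 0) : insert (nthd [] (cs x) 0) (set (cs x))" (is "?f : _") using set_take_subset[of i "cs x"] by blast
thus "isize ?f <= isize (cs x)" using isize_rw[of "cs x" 0] isize_mem[of _ "cs x"] by auto
qed (use assms in "auto simp: ext_def")

section \<open>Decoding of the input and the complete algorithm\<close>

definition inn where "inn L = nat (el L 0)"
definition inp where "inp L = nat (el L 1)"
definition inm where "inm L = nat (el L 2)"
definition inc where "inc L = inn L*inn L+inn L+inm L*inn L+inm L"
text \<open>One common denominator for the whole input. Multiplying constraints and objective by
  this positive number changes neither the feasible set nor the approximate solutions.\<close>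

definition inden where "inden L = (PROD e<inc L. el L (4+2*e))"
definition ent where "ent L e = el L (3+2*e)*(inden L div el L (4+2*e))"
definition inH where "inH L = mk (inn L) (%i. mk (inn L) (%j. ent L (i*inn L+j)))"
definition inh where "inh L = mk (inn L) (%i. ent L (inn L*inn L+i))"
definition inW where "inW L = mk (inm L) (%k. mk (inn L) (%j. ent L (inn L*inn L+inn L+k*inn L+j)))"
definition inw where "inw L = mk (inm L) (%k. ent L (inn L*inn L+inn L+inm L*inn L+k))"
definition inR :: "int list => int" where "inR L = Rb (inn L) (inm L) (inW L) (inw L)"
definition algc where "algc L = mall (inp L) (inn L) (inm L) (inW L) (inw L)"
definition algb where "algb L = best (inn L) (inH L) (inh L) (inR L) (algc L)"
definition alg where "alg L = (if algc L = [] then [0] else 1 # concat (map (%i. [el (algb L) (Suc i) - inR L*el (algb L) 0, el (algb L) 0]) [0..<inn L]))"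

definition inD where "inD p = {L. inp L = p & length L = 3+2*inc L}"

lemma PT_alg: "PT inD alg"
proof -
have c: "inn L <= length L & inm L <= length L & inc L <= length L" if "L : inD q" for L q using that by (auto simp: inD_def) (auto simp: inc_def)
have n: "PT inD inn" "pb inD inn" and m: "PT inD inm" "pb inD inm" and p: "PT inD inp" unfolding inn_def inm_def inp_def
 by (intro PT_nat PT_rules pb_mono[OF pb_length[OF PT_id]] | rule order_trans, erule c[unfolded inn_def inm_def, THEN conjunct1] | auto dest: c simp: inn_def inm_def)+
have ic: "PT inD inc" "pb inD inc" unfolding inc_def by (intro n m PT_rules)+
have den: "PT inD inden" unfolding inden_def by (intro ic PT_rules)
have e: "PT (ext (ext inD A) B) (%z. ent (fst (fst z)) (f z))" if "PT (ext (ext inD A) B) f" for A B f unfolding ent_def by (intro that den PT_rules)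
have e1: "PT (ext inD A) (%z. ent (fst z) (f z))" if "PT (ext inD A) f" for A f unfolding ent_def by (intro that den PT_rules)
note l = n(1)[THEN PT_lift] n(1)[THEN PT_lift, THEN PT_lift] m(1)[THEN PT_lift] m(1)[THEN PT_lift, THEN PT_lift] n(2)[THEN pb_lift] m(2)[THEN pb_lift]
have H: "PT inD inH" unfolding inH_def by (intro e n l PT_rules)
have h: "PT inD inh" unfolding inh_def by (intro e1 n l PT_rules)
have W: "PT inD inW" unfolding inW_def by (intro e n m l PT_rules)
have w: "PT inD inw" unfolding inw_def by (intro e1 n m l PT_rules)
have R: "PT inD inR" unfolding inR_def by (intro n m W w PT_rules)
have cs: "PT inD algc" unfolding algc_def by (intro p n m W w PT_rules) (auto simp: inD_def)
have b: "PT inD algb" unfolding algb_def by (intro n H h R cs PT_rules)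
show ?thesis unfolding alg_def by (intro n cs b R PT_rules)
qed

section \<open>Input and output\<close>

text \<open>The length of the input, computed from the dimensions at its beginning.\<close>

definition lenE :: iexp where
"lenE = Add (Const 3) (Mul (Const 2) (Add (Add (Add (Mul (Read 0 (Const 0)) (Read 0 (Const 0))) (Read 0 (Const 0)))
 (Mul (Read 0 (Const 2)) (Read 0 (Const 0)))) (Read 0 (Const 2))))"
text \<open>The input is read from its end because the list code grows at its head.\<close>

definition readP :: prog where
"readP = Seq (wr 1 (Const 0)) (Seq (wr 0 lenE) (WhilePos (vr 0)
 (Seq (wr 0 (Sub (vr 0) (Const 1))) (Seq (wr 2 (vr 1)) (Seq (wr 1 (Read 0 (vr 0))) (pairP 1))))))"
text \<open>The square in the guard tests whether the remaining list code is nonzero, that is,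
  whether the list is nonempty.\<close>

definition writeP :: prog where
"writeP = Seq (wr 0 (Const 0)) (WhilePos (Mul (vr 1) (vr 1))
 (Seq (unpairP 1) (Seq (Write 1 (vr 0) (vr 1)) (Seq (wr 1 (vr 2)) (wr 0 (Add (vr 0) (Const 1)))))))"

lemma kk_1: "kk 1 <= 10" using size_int_of_nat_le[of 1] size_int_of_nat_le[of 2] size_int_of_nat_le[of 3] size_int_of_nat_le[of 4] by (simp add: kk_def)

lemma enc_int_list: "enc ((x::int) # xs) = pr x (enc xs)" by (simp add: enc_int_def)

lemma size_int_01 [simp]: "size_int 0 = 0" "size_int 1 = 1" "size_int (Suc 0) = 1" by (simp_all add: size_int_def floorlog_def)

lemma size_small: "size_int 2 <= 2" "size_int 3 <= 3" "sk 2 <= 2" "sk 1 <= 1" "sk 0 <= 0"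
using size_int_of_nat_le[of 2] size_int_of_nat_le[of 3] size_int_of_nat_le[of 1] size_int_of_nat_le[of 0] by simp_all

lemma read_ex:
assumes L: "0 <= el L 0" "0 <= el L 2" "length L = 3+2*inc L"
shows "EX s'. ex readP (input_store L) (10000*(isize L+100)^3) s' & cell s' 1 = enc L"
proof -
define Z where "Z = isize L+100"
define s where "s = input_store L"
have sL: "s 0 (int i) = el L i" for i by (simp add: s_def input_store_def nthd_def)
have n: "s 0 0 = int (inn L)" "s 0 2 = int (inm L)" using sL[of 0] sL[of 2] L by (simp_all add: inn_def inm_def)
have lZ: "length L <= isize L" by (rule length_le_isize)
have szn: "sk k <= isize L" if "k <= length L" for k using size_int_of_nat_le[of k] lZ that by linarith
define s1 where "s1 = setc (setc s 1 0) 0 (int (length L))"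
define Inv where "Inv i s' <-> s' 0 = s 0 & cell s' 0 = int (length L - i) & cell s' 1 = enc (drop (length L - i) L)" for i s'
let ?b = "Seq (wr 0 (Sub (vr 0) (Const 1))) (Seq (wr 2 (vr 1)) (Seq (wr 1 (Read 0 (vr 0))) (pairP 1)))"
have "EX s'. ex (WhilePos (vr 0) ?b) s1 (8000*Z^3) s' & Inv (length L) s'"
proof (rule ex_while[where C = "2*Z" and B = "7000*Z^2"])
 fix i s' assume I: "Inv i s'" and i: "i < length L"
 let ?k = "length L - Suc i"
 have k: "int (length L - i) - 1 = int ?k" "Suc ?k = length L - i" using i by auto
 have sz: "size_int (int (length L - i)) <= isize L" "size_int (int ?k) <= isize L" by (rule szn, simp)+
 have se: "size_int (enc (drop j L)) <= isize L" for j using isize_drop[of j L] by (simp add: isize_def)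
 have sl: "size_int (el L ?k) <= isize L" using isize_mem[of "L ! ?k" L] i by (simp add: nthd_def)
 let ?s1 = "setc s' 0 (int ?k)" and ?s2 = "setc (setc s' 0 (int ?k)) 2 (enc (drop (length L - i) L))"
 let ?s3 = "setc ?s2 1 (el L ?k)"
 have 1: "ex (wr 0 (Sub (vr 0) (Const 1))) s' (4*Z) ?s1"
 proof (rule ex_wr_val)
  obtain x where x: "cell s' 0 = x" "x - 1 = int ?k" "size_int x <= isize L" "size_int (x - 1) <= isize L" using I sz unfolding Inv_def k(1)[symmetric] by blast
  show "ival s' (Sub (vr 0) (Const 1)) = int ?k" "2+sk 0+icost s' (Sub (vr 0) (Const 1)) <= 4*Z" using x by (simp_all add: Z_def)
 qed
 have 2: "ex (wr 2 (vr 1)) ?s1 (4*Z) ?s2" by (rule ex_wr_val) (use I se[of "length L - i"] size_small in "auto simp: Inv_def Z_def")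
 have r: "?s2 0 (int ?k) = el L ?k" using I sL by (simp add: Inv_def setc_def)
 have 3: "ex (wr 1 (Read 0 (vr 0))) ?s2 (4*Z) ?s3" by (rule ex_wr_val) (use I sl sz size_small r in "auto simp: Z_def")
 obtain s4 where s4: "ex (pairP 1) ?s3 (1000*(size_int (cell ?s3 1)+size_int (cell ?s3 (1+1))+kk 1+3)^2) s4"
  "agree 1 ?s3 s4" "cell s4 1 = pr (cell ?s3 1) (cell ?s3 (1+1))" by (rule pairP_ex)
 have c: "cell ?s3 1 = el L ?k" "cell ?s3 (1+1) = enc (drop (length L - i) L)" by simp_all
 have "size_int (cell ?s3 1)+size_int (cell ?s3 (1+1))+kk 1+3 <= 2*Z" unfolding c using sl se[of "length L - i"] kk_1 by (simp add: Z_def)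
 hence "1000*(size_int (cell ?s3 1)+size_int (cell ?s3 (1+1))+kk 1+3)^2 <= 1000*(2*Z)^2" by (intro mult_left_mono power_mono) auto
 hence T: "1000*(size_int (cell ?s3 1)+size_int (cell ?s3 (1+1))+kk 1+3)^2 <= 4000*Z^2" by (simp add: power2_eq_square)
 have ZZ: "Z <= Z^2" "100 <= Z" by (simp_all add: Z_def power2_eq_square)
 have b: "ex ?b s' (7000*Z^2) s4" by (rule ex_seq[OF 1 ex_seq[OF 2 ex_seq[OF 3 s4(1) order_refl] order_refl]]) (use T ZZ in linarith)
 have "Inv (Suc i) s4" unfolding Inv_def
 proof (intro conjI)
  show "s4 0 = s 0" using s4(2) I by (auto simp: agree_def Inv_def setc_def)
  show "cell s4 0 = int (length L - Suc i)" using agree_cell[OF s4(2), of 0] by simp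
  have nk: "el L ?k = L ! ?k" using i by (simp add: nthd_def)
  have "drop ?k L = L ! ?k # drop (length L - i) L" using Cons_nth_drop_Suc[of ?k L] i k by simp
  thus "cell s4 1 = enc (drop ?k L)" unfolding s4(3) c enc_int_list[symmetric] using i nk by (simp only:)
 qed
 moreover have "0 < ival s' (vr 0)" using I i by (simp add: Inv_def)
 moreover have "icost s' (vr 0) <= 2*Z" using I sz by (simp add: Inv_def Z_def)
 ultimately show "0 < ival s' (vr 0) & icost s' (vr 0) <= 2*Z & (EX s''. ex ?b s' (7000*Z^2) s'' & Inv (Suc i) s'')" using b by blast
next
 fix s' assume "Inv (length L) s'"
 thus "~ 0 < ival s' (vr 0) & icost s' (vr 0) <= 2*Z" by (simp add: Inv_def Z_def)
next
 show "Inv 0 s1" by (simp add: Inv_def s1_def setc_def cell_def)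
 have "(length L+1)*(1+2*Z+7000*Z^2) <= Z*(8000*Z^2)"
 proof (rule mult_mono)
  show "length L+1 <= Z" using lZ by (simp add: Z_def)
  have "100*Z <= Z^2" unfolding power2_eq_square by (rule mult_right_mono) (simp_all add: Z_def)
  moreover have "1 <= Z" by (simp add: Z_def)
  ultimately show "1+2*Z+7000*Z^2 <= 8000*Z^2" by linarith
 qed auto
 thus "(length L+1)*(1+2*Z+7000*Z^2) <= 8000*Z^3" by (simp add: power3_eq_cube power2_eq_square mult_ac)
qed
then obtain s' where s': "ex (WhilePos (vr 0) ?b) s1 (8000*Z^3) s'" "Inv (length L) s'" by blast
have w1: "ex (wr 1 (Const 0)) s (4*Z) (setc s 1 0)" by (rule ex_wr_val) (use size_small in "auto simp: Z_def")
have w2: "ex (wr 0 lenE) (setc s 1 0) (30*Z) s1" unfolding s1_def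
proof (rule ex_wr_val)
 have r: "setc s 1 0 0 0 = int (inn L)" "setc s 1 0 0 2 = int (inm L)" using n by (simp_all add: setc_def)
 show "ival (setc s 1 0) lenE = int (length L)" using L(3) r by (simp add: lenE_def inc_def)
 define n m where "n = inn L" and "m = inm L"
 have lL: "length L = 3+2*(n*n+n+m*n+m)" using L(3) by (simp add: inc_def n_def m_def)
 hence "n <= length L" "m <= length L" "n*n <= length L" "m*n <= length L" "n*n+n <= length L"
  "n*n+n+m*n <= length L" "n*n+n+m*n+m <= length L" "2*(n*n+n+m*n+m) <= length L" "3+2*(n*n+n+m*n+m) <= length L" by simp_all
 note q = this[THEN szn, unfolded of_nat_add of_nat_mult of_nat_numeral]
 have "icost (setc s 1 0) lenE <= 25*(isize L+4)" unfolding lenE_def icost.simps ival.simps r n_def[symmetric] m_def[symmetric] using q size_small(1,2)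
  by (simp only: size_int_01) (simp only: algebra_simps)
 hence e: "icost (setc s 1 0) lenE <= 25*Z" by (simp add: Z_def)
 thus "2+sk 0+icost (setc s 1 0) lenE <= 30*Z" by (simp add: Z_def)
qed
have "ex readP s (10000*Z^3) s'" unfolding readP_def
proof (rule ex_seq[OF w1 ex_seq[OF w2 s'(1) order_refl]])
 have "Z*1 <= Z*(Z*Z)" "100 <= Z" by (intro mult_left_mono) (auto simp: Z_def)
 thus "1+4*Z+(1+30*Z+8000*Z^3) <= 10000*Z^3" unfolding power3_eq_cube mult.assoc by linarith
qed
thus ?thesis using s'(2) unfolding Z_def s_def Inv_def by auto
qed

lemma ex_Write: "1+icost s e1+icost s e2 <= T ==> ex (Write a e1 e2) s T (s(a := (s a)(ival s e1 := ival s e2)))" unfolding ex_def using Write[of a e1 e2 s] by blast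

lemma write_ex:
assumes c: "cell s 1 = enc xs"
shows "EX s'. ex writeP s (10000*(isize xs+100)^3) s' & (ALL i<length xs. s' 1 (int i) = xs ! i)"
proof -
define Z where "Z = isize (xs :: int list)+100"
have lZ: "length xs <= isize xs" by (rule length_le_isize)
have szn: "sk k <= isize xs" if "k <= length xs" for k using size_int_of_nat_le[of k] lZ that by linarith
have se: "size_int (enc (drop j xs)) <= isize xs" for j using isize_drop[of j xs] by (simp add: isize_def)
define Inv where "Inv i s' <-> cell s' 0 = int i & cell s' 1 = enc (drop i xs) & (ALL j<i. s' 1 (int j) = xs ! j)" for i s'
let ?b = "Seq (unpairP 1) (Seq (Write 1 (vr 0) (vr 1)) (Seq (wr 1 (vr 2)) (wr 0 (Add (vr 0) (Const 1)))))"
have co: "icost s' (Mul (vr 1) (vr 1)) <= 6*Z" if "cell s' 1 = enc (drop i xs)" for s' i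
 using that se[of i] size_int_mult[of "enc (drop i xs)" "enc (drop i xs)"] size_small by (simp add: Z_def)
have "EX s'. ex (WhilePos (Mul (vr 1) (vr 1)) ?b) (setc s 0 0) (8000*Z^3) s' & Inv (length xs) s'"
proof (rule ex_while[where C = "6*Z" and B = "7000*Z^2"])
 fix i s' assume I: "Inv i s'" and i: "i < length xs"
 have d: "drop i xs = xs ! i # drop (Suc i) xs" using i by (rule Cons_nth_drop_Suc[symmetric])
 have e: "cell s' 1 = pr (xs ! i) (enc (drop (Suc i) xs))" using I unfolding Inv_def d enc_int_list by simp
 obtain s2 where s2: "ex (unpairP 1) s' (1000*(size_int (pr (xs ! i) (enc (drop (Suc i) xs)))+kk 1+3)^2) s2"
  "agree 1 s' s2" "cell s2 1 = xs ! i" "cell s2 (1+1) = enc (drop (Suc i) xs)" using unpairP_ex[OF e] by blast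
 have s20: "cell s2 0 = int i" "s2 1 = s' 1" using agree_cell[OF s2(2), of 0] I s2(2) by (auto simp: Inv_def agree_def)
 have "size_int (pr (xs ! i) (enc (drop (Suc i) xs))) <= isize xs" using se[of i] unfolding d enc_int_list .
 hence "size_int (pr (xs ! i) (enc (drop (Suc i) xs)))+kk 1+3 <= Z" using kk_1 by (simp add: Z_def)
 hence T: "1000*(size_int (pr (xs ! i) (enc (drop (Suc i) xs)))+kk 1+3)^2 <= 1000*Z^2" by (intro mult_left_mono power_mono) auto
 define s3 where "s3 = s2(1 := (s2 1)(int i := xs ! i))"
 have c3: "cell s3 j = cell s2 j" for j by (simp add: s3_def cell_def)
 have sx: "size_int (xs ! i) <= isize xs" using isize_mem[of "xs ! i" xs] i by simp
 have si: "sk i <= isize xs" "size_int (int (Suc i)) <= isize xs" by (rule szn, use i in simp)+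
 have 2: "ex (Write 1 (vr 0) (vr 1)) s2 (4*Z) s3" using ex_Write[of s2 "vr 0" "vr 1" "4*Z" 1] s20 s2(3) si sx size_small by (simp add: s3_def Z_def)
 let ?s4 = "setc s3 1 (enc (drop (Suc i) xs))" and ?s5 = "setc (setc s3 1 (enc (drop (Suc i) xs))) 0 (int (Suc i))"
 have 3: "ex (wr 1 (vr 2)) s3 (4*Z) ?s4" by (rule ex_wr_val) (use s2(4) c3 se[of "Suc i"] size_small in "auto simp: Z_def numeral_2_eq_2")
 have 4: "ex (wr 0 (Add (vr 0) (Const 1))) ?s4 (4*Z) ?s5" by (rule ex_wr_val) (use s20 c3 si size_small in "auto simp: Z_def add.commute")
 have ZZ: "Z <= Z^2" "100 <= Z" by (simp_all add: Z_def power2_eq_square)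
 have b: "ex ?b s' (7000*Z^2) ?s5" by (rule ex_seq[OF s2(1) ex_seq[OF 2 ex_seq[OF 3 4 order_refl] order_refl]]) (use T ZZ in linarith)
 have "Inv (Suc i) ?s5" using I s20(2) by (auto simp: Inv_def less_Suc_eq s3_def setc_def cell_def)
 moreover have "0 < ival s' (Mul (vr 1) (vr 1))" unfolding ival.simps ival_vr e zero_less_mult_iff using pr_nonzero[of "xs ! i" "enc (drop (Suc i) xs)"] by linarith
 moreover have "icost s' (Mul (vr 1) (vr 1)) <= 6*Z" using I co by (simp only: Inv_def)
 ultimately show "0 < ival s' (Mul (vr 1) (vr 1)) & icost s' (Mul (vr 1) (vr 1)) <= 6*Z & (EX s''. ex ?b s' (7000*Z^2) s'' & Inv (Suc i) s'')" using b by blast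
next
 fix s' assume I: "Inv (length xs) s'"
 hence "cell s' 1 = 0" by (simp add: Inv_def)
 moreover have "icost s' (Mul (vr 1) (vr 1)) <= 6*Z" using I co by (simp only: Inv_def)
 ultimately show "~ 0 < ival s' (Mul (vr 1) (vr 1)) & icost s' (Mul (vr 1) (vr 1)) <= 6*Z" by simp
next
 show "Inv 0 (setc s 0 0)" using c by (simp add: Inv_def)
 have "(length xs+1)*(1+6*Z+7000*Z^2) <= Z*(8000*Z^2)"
 proof (rule mult_mono)
  show "length xs+1 <= Z" using lZ by (simp add: Z_def)
  have "100*Z <= Z^2" unfolding power2_eq_square by (rule mult_right_mono) (simp_all add: Z_def)
  moreover have "1 <= Z" by (simp add: Z_def)
  ultimately show "1+6*Z+7000*Z^2 <= 8000*Z^2" by linarith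
 qed auto
 thus "(length xs+1)*(1+6*Z+7000*Z^2) <= 8000*Z^3" by (simp add: power3_eq_cube power2_eq_square mult_ac)
qed
then obtain s' where s': "ex (WhilePos (Mul (vr 1) (vr 1)) ?b) (setc s 0 0) (8000*Z^3) s'" "Inv (length xs) s'" by blast
have w1: "ex (wr 0 (Const 0)) s (4*Z) (setc s 0 0)" by (rule ex_wr_val) (use size_small in "auto simp: Z_def")
have "ex writeP s (10000*Z^3) s'" unfolding writeP_def
proof (rule ex_seq[OF w1 s'(1)])
 have "Z*1 <= Z*(Z*Z)" "100 <= Z" by (intro mult_left_mono) (auto simp: Z_def)
 thus "1+4*Z+8000*Z^3 <= 10000*Z^3" unfolding power3_eq_cube mult.assoc by linarith
qed
thus ?thesis using s'(2) unfolding Z_def Inv_def by auto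
qed

lemma alg_program:
"EX A T. pb inD T & (ALL p. ALL L:inD p. 0 <= el L 0 --> 0 <= el L 2 -->
 (EX s. ex A (input_store L) (T L) s & (ALL i<length (alg L). s 1 (int i) = alg L ! i)))"
proof -
obtain c T where T: "pb inD T" and c: "!!p L s. L : inD p ==> cell s 1 = enc L ==>
 (EX s'. ex c s (T L) s' & cell s' 1 = enc (alg L) & agree 1 s s')" using PTE[OF PT_alg, of 1] by blast
let ?T = "%L. 1+10000*(isize L+100)^3+(1+T L+10000*(isize (alg L)+100)^3)"
have "pb inD ?T" by (intro T PT_size[OF PT_alg] PT_rules)
moreover have "EX s. ex (Seq readP (Seq c writeP)) (input_store L) (?T L) s & (ALL i<length (alg L). s 1 (int i) = alg L ! i)"
 if L: "L : inD p" "0 <= el L 0" "0 <= el L 2" for p L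
proof -
 obtain s1 where s1: "ex readP (input_store L) (10000*(isize L+100)^3) s1" "cell s1 1 = enc L" using read_ex[OF L(2,3)] L(1) by (auto simp: inD_def)
 obtain s2 where s2: "ex c s1 (T L) s2" "cell s2 1 = enc (alg L)" using c[OF L(1) s1(2)] by blast
 obtain s3 where s3: "ex writeP s2 (10000*(isize (alg L)+100)^3) s3" "ALL i<length (alg L). s3 1 (int i) = alg L ! i" using write_ex[OF s2(2)] by blast
 show ?thesis using ex_seq[OF s1(1) ex_seq[OF s2(1) s3(1) order_refl] order_refl] s3(2) by blast
qed
ultimately show ?thesis by (intro exI[of _ "Seq readP (Seq c writeP)"] exI[of _ ?T]) blast
qed

section \<open>The main theorem\<close>

lemma concat_map_nth:
assumes "i < m" "j < n"
shows "concat (map (%i. map (f i) [0..<n]) [0..<m]) ! (i*n+j) = f i j" using assms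
proof (induction m)
case (Suc m)
have l: "length (concat (map (%i. map (f i) [0..<n]) [0..<m])) = m*n" by (simp add: length_concat o_def sum_list_triv)
show ?case
proof (cases "i < m")
 case True
 have "i*n+j < Suc i*n" using Suc.prems by simp
 also have "... <= m*n" using True by (intro mult_right_mono) auto
 finally show ?thesis using Suc True l by (simp add: nth_append)
next
 case False
 hence "i = m" using Suc.prems by simp
 thus ?thesis using Suc.prems l by (simp add: nth_append)
qed
qed simp

lemma rats_as_ints_Cons: "rats_as_ints (r # rs) = fst (quotient_of r) # snd (quotient_of r) # rats_as_ints rs" by (simp add: rats_as_ints_def case_prod_beta)

lemma rats_as_ints_nth:
"e < length rs ==> el (rats_as_ints rs) (2*e) = fst (quotient_of (rs ! e)) & el (rats_as_ints rs) (Suc (2*e)) = snd (quotient_of (rs ! e))"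
proof (induction rs arbitrary: e)
case (Cons r rs)
thus ?case unfolding rats_as_ints_Cons by (cases e) (auto simp: nthd_Suc, auto simp: nthd_def)
qed simp

lemma length_rats_as_ints: "length (rats_as_ints rs) = 2*length rs" by (induction rs) (simp_all add: rats_as_ints_Cons, simp add: rats_as_ints_def)

lemma set_rats_as_ints: "x : set (rats_as_ints rs) ==> EX r:set rs. size_int x <= size_rat r"
by (induction rs) (auto simp: rats_as_ints_Cons size_rat_def case_prod_beta, simp add: rats_as_ints_def)

locale miqp =
fixes p n m :: nat and H W :: "rat mat" and h w :: "rat vec"
assumes pn: "p <= n" and H: "H : carrier_mat n n" and h: "h : carrier_vec n" and W: "W : carrier_mat m n" and w: "w : carrier_vec m"
begin

definition "rl = concat (mat_to_list H) @ list_of_vec h @ concat (mat_to_list W) @ list_of_vec w"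
definition "L = miqp_as_ints p H h W w"

lemma mat_list: "A : carrier_mat k l ==> concat (mat_to_list A) = concat (map (%i. map (%j. A $$ (i, j)) [0..<l]) [0..<k])" by (simp add: mat_to_list_def)

lemma length_mat: "length (concat (map (%i. map (f i) [0..<l]) [0..<k])) = k*l" by (simp add: length_concat o_def sum_list_triv)

lemma length_rl: "length rl = n*n+n+m*n+m" using h w unfolding rl_def mat_list[OF H] mat_list[OF W] length_append length_mat by simp

lemma rl_nth:
"i < n ==> j < n ==> rl ! (i*n+j) = H $$ (i, j)" "i < n ==> rl ! (n*n+i) = h $ i"
"k < m ==> j < n ==> rl ! (n*n+n+k*n+j) = W $$ (k, j)" "k < m ==> rl ! (n*n+n+m*n+k) = w $ k"
proof -
have lt: "a*n+b < c*n" if "a < c" "b < n" for a b c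
proof -
 have "a*n+b < Suc a*n" using that by simp
 also have "... <= c*n" using that by (intro mult_right_mono) auto
 finally show ?thesis .
qed
note l = length_mat[of "%i j. H $$ (i, j)" n n] length_mat[of "%i j. W $$ (i, j)" n m]
show "i < n ==> j < n ==> rl ! (i*n+j) = H $$ (i, j)" unfolding rl_def mat_list[OF H] using lt[of i n j] l by (simp add: nth_append concat_map_nth)
show "i < n ==> rl ! (n*n+i) = h $ i" unfolding rl_def mat_list[OF H] using l h by (simp add: nth_append)
show "rl ! (n*n+n+k*n+j) = W $$ (k, j)" if k: "k < m" "j < n"
proof -
 have "rl ! (n*n+(n+(k*n+j))) = W $$ (k, j)" unfolding rl_def mat_list[OF H] mat_list[OF W] using lt[of k m j] l h k by (simp add: nth_append concat_map_nth)
 thus ?thesis by (simp add: add.assoc)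
qed
show "rl ! (n*n+n+m*n+k) = w $ k" if k: "k < m"
proof -
 have "rl ! (n*n+(n+(m*n+k))) = w $ k" unfolding rl_def mat_list[OF H] mat_list[OF W] using l h w k by (simp add: nth_append)
 thus ?thesis by (simp add: add.assoc)
qed
qed

lemma L_eq: "L = int n # int p # int m # rats_as_ints rl" using h w by (simp add: L_def miqp_as_ints_def rl_def)

lemma L_nth: "el L 0 = int n" "el L 1 = int p" "el L 2 = int m"
"e < length rl ==> el L (3+2*e) = fst (quotient_of (rl ! e))" "e < length rl ==> el L (4+2*e) = snd (quotient_of (rl ! e))"
proof -
show "el L 0 = int n" "el L 1 = int p" "el L 2 = int m" by (simp_all add: L_eq nthd_def)
have "el L (3+k) = el (rats_as_ints rl) k" for k by (simp add: L_eq nthd_def numeral_3_eq_3)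
from this[of "2*e"] this[of "Suc (2*e)"] rats_as_ints_nth[of e rl]
show "e < length rl ==> el L (3+2*e) = fst (quotient_of (rl ! e))" "e < length rl ==> el L (4+2*e) = snd (quotient_of (rl ! e))" by (simp_all add: eval_nat_numeral)
qed

lemma in_L: "inn L = n" "inp L = p" "inm L = m" "inc L = length rl" by (simp_all add: inn_def inp_def inm_def inc_def L_nth L_nth(2)[unfolded One_nat_def] length_rl)

lemma L_inD: "L : inD p" by (simp add: inD_def in_L) (simp add: L_eq length_rats_as_ints)

lemma den_pos: "0 < inden L" unfolding inden_def in_L by (intro prod_pos) (auto simp: L_nth quotient_of_denom_pos')

lemma ent: "e < length rl ==> ri (ent L e) = ri (inden L)*of_rat (rl ! e)"
proof -
assume e: "e < length rl"
let ?a = "fst (quotient_of (rl ! e))" and ?b = "snd (quotient_of (rl ! e))"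
have "?b dvd inden L" unfolding inden_def in_L using e L_nth(5)[OF e] by (metis dvd_prodI finite_lessThan lessThan_iff)
hence d: "ri (inden L div ?b) = ri (inden L)/ri ?b" by (rule real_of_int_div)
have "rl ! e = of_int ?a/of_int ?b" by (rule quotient_of_div) simp
hence "real_of_rat (rl ! e) = ri ?a/ri ?b" by (metis of_rat_divide of_rat_of_int_eq)
thus ?thesis unfolding ent_def L_nth(4,5)[OF e] using d by simp
qed

lemma idx: "i < n ==> j < n ==> i*n+j < length rl" "i < n ==> n*n+i < length rl"
"k < m ==> j < n ==> n*n+n+k*n+j < length rl" "k < m ==> n*n+n+m*n+k < length rl"
proof -
have lt: "a*n+b < c*n" if "a < c" "b < n" for a b c
proof -
 have "a*n+b < Suc a*n" using that by simp
 also have "... <= c*n" using that by (intro mult_right_mono) auto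
 finally show ?thesis .
qed
show "i < n ==> j < n ==> i*n+j < length rl" using lt[of i n j] by (simp add: length_rl)
show "i < n ==> n*n+i < length rl" by (simp add: length_rl)
show "k < m ==> j < n ==> n*n+n+k*n+j < length rl" using lt[of k m j] by (simp add: length_rl)
show "k < m ==> n*n+n+m*n+k < length rl" by (simp add: length_rl)
qed

lemma data:
"i < n ==> j < n ==> ra (rw (inH L) i) j = ri (inden L)*of_rat (H $$ (i, j))"
"i < n ==> ra (inh L) i = ri (inden L)*of_rat (h $ i)"
"k < m ==> j < n ==> ra (rw (inW L) k) j = ri (inden L)*of_rat (W $$ (k, j))"
"k < m ==> ra (inw L) k = ri (inden L)*of_rat (w $ k)" by (simp_all add: inH_def inh_def inW_def inw_def in_L ent idx rl_nth)

abbreviation "F == qf n (%i j. ra (rw (inH L) i) j) (ra (inh L))"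

lemma feasible: "x : miqp_feasible p W w <-> x : carrier_vec n & rfeas p n m (inW L) (inw L) (%j. x $ j)"
proof -
have d: "0 < ri (inden L)" using den_pos by simp
have "real_mat W *\<^sub>v x <= real_vec w <-> (ALL k<m. (SUM j<n. ra (rw (inW L) k) j*x $ j) <= ra (inw L) k)" if x: "x : carrier_vec n"
proof -
 have "(real_mat W *\<^sub>v x) $ k = (SUM j<n. of_rat (W $$ (k, j))*x $ j)" if "k < m" for k using W x that by (simp add: scalar_prod_def lessThan_atLeast0 row_def)
 moreover have "(SUM j<n. ra (rw (inW L) k) j*x $ j) = ri (inden L)*(SUM j<n. of_rat (W $$ (k, j))*x $ j)" if "k < m" for k using that data(3) by (simp add: sum_distrib_left mult.assoc)
 ultimately show ?thesis using W w d by (auto simp: less_eq_vec_def data(4))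
qed
thus ?thesis using W by (auto simp: miqp_feasible_def rfeas_def)
qed

lemma objective: "x : carrier_vec n ==> F (%j. x $ j) = ri (inden L)*miqp_objective H h x"
proof -
assume x: "x : carrier_vec n"
have "miqp_objective H h x = (SUM i<n. x $ i*(SUM j<n. of_rat (H $$ (i, j))*x $ j))+(SUM i<n. of_rat (h $ i)*x $ i)"
 using H h x by (simp add: miqp_objective_def scalar_prod_def lessThan_atLeast0 row_def)
thus ?thesis by (simp add: qf_def data sum_distrib_left distrib_left mult_ac)
qed

lemma size_bound:
"isize L <= (3+2*miqp_size H h W w)*(3*miqp_size H h W w+10)"
proof -
let ?S = "miqp_size H h W w"
have sm: "sum_list (map size_rat (concat (map (%i. map (f i) [0..<l]) [0..<k]))) = (SUM i<k. SUM j<l. size_rat (f i j))" for f :: "nat => nat => rat" and k l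
 by (induction k) (simp_all add: o_def interv_sum_list_conv_sum_set_nat lessThan_atLeast0)
have sv: "sum_list (map size_rat (list_of_vec v)) = (SUM i<dim_vec v. size_rat (v $ i))" for v by (simp add: list_of_vec_map o_def interv_sum_list_conv_sum_set_nat lessThan_atLeast0)
have rlS: "sum_list (map size_rat rl)+length rl <= ?S" unfolding length_rl using H h W w
 by (simp add: rl_def mat_list[OF H] mat_list[OF W] sm sv miqp_size_def size_rat_mat_def size_rat_vec_def)
have nm: "n <= ?S" "m <= ?S" using rlS by (simp_all add: length_rl)
have "isize x <= ?S" if x: "x : set L" for x
proof -
 consider "x = int n" | "x = int p" | "x = int m" | "x : set (rats_as_ints rl)" using x unfolding L_eq by auto
 thus ?thesis
 proof cases
  case 4
  then obtain r where r: "r : set rl" "size_int x <= size_rat r" using set_rats_as_ints by blast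
  have "size_rat r <= sum_list (map size_rat rl)" using r(1) by (intro member_le_sum_list) auto
  thus ?thesis using r(2) rlS by simp
 qed (use nm pn size_int_of_nat_le[of n] size_int_of_nat_le[of p] size_int_of_nat_le[of m] in simp_all)
qed
moreover have "length L <= 3+2 * ?S" using rlS by (simp add: L_eq length_rats_as_ints)
ultimately show ?thesis by (rule isize_list_le')
qed

definition "appr = 1 - 1/(8*(real (Suc n))^2)"

lemma appr_01: "0 < appr" "appr < 1"
proof -
have "1 <= (real (Suc n))^2" by (rule one_le_power) simp
hence "1 < 8*(real (Suc n))^2" by linarith
thus "0 < appr" "appr < 1" by (simp_all add: appr_def divide_less_eq del: of_nat_Suc)
qed

text \<open>For a finite supremum \<open>U\<close> and \<open>c = 8 * (n + 1)^2\<close>, the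
  estimate \<open>U - f y <= c * (U - f x)\<close> holds for every feasible \<open>y\<close>. It
  passes to the infimum, even if that is not attained, and rearranges to the factor
  \<open>1 - 1 / c\<close>.\<close>

lemma answer:
assumes bd: "!!x. x : miqp_feasible p W w ==> fbar <= miqp_objective H h x"
 and s: "!!i. i < length (alg L) ==> s 1 (int i) = alg L ! i"
shows "(EX x. returns_point n s x & approx_solution appr (miqp_objective H h) (miqp_feasible p W w) x) |
 (reports_infeasible s & miqp_feasible p W w = {})"
proof -
let ?S = "miqp_feasible p W w" and ?f = "miqp_objective H h" and ?D = "ri (inden L)"
have D: "0 < ?D" using den_pos by simp
note mc = mall_correct[OF pn, of m "inW L" "inw L"]
have alg: "algc L = mall p n m (inW L) (inw L)" "inR L = Rb n m (inW L) (inw L)"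
 "algb L = best n (inH L) (inh L) (Rb n m (inW L) (inw L)) (mall p n m (inW L) (inw L))" by (simp_all add: algc_def inR_def algb_def in_L)
show ?thesis
proof (cases "algc L = []")
 case True
 have "?S = {}"
 proof (rule ccontr)
  assume "?S ~= {}"
  then obtain x where "x : ?S" by blast
  hence "rfeas p n m (inW L) (inw L) (%j. x $ j)" by (simp add: feasible)
  from mc(1)[OF this] show False using True alg by simp
 qed
 moreover have "s 1 0 = 0" using s[of 0] True by (simp add: alg_def)
 ultimately show ?thesis by (simp add: reports_infeasible_def)
next
 case False
 let ?b = "algb L"
 define x where "x = vec n (%j. ra ?b (Suc j)/ra ?b 0 - ri (inR L))"
 have b: "0 < el ?b 0" "rfeas p n m (inW L) (inw L) (%j. ra ?b (Suc j)/ra ?b 0 - ri (inR L))" using mc(2)[of "inH L" "inh L"] False unfolding alg by blast+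
 have xc: "x : carrier_vec n" by (simp add: x_def)
 have xS: "x : ?S" using b(2) pn by (simp add: feasible x_def rfeas_def)
 have Fx: "F (%j. ra ?b (Suc j)/ra ?b 0 - ri (inR L)) = ?D * ?f x" unfolding objective[OF xc, symmetric] by (rule qf_cong) (simp add: x_def)
 have "returns_point n s x"
 proof -
  have a: "alg L = 1 # concat (map (%i. map (%j. if j = 0 then el ?b (Suc i) - inR L*el ?b 0 else el ?b 0) [0..<2]) [0..<n])" using False by (simp add: alg_def in_L upt_rec numeral_2_eq_2)
  have la: "length (alg L) = Suc (n*2)" unfolding a by (simp add: length_mat)
  have o: "alg L ! Suc (i*2+j) = (if j = 0 then el ?b (Suc i) - inR L*el ?b 0 else el ?b 0)" if "i < n" "j < 2" for i j unfolding a nth_Cons_Suc by (rule concat_map_nth[OF that])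
  have "s 1 (2*int i+1) = el ?b (Suc i) - inR L*el ?b 0" "s 1 (2*int i+2) = el ?b 0" if i: "i < n" for i
  proof -
   have e: "2*int i+1 = int (Suc (i*2+0))" "2*int i+2 = int (Suc (i*2+1))" by simp_all
   show "s 1 (2*int i+1) = el ?b (Suc i) - inR L*el ?b 0" unfolding e using s[of "Suc (i*2+0)"] o[OF i, of 0] i la by simp
   show "s 1 (2*int i+2) = el ?b 0" unfolding e using s[of "Suc (i*2+1)"] o[OF i, of 1] i la by simp
  qed
  moreover have "s 1 0 = 1" using s[of 0] la a by simp
  ultimately show ?thesis using b(1) xc by (simp add: returns_point_def x_def diff_divide_distrib)
 qed
 moreover have "approx_solution appr ?f ?S x"
 proof -
  let ?I = "INF y\<in>?S. ereal (?f y)" and ?U = "SUP y\<in>?S. ereal (?f y)"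
  have Ifin: "ereal fbar <= ?I" "?I <= ereal (?f x)" using bd xS by (auto intro: INF_greatest INF_lower)
  then obtain I where I: "?I = ereal I" by (cases ?I) auto
  have Ux: "ereal (?f x) <= ?U" using xS by (rule SUP_upper)
  have "ereal (?f x) - ?I <= ereal appr*(?U - ?I)"
  proof (cases ?U)
   \<comment> \<open>With an infinite supremum and a finite infimum, the positive factor makes the
     right-hand side infinite.\<close>
   case PInf
   thus ?thesis using I appr_01 by simp
  next
   case MInf
   thus ?thesis using Ux by simp
  next
   case (real U)
   define c where "c = 8*(real (Suc n))^2"
   have c: "0 < c" by (simp add: c_def)
   have Uf: "?f y <= U" if "y : ?S" for y using SUP_upper[OF that, of "%y. ereal (?f y)"] real by simp
   have key: "U - ?f y <= c*(U - ?f x)" if y: "y : ?S" for y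
   proof -
    have yc: "y : carrier_vec n" and yr: "rfeas p n m (inW L) (inw L) (%j. y $ j)" using y by (simp_all add: feasible)
    have "?D*U - F (%j. y $ j) <= c*(?D*U - F (%j. ra ?b (Suc j)/ra ?b 0 - ri (inR L)))" unfolding c_def alg
    proof (rule mc(3)[OF yr])
     fix z assume z: "rfeas p n m (inW L) (inw L) z"
     let ?z = "vec n z"
     have "?z : ?S" using z pn by (simp add: feasible rfeas_def)
     hence "fbar <= ?f ?z" "?f ?z <= U" using bd Uf by auto
     moreover have "F z = ?D * ?f ?z" unfolding objective[OF vec_carrier, symmetric] by (rule qf_cong) simp
     ultimately show "?D*fbar <= F z & F z <= ?D*U" using D by simp
    qed
    hence "?D*(U - ?f y) <= ?D*(c*(U - ?f x))" unfolding Fx objective[OF yc] by (simp add: algebra_simps)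
    thus ?thesis using D by simp
   qed
   have "ereal (U - c*(U - ?f x)) <= ?I"
   proof (rule INF_greatest)
    fix y assume "y : ?S"
    thus "ereal (U - c*(U - ?f x)) <= ereal (?f y)" using key[of y] by simp
   qed
   hence "U - I <= c*(U - ?f x)" using I by simp
   hence "?f x - I <= (1 - 1/c)*(U - I)" using c by (simp add: field_simps)
   thus ?thesis using I real by (simp add: appr_def c_def)
  qed
  thus ?thesis using xS by (simp add: approx_solution_def)
 qed
 ultimately show ?thesis by blast
qed
qed

end

text \<open>For positive \<open>n\<close> the number \<open>n + 1\<close> lies between
  \<open>n\<close> and \<open>2 * n\<close>, which gives the constants \<open>1/32\<close> and
  1.\<close>

lemma appr_Theta: "(%n. 1 - (1 - 1/(8*(real (Suc n))^2))) : \<Theta>(%n. 1/real n^2)"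
proof (rule bigthetaI')
show "0 < (1/32 :: real)" "0 < (1 :: real)" by simp_all
show "\<forall>\<^sub>F n in at_top. 1/32*norm (1/real n^2) <= norm (1 - (1 - 1/(8*(real (Suc n))^2))) &
  norm (1 - (1 - 1/(8*(real (Suc n))^2))) <= 1*norm (1/real n^2)" using eventually_gt_at_top[of 0]
proof eventually_elim
 case (elim n)
 have "(real (Suc n))^2 <= (2*real n)^2" using elim by (intro power_mono) auto
 hence u: "8*(real (Suc n))^2 <= 32*(real n)^2" by (simp add: power_mult_distrib)
 have "(real n)^2 <= (real (Suc n))^2" by (intro power_mono) auto
 hence l: "(real n)^2 <= 8*(real (Suc n))^2" using zero_le_power2[of "real (Suc n)"] by linarith
 have n: "0 < (real n)^2" using elim by simp
 have "1/(32*(real n)^2) <= 1/(8*(real (Suc n))^2)" using u by (intro divide_left_mono) (auto intro!: mult_pos_pos n)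
 moreover have "1/(8*(real (Suc n))^2) <= 1/(real n)^2" using l n by (intro divide_left_mono) auto
 ultimately show ?case by simp
qed
qed

theorem theorem2:
  shows "\<exists>\<epsilon> :: nat \<Rightarrow> real.
    (\<forall>n. 0 \<le> \<epsilon> n \<and> \<epsilon> n \<le> 1) \<and>
    (\<lambda>n. 1 - \<epsilon> n) \<in> \<Theta>(\<lambda>n. 1 / real n ^ 2) \<and>
    (\<exists>A :: prog. \<forall>p. \<exists>q :: nat poly.
      \<forall>n m (H :: rat mat) (h :: rat vec) (W :: rat mat) (w :: rat vec).
        p \<le> n \<longrightarrow>
        H \<in> carrier_mat n n \<longrightarrow> transpose_mat H = H \<longrightarrow> h \<in> carrier_vec n \<longrightarrow>
        W \<in> carrier_mat m n \<longrightarrow> w \<in> carrier_vec m \<longrightarrow>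
        (\<exists>fbar :: real. \<forall>x \<in> miqp_feasible p W w. fbar \<le> miqp_objective H h x) \<longrightarrow>
        (\<exists>t s. runs A (input_store (miqp_as_ints p H h W w)) t s \<and>
               t \<le> poly q (miqp_size H h W w) \<and>
               ((\<exists>x. returns_point n s x \<and>
                     approx_solution (\<epsilon> n) (miqp_objective H h) (miqp_feasible p W w) x) \<or>
                (reports_infeasible s \<and> miqp_feasible p W w = {}))))"
proof -
let ?e = "%n. 1 - 1/(8*(real (Suc n))^2)"
obtain A T where T: "pb inD T" and A: "!!p L. L : inD p ==> 0 <= el L 0 ==> 0 <= el L 2 ==>
 EX s. ex A (input_store L) (T L) s & (ALL i<length (alg L). s 1 (int i) = alg L ! i)" using alg_program by blast
obtain d where d: "!!L. L : inD p ==> T L <= (isize L+2)^d p" for p using T unfolding pb_def by metis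
\<comment> \<open>The inner polynomial bounds the size of the encoded input in terms of the bit size
  of the problem; only the exponent depends on \<open>p\<close>.\<close>
let ?q = "%p. ([:3, 2:] * [:10, 3:] + [:2:])^d p :: nat poly"
have e: "0 <= ?e n" "?e n <= 1" for n
proof -
 have "1 <= (real (Suc n))^2" by (rule one_le_power) simp
 hence "1 <= 8*(real (Suc n))^2" by linarith
 thus "0 <= ?e n" "?e n <= 1" by (simp_all add: divide_le_eq del: of_nat_Suc)
qed
have run: "EX t s. runs A (input_store (miqp_as_ints p H h W w)) t s & t <= poly (?q p) (miqp_size H h W w) &
  ((EX x. returns_point n s x & approx_solution (?e n) (miqp_objective H h) (miqp_feasible p W w) x) |
  (reports_infeasible s & miqp_feasible p W w = {}))"
 if a: "p <= n" "H : carrier_mat n n" "h : carrier_vec n" "W : carrier_mat m n" "w : carrier_vec m"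
  and bd: "ALL x:miqp_feasible p W w. fbar <= miqp_objective H h x" for p n m H h W w fbar
proof -
 interpret Q: miqp p n m H W h w by unfold_locales (fact a)+
 let ?S = "miqp_size H h W w"
 obtain s where s: "ex A (input_store Q.L) (T Q.L) s" "ALL i<length (alg Q.L). s 1 (int i) = alg Q.L ! i" using A[OF Q.L_inD] Q.L_nth by auto
 obtain t where t: "runs A (input_store Q.L) t s" "t <= T Q.L" using s(1) by (auto simp: ex_def)
 have "t <= (isize Q.L+2)^d p" using t(2) d[OF Q.L_inD] by simp
 also have "... <= ((3+2 * ?S)*(3 * ?S+10)+2)^d p" using Q.size_bound by (intro power_mono add_mono) auto
 also have "... = poly (?q p) ?S" by (simp add: poly_power algebra_simps)
 finally have "t <= poly (?q p) ?S" .
 moreover have "(EX x. returns_point n s x & approx_solution Q.appr (miqp_objective H h) (miqp_feasible p W w) x) |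
  (reports_infeasible s & miqp_feasible p W w = {})" by (rule Q.answer) (use bd s(2) in auto)
 ultimately show ?thesis using t(1) unfolding Q.L_def Q.appr_def by blast
qed
show ?thesis by (rule exI[of _ ?e], intro conjI allI exI[of _ A] exI[of _ "?q _"] impI, fact e, fact e, rule appr_Theta, elim exE, rule run; assumption)
qed

end
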